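(* Let $p \geq 2$ and $n \geq 3$, let $G=\mathrm{GL}_p(\mathbb{C})$ act on $\mathcal{V}=\mathcal{M}_p^n$ by simultaneous conjugation. Then $$\mathcal{S}_{G,\mathcal{V}} = \bigcup_{k=1}^p \ \bigcup_{\pi\in\Pi(p,k)} \ \bigcup_{\sigma\in T_k} \overline{G^2\cdot \mathcal{C}_{\pi,\sigma}},$$ and this is a complete irredundant decomposition of $\mathcal{S}_{G,\mathcal{V}}$ (i.e. the terms on the right are exactly the irreducible components, without repetition), where $T_k$ is the subset of the symmetric group $S_k$ consisting of permutations which are not partial reversals.
   Context: $\mathcal{M}_p$ is the space of complex $p\times p$ matrices; $g\cdot(A_1,\dots,A_n)=(gA_1g^{-1},\dots,gA_ng^{-1})$. The separating variety is $\mathcal{S}_{G,\mathcal{V}}=\{(v,w)\in\mathcal{V}^2: f(v)=f(w)\ \forall f\in\mathbb{C}[\mathcal{V}]^G\}$. $\Pi(p,k)$ is the set of ordered partitions (compositions) $\pi=(p_1,\dots,p_k)$ of $p$ into $k$ positive parts. For $\sigma\in S_k$, $\sigma(\pi)=(p_{\sigma(1)},\dots,p_{\sigma(k)})$. For $\pi\in\Pi(p,k)$, $\mathcal{V}_\pi\subseteq\mathcal{V}$ is the subspace of tuples all of whose entries are block upper triangular with respect to the block sizes $\pi$. For $\sigma\in S_k$, $\mathcal{C}_{\pi,\sigma}\subseteq\mathcal{V}^2$ is the subspace of pairs $(\mathbf{A},\mathbf{A}')$ with $\mathbf{A}\in\mathcal{V}_\pi$, $\mathbf{A}'\in\mathcal{V}_{\sigma(\pi)}$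 and $\mathbf{B}'_{i,i}=\mathbf{B}_{\sigma(i),\sigma(i)}$ for $i=1,\dots,k$, where $\mathbf{B}_{i,i}$ (resp. $\mathbf{B}'_{i,i}$) is the tuple of $i$-th diagonal $\pi$-blocks of $\mathbf{A}$ (resp. $i$-th diagonal $\sigma(\pi)$-blocks of $\mathbf{A}'$). $G^2$ acts componentwise on $\mathcal{V}^2$ and closures are Zariski closures. A permutation $\sigma\in S_k$ is a partial reversal if $\sigma(l)=\sigma(l+1)+1$ for some $1\leq l<k$. *)

theory Defs
  imports
    "HOL-Analysis.Abstract_Topology"
    "HOL-Combinatorics.Permutations"
    "Jordan_Normal_Form.Matrix"
begin

section \<open>Polynomial functions and the Zariski topology\<close>

text \<open>
  The ground field is infinite, so the coordinate ring of an affine space is identified with the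
  algebra of functions generated by the constants and a set \<open>K\<close> of coordinate functions.
\<close>

inductive_set polyfuns :: "('x \<Rightarrow> complex) set \<Rightarrow> ('x \<Rightarrow> complex) set"
  for K :: "('x \<Rightarrow> complex) set" where
  const: "(\<lambda>_. c) \<in> polyfuns K"
| coord: "f \<in> K \<Longrightarrow> f \<in> polyfuns K"
| add: "f \<in> polyfuns K \<Longrightarrow> g \<in> polyfuns K \<Longrightarrow> (\<lambda>x. f x + g x) \<in> polyfuns K"
| mult: "f \<in> polyfuns K \<Longrightarrow> g \<in> polyfuns K \<Longrightarrow> (\<lambda>x. f x * g x) \<in> polyfuns K"

definition zariski_open :: "'x set \<Rightarrow> ('x \<Rightarrow> complex) set \<Rightarrow> 'x set \<Rightarrow> bool" where
  "zariski_open X K U \<longleftrightarrow> (\<exists>F \<subseteq> polyfuns K. U = {x \<in> X. \<exists>f \<in> F. f x \<noteq> 0})"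

definition zariski :: "'x set \<Rightarrow> ('x \<Rightarrow> complex) set \<Rightarrow> 'x topology" where
  "zariski X K = topology (zariski_open X K)"

lemma istopology_zariski_open: "istopology (zariski_open X K)"
  unfolding istopology_def
proof (intro conjI allI impI)
  fix S T assume "zariski_open X K S" "zariski_open X K T"
  then obtain F H where F: "F \<subseteq> polyfuns K" "S = {x \<in> X. \<exists>f \<in> F. f x \<noteq> 0}"
    and H: "H \<subseteq> polyfuns K" "T = {x \<in> X. \<exists>f \<in> H. f x \<noteq> 0}"
    unfolding zariski_open_def by (elim exE conjE)
  define M where "M = (\<lambda>(f, h) x. f x * h x) ` (F \<times> H)"
  have "M \<subseteq> polyfuns K"
    using F(1) H(1) by (auto simp: M_def intro!: polyfuns.mult)
  moreover have "S \<inter> T = {x \<in> X. \<exists>f \<in> M. f x \<noteq> 0}"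
    by (auto simp: F(2) H(2) M_def)
  ultimately show "zariski_open X K (S \<inter> T)"
    unfolding zariski_open_def by (intro exI[of _ M] conjI)
next
  fix \<K> assume "\<forall>S\<in>\<K>. zariski_open X K S"
  hence "\<exists>F. \<forall>S\<in>\<K>. F S \<subseteq> polyfuns K \<and> S = {x \<in> X. \<exists>f \<in> F S. f x \<noteq> 0}"
    unfolding zariski_open_def by (rule bchoice)
  then obtain F where F: "\<forall>S\<in>\<K>. F S \<subseteq> polyfuns K \<and> S = {x \<in> X. \<exists>f \<in> F S. f x \<noteq> 0}" ..
  have mem: "x \<in> S \<longleftrightarrow> x \<in> X \<and> (\<exists>f \<in> F S. f x \<noteq> 0)" if "S \<in> \<K>" for x S
    using bspec[OF F that] by (auto simp: set_eq_iff)
  have "\<Union>\<K> = {x \<in> X. \<exists>f \<in> \<Union>(F ` \<K>). f x \<noteq> 0}"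
  proof (rule Set.set_eqI)
    fix x
    have "x \<in> \<Union>\<K> \<longleftrightarrow> (\<exists>S\<in>\<K>. x \<in> X \<and> (\<exists>f \<in> F S. f x \<noteq> 0))"
      unfolding Union_iff by (rule bex_cong[OF refl mem])
    thus "x \<in> \<Union>\<K> \<longleftrightarrow> x \<in> {x \<in> X. \<exists>f \<in> \<Union>(F ` \<K>). f x \<noteq> 0}"
      by auto
  qed
  moreover have "\<Union>(F ` \<K>) \<subseteq> polyfuns K"
    using F by (simp add: UN_subset_iff)
  ultimately show "zariski_open X K (\<Union>\<K>)"
    unfolding zariski_open_def by (intro exI[of _ "\<Union>(F ` \<K>)"] conjI)
qed

lemma openin_zariski: "openin (zariski X K) = zariski_open X K"
  unfolding zariski_def by (rule topology_inverse'[OF istopology_zariski_open])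

lemma topspace_zariski: "topspace (zariski X K) = X"
proof
  have "zariski_open X K X"
    unfolding zariski_open_def
    by (rule exI[of _ "{\<lambda>_. 1}"]) (simp add: polyfuns.const)
  thus "X \<subseteq> topspace (zariski X K)"
    by (metis openin_zariski openin_subset)
  have "zariski_open X K (topspace (zariski X K))"
    by (metis openin_zariski openin_topspace)
  thus "topspace (zariski X K) \<subseteq> X"
    unfolding zariski_open_def by auto
qed

lemma closedin_zariski:
  "closedin (zariski X K) C \<longleftrightarrow> (\<exists>F \<subseteq> polyfuns K. C = {x \<in> X. \<forall>f \<in> F. f x = 0})"
proof -
  have eq: "C \<subseteq> X \<and> X - C = {x \<in> X. \<exists>f \<in> F. f x \<noteq> 0} \<longleftrightarrow> C = {x \<in> X. \<forall>f \<in> F. f x = 0}"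
    for F :: "('a \<Rightarrow> complex) set"
    by (auto simp: set_eq_iff)
  have "closedin (zariski X K) C \<longleftrightarrow>
      (\<exists>F. F \<subseteq> polyfuns K \<and> (C \<subseteq> X \<and> X - C = {x \<in> X. \<exists>f \<in> F. f x \<noteq> 0}))"
    unfolding closedin_def openin_zariski topspace_zariski zariski_open_def by auto
  thus ?thesis
    unfolding eq .
qed

definition irreducible_in :: "'x topology \<Rightarrow> 'x set \<Rightarrow> bool" where
  "irreducible_in T S \<longleftrightarrow> S \<subseteq> topspace T \<and> S \<noteq> {} \<and>
     (\<forall>C D. closedin T C \<and> closedin T D \<and> S \<subseteq> C \<union> D \<longrightarrow> S \<subseteq> C \<or> S \<subseteq> D)"

definition irreducible_components :: "'x topology \<Rightarrow> 'x set \<Rightarrow> 'x set set" where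
  "irreducible_components T S =
     {Z. irreducible_in T Z \<and> Z \<subseteq> S \<and> (\<forall>W. irreducible_in T W \<and> Z \<subseteq> W \<and> W \<subseteq> S \<longrightarrow> W = Z)}"


section \<open>Simultaneous conjugation on matrix tuples\<close>

type_synonym mtuple = "complex mat list"

definition mtuples :: "nat \<Rightarrow> nat \<Rightarrow> mtuple set" where
  "mtuples p n = {A. length A = n \<and> set A \<subseteq> carrier_mat p p}"

abbreviation matring :: "nat \<Rightarrow> complex mat ring" where
  "matring p \<equiv> ring_mat TYPE(complex) p ()"

abbreviation GL :: "nat \<Rightarrow> complex mat set" where
  "GL p \<equiv> Units (matring p)"

definition conj_act :: "nat \<Rightarrow> complex mat \<Rightarrow> mtuple \<Rightarrow> mtuple" where
  "conj_act p g A = map (\<lambda>M. g * M * inv\<^bsub>matring p\<^esub> g) A"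

definition coords :: "nat \<Rightarrow> nat \<Rightarrow> (mtuple \<Rightarrow> complex) set" where
  "coords p n = {\<lambda>A. (A ! m) $$ (r, c) | m r c. m < n \<and> r < p \<and> c < p}"

definition invariants :: "nat \<Rightarrow> nat \<Rightarrow> (mtuple \<Rightarrow> complex) set" where
  "invariants p n = {f \<in> polyfuns (coords p n).
     \<forall>g \<in> GL p. \<forall>v \<in> mtuples p n. f (conj_act p g v) = f v}"

definition separating_variety :: "nat \<Rightarrow> nat \<Rightarrow> (mtuple \<times> mtuple) set" where
  "separating_variety p n = {(v, w). v \<in> mtuples p n \<and> w \<in> mtuples p n \<and>
     (\<forall>f \<in> invariants p n. f v = f w)}"

definition pair_coords :: "nat \<Rightarrow> nat \<Rightarrow> (mtuple \<times> mtuple \<Rightarrow> complex) set" where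
  "pair_coords p n = (\<lambda>f. f \<circ> fst) ` coords p n \<union> (\<lambda>f. f \<circ> snd) ` coords p n"

definition pair_zariski :: "nat \<Rightarrow> nat \<Rightarrow> (mtuple \<times> mtuple) topology" where
  "pair_zariski p n = zariski (mtuples p n \<times> mtuples p n) (pair_coords p n)"

definition pair_orbit :: "nat \<Rightarrow> (mtuple \<times> mtuple) set \<Rightarrow> (mtuple \<times> mtuple) set" where
  "pair_orbit p C = {(conj_act p g v, conj_act p h w) | g h v w.
     g \<in> GL p \<and> h \<in> GL p \<and> (v, w) \<in> C}"


section \<open>Block structure\<close>

text \<open>
  Matrix entries, blocks, parts of a composition and the points moved by permutations are all
  numbered from 0, so the symmetric group on \<open>k\<close> letters acts on \<open>{..<k}\<close>.
  Note that \<open>permute_list \<sigma> \<pi>\<close> has \<open>\<pi> ! \<sigma> i\<close> as its \<open>i\<close>-th part.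
\<close>

definition compositions :: "nat \<Rightarrow> nat \<Rightarrow> nat list set" where
  "compositions p k = {\<pi>. length \<pi> = k \<and> (\<forall>x \<in> set \<pi>. 0 < x) \<and> sum_list \<pi> = p}"

definition block :: "nat list \<Rightarrow> nat \<Rightarrow> nat \<Rightarrow> complex mat \<Rightarrow> complex mat" where
  "block \<pi> i j M = mat (\<pi> ! i) (\<pi> ! j)
     (\<lambda>(r, c). M $$ (sum_list (take i \<pi>) + r, sum_list (take j \<pi>) + c))"

definition block_upper_triangular :: "nat list \<Rightarrow> complex mat \<Rightarrow> bool" where
  "block_upper_triangular \<pi> M \<longleftrightarrow>
     (\<forall>i < length \<pi>. \<forall>j < i. block \<pi> i j M = 0\<^sub>m (\<pi> ! i) (\<pi> ! j))"

definition block_tuples :: "nat \<Rightarrow> nat \<Rightarrow> nat list \<Rightarrow> mtuple set" where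
  "block_tuples p n \<pi> = {A \<in> mtuples p n. \<forall>M \<in> set A. block_upper_triangular \<pi> M}"

definition diag_block :: "nat list \<Rightarrow> nat \<Rightarrow> mtuple \<Rightarrow> mtuple" where
  "diag_block \<pi> i A = map (block \<pi> i i) A"

definition C_pairs ::
  "nat \<Rightarrow> nat \<Rightarrow> nat list \<Rightarrow> (nat \<Rightarrow> nat) \<Rightarrow> (mtuple \<times> mtuple) set" where
  "C_pairs p n \<pi> \<sigma> = {(A, A'). A \<in> block_tuples p n \<pi> \<and>
     A' \<in> block_tuples p n (permute_list \<sigma> \<pi>) \<and>
     (\<forall>i < length \<pi>. diag_block (permute_list \<sigma> \<pi>) i A' = diag_block \<pi> (\<sigma> i) A)}"

definition partial_reversal :: "nat \<Rightarrow> (nat \<Rightarrow> nat) \<Rightarrow> bool" where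
  "partial_reversal k \<sigma> \<longleftrightarrow> (\<exists>l. l + 1 < k \<and> \<sigma> l = \<sigma> (l + 1) + 1)"

definition T_perms :: "nat \<Rightarrow> (nat \<Rightarrow> nat) set" where
  "T_perms k = {\<sigma>. \<sigma> permutes {..<k} \<and> \<not> partial_reversal k \<sigma>}"

end

theory Submission
  imports
    Defs
    "Jordan_Normal_Form.Determinant"
    "Jordan_Normal_Form.Char_Poly"
    "HOL-Computational_Algebra.Polynomial"
    "HOL-Computational_Algebra.Fundamental_Theorem_Algebra"
begin

text \<open>
  Two tuples with the same invariants are put into block triangular form with irreducible diagonal
  blocks. By Burnside's theorem the traces of words determine these blocks up to isomorphism and
  order, so the pair lies in the orbit of some \<open>C_pairs\<close>. If the permutation swaps the order of two
  blocks that are consecutive on both sides, a one-parameter subgroup shows that the orbit lies in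
  the closure of the one for which the two blocks are merged; hence partial reversals are superfluous.

  For irredundancy, a tuple \<open>A\<close> is regarded as a module over the free algebra. For \<open>n \<ge> 3\<close> a suitable
  pair \<open>(A, A')\<close> in \<open>C_pairs p n \<pi> \<sigma>\<close> generates all matrix units permitted by \<open>\<pi>\<close> and \<open>\<sigma>\<close>. On
  the dense part of another term, the sum of two copies of \<open>A \<oplus> A'\<close> contains submodules built
  from the steps of the two flags, in which the two copies of a block common to \<open>A\<close> and \<open>A'\<close> may be
  identified. The existence of a submodule with a given nonzero type of Pluecker coordinate passes to
  the closure, and for the generating pair its index sets are closed under the two block orders.
  Comparing cardinalities recovers \<open>\<pi>\<close> and \<open>\<sigma>\<close>.
\<close>

text \<open>A limit of submodules would exist by compactness of the Grassmannian, but no projective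
  variety is used here. The Pluecker vector of a submodule is an eigenvector of the derivation given
  by each algebra element, with eigenvalue the trace of that element on the submodule. This trace is
  in general not a regular function of the pair. Hence only elements of trace 0 on the submodule are
  used: they give homogeneous linear equations with regular coefficients, and having a nonzero
  solution of prescribed multidegree is a closed condition. Commutators have trace 0, but they
  compare weights only inside one block. The second copy of the module supplies the rest: the
  submodule is the same in both copies, so \<open>w\<close> on one copy and \<open>- w\<close> on
  the other have total trace 0, which forces equal weights in both copies. A direct sum of
  submodules of \<open>A\<close> and \<open>A'\<close> has Pluecker coordinates in one bidegree
  only; identifying a common block of size s yields s + 1 bidegrees. Different bidegrees chosen in
  the two copies show which indices can be exchanged between the tuples.\<close>

no_notation eq_closure_of ("closure'_of\<index>")

section \<open>Regular functions and closures in the Zariski topology\<close>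

lemma polyfuns_compose:
  assumes "f \<in> polyfuns K" and "\<And>k. k \<in> K \<Longrightarrow> (\<lambda>x. k (u x)) \<in> polyfuns L"
  shows "(\<lambda>x. f (u x)) \<in> polyfuns L"
  using assms(1) by induction (auto intro: polyfuns.intros assms(2))

text \<open>Entries of \<open>nc_eval\<close> agree with polynomial functions on well-formed tuples
  but not necessarily elsewhere, so agreement is asked for on \<open>X\<close> alone.\<close>

definition regular_on :: "'x set \<Rightarrow> ('x \<Rightarrow> complex) set \<Rightarrow> ('x \<Rightarrow> complex) \<Rightarrow> bool" where
  "regular_on X K f \<longleftrightarrow> (\<exists>F \<in> polyfuns K. \<forall>x \<in> X. f x = F x)"

lemma regular_on_polyfun: "f \<in> polyfuns K \<Longrightarrow> regular_on X K f"
  unfolding regular_on_def by blast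

lemma regular_on_const: "regular_on X K (\<lambda>_. c)"
  by (intro regular_on_polyfun polyfuns.const)

lemma regular_on_coord: "f \<in> K \<Longrightarrow> regular_on X K f"
  by (intro regular_on_polyfun polyfuns.coord)

lemma regular_on_add:
  assumes "regular_on X K f" "regular_on X K g"
  shows "regular_on X K (\<lambda>x. f x + g x)"
proof -
  from assms obtain F G where "F \<in> polyfuns K" "G \<in> polyfuns K" "\<forall>x \<in> X. f x = F x" "\<forall>x \<in> X. g x = G x"
    unfolding regular_on_def by blast
  thus ?thesis unfolding regular_on_def by (intro bexI[of _ "\<lambda>x. F x + G x"]) (auto intro: polyfuns.add)
qed

lemma regular_on_mult:
  assumes "regular_on X K f" "regular_on X K g"
  shows "regular_on X K (\<lambda>x. f x * g x)"
proof -
  from assms obtain F G where "F \<in> polyfuns K" "G \<in> polyfuns K" "\<forall>x \<in> X. f x = F x" "\<forall>x \<in> X. g x = G x"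
    unfolding regular_on_def by blast
  thus ?thesis unfolding regular_on_def by (intro bexI[of _ "\<lambda>x. F x * G x"]) (auto intro: polyfuns.mult)
qed

lemma regular_on_cong:
  "regular_on X K f \<Longrightarrow> (\<And>x. x \<in> X \<Longrightarrow> g x = f x) \<Longrightarrow> regular_on X K g"
  unfolding regular_on_def by simp

lemma regular_on_sum:
  assumes "\<And>i. i \<in> I \<Longrightarrow> regular_on X K (f i)"
  shows "regular_on X K (\<lambda>x. \<Sum>i\<in>I. f i x)"
  using assms
  by (induction I rule: infinite_finite_induct) (auto intro: regular_on_const regular_on_add)

lemma regular_on_prod:
  assumes "\<And>i. i \<in> I \<Longrightarrow> regular_on X K (f i)"
  shows "regular_on X K (\<lambda>x. \<Prod>i\<in>I. f i x)"
  using assms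
  by (induction I rule: infinite_finite_induct) (auto intro: regular_on_const regular_on_mult)

lemma permutes_lt: "s permutes {0..<N} \<Longrightarrow> i < N \<Longrightarrow> s i < (N :: nat)"
  using permutes_in_image[of s "{0..<N}" i] by simp

lemma regular_on_det:
  assumes "\<And>i j. i < N \<Longrightarrow> j < N \<Longrightarrow> regular_on X K (\<lambda>x. m x i j)"
  shows "regular_on X K (\<lambda>x. det (mat N N (\<lambda>(i, j). m x i j)))"
proof (rule regular_on_cong)
  show "regular_on X K (\<lambda>x. \<Sum>s | s permutes {0..<N}. signof s * (\<Prod>i = 0..<N. m x i (s i)))"
    by (intro regular_on_sum regular_on_mult regular_on_prod regular_on_const assms)
      (auto simp: permutes_lt)
next
  fix x
  show "det (mat N N (\<lambda>(i, j). m x i j)) =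
      (\<Sum>s | s permutes {0..<N}. signof s * (\<Prod>i = 0..<N. m x i (s i)))"
    by (subst det_def'[of _ N]) (auto intro!: sum.cong prod.cong simp: permutes_lt)
qed

lemma zariski_closure_of_iff:
  assumes "Y \<subseteq> X"
  shows "x \<in> zariski X K closure_of Y \<longleftrightarrow>
    x \<in> X \<and> (\<forall>f \<in> polyfuns K. (\<forall>y \<in> Y. f y = 0) \<longrightarrow> f x = 0)" (is "?L \<longleftrightarrow> ?R")
proof
  assume L: ?L
  have x: "x \<in> X" using L by (metis closure_of_subset_topspace subsetD topspace_zariski)
  have "f x = 0" if "f \<in> polyfuns K" "\<forall>y \<in> Y. f y = 0" for f
  proof -
    have "closedin (zariski X K) {x \<in> X. \<forall>f \<in> {f}. f x = 0}"
      unfolding closedin_zariski using that(1) by (intro exI[of _ "{f}"]) simp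
    moreover have "Y \<subseteq> {x \<in> X. \<forall>f \<in> {f}. f x = 0}" using that assms by auto
    ultimately have "zariski X K closure_of Y \<subseteq> {x \<in> X. \<forall>f \<in> {f}. f x = 0}"
      by (rule closure_of_minimal[rotated])
    thus ?thesis using L by auto
  qed
  with x show ?R by blast
next
  assume R: ?R
  have "closedin (zariski X K) (zariski X K closure_of Y)" by simp
  then obtain F where F: "F \<subseteq> polyfuns K"
    "zariski X K closure_of Y = {x \<in> X. \<forall>f \<in> F. f x = 0}"
    unfolding closedin_zariski by blast
  have "Y \<subseteq> zariski X K closure_of Y"
    by (rule closure_of_subset) (simp add: topspace_zariski assms)
  hence "\<forall>f \<in> F. \<forall>y \<in> Y. f y = 0" using F by auto
  thus ?L using R F by auto
qed

text \<open>A polynomial vanishing on all of \<open>Y\<close> vanishes on its closure. This is how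
  information at a closure point is carried back to the orbit.\<close>

lemma regular_nonzero_near:
  assumes "Y \<subseteq> X" "x \<in> zariski X K closure_of Y" "regular_on X K f" "f x \<noteq> 0"
  shows "\<exists>y \<in> Y. f y \<noteq> 0"
proof (rule ccontr)
  assume n: "\<not> (\<exists>y \<in> Y. f y \<noteq> 0)"
  from assms(3) obtain F where F: "F \<in> polyfuns K" "\<forall>x \<in> X. f x = F x"
    unfolding regular_on_def by blast
  have "\<forall>y \<in> Y. F y = 0" using n F assms(1) by (metis subsetD)
  moreover have "x \<in> X" "\<And>f. f \<in> polyfuns K \<Longrightarrow> \<forall>y \<in> Y. f y = 0 \<Longrightarrow> f x = 0"
    using assms(2) unfolding zariski_closure_of_iff[OF assms(1)] by auto
  ultimately have "F x = 0" "x \<in> X" using F(1) by auto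
  thus False using F assms(4) by auto
qed

section \<open>Rational curves\<close>

text \<open>\<open>B\<close> collects the parameters where a curve is undefined, such as those with
  a singular conjugating matrix; nothing is claimed there.\<close>

definition ratfun :: "complex set \<Rightarrow> (complex \<Rightarrow> complex) \<Rightarrow> bool" where
  "ratfun B f \<longleftrightarrow> (\<exists>q d. \<forall>t. t \<notin> B \<longrightarrow> poly d t \<noteq> 0 \<and> f t = poly q t / poly d t)"

lemma ratfun_poly: "ratfun B (poly q)"
  unfolding ratfun_def by (rule exI[of _ q], rule exI[of _ 1]) simp

lemma ratfun_const: "ratfun B (\<lambda>_. c)"
  unfolding ratfun_def by (rule exI[of _ "[:c:]"], rule exI[of _ 1]) simp

lemma ratfun_id: "ratfun B (\<lambda>t. t)"
  unfolding ratfun_def by (rule exI[of _ "[:0, 1:]"], rule exI[of _ 1]) simp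

lemma ratfun_add:
  assumes "ratfun B f" "ratfun B g" shows "ratfun B (\<lambda>t. f t + g t)"
proof -
  from assms obtain q d q' d' where
    "\<forall>t. t \<notin> B \<longrightarrow> poly d t \<noteq> 0 \<and> f t = poly q t / poly d t"
    "\<forall>t. t \<notin> B \<longrightarrow> poly d' t \<noteq> 0 \<and> g t = poly q' t / poly d' t"
    unfolding ratfun_def by blast
  thus ?thesis unfolding ratfun_def
    by (intro exI[of _ "q * d' + q' * d"] exI[of _ "d * d'"]) (auto simp: field_simps)
qed

lemma ratfun_mult:
  assumes "ratfun B f" "ratfun B g" shows "ratfun B (\<lambda>t. f t * g t)"
proof -
  from assms obtain q d q' d' where
    "\<forall>t. t \<notin> B \<longrightarrow> poly d t \<noteq> 0 \<and> f t = poly q t / poly d t"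
    "\<forall>t. t \<notin> B \<longrightarrow> poly d' t \<noteq> 0 \<and> g t = poly q' t / poly d' t"
    unfolding ratfun_def by blast
  thus ?thesis unfolding ratfun_def
    by (intro exI[of _ "q * q'"] exI[of _ "d * d'"]) auto
qed

lemma ratfun_inverse:
  assumes "ratfun B f" "\<And>t. t \<notin> B \<Longrightarrow> f t \<noteq> 0" shows "ratfun B (\<lambda>t. inverse (f t))"
proof -
  from assms(1) obtain q d where
    "\<forall>t. t \<notin> B \<longrightarrow> poly d t \<noteq> 0 \<and> f t = poly q t / poly d t"
    unfolding ratfun_def by blast
  thus ?thesis using assms(2) unfolding ratfun_def
    by (intro exI[of _ d] exI[of _ q]) (auto simp: field_simps)
qed

lemma ratfun_sum:
  assumes "\<And>i. i \<in> I \<Longrightarrow> ratfun B (f i)"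
  shows "ratfun B (\<lambda>t. \<Sum>i\<in>I. f i t)"
  using assms by (induction I rule: infinite_finite_induct) (auto intro: ratfun_const ratfun_add)

lemma ratfun_prod:
  assumes "\<And>i. i \<in> I \<Longrightarrow> ratfun B (f i)"
  shows "ratfun B (\<lambda>t. \<Prod>i\<in>I. f i t)"
  using assms by (induction I rule: infinite_finite_induct) (auto intro: ratfun_const ratfun_mult)

lemma ratfun_cong:
  "ratfun B f \<Longrightarrow> (\<And>t. t \<notin> B \<Longrightarrow> g t = f t) \<Longrightarrow> ratfun B g"
  unfolding ratfun_def by simp

lemma ratfun_det:
  assumes "\<And>i j. i < N \<Longrightarrow> j < N \<Longrightarrow> ratfun B (\<lambda>t. m t i j)"
  shows "ratfun B (\<lambda>t. det (mat N N (\<lambda>(i, j). m t i j)))"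
proof (rule ratfun_cong)
  show "ratfun B (\<lambda>t. \<Sum>s | s permutes {0..<N}. signof s * (\<Prod>i = 0..<N. m t i (s i)))"
    by (intro ratfun_sum ratfun_mult ratfun_prod ratfun_const assms)
      (auto simp: permutes_lt)
next
  fix t
  show "det (mat N N (\<lambda>(i, j). m t i j)) =
      (\<Sum>s | s permutes {0..<N}. signof s * (\<Prod>i = 0..<N. m t i (s i)))"
    by (subst det_def'[of _ N]) (auto intro!: sum.cong prod.cong simp: permutes_lt)
qed

lemma ratfun_zeros_finite:
  assumes "ratfun B f" "t0 \<notin> B" "f t0 \<noteq> 0"
  shows "finite {t. t \<notin> B \<and> f t = 0}"
proof -
  from assms(1) obtain q d where q:
    "\<forall>t. t \<notin> B \<longrightarrow> poly d t \<noteq> 0 \<and> f t = poly q t / poly d t"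
    unfolding ratfun_def by blast
  hence "q \<noteq> 0" using assms by auto
  hence "finite {t. poly q t = 0}" by (rule poly_roots_finite)
  thus ?thesis by (rule finite_subset[rotated]) (use q in auto)
qed

lemma polyfun_ratfun:
  assumes "f \<in> polyfuns K" "\<And>k. k \<in> K \<Longrightarrow> ratfun B (\<lambda>t. k (c t))"
  shows "ratfun B (\<lambda>t. f (c t))"
  using assms(1) by induction (auto intro: ratfun_const ratfun_add ratfun_mult assms(2))

lemma infinite_complex_avoid:
  assumes "finite (B :: complex set)" shows "\<exists>t. t \<notin> B"
  by (rule ex_new_if_finite[OF infinite_UNIV_char_0 assms])

text \<open>Pulled back to the curve, an equation of \<open>Z\<close> is a rational function with
  infinitely many zeros, hence zero. There are two exceptional sets because \<open>t0\<close> may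
  lie in \<open>B'\<close>, where membership in \<open>Z\<close> is not known beforehand, but not in
  \<open>B\<close>, where the coordinates may fail to be rational.\<close>

lemma curve_limit:
  assumes Z: "closedin (zariski X K) Z" and fin: "finite B'"
    and c: "\<And>t. t \<notin> B' \<Longrightarrow> c t \<in> Z"
    and rat: "\<And>k. k \<in> K \<Longrightarrow> ratfun B (\<lambda>t. k (c t))" "finite B" "t0 \<notin> B" "c t0 \<in> X"
  shows "c t0 \<in> Z"
proof -
  obtain F where F: "F \<subseteq> polyfuns K" "Z = {x \<in> X. \<forall>f \<in> F. f x = 0}"
    using Z unfolding closedin_zariski by blast
  have "f (c t0) = 0" if f: "f \<in> F" for f
  proof (rule ccontr)
    assume n: "f (c t0) \<noteq> 0"
    have "ratfun B (\<lambda>t. f (c t))" by (rule polyfun_ratfun[of f K]) (use f F rat(1) in auto)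
    hence "finite {t. t \<notin> B \<and> f (c t) = 0}" using ratfun_zeros_finite[of B "\<lambda>t. f (c t)" t0] rat(3) n by simp
    hence "finite ({t. t \<notin> B \<and> f (c t) = 0} \<union> B \<union> B')" using fin rat by auto
    then obtain t where "t \<notin> {t. t \<notin> B \<and> f (c t) = 0} \<union> B \<union> B'"
      using infinite_complex_avoid by meson
    thus False using c[of t] F f by auto
  qed
  thus ?thesis using F rat by auto
qed

text \<open>Suppose x avoids \<open>C\<close> and y avoids \<open>D\<close>. On a rational curve
  through both, an equation of \<open>C\<close> nonzero at x and an equation of \<open>D\<close>
  nonzero at y have finitely many zeros each, so some point of the curve avoids both closed
  sets.\<close>

lemma irreducible_by_curves:
  assumes S: "S \<subseteq> X" "S \<noteq> {}"
    and curve: "\<And>x y. x \<in> S \<Longrightarrow> y \<in> S \<Longrightarrow> \<exists>B c t0 t1. finite B \<and> t0 \<notin> B \<and> t1 \<notin> B \<and> c t0 = x \<and> c t1 = y \<and>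
      (\<forall>t. t \<notin> B \<longrightarrow> c t \<in> S) \<and> (\<forall>k \<in> K. ratfun B (\<lambda>t. k (c t)))"
  shows "irreducible_in (zariski X K) S"
  unfolding irreducible_in_def topspace_zariski
proof (intro conjI allI impI S)
  fix C D assume "closedin (zariski X K) C \<and> closedin (zariski X K) D \<and> S \<subseteq> C \<union> D"
  hence C: "closedin (zariski X K) C" and D: "closedin (zariski X K) D" and sub: "S \<subseteq> C \<union> D" by auto
  show "S \<subseteq> C \<or> S \<subseteq> D"
  proof (rule ccontr)
    assume "\<not> (S \<subseteq> C \<or> S \<subseteq> D)"
    then obtain x y where xy: "x \<in> S" "x \<notin> C" "y \<in> S" "y \<notin> D" by auto
    from C D obtain F H where F: "F \<subseteq> polyfuns K" "C = {x \<in> X. \<forall>f \<in> F. f x = 0}"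
      and H: "H \<subseteq> polyfuns K" "D = {x \<in> X. \<forall>f \<in> H. f x = 0}"
      unfolding closedin_zariski by blast
    have "x \<in> X" "y \<in> X" using xy S by auto
    then obtain f h where f: "f \<in> F" "f x \<noteq> 0" and h: "h \<in> H" "h y \<noteq> 0" using xy(2,4) unfolding F(2) H(2) by auto
    obtain B c t0 t1 where c: "finite B" "t0 \<notin> B" "t1 \<notin> B" "c t0 = x" "c t1 = y"
      "\<forall>t. t \<notin> B \<longrightarrow> c t \<in> S" "\<forall>k \<in> K. ratfun B (\<lambda>t. k (c t))"
      using curve[OF xy(1,3)] by (elim exE conjE)
    have "ratfun B (\<lambda>t. f (c t))" by (rule polyfun_ratfun[of f K]) (use f F c in auto)
    moreover have "ratfun B (\<lambda>t. h (c t))" by (rule polyfun_ratfun[of h K]) (use h H c in auto)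
    ultimately have "finite {t. t \<notin> B \<and> f (c t) = 0}" "finite {t. t \<notin> B \<and> h (c t) = 0}"
      using ratfun_zeros_finite[of B "\<lambda>t. f (c t)" t0] ratfun_zeros_finite[of B "\<lambda>t. h (c t)" t1] c f h by simp_all
    hence "finite ({t. t \<notin> B \<and> f (c t) = 0} \<union> {t. t \<notin> B \<and> h (c t) = 0} \<union> B)" using c by auto
    then obtain t where t: "t \<notin> {t. t \<notin> B \<and> f (c t) = 0} \<union> {t. t \<notin> B \<and> h (c t) = 0} \<union> B"
      using infinite_complex_avoid by meson
    hence "c t \<in> C \<union> D" using sub c by auto
    hence "f (c t) = 0 \<or> h (c t) = 0" using f(1) h(1) unfolding F(2) H(2) by auto
    thus False using t by auto
  qed
qed

section \<open>Irreducible components of finite unions\<close>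

lemma irreducible_in_closure_of:
  assumes "irreducible_in T S" shows "irreducible_in T (T closure_of S)"
proof -
  have S: "S \<subseteq> topspace T" "S \<noteq> {}" and irr: "\<And>C D. closedin T C \<Longrightarrow> closedin T D \<Longrightarrow> S \<subseteq> C \<union> D \<Longrightarrow> S \<subseteq> C \<or> S \<subseteq> D"
    using assms unfolding irreducible_in_def by auto
  have sub: "S \<subseteq> T closure_of S" using S by (simp add: closure_of_subset)
  show ?thesis unfolding irreducible_in_def
  proof (intro conjI allI impI)
    show "T closure_of S \<noteq> {}" using sub S by auto
    fix C D assume a: "closedin T C \<and> closedin T D \<and> T closure_of S \<subseteq> C \<union> D"
    hence "S \<subseteq> C \<or> S \<subseteq> D" using irr sub by blast
    thus "T closure_of S \<subseteq> C \<or> T closure_of S \<subseteq> D" using a closure_of_minimal by metis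
  qed (rule closure_of_subset_topspace)
qed

lemma irreducible_in_finite_Union:
  assumes "finite I" "irreducible_in T W" "\<And>i. i \<in> I \<Longrightarrow> closedin T (Z i)" "W \<subseteq> (\<Union>i\<in>I. Z i)"
  shows "\<exists>i\<in>I. W \<subseteq> Z i"
  using assms(1,3,4)
proof (induction I)
  case empty
  thus ?case using assms(2) unfolding irreducible_in_def by auto
next
  case (insert i I)
  have "closedin T (\<Union>i\<in>I. Z i)" using insert by (intro closedin_Union) auto
  moreover have "W \<subseteq> Z i \<union> (\<Union>i\<in>I. Z i)" using insert by auto
  ultimately have "W \<subseteq> Z i \<or> W \<subseteq> (\<Union>i\<in>I. Z i)"
    using assms(2) insert.prems(1)[of i] unfolding irreducible_in_def by blast
  thus ?case using insert by blast
qed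

text \<open>An irreducible set inside a finite union of closed sets lies in one of them. Maximality
  and injectivity therefore both reduce to the absence of inclusions between different
  terms.\<close>

lemma bij_betw_irreducible_components:
  assumes fin: "finite I" and irr: "\<And>i. i \<in> I \<Longrightarrow> irreducible_in T (Z i)"
    and cl: "\<And>i. i \<in> I \<Longrightarrow> closedin T (Z i)"
    and irred: "\<And>i j. i \<in> I \<Longrightarrow> j \<in> I \<Longrightarrow> Z i \<subseteq> Z j \<Longrightarrow> i = j"
  shows "bij_betw Z I (irreducible_components T (\<Union>i\<in>I. Z i))"
  unfolding bij_betw_def
proof (intro conjI equalityI subsetI)
  show "inj_on Z I" using irred by (intro inj_onI) auto
next
  fix W assume "W \<in> Z ` I"
  then obtain i where i: "i \<in> I" "W = Z i" by auto
  have "W' = Z i" if "irreducible_in T W'" "Z i \<subseteq> W'" "W' \<subseteq> (\<Union>i\<in>I. Z i)" for W'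
  proof -
    have "\<exists>j\<in>I. W' \<subseteq> Z j"
      using irreducible_in_finite_Union[OF fin that(1) cl that(3)] by auto
    thus ?thesis using irred[OF i(1)] that by fastforce
  qed
  thus "W \<in> irreducible_components T (\<Union>i\<in>I. Z i)"
    unfolding irreducible_components_def using i irr by auto
next
  fix W assume "W \<in> irreducible_components T (\<Union>i\<in>I. Z i)"
  hence W: "irreducible_in T W" "W \<subseteq> (\<Union>i\<in>I. Z i)"
    "\<And>W'. irreducible_in T W' \<Longrightarrow> W \<subseteq> W' \<Longrightarrow> W' \<subseteq> (\<Union>i\<in>I. Z i) \<Longrightarrow> W' = W"
    unfolding irreducible_components_def by auto
  obtain j where "j \<in> I" "W \<subseteq> Z j"
    using irreducible_in_finite_Union[OF fin W(1) cl W(2)] by auto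
  thus "W \<in> Z ` I" using W(3)[of "Z j"] irr by auto
qed

section \<open>Simultaneous conjugation\<close>

abbreviation ginv :: "nat \<Rightarrow> complex mat \<Rightarrow> complex mat" where
  "ginv p g \<equiv> inv\<^bsub>matring p\<^esub> g"

lemma mult_mat_entry:
  assumes "A \<in> carrier_mat p q" "B \<in> carrier_mat q r" "i < p" "j < r"
  shows "(A * B) $$ (i, j) = (\<Sum>k<q. A $$ (i, k) * B $$ (k, j))"
  using assms by (auto simp: scalar_prod_def atLeast0LessThan)

lemma GL_D:
  assumes "g \<in> GL p"
  shows "g \<in> carrier_mat p p" "ginv p g \<in> carrier_mat p p" "ginv p g \<in> GL p"
    "g * ginv p g = 1\<^sub>m p" "ginv p g * g = 1\<^sub>m p" "ginv p (ginv p g) = g"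
proof -
  interpret ring "matring p" by (rule ring_mat)
  show "g \<in> carrier_mat p p" using Units_closed[OF assms] by (simp add: ring_mat_simps)
  show "ginv p g \<in> carrier_mat p p" using Units_inv_closed[OF assms] by (simp add: ring_mat_simps)
  show "ginv p g \<in> GL p" using Units_inv_Units[OF assms] .
  show "g * ginv p g = 1\<^sub>m p" using Units_r_inv[OF assms] by (simp add: ring_mat_simps)
  show "ginv p g * g = 1\<^sub>m p" using Units_l_inv[OF assms] by (simp add: ring_mat_simps)
  show "ginv p (ginv p g) = g" using Units_inv_inv[OF assms] .
qed

lemma GL_I:
  assumes "g \<in> carrier_mat p p" "h \<in> carrier_mat p p" "g * h = 1\<^sub>m p"
  shows "g \<in> GL p" "ginv p g = h"
proof -
  interpret ring "matring p" by (rule ring_mat)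
  have hg: "h * g = 1\<^sub>m p" using mat_mult_left_right_inverse assms by blast
  show "g \<in> GL p" unfolding Units_def using assms hg by (auto simp: ring_mat_simps)
  show "ginv p g = h" using assms hg by (intro inv_unique'[symmetric]) (auto simp: ring_mat_simps)
qed

lemma GL_det: "g \<in> carrier_mat p p \<Longrightarrow> det g \<noteq> 0 \<Longrightarrow> g \<in> GL p"
  by (rule det_non_zero_imp_unit)

lemma GL_det_nonzero: "g \<in> GL p \<Longrightarrow> det g \<noteq> 0"
  by (rule unit_imp_det_non_zero)

lemma GL_one: "1\<^sub>m p \<in> GL p" "ginv p (1\<^sub>m p) = 1\<^sub>m p"
  using GL_I[of "1\<^sub>m p" p "1\<^sub>m p"] by simp_all

lemma GL_mult:
  assumes "g \<in> GL p" "h \<in> GL p"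
  shows "g * h \<in> GL p" "ginv p (g * h) = ginv p h * ginv p g"
proof -
  note g = GL_D[OF assms(1)] and h = GL_D[OF assms(2)]
  have "(g * h) * (ginv p h * ginv p g) = g * (h * ginv p h) * ginv p g"
    using g(1,2) h(1,2) by (simp add: assoc_mult_mat[of _ p p _ p _ p])
  also have "\<dots> = 1\<^sub>m p" using g h by simp
  finally have e: "(g * h) * (ginv p h * ginv p g) = 1\<^sub>m p" .
  show "g * h \<in> GL p" "ginv p (g * h) = ginv p h * ginv p g"
    by (rule GL_I[OF _ _ e]; use g h in auto)+
qed

text \<open>The adjugate has polynomial entries, so this exhibits the entries of the inverse as
  rational functions along a curve of matrices.\<close>

lemma ginv_adj:
  assumes "g \<in> GL p" "a < p" "b < p"
  shows "ginv p g $$ (a, b) = inverse (det g) * adj_mat g $$ (a, b)"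
proof -
  note g = GL_D[OF assms(1)]
  note adj = adj_mat[OF g(1)]
  have "ginv p g = inverse (det g) \<cdot>\<^sub>m adj_mat g"
  proof (rule GL_I)
    show "g * (inverse (det g) \<cdot>\<^sub>m adj_mat g) = 1\<^sub>m p"
      using adj g(1) GL_det_nonzero[OF assms(1)]
      by (intro eq_matI) (auto simp: mult_smult_distrib[OF g(1) adj(1)])
  qed (use adj g in auto)
  thus ?thesis using adj assms by simp
qed

lemma mtuplesD: "A \<in> mtuples p n \<Longrightarrow> length A = n"
  "A \<in> mtuples p n \<Longrightarrow> m < n \<Longrightarrow> A ! m \<in> carrier_mat p p"
  unfolding mtuples_def by auto

lemma mtuplesI: "length A = n \<Longrightarrow> (\<And>m. m < n \<Longrightarrow> A ! m \<in> carrier_mat p p) \<Longrightarrow> A \<in> mtuples p n"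
  unfolding mtuples_def by (auto simp: in_set_conv_nth)

lemma mtuples_eqI:
  assumes "A \<in> mtuples p n" "B \<in> mtuples p n"
    "\<And>m a b. m < n \<Longrightarrow> a < p \<Longrightarrow> b < p \<Longrightarrow> A ! m $$ (a, b) = B ! m $$ (a, b)"
  shows "A = B"
proof (rule nth_equalityI)
  fix m assume "m < length A"
  hence "m < n" using mtuplesD(1)[OF assms(1)] by simp
  thus "A ! m = B ! m" using mtuplesD(2)[OF assms(1), of m] mtuplesD(2)[OF assms(2), of m] assms(3)
    by (intro eq_matI) auto
qed (use mtuplesD(1)[OF assms(1)] mtuplesD(1)[OF assms(2)] in auto)

lemma conj_act_nth: "m < length A \<Longrightarrow> conj_act p g A ! m = g * A ! m * ginv p g"
  unfolding conj_act_def by simp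

lemma length_conj_act [simp]: "length (conj_act p g A) = length A"
  unfolding conj_act_def by simp

lemma conj_act_mtuples:
  assumes "g \<in> GL p" "A \<in> mtuples p n" shows "conj_act p g A \<in> mtuples p n"
  using assms GL_D(1,2)[OF assms(1)] mtuplesD[OF assms(2)]
  by (intro mtuplesI) (auto simp: conj_act_nth)

lemma conj_act_mult:
  assumes "g \<in> GL p" "h \<in> GL p" "A \<in> mtuples p n"
  shows "conj_act p g (conj_act p h A) = conj_act p (g * h) A"
proof (rule nth_equalityI)
  fix m assume "m < length (conj_act p g (conj_act p h A))"
  hence m: "m < n" "m < length A" using mtuplesD(1)[OF assms(3)] by auto
  note g = GL_D[OF assms(1)] and h = GL_D[OF assms(2)] and A = mtuplesD(2)[OF assms(3) m(1)]
  show "conj_act p g (conj_act p h A) ! m = conj_act p (g * h) A ! m"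
    using m g(1,2) h(1,2) A GL_mult(2)[OF assms(1,2)]
    by (simp add: conj_act_nth assoc_mult_mat[of _ p p _ p _ p])
qed simp

lemma conj_act_entry:
  assumes "g \<in> GL p" "A \<in> mtuples p n" "m < n" "a < p" "b < p"
  shows "conj_act p g A ! m $$ (a, b) = (\<Sum>c<p. \<Sum>d<p. g $$ (a, c) * A ! m $$ (c, d) * ginv p g $$ (d, b))"
proof -
  note g = GL_D(1,2)[OF assms(1)] and A = mtuplesD(2)[OF assms(2,3)]
  have "conj_act p g A ! m $$ (a, b) = (\<Sum>d<p. (\<Sum>c<p. g $$ (a, c) * A ! m $$ (c, d)) * ginv p g $$ (d, b))"
    using assms mtuplesD(1)[OF assms(2)] g A
    by (simp add: conj_act_nth mult_mat_entry[of _ p p _ p] del: index_mult_mat assoc_mult_mat)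
  thus ?thesis by (subst sum.swap) (simp add: sum_distrib_right)
qed

lemma conj_act_eqI:
  assumes "g \<in> GL p" "A \<in> mtuples p n" "B \<in> mtuples p n"
    and "\<And>m. m < n \<Longrightarrow> g * A ! m = B ! m * g"
  shows "conj_act p g A = B"
proof (rule nth_equalityI)
  fix m assume "m < length (conj_act p g A)"
  hence m: "m < n" "m < length A" using mtuplesD(1)[OF assms(2)] by auto
  note g = GL_D[OF assms(1)]
  have "g * A ! m * ginv p g = B ! m * (g * ginv p g)"
    using assms(4)[OF m(1)] g(1,2) mtuplesD(2)[OF assms(3) m(1)]
    by (simp add: assoc_mult_mat[of _ p p _ p _ p])
  thus "conj_act p g A ! m = B ! m" using m g mtuplesD(2)[OF assms(3) m(1)] by (simp add: conj_act_nth)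
qed (use mtuplesD(1)[OF assms(2)] mtuplesD(1)[OF assms(3)] in simp)

lemma conj_act_one: "A \<in> mtuples p n \<Longrightarrow> conj_act p (1\<^sub>m p) A = A"
  by (rule conj_act_eqI[OF GL_one(1)]) (auto dest: mtuplesD(2))

lemma conj_act_ginv:
  assumes "g \<in> GL p" "A \<in> mtuples p n"
  shows "conj_act p (ginv p g) (conj_act p g A) = A" "conj_act p g (conj_act p (ginv p g) A) = A"
  using assms GL_D[OF assms(1)] by (simp_all add: conj_act_mult[of _ p _ _ n] conj_act_one)

lemma pair_orbit_subset:
  "C \<subseteq> mtuples p n \<times> mtuples p n \<Longrightarrow> pair_orbit p C \<subseteq> mtuples p n \<times> mtuples p n"
  unfolding pair_orbit_def using conj_act_mtuples by blast

lemma pair_orbit_subsetI: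
  assumes "C \<subseteq> mtuples p n \<times> mtuples p n"
    and "\<And>v w. (v, w) \<in> C' \<Longrightarrow> v \<in> mtuples p n \<and> w \<in> mtuples p n \<and>
      (\<exists>g\<in>GL p. \<exists>h\<in>GL p. (conj_act p g v, conj_act p h w) \<in> C)"
  shows "pair_orbit p C' \<subseteq> pair_orbit p C"
proof
  fix x assume "x \<in> pair_orbit p C'"
  then obtain g h v w where x: "x = (conj_act p g v, conj_act p h w)" "g \<in> GL p" "h \<in> GL p" "(v, w) \<in> C'"
    unfolding pair_orbit_def by blast
  obtain g' h' where gh: "v \<in> mtuples p n" "w \<in> mtuples p n" "g' \<in> GL p" "h' \<in> GL p"
    "(conj_act p g' v, conj_act p h' w) \<in> C" using assms(2)[OF x(4)] by blast
  have *: "conj_act p k u = conj_act p (k * ginv p k') (conj_act p k' u)"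
    if "k \<in> GL p" "k' \<in> GL p" "u \<in> mtuples p n" for k k' u
    using that conj_act_mult[OF that(1) GL_D(3)[OF that(2)] conj_act_mtuples[OF that(2,3)]]
    by (simp add: conj_act_ginv)
  have "x = (conj_act p (g * ginv p g') (conj_act p g' v), conj_act p (h * ginv p h') (conj_act p h' w))"
    using x(1) *[OF x(2) gh(3,1)] *[OF x(3) gh(4,2)] by simp
  thus "x \<in> pair_orbit p C" unfolding pair_orbit_def
    using gh GL_mult(1) GL_D(3) x(2,3) by blast
qed

lemma pair_orbitI:
  "(conj_act p g v, conj_act p h w) \<in> C \<Longrightarrow> v \<in> mtuples p n \<Longrightarrow> w \<in> mtuples p n \<Longrightarrow>
    g \<in> GL p \<Longrightarrow> h \<in> GL p \<Longrightarrow> (v, w) \<in> pair_orbit p C"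
  unfolding pair_orbit_def using conj_act_ginv(1) GL_D(3) by (smt (verit) mem_Collect_eq)

section \<open>Noncommutative polynomials\<close>

text \<open>Elements of the free algebra are kept as syntax, so that one element can be evaluated at
  tuples of different sizes and at both members of a pair.\<close>

datatype nc = NOne | NVar nat | NAdd nc nc | NMul nc nc | NScale complex nc

primrec nc_eval :: "nat \<Rightarrow> nc \<Rightarrow> mtuple \<Rightarrow> complex mat" where
  "nc_eval p NOne A = 1\<^sub>m p"
| "nc_eval p (NVar m) A = (if m < length A then A ! m else 0\<^sub>m p p)"
| "nc_eval p (NAdd u v) A = nc_eval p u A + nc_eval p v A"
| "nc_eval p (NMul u v) A = nc_eval p u A * nc_eval p v A"
| "nc_eval p (NScale c u) A = c \<cdot>\<^sub>m nc_eval p u A"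

lemma nc_eval_carrier: "A \<in> mtuples p n \<Longrightarrow> nc_eval p w A \<in> carrier_mat p p"
  by (induction w) (auto simp: mtuplesD)

lemma nc_eval_conj:
  assumes g: "g \<in> GL p" and A: "A \<in> mtuples p n"
  shows "nc_eval p w (conj_act p g A) = g * nc_eval p w A * ginv p g"
proof (induction w)
  case NOne
  show ?case using GL_D[OF g] by simp
next
  case (NVar m)
  show ?case using GL_D[OF g] by (auto simp: conj_act_nth)
next
  case (NAdd u v)
  show ?case using NAdd GL_D(1,2)[OF g] nc_eval_carrier[OF A]
    by (simp add: mult_add_distrib_mat[of _ p p _ p] add_mult_distrib_mat[of _ p p _ _ p])
next
  case (NMul u v)
  note c = GL_D(1,2)[OF g] nc_eval_carrier[OF A, of u] nc_eval_carrier[OF A, of v]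
  have "g * nc_eval p u A * ginv p g * (g * nc_eval p v A * ginv p g)
      = g * nc_eval p u A * ((ginv p g * g) * nc_eval p v A * ginv p g)"
    using c by (simp add: assoc_mult_mat[of _ p p _ p _ p])
  also have "\<dots> = g * (nc_eval p u A * nc_eval p v A) * ginv p g"
    using c GL_D(5)[OF g] by (simp add: assoc_mult_mat[of _ p p _ p _ p])
  finally show ?case using NMul by simp
next
  case (NScale c u)
  show ?case using NScale GL_D(1,2)[OF g] nc_eval_carrier[OF A, of u]
    by (simp add: mult_smult_distrib[of _ p p _ p] mult_smult_assoc_mat[of _ p p _ p])
qed

lemma regular_on_nc_eval:
  assumes "a < p" "b < p"
  shows "regular_on (mtuples p n) (coords p n) (\<lambda>A. nc_eval p w A $$ (a, b))"
  using assms
proof (induction w arbitrary: a b)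
  case NOne
  show ?case by (rule regular_on_cong[OF regular_on_const]) simp
next
  case (NVar m)
  show ?case
  proof (cases "m < n")
    case True
    show ?thesis
      by (rule regular_on_cong[OF regular_on_coord[of "\<lambda>A. (A ! m) $$ (a, b)"]])
        (use True NVar in \<open>auto simp: coords_def mtuplesD\<close>)
  next
    case False
    show ?thesis by (rule regular_on_cong[OF regular_on_const[of _ _ 0]])
      (use False NVar in \<open>auto simp: mtuplesD\<close>)
  qed
next
  case (NAdd u v)
  show ?case by (rule regular_on_cong[OF regular_on_add[OF NAdd.IH(1)[of a b] NAdd.IH(2)[of a b]]])
    (use NAdd.prems in \<open>auto dest: nc_eval_carrier[of _ p n u] nc_eval_carrier[of _ p n v]\<close>)
next
  case (NMul u v)
  have "regular_on (mtuples p n) (coords p n) (\<lambda>A. \<Sum>k<p. nc_eval p u A $$ (a, k) * nc_eval p v A $$ (k, b))"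
    using NMul by (intro regular_on_sum regular_on_mult) auto
  thus ?case by (rule regular_on_cong)
    (use NMul.prems in \<open>simp add: mult_mat_entry[OF nc_eval_carrier nc_eval_carrier]\<close>)
next
  case (NScale c u)
  have "regular_on (mtuples p n) (coords p n) (\<lambda>A. c * nc_eval p u A $$ (a, b))"
    using NScale by (intro regular_on_mult regular_on_const)
  thus ?case
  proof (rule regular_on_cong)
    fix A assume "A \<in> mtuples p n"
    thus "nc_eval p (NScale c u) A $$ (a, b) = c * nc_eval p u A $$ (a, b)"
      using NScale.prems nc_eval_carrier[of A p n u] by simp
  qed
qed

section \<open>The separating variety\<close>

lemma pair_coords_cases:
  assumes "k \<in> pair_coords p n"
  obtains m a b where "m < n" "a < p" "b < p" "k = (\<lambda>x. fst x ! m $$ (a, b))"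
  | m a b where "m < n" "a < p" "b < p" "k = (\<lambda>x. snd x ! m $$ (a, b))"
proof -
  from assms consider f where "f \<in> coords p n" "k = f \<circ> fst" | f where "f \<in> coords p n" "k = f \<circ> snd"
    unfolding pair_coords_def by blast
  thus thesis
    by cases (auto simp: coords_def o_def intro: that)
qed

lemma polyfuns_fst: "f \<in> polyfuns (coords p n) \<Longrightarrow> (\<lambda>x. f (fst x)) \<in> polyfuns (pair_coords p n)"
  by (erule polyfuns_compose, rule polyfuns.coord) (auto simp: pair_coords_def o_def)

lemma polyfuns_snd: "f \<in> polyfuns (coords p n) \<Longrightarrow> (\<lambda>x. f (snd x)) \<in> polyfuns (pair_coords p n)"
  by (erule polyfuns_compose, rule polyfuns.coord) (auto simp: pair_coords_def o_def)

lemma regular_on_pair_nc_eval: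
  assumes "a < p" "b < p"
  shows "regular_on (mtuples p n \<times> mtuples p n) (pair_coords p n) (\<lambda>x. nc_eval p w (fst x) $$ (a, b))"
    and "regular_on (mtuples p n \<times> mtuples p n) (pair_coords p n) (\<lambda>x. nc_eval p w (snd x) $$ (a, b))"
proof -
  obtain F where F: "F \<in> polyfuns (coords p n)"
    "\<And>A. A \<in> mtuples p n \<Longrightarrow> nc_eval p w A $$ (a, b) = F A"
    using regular_on_nc_eval[OF assms, of n w] unfolding regular_on_def by blast
  show "regular_on (mtuples p n \<times> mtuples p n) (pair_coords p n) (\<lambda>x. nc_eval p w (fst x) $$ (a, b))"
    by (rule regular_on_cong[OF regular_on_polyfun[OF polyfuns_fst[OF F(1)]]]) (auto simp: F(2))
  show "regular_on (mtuples p n \<times> mtuples p n) (pair_coords p n) (\<lambda>x. nc_eval p w (snd x) $$ (a, b))"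
    by (rule regular_on_cong[OF regular_on_polyfun[OF polyfuns_snd[OF F(1)]]]) (auto simp: F(2))
qed

lemma closedin_separating_variety: "closedin (pair_zariski p n) (separating_variety p n)"
proof -
  define F where "F = (\<lambda>f x. f (fst x) + - 1 * f (snd x)) ` invariants p n"
  have "(\<lambda>x. f (fst x) + - 1 * f (snd x)) \<in> polyfuns (pair_coords p n)" if "f \<in> invariants p n" for f
    using that unfolding invariants_def
    by (intro polyfuns.add polyfuns.mult polyfuns_fst polyfuns_snd polyfuns.const) auto
  hence "F \<subseteq> polyfuns (pair_coords p n)" unfolding F_def by blast
  moreover have "separating_variety p n = {x \<in> mtuples p n \<times> mtuples p n. \<forall>f \<in> F. f x = 0}"
    unfolding separating_variety_def F_def by auto
  ultimately show ?thesis unfolding pair_zariski_def closedin_zariski by blast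
qed

lemma pair_orbit_subset_separating:
  assumes "C \<subseteq> separating_variety p n" shows "pair_orbit p C \<subseteq> separating_variety p n"
proof
  fix x assume "x \<in> pair_orbit p C"
  then obtain g h v w where x: "x = (conj_act p g v, conj_act p h w)" "g \<in> GL p" "h \<in> GL p" "(v, w) \<in> C"
    unfolding pair_orbit_def by blast
  hence "v \<in> mtuples p n" "w \<in> mtuples p n" "\<forall>f \<in> invariants p n. f v = f w"
    using assms unfolding separating_variety_def by auto
  thus "x \<in> separating_variety p n" using x conj_act_mtuples
    unfolding separating_variety_def invariants_def by simp
qed

lemma sum_trace_commute:
  fixes f :: "'i \<Rightarrow> 'j \<Rightarrow> complex" and g :: "'j \<Rightarrow> 'i \<Rightarrow> complex"
  shows "(\<Sum>a\<in>S. \<Sum>b\<in>T. f a b * g b a) = (\<Sum>b\<in>T. \<Sum>a\<in>S. g b a * f a b)"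
  by (subst sum.swap) (simp add: mult.commute)

text \<open>Of all invariants only these traces enter the inclusion of the separating variety in the
  union; they suffice to recover the irreducible diagonal blocks.\<close>

lemma separating_trace:
  assumes "(v, w) \<in> separating_variety p n"
  shows "(\<Sum>a<p. nc_eval p W v $$ (a, a)) = (\<Sum>a<p. nc_eval p W w $$ (a, a))"
proof -
  have "regular_on (mtuples p n) (coords p n) (\<lambda>A. \<Sum>a<p. nc_eval p W A $$ (a, a))"
    by (intro regular_on_sum regular_on_nc_eval) auto
  then obtain F where F: "F \<in> polyfuns (coords p n)"
    "\<And>A. A \<in> mtuples p n \<Longrightarrow> (\<Sum>a<p. nc_eval p W A $$ (a, a)) = F A"
    unfolding regular_on_def by blast
  have "F (conj_act p g A) = F A" if g: "g \<in> GL p" and A: "A \<in> mtuples p n" for g A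
  proof -
    note c = GL_D(1,2)[OF g] nc_eval_carrier[OF A, of W]
    have "F (conj_act p g A) = (\<Sum>a<p. (g * (nc_eval p W A * ginv p g)) $$ (a, a))"
      using F(2)[OF conj_act_mtuples[OF g A]] c by (simp add: nc_eval_conj[OF g A])
    also have "\<dots> = (\<Sum>a<p. \<Sum>b<p. g $$ (a, b) * (nc_eval p W A * ginv p g) $$ (b, a))"
      using c by (simp add: mult_mat_entry[of _ p p _ p] del: index_mult_mat)
    also have "\<dots> = (\<Sum>b<p. \<Sum>a<p. (nc_eval p W A * ginv p g) $$ (b, a) * g $$ (a, b))"
      by (rule sum_trace_commute)
    also have "\<dots> = (\<Sum>b<p. (nc_eval p W A * ginv p g * g) $$ (b, b))"
      using c by (simp add: mult_mat_entry[of _ p p _ p] del: index_mult_mat assoc_mult_mat)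
    also have "nc_eval p W A * ginv p g * g = nc_eval p W A"
      using c GL_D(5)[OF g] by simp
    finally show ?thesis using F(2)[OF A] by simp
  qed
  hence "F \<in> invariants p n" unfolding invariants_def using F(1) by blast
  thus ?thesis using assms F(2) unfolding separating_variety_def by auto
qed

section \<open>Pairs of tuples triangular for two level functions\<close>

text \<open>
  A composition together with a permutation is encoded by two level functions on the index set
  \<open>{..<p}\<close> with the same fibres: \<open>\<alpha>\<close> orders the diagonal blocks of the first tuple and \<open>\<beta>\<close> those of
  the second one, and after a permutation of coordinates matching blocks sit on the same indices.
\<close>

definition level_pairs :: "nat \<Rightarrow> nat \<Rightarrow> (nat \<Rightarrow> nat) \<Rightarrow> (nat \<Rightarrow> nat) \<Rightarrow> (mtuple \<times> mtuple) set" where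
  "level_pairs p n \<alpha> \<beta> = {(A, A'). A \<in> mtuples p n \<and> A' \<in> mtuples p n \<and>
     (\<forall>m<n. \<forall>a<p. \<forall>b<p. (\<alpha> b < \<alpha> a \<longrightarrow> A ! m $$ (a, b) = 0) \<and> (\<beta> b < \<beta> a \<longrightarrow> A' ! m $$ (a, b) = 0) \<and>
       (\<alpha> a = \<alpha> b \<longrightarrow> A ! m $$ (a, b) = A' ! m $$ (a, b)))}"

definition same_fibres :: "nat \<Rightarrow> (nat \<Rightarrow> nat) \<Rightarrow> (nat \<Rightarrow> nat) \<Rightarrow> bool" where
  "same_fibres p \<alpha> \<beta> \<longleftrightarrow> (\<forall>a<p. \<forall>b<p. \<alpha> a = \<alpha> b \<longleftrightarrow> \<beta> a = \<beta> b)"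

definition mk_tuple :: "nat \<Rightarrow> nat \<Rightarrow> (nat \<Rightarrow> nat \<Rightarrow> nat \<Rightarrow> complex) \<Rightarrow> mtuple" where
  "mk_tuple p n f = map (\<lambda>m. mat p p (\<lambda>(a, b). f m a b)) [0..<n]"

lemma mk_tuple_mtuples: "mk_tuple p n f \<in> mtuples p n"
  unfolding mk_tuple_def by (rule mtuplesI) auto

lemma mk_tuple_entry [simp]:
  "m < n \<Longrightarrow> a < p \<Longrightarrow> b < p \<Longrightarrow> mk_tuple p n f ! m $$ (a, b) = f m a b"
  unfolding mk_tuple_def by simp

lemma level_pairs_subset: "level_pairs p n \<alpha> \<beta> \<subseteq> mtuples p n \<times> mtuples p n"
  unfolding level_pairs_def by auto

lemma pair_orbit_conj:
  assumes "(v, w) \<in> pair_orbit p C" "C \<subseteq> mtuples p n \<times> mtuples p n" "g \<in> GL p" "h \<in> GL p"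
  shows "(conj_act p g v, conj_act p h w) \<in> pair_orbit p C"
proof -
  obtain g' h' v' w' where "v = conj_act p g' v'" "w = conj_act p h' w'" "g' \<in> GL p" "h' \<in> GL p" "(v', w') \<in> C"
    using assms(1) unfolding pair_orbit_def by blast
  moreover have "v' \<in> mtuples p n" "w' \<in> mtuples p n" using calculation(5) assms(2) by auto
  ultimately have "(conj_act p g v, conj_act p h w) = (conj_act p (g * g') v', conj_act p (h * h') w')"
    using assms(3,4) by (simp add: conj_act_mult)
  moreover have "g * g' \<in> GL p" "h * h' \<in> GL p" using GL_mult(1) assms(3,4) \<open>g' \<in> GL p\<close> \<open>h' \<in> GL p\<close> by auto
  ultimately show ?thesis unfolding pair_orbit_def using \<open>(v', w') \<in> C\<close> by blast
qed

section \<open>Diagonal conjugation and degeneration of triangular pairs\<close>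

definition diag_gl :: "nat \<Rightarrow> (nat \<Rightarrow> complex) \<Rightarrow> complex mat" where
  "diag_gl p d = mat p p (\<lambda>(a, b). if a = b then d a else 0)"

lemma diag_gl_GL:
  assumes "\<And>a. a < p \<Longrightarrow> d a \<noteq> 0"
  shows "diag_gl p d \<in> GL p" "ginv p (diag_gl p d) = diag_gl p (\<lambda>a. inverse (d a))"
proof -
  have "(\<Sum>k<p. diag_gl p d $$ (a, k) * diag_gl p (\<lambda>a. inverse (d a)) $$ (k, b)) = 1\<^sub>m p $$ (a, b)"
    if ab: "a < p" "b < p" for a b
  proof -
    have "(\<Sum>k<p. diag_gl p d $$ (a, k) * diag_gl p (\<lambda>a. inverse (d a)) $$ (k, b))
        = (\<Sum>k<p. if k = a then (if a = b then 1 else 0) else 0)"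
      using ab assms by (intro sum.cong refl) (auto simp: diag_gl_def)
    thus ?thesis using ab by simp
  qed
  moreover have "diag_gl p e \<in> carrier_mat p p" for e by (simp add: diag_gl_def)
  ultimately have "diag_gl p d * diag_gl p (\<lambda>a. inverse (d a)) = 1\<^sub>m p"
    by (intro eq_matI) (auto simp: mult_mat_entry[of _ p p _ p] simp del: index_mult_mat(1))
  thus "diag_gl p d \<in> GL p" "ginv p (diag_gl p d) = diag_gl p (\<lambda>a. inverse (d a))"
    using GL_I[of "diag_gl p d" p "diag_gl p (\<lambda>a. inverse (d a))"] by (auto simp: diag_gl_def)
qed

lemma conj_act_diag_gl:
  assumes "\<And>a. a < p \<Longrightarrow> d a \<noteq> 0" "A \<in> mtuples p n" "m < n" "a < p" "b < p"
  shows "conj_act p (diag_gl p d) A ! m $$ (a, b) = d a * A ! m $$ (a, b) / d b"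
proof -
  have "conj_act p (diag_gl p d) A ! m $$ (a, b) =
    (\<Sum>x<p. \<Sum>y<p. diag_gl p d $$ (a, x) * A ! m $$ (x, y) * diag_gl p (\<lambda>a. inverse (d a)) $$ (y, b))"
    using assms diag_gl_GL[of p d] by (simp add: conj_act_entry)
  also have "\<dots> = (\<Sum>x<p. \<Sum>y<p. if y = b then (if x = a then d a * A ! m $$ (a, b) * inverse (d b) else 0) else 0)"
    using assms by (intro sum.cong refl) (auto simp: diag_gl_def)
  also have "\<dots> = d a * A ! m $$ (a, b) / d b"
    using assms by (simp add: sum.delta sum.delta' divide_inverse)
  finally show ?thesis .
qed

text \<open>Conjugation by the diagonal matrix with entries t^(-\<alpha> a) multiplies entry (a, b)
  by t^(\<alpha> b - \<alpha> a). On the support of a triangular tuple the exponents are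
  nonnegative, so the limit at t = 0 exists and keeps only the diagonal blocks, while
  \<open>f\<close> is constant along the curve.\<close>

lemma invariant_diagonal_part:
  assumes f: "f \<in> invariants p n" and A: "A \<in> mtuples p n"
    and tri: "\<And>m a b. m < n \<Longrightarrow> a < p \<Longrightarrow> b < p \<Longrightarrow> \<alpha> b < \<alpha> a \<Longrightarrow> A ! m $$ (a, b) = 0"
  shows "f A = f (mk_tuple p n (\<lambda>m a b. if \<alpha> a = (\<alpha> b :: nat) then A ! m $$ (a, b) else 0))" (is "_ = f ?D")
proof -
  define c where "c t = mk_tuple p n (\<lambda>m a b. if \<alpha> a \<le> \<alpha> b then A ! m $$ (a, b) * t ^ (\<alpha> b - \<alpha> a) else 0)" for t
  have f': "f \<in> polyfuns (coords p n)" "\<And>g v. g \<in> GL p \<Longrightarrow> v \<in> mtuples p n \<Longrightarrow> f (conj_act p g v) = f v"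
    using f unfolding invariants_def by auto
  define Z where "Z = {x \<in> mtuples p n. \<forall>h \<in> {\<lambda>x. f x + (- f A)}. h x = 0}"
  have cl: "closedin (zariski (mtuples p n) (coords p n)) Z"
    unfolding closedin_zariski Z_def
    using polyfuns.add[OF f'(1) polyfuns.const[of "- f A"]]
    by (intro exI[of _ "{\<lambda>x. f x + (- f A)}"] conjI refl) (simp only: insert_subset empty_subsetI simp_thms)
  have cZ: "c t \<in> Z" if "t \<notin> {0}" for t
  proof -
    have t: "t \<noteq> 0" using that by simp
    have "c t = conj_act p (diag_gl p (\<lambda>a. inverse t ^ \<alpha> a)) A"
    proof (rule mtuples_eqI[of _ p n])
      fix m a b assume ab: "m < n" "a < p" "b < p"
      show "c t ! m $$ (a, b) = conj_act p (diag_gl p (\<lambda>a. inverse t ^ \<alpha> a)) A ! m $$ (a, b)"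
        using ab t tri[OF ab] A by (auto simp: c_def conj_act_diag_gl[of p _ A n] power_diff field_simps)
    qed (use A t in \<open>auto simp: c_def intro!: mk_tuple_mtuples conj_act_mtuples diag_gl_GL\<close>)
    moreover have "diag_gl p (\<lambda>a. inverse t ^ \<alpha> a) \<in> GL p" using t by (intro diag_gl_GL) auto
    ultimately show ?thesis unfolding Z_def using f'(2) A conj_act_mtuples by auto
  qed
  have rat: "ratfun {} (\<lambda>t. k (c t))" if "k \<in> coords p n" for k
  proof -
    from that obtain m a b where k: "k = (\<lambda>A. (A ! m) $$ (a, b))" "m < n" "a < p" "b < p"
      unfolding coords_def by blast
    have "k (c t) = poly (if \<alpha> a \<le> \<alpha> b then monom (A ! m $$ (a, b)) (\<alpha> b - \<alpha> a) else 0) t" for t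
      using k by (simp add: c_def poly_monom)
    thus ?thesis using ratfun_poly by simp
  qed
  have "c 0 \<in> Z"
    by (rule curve_limit[of _ _ _ "{0}" c "{}" 0, OF cl _ cZ rat]) (simp_all add: c_def mk_tuple_mtuples)
  moreover have "c 0 = ?D"
    by (rule mtuples_eqI[of _ p n]) (auto simp: c_def mk_tuple_mtuples)
  ultimately show ?thesis unfolding Z_def by simp
qed

lemma level_pairs_separating:
  assumes "same_fibres p \<alpha> \<beta>"
  shows "level_pairs p n \<alpha> \<beta> \<subseteq> separating_variety p n"
proof clarify
  fix A A' assume x: "(A, A') \<in> level_pairs p n \<alpha> \<beta>"
  hence AA: "A \<in> mtuples p n" "A' \<in> mtuples p n" unfolding level_pairs_def by auto
  have "f A = f A'" if f: "f \<in> invariants p n" for f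
  proof -
    have "f A = f (mk_tuple p n (\<lambda>m a b. if \<alpha> a = \<alpha> b then A ! m $$ (a, b) else 0))"
      by (rule invariant_diagonal_part[OF f AA(1)]) (use x in \<open>auto simp: level_pairs_def\<close>)
    also have "mk_tuple p n (\<lambda>m a b. if \<alpha> a = \<alpha> b then A ! m $$ (a, b) else 0) =
      mk_tuple p n (\<lambda>m a b. if \<beta> a = \<beta> b then A' ! m $$ (a, b) else 0)"
      by (rule mtuples_eqI[of _ p n])
        (use x assms in \<open>auto simp: mk_tuple_mtuples level_pairs_def same_fibres_def\<close>)
    also have "f \<dots> = f A'"
      by (rule invariant_diagonal_part[OF f AA(2), symmetric]) (use x in \<open>auto simp: level_pairs_def\<close>)
    finally show ?thesis .
  qed
  thus "(A, A') \<in> separating_variety p n" unfolding separating_variety_def using AA by auto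
qed

lemma closure_orbit_separating:
  assumes "same_fibres p \<alpha> \<beta>"
  shows "pair_zariski p n closure_of pair_orbit p (level_pairs p n \<alpha> \<beta>) \<subseteq> separating_variety p n"
  by (intro closure_of_minimal pair_orbit_subset_separating level_pairs_separating assms
      closedin_separating_variety)

text \<open>The blocks \<open>l2\<close>, \<open>l1\<close> come in this order in \<open>A\<close>
  and in the opposite order in \<open>A'\<close>, so each tuple has one of the two off-diagonal
  corners free and the other one zero. Each is given t times the corner it lacks, taken from the
  other tuple. For t \<noteq> 0, rescaling one block of the second tuple makes the merged diagonal
  blocks equal; at t = 0 the original pair returns.\<close>

lemma level_pairs_degeneration:
  fixes \<alpha> \<beta> :: "nat \<Rightarrow> nat"
  assumes sf: "same_fibres p \<alpha> \<beta>" and l: "l2 < l1" "b1 < b2"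
    and fib: "\<And>a. a < p \<Longrightarrow> \<alpha> a = l1 \<longleftrightarrow> \<beta> a = b1" "\<And>a. a < p \<Longrightarrow> \<alpha> a = l2 \<longleftrightarrow> \<beta> a = b2"
    and adj: "\<And>a. a < p \<Longrightarrow> \<not> (l2 < \<alpha> a \<and> \<alpha> a < l1)" "\<And>a. a < p \<Longrightarrow> \<not> (b1 < \<beta> a \<and> \<beta> a < b2)"
  defines "\<alpha>' \<equiv> \<lambda>a. if \<alpha> a = l1 then l2 else \<alpha> a" and "\<beta>' \<equiv> \<lambda>a. if \<beta> a = b2 then b1 else \<beta> a"
  shows "same_fibres p \<alpha>' \<beta>'"
    "pair_orbit p (level_pairs p n \<alpha> \<beta>) \<subseteq> pair_zariski p n closure_of pair_orbit p (level_pairs p n \<alpha>' \<beta>')"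
proof -
  show "same_fibres p \<alpha>' \<beta>'"
    unfolding same_fibres_def
  proof (intro allI impI)
    fix a b assume "a < p" "b < p"
    hence "\<alpha> a = \<alpha> b \<longleftrightarrow> \<beta> a = \<beta> b" "\<alpha> a = l1 \<longleftrightarrow> \<beta> a = b1" "\<alpha> a = l2 \<longleftrightarrow> \<beta> a = b2"
      "\<alpha> b = l1 \<longleftrightarrow> \<beta> b = b1" "\<alpha> b = l2 \<longleftrightarrow> \<beta> b = b2"
      using sf fib unfolding same_fibres_def by auto
    thus "\<alpha>' a = \<alpha>' b \<longleftrightarrow> \<beta>' a = \<beta>' b" unfolding \<alpha>'_def \<beta>'_def by presburger
  qed
  let ?O = "pair_orbit p (level_pairs p n \<alpha>' \<beta>')"
  note sub = level_pairs_subset[of p n \<alpha>' \<beta>']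
  show "pair_orbit p (level_pairs p n \<alpha> \<beta>) \<subseteq> pair_zariski p n closure_of ?O"
  proof
    fix x assume "x \<in> pair_orbit p (level_pairs p n \<alpha> \<beta>)"
    then obtain g h A A' where x: "x = (conj_act p g A, conj_act p h A')" "g \<in> GL p" "h \<in> GL p"
      "(A, A') \<in> level_pairs p n \<alpha> \<beta>" unfolding pair_orbit_def by blast
    hence AA: "A \<in> mtuples p n" "A' \<in> mtuples p n" unfolding level_pairs_def by auto
    define u where "u t = mk_tuple p n (\<lambda>m a b. A ! m $$ (a, b) + t * (if \<alpha> a = l1 \<and> \<alpha> b = l2 then A' ! m $$ (a, b) else 0))" for t
    define u' where "u' t = mk_tuple p n (\<lambda>m a b. A' ! m $$ (a, b) + t * (if \<alpha> a = l2 \<and> \<alpha> b = l1 then A ! m $$ (a, b) else 0))" for t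
    have uu: "u t \<in> mtuples p n" "u' t \<in> mtuples p n" for t unfolding u_def u'_def by (rule mk_tuple_mtuples)+
    define c where "c t = (conj_act p g (u t), conj_act p h (u' t))" for t
    have u0: "u 0 = A" "u' 0 = A'"
      by (rule mtuples_eqI[of _ p n]; use AA in \<open>auto simp: u_def u'_def mk_tuple_mtuples\<close>)+
    have cZ: "c t \<in> pair_zariski p n closure_of ?O" if "t \<notin> {0}" for t
    proof -
      have t: "t \<noteq> 0" using that by simp
      \<comment> \<open>In the corner (\<open>l1\<close>, \<open>l2\<close>) this scaling supplies
        the factor t already present in \<open>u t\<close>; in the corner (\<open>l2\<close>,
        \<open>l1\<close>) it cancels the factor t of \<open>u' t\<close>.\<close>
      define d where "d a = (if \<alpha> a = l1 then t else 1)" for a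
      have d: "d a \<noteq> 0" for a using t by (simp add: d_def)
      have "(u t, conj_act p (diag_gl p d) (u' t)) \<in> level_pairs p n \<alpha>' \<beta>'"
        unfolding level_pairs_def
      proof (clarify, intro conjI allI impI uu conj_act_mtuples diag_gl_GL d)
        fix m a b assume mab: "m < n" "a < p" "b < p"
        have H: "\<alpha> b < \<alpha> a \<Longrightarrow> A ! m $$ (a, b) = 0" "\<beta> b < \<beta> a \<Longrightarrow> A' ! m $$ (a, b) = 0"
          "\<alpha> a = \<alpha> b \<Longrightarrow> A ! m $$ (a, b) = A' ! m $$ (a, b)"
          using x(4) mab unfolding level_pairs_def by auto
        note F = fib[OF mab(2)] fib[OF mab(3)] adj[OF mab(2)] adj[OF mab(3)]
          sf[unfolded same_fibres_def, rule_format, OF mab(2,3)]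
        show "u t ! m $$ (a, b) = 0" if "\<alpha>' b < \<alpha>' a"
        proof -
          have "\<alpha> b < \<alpha> a" "\<not> (\<alpha> a = l1 \<and> \<alpha> b = l2)" using that adj(1)[OF mab(2)] adj(1)[OF mab(3)] l unfolding \<alpha>'_def by (auto split: if_splits)
          thus ?thesis using H mab by (auto simp: u_def)
        qed
        show "conj_act p (diag_gl p d) (u' t) ! m $$ (a, b) = 0" if "\<beta>' b < \<beta>' a"
        proof -
          have "\<beta> b < \<beta> a" "\<not> (\<beta> a = b2 \<and> \<beta> b = b1)" using that adj(2)[OF mab(2)] adj(2)[OF mab(3)] l unfolding \<beta>'_def by (auto split: if_splits)
          hence "A' ! m $$ (a, b) = 0" "\<not> (\<alpha> a = l2 \<and> \<alpha> b = l1)"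
            using H(2) fib(1)[OF mab(3)] fib(2)[OF mab(2)] by blast+
          thus ?thesis using mab by (subst conj_act_diag_gl[OF d uu(2)]) (auto simp: u'_def)
        qed
        show "u t ! m $$ (a, b) = conj_act p (diag_gl p d) (u' t) ! m $$ (a, b)" if e: "\<alpha>' a = \<alpha>' b"
        proof -
          have R: "conj_act p (diag_gl p d) (u' t) ! m $$ (a, b) = d a * u' t ! m $$ (a, b) / d b"
            by (rule conj_act_diag_gl[OF d uu(2) mab])
          consider (eq) "\<alpha> a = \<alpha> b" | (down) "\<alpha> a = l1" "\<alpha> b = l2" | (up) "\<alpha> a = l2" "\<alpha> b = l1"
            using e unfolding \<alpha>'_def by (auto split: if_splits)
          thus ?thesis
          proof cases
            case eq
            thus ?thesis unfolding R using H(3) mab t l(1) by (auto simp: u'_def u_def d_def)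
          next
            case down
            hence "A ! m $$ (a, b) = 0" using H(1) l(1) by simp
            thus ?thesis unfolding R using down mab t l(1) by (simp add: u'_def u_def d_def)
          next
            case up
            hence "A' ! m $$ (a, b) = 0" using H(2) l(2) fib(1)[OF mab(3)] fib(2)[OF mab(2)] by simp
            thus ?thesis unfolding R using up mab t l(1) by (simp add: u'_def u_def d_def)
          qed
        qed
      qed
      hence "(u t, u' t) \<in> ?O"
        using pair_orbitI[of p "1\<^sub>m p" "u t" "diag_gl p d" "u' t" _ n] uu diag_gl_GL[of p d] d
        by (simp add: conj_act_one[OF uu(1)] GL_one)
      hence "c t \<in> ?O" unfolding c_def using pair_orbit_conj[OF _ sub x(2,3)] by simp
      moreover have "?O \<subseteq> topspace (pair_zariski p n)"
        using pair_orbit_subset[OF sub] unfolding pair_zariski_def topspace_zariski .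
      ultimately show ?thesis using closure_of_subset by blast
    qed
    have rat: "ratfun {} (\<lambda>t. k (c t))" if "k \<in> pair_coords p n" for k
      using that
    proof (cases rule: pair_coords_cases)
      case (1 m a b)
      have "k (c t) = (\<Sum>i<p. \<Sum>j<p. g $$ (a, i) * u t ! m $$ (i, j) * ginv p g $$ (j, b))" for t
        using 1 x(2) by (simp add: c_def conj_act_entry[OF _ uu(1)])
      also have "\<dots> t = (\<Sum>i<p. \<Sum>j<p. g $$ (a, i) * (A ! m $$ (i, j) + t * (if \<alpha> i = l1 \<and> \<alpha> j = l2 then A' ! m $$ (i, j) else 0)) * ginv p g $$ (j, b))" for t
        using 1 by (intro sum.cong refl) (simp add: u_def)
      finally show ?thesis
        by (simp only:) (intro ratfun_sum ratfun_mult ratfun_add ratfun_const ratfun_id)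
    next
      case (2 m a b)
      have "k (c t) = (\<Sum>i<p. \<Sum>j<p. h $$ (a, i) * u' t ! m $$ (i, j) * ginv p h $$ (j, b))" for t
        using 2 x(3) by (simp add: c_def conj_act_entry[OF _ uu(2)])
      also have "\<dots> t = (\<Sum>i<p. \<Sum>j<p. h $$ (a, i) * (A' ! m $$ (i, j) + t * (if \<alpha> i = l2 \<and> \<alpha> j = l1 then A ! m $$ (i, j) else 0)) * ginv p h $$ (j, b))" for t
        using 2 by (intro sum.cong refl) (simp add: u'_def)
      finally show ?thesis
        by (simp only:) (intro ratfun_sum ratfun_mult ratfun_add ratfun_const ratfun_id)
    qed
    have c0: "c 0 \<in> mtuples p n \<times> mtuples p n"
      unfolding c_def using x(2,3) uu by (auto intro: conj_act_mtuples)
    have cl: "closedin (zariski (mtuples p n \<times> mtuples p n) (pair_coords p n)) (pair_zariski p n closure_of ?O)"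
      unfolding pair_zariski_def by simp
    have "c 0 \<in> pair_zariski p n closure_of ?O"
      by (rule curve_limit[of _ _ _ "{0}" c "{}" 0, OF cl _ cZ rat]) (simp_all add: c0)
    thus "x \<in> pair_zariski p n closure_of ?O" unfolding c_def u0 x(1) .
  qed
qed

section \<open>Irreducibility of the orbits\<close>

lemma ratfun_adj_mat:
  assumes "\<And>i j. i < N \<Longrightarrow> j < N \<Longrightarrow> ratfun B (\<lambda>t. m t i j)" "a < N" "b < N"
  shows "ratfun B (\<lambda>t. adj_mat (mat N N (\<lambda>(i, j). m t i j)) $$ (a, b))"
proof -
  have "ratfun B (\<lambda>t. (-1) ^ (b + a) * det (mat (N - 1) (N - 1)
    (\<lambda>(i, j). m t (if i < b then i else Suc i) (if j < a then j else Suc j))))"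
    using assms by (intro ratfun_mult ratfun_const ratfun_det) auto
  moreover have "mat_delete (mat N N (\<lambda>(i, j). m t i j)) b a = mat (N - 1) (N - 1)
    (\<lambda>(i, j). m t (if i < b then i else Suc i) (if j < a then j else Suc j))" for t
    unfolding mat_delete_def by (rule eq_matI) auto
  ultimately show ?thesis using assms(2,3) by (simp add: adj_mat_def cofactor_def)
qed

text \<open>Two points of the orbit are joined by moving the conjugating matrices and the tuples
  along straight lines. The tuples stay in the linear space \<open>level_pairs\<close>, and the
  matrices are singular at only finitely many parameters.\<close>

lemma irreducible_orbit:
  "irreducible_in (pair_zariski p n) (pair_orbit p (level_pairs p n \<alpha> \<beta>))"
  unfolding pair_zariski_def
proof (rule irreducible_by_curves)
  let ?C = "level_pairs p n \<alpha> \<beta>"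
  show "pair_orbit p ?C \<subseteq> mtuples p n \<times> mtuples p n"
    by (rule pair_orbit_subset[OF level_pairs_subset])
  have "(mk_tuple p n (\<lambda>_ _ _. 0), mk_tuple p n (\<lambda>_ _ _. 0)) \<in> ?C"
    unfolding level_pairs_def by (auto simp: mk_tuple_mtuples)
  thus "pair_orbit p ?C \<noteq> {}" unfolding pair_orbit_def using GL_one(1)[of p] by blast
  fix x y assume "x \<in> pair_orbit p ?C" "y \<in> pair_orbit p ?C"
  then obtain g h A A' g1 h1 A1 A1' where
    x: "x = (conj_act p g A, conj_act p h A')" "g \<in> GL p" "h \<in> GL p" "(A, A') \<in> ?C" and
    y: "y = (conj_act p g1 A1, conj_act p h1 A1')" "g1 \<in> GL p" "h1 \<in> GL p" "(A1, A1') \<in> ?C"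
    unfolding pair_orbit_def by blast
  have AA: "A \<in> mtuples p n" "A' \<in> mtuples p n" "A1 \<in> mtuples p n" "A1' \<in> mtuples p n"
    using x(4) y(4) unfolding level_pairs_def by auto
  define ln where "ln u v t = mat p p (\<lambda>(i, j). u $$ (i, j) + t * (v $$ (i, j) - u $$ (i, j)))" for u v :: "complex mat" and t
  define lt where "lt U V t = mk_tuple p n (\<lambda>m i j. U ! m $$ (i, j) + t * (V ! m $$ (i, j) - U ! m $$ (i, j)))" for U V t
  have lt: "lt U V t \<in> mtuples p n" for U V t unfolding lt_def by (rule mk_tuple_mtuples)
  have ln: "ln u v t \<in> carrier_mat p p" for u v t unfolding ln_def by simp
  have ln01: "ln u v 0 = u" "ln u v 1 = v" if "u \<in> GL p" "v \<in> GL p" for u v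
    using GL_D(1)[OF that(1)] GL_D(1)[OF that(2)] unfolding ln_def by (auto intro!: eq_matI)
  have lt01: "lt U V 0 = U" "lt U V 1 = V" if "U \<in> mtuples p n" "V \<in> mtuples p n" for U V
    by (rule mtuples_eqI[of _ p n]; use that in \<open>auto simp: lt_def mk_tuple_mtuples\<close>)+
  define B where "B = {t. det (ln g g1 t) = 0 \<or> det (ln h h1 t) = 0}"
  have rd: "ratfun D (\<lambda>t. det (ln u v t))" for u v D
    unfolding ln_def by (intro ratfun_det ratfun_add ratfun_mult ratfun_id ratfun_const)
  have fin: "finite {t. det (ln u v t) = 0}" if "u \<in> GL p" "v \<in> GL p" for u v
    using ratfun_zeros_finite[OF rd[of "{}" u v], of 0] ln01(1)[OF that] GL_det_nonzero[OF that(1)] by simp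
  have finB: "finite B" unfolding B_def Collect_disj_eq using fin x y by auto
  have B01: "0 \<notin> B" "1 \<notin> B" unfolding B_def using x y ln01 GL_det_nonzero by auto
  define c where "c t = (conj_act p (ln g g1 t) (lt A A1 t), conj_act p (ln h h1 t) (lt A' A1' t))" for t
  have gl: "ln g g1 t \<in> GL p" "ln h h1 t \<in> GL p" if "t \<notin> B" for t
    using that ln unfolding B_def by (auto intro: GL_det)
  have "c t \<in> pair_orbit p ?C" if "t \<notin> B" for t
  proof -
    have "(lt A A1 t, lt A' A1' t) \<in> ?C"
      unfolding level_pairs_def using lt x(4) y(4) by (auto simp: level_pairs_def) (auto simp: lt_def)
    thus ?thesis unfolding c_def pair_orbit_def using gl[OF that] by blast
  qed
  moreover have R: "ratfun B (\<lambda>t. conj_act p (ln u v t) (lt U V t) ! m $$ (a, b))"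
    if "\<And>t. t \<notin> B \<Longrightarrow> ln u v t \<in> GL p" "m < n" "a < p" "b < p" for u v U V m a b
  proof (rule ratfun_cong)
    show "ratfun B (\<lambda>t. \<Sum>i<p. \<Sum>j<p. (u $$ (a, i) + t * (v $$ (a, i) - u $$ (a, i))) *
      (U ! m $$ (i, j) + t * (V ! m $$ (i, j) - U ! m $$ (i, j))) *
      (inverse (det (ln u v t)) * adj_mat (mat p p (\<lambda>(i, j). u $$ (i, j) + t * (v $$ (i, j) - u $$ (i, j)))) $$ (j, b)))"
      using that GL_det_nonzero
      by (intro ratfun_sum ratfun_mult ratfun_add ratfun_const ratfun_id ratfun_inverse rd ratfun_adj_mat) auto
    fix t assume t: "t \<notin> B"
    show "conj_act p (ln u v t) (lt U V t) ! m $$ (a, b) = (\<Sum>i<p. \<Sum>j<p. (u $$ (a, i) + t * (v $$ (a, i) - u $$ (a, i))) *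
      (U ! m $$ (i, j) + t * (V ! m $$ (i, j) - U ! m $$ (i, j))) *
      (inverse (det (ln u v t)) * adj_mat (mat p p (\<lambda>(i, j). u $$ (i, j) + t * (v $$ (i, j) - u $$ (i, j)))) $$ (j, b)))"
      unfolding conj_act_entry[OF that(1)[OF t] lt that(2-4)] ln_def[symmetric]
      by (intro sum.cong refl)
        (use that(2-4) ginv_adj[OF that(1)[OF t]] in \<open>simp add: lt_def, simp add: ln_def\<close>)
  qed
  have "ratfun B (\<lambda>t. k (c t))" if "k \<in> pair_coords p n" for k
    using that by (cases rule: pair_coords_cases) (auto simp: c_def intro!: R gl)
  moreover have "c 0 = x" "c 1 = y" unfolding c_def using ln01 lt01 x y AA by simp_all
  ultimately show "\<exists>B c t0 t1. finite B \<and> t0 \<notin> B \<and> t1 \<notin> B \<and> c t0 = x \<and> c t1 = y \<and>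
      (\<forall>t. t \<notin> B \<longrightarrow> c t \<in> pair_orbit p ?C) \<and> (\<forall>k\<in>pair_coords p n. ratfun B (\<lambda>t. k (c t)))"
    using finB B01 by blast
qed

section \<open>Compositions and level functions\<close>

definition perm_gl :: "nat \<Rightarrow> (nat \<Rightarrow> nat) \<Rightarrow> complex mat" where
  "perm_gl p \<rho> = mat p p (\<lambda>(a, b). if a = \<rho> b then 1 else 0)"

lemma perm_gl_GL:
  assumes "bij_betw \<rho> {..<p} {..<p}"
  shows "perm_gl p \<rho> \<in> GL p"
    "ginv p (perm_gl p \<rho>) = mat p p (\<lambda>(a, b). if \<rho> a = b then 1 else 0)"
proof -
  let ?h = "mat p p (\<lambda>(a, b). if \<rho> a = b then 1 else 0) :: complex mat"
  have inj: "\<rho> a = \<rho> b \<longleftrightarrow> a = b" if "a < p" "b < p" for a b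
    using assms that unfolding bij_betw_def inj_on_def by auto
  have lt: "\<rho> a < p" if "a < p" for a using bij_betwE[OF assms] that by auto
  have "(\<Sum>k<p. ?h $$ (a, k) * perm_gl p \<rho> $$ (k, b)) = 1\<^sub>m p $$ (a, b)" if ab: "a < p" "b < p" for a b
  proof -
    have "(\<Sum>k<p. ?h $$ (a, k) * perm_gl p \<rho> $$ (k, b)) = (\<Sum>k<p. if k = \<rho> a then (if a = b then 1 else 0) else 0)"
      using ab inj[OF ab] by (intro sum.cong refl) (auto simp: perm_gl_def)
    thus ?thesis using ab lt by simp
  qed
  hence "?h * perm_gl p \<rho> = 1\<^sub>m p"
    by (intro eq_matI) (auto simp: mult_mat_entry[of _ p p _ p] perm_gl_def simp del: index_mult_mat(1))
  hence e: "perm_gl p \<rho> * ?h = 1\<^sub>m p"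
    by (rule mat_mult_left_right_inverse[rotated 2]) (simp_all add: perm_gl_def)
  have c: "perm_gl p \<rho> \<in> carrier_mat p p" "?h \<in> carrier_mat p p" by (auto simp: perm_gl_def)
  show "perm_gl p \<rho> \<in> GL p" "ginv p (perm_gl p \<rho>) = ?h" using GL_I[OF c e] by auto
qed

lemma conj_act_perm_gl:
  assumes \<rho>: "bij_betw \<rho> {..<p} {..<p}" and A: "A \<in> mtuples p n" and "m < n" "a < p" "b < p"
  shows "conj_act p (perm_gl p \<rho>) A ! m $$ (\<rho> a, \<rho> b) = A ! m $$ (a, b)"
proof -
  have inj: "\<rho> a = \<rho> b \<longleftrightarrow> a = b" if "a < p" "b < p" for a b
    using \<rho> that unfolding bij_betw_def inj_on_def by auto
  have lt: "\<rho> a < p" if "a < p" for a using bij_betwE[OF \<rho>] that by auto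
  have "conj_act p (perm_gl p \<rho>) A ! m $$ (\<rho> a, \<rho> b) =
    (\<Sum>c<p. \<Sum>d<p. perm_gl p \<rho> $$ (\<rho> a, c) * A ! m $$ (c, d) * ginv p (perm_gl p \<rho>) $$ (d, \<rho> b))"
    using assms lt by (intro conj_act_entry perm_gl_GL) auto
  also have "\<dots> = (\<Sum>c<p. \<Sum>d<p. if d = b then (if c = a then A ! m $$ (a, b) else 0) else 0)"
    unfolding perm_gl_GL(2)[OF \<rho>]
    using assms inj lt by (intro sum.cong refl) (auto simp: perm_gl_def)
  also have "\<dots> = A ! m $$ (a, b)" using assms by simp
  finally show ?thesis .
qed

text \<open>The position of \<open>a\<close> inside its own fibre. \<open>block_index\<close> then
  sorts all indices by level and keeps the order within a fibre, which turns a level-triangular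
  matrix into a literally block triangular one.\<close>

definition offset :: "(nat \<Rightarrow> nat) \<Rightarrow> nat \<Rightarrow> nat" where
  "offset \<alpha> a = card {s. s < a \<and> \<alpha> s = \<alpha> a}"

definition block_index :: "nat list \<Rightarrow> (nat \<Rightarrow> nat) \<Rightarrow> nat \<Rightarrow> nat" where
  "block_index \<pi> \<alpha> a = sum_list (take (\<alpha> a) \<pi>) + offset \<alpha> a"

definition has_sizes :: "nat \<Rightarrow> nat list \<Rightarrow> (nat \<Rightarrow> nat) \<Rightarrow> bool" where
  "has_sizes p \<pi> \<alpha> \<longleftrightarrow> sum_list \<pi> = p \<and> (\<forall>a<p. \<alpha> a < length \<pi>) \<and>
     (\<forall>i<length \<pi>. \<pi> ! i = card {a. a < p \<and> \<alpha> a = i})"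

lemma sum_list_take_Suc:
  "i < length (\<pi> :: nat list) \<Longrightarrow> sum_list (take (Suc i) \<pi>) = sum_list (take i \<pi>) + \<pi> ! i"
  by (simp add: take_Suc_conv_app_nth)

lemma sum_list_take_mono:
  "i \<le> j \<Longrightarrow> sum_list (take i (\<pi> :: nat list)) \<le> sum_list (take j \<pi>)"
  by (metis le_add1 le_add_diff_inverse sum_list_append take_add)

context
  fixes p \<pi> \<alpha> assumes sz: "has_sizes p \<pi> \<alpha>"
begin

lemma offset_less:
  assumes "a < p" shows "offset \<alpha> a < \<pi> ! \<alpha> a"
proof -
  have "\<pi> ! \<alpha> a = card {s. s < p \<and> \<alpha> s = \<alpha> a}" using sz assms unfolding has_sizes_def by auto
  moreover have "{s. s < a \<and> \<alpha> s = \<alpha> a} \<subset> {s. s < p \<and> \<alpha> s = \<alpha> a}" using assms by auto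
  ultimately show ?thesis unfolding offset_def by (auto intro!: psubset_card_mono)
qed

lemma offset_inj:
  assumes "a < p" "b < p" "\<alpha> a = \<alpha> b" "offset \<alpha> a = offset \<alpha> b" shows "a = b"
proof -
  have *: "offset \<alpha> x < offset \<alpha> y" if "x < y" "\<alpha> x = \<alpha> y" for x y
    unfolding offset_def using that by (intro psubset_card_mono) auto
  show ?thesis using *[of a b] *[of b a] assms by (cases a b rule: linorder_cases) auto
qed

lemma offset_surj:
  assumes "i < length \<pi>" "r < \<pi> ! i" shows "\<exists>a<p. \<alpha> a = i \<and> offset \<alpha> a = r"
proof -
  let ?S = "{a. a < p \<and> \<alpha> a = i}"
  have "card (offset \<alpha> ` ?S) = card ?S" by (intro card_image inj_onI) (auto intro: offset_inj)
  also have "\<dots> = card {..<\<pi> ! i}" using sz assms(1) unfolding has_sizes_def by auto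
  finally have "offset \<alpha> ` ?S = {..<\<pi> ! i}"
    by (intro card_subset_eq) (use offset_less in auto)
  hence "r \<in> offset \<alpha> ` ?S" using assms(2) by simp
  thus ?thesis by blast
qed

lemma block_index_bij: "bij_betw (block_index \<pi> \<alpha>) {..<p} {..<p}"
proof -
  have len: "\<alpha> a < length \<pi>" if "a < p" for a using sz that unfolding has_sizes_def by auto
  have up: "block_index \<pi> \<alpha> a < sum_list (take (Suc (\<alpha> a)) \<pi>)" if "a < p" for a
    unfolding block_index_def sum_list_take_Suc[OF len[OF that]] using offset_less[OF that] by simp
  have "block_index \<pi> \<alpha> ` {..<p} \<subseteq> {..<p}"
  proof clarsimp
    fix a assume a: "a < p"
    have "sum_list (take (Suc (\<alpha> a)) \<pi>) \<le> sum_list (take (length \<pi>) \<pi>)"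
      by (rule sum_list_take_mono) (use len[OF a] in simp)
    thus "block_index \<pi> \<alpha> a < p" using up[OF a] sz unfolding has_sizes_def by simp
  qed
  moreover have "inj_on (block_index \<pi> \<alpha>) {..<p}"
  proof (rule inj_onI)
    fix a b assume ab: "a \<in> {..<p}" "b \<in> {..<p}" "block_index \<pi> \<alpha> a = block_index \<pi> \<alpha> b"
    have *: "\<not> \<alpha> x < \<alpha> y" if "x < p" "y < p" "block_index \<pi> \<alpha> x = block_index \<pi> \<alpha> y" for x y
    proof
      assume "\<alpha> x < \<alpha> y"
      hence "sum_list (take (Suc (\<alpha> x)) \<pi>) \<le> sum_list (take (\<alpha> y) \<pi>)" by (intro sum_list_take_mono) simp
      thus False using up[OF that(1)] that(3) unfolding block_index_def by simp
    qed
    hence "\<alpha> a = \<alpha> b" using ab by (metis lessThan_iff linorder_neqE_nat)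
    thus "a = b" using ab offset_inj unfolding block_index_def by auto
  qed
  ultimately show ?thesis by (metis bij_betw_def endo_inj_surj finite_lessThan)
qed

lemma block_entry:
  assumes "a < p" "b < p"
  shows "block \<pi> (\<alpha> a) (\<alpha> b) M $$ (offset \<alpha> a, offset \<alpha> b) = M $$ (block_index \<pi> \<alpha> a, block_index \<pi> \<alpha> b)"
  using offset_less assms unfolding block_def block_index_def by simp

lemma block_upper_triangular_iff:
  "block_upper_triangular \<pi> M \<longleftrightarrow>
    (\<forall>a<p. \<forall>b<p. \<alpha> b < \<alpha> a \<longrightarrow> M $$ (block_index \<pi> \<alpha> a, block_index \<pi> \<alpha> b) = 0)" (is "?L \<longleftrightarrow> ?R")
proof
  assume L: ?L
  show ?R
  proof (intro allI impI)
    fix a b assume ab: "a < p" "b < p" "\<alpha> b < \<alpha> a"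
    have "\<alpha> a < length \<pi>" using sz ab unfolding has_sizes_def by auto
    hence "block \<pi> (\<alpha> a) (\<alpha> b) M = 0\<^sub>m (\<pi> ! \<alpha> a) (\<pi> ! \<alpha> b)"
      using L ab unfolding block_upper_triangular_def by auto
    thus "M $$ (block_index \<pi> \<alpha> a, block_index \<pi> \<alpha> b) = 0"
      using block_entry[OF ab(1,2), of M] offset_less ab by simp
  qed
next
  assume R: ?R
  show ?L unfolding block_upper_triangular_def
  proof (intro allI impI eq_matI)
    fix i j r c assume ij: "i < length \<pi>" "j < i"
      and "r < dim_row (0\<^sub>m (\<pi> ! i) (\<pi> ! j) :: complex mat)" "c < dim_col (0\<^sub>m (\<pi> ! i) (\<pi> ! j) :: complex mat)"
    hence rc: "r < \<pi> ! i" "c < \<pi> ! j" by auto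
    obtain a b where "a < p" "\<alpha> a = i" "offset \<alpha> a = r" "b < p" "\<alpha> b = j" "offset \<alpha> b = c"
      using offset_surj[OF ij(1) rc(1)] offset_surj[OF _ rc(2)] ij by auto
    thus "block \<pi> i j M $$ (r, c) = 0\<^sub>m (\<pi> ! i) (\<pi> ! j) $$ (r, c)"
      using R block_entry[of a b M] ij rc by auto
  qed (auto simp: block_def)
qed

end

lemma C_pairs_iff_level_pairs:
  assumes sz: "has_sizes p \<pi> \<alpha>" and sz': "has_sizes p (permute_list \<sigma> \<pi>) \<beta>"
    and \<sigma>: "\<sigma> permutes {..<length \<pi>}" and \<sigma>\<beta>: "\<And>a. a < p \<Longrightarrow> \<sigma> (\<beta> a) = \<alpha> a"
    and A: "A \<in> mtuples p n" and A': "A' \<in> mtuples p n"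
  shows "(conj_act p (perm_gl p (block_index \<pi> \<alpha>)) A,
      conj_act p (perm_gl p (block_index (permute_list \<sigma> \<pi>) \<beta>)) A') \<in> C_pairs p n \<pi> \<sigma>
    \<longleftrightarrow> (A, A') \<in> level_pairs p n \<alpha> \<beta>"
proof -
  let ?\<pi>' = "permute_list \<sigma> \<pi>"
  let ?r = "block_index \<pi> \<alpha>" and ?r' = "block_index ?\<pi>' \<beta>"
  let ?B = "conj_act p (perm_gl p ?r) A" and ?B' = "conj_act p (perm_gl p ?r') A'"
  note bij = block_index_bij[OF sz] and bij' = block_index_bij[OF sz']
  have B: "?B \<in> mtuples p n" "?B' \<in> mtuples p n"
    using conj_act_mtuples perm_gl_GL(1) bij bij' A A' by blast+
  note ent = conj_act_perm_gl[OF bij A] and ent' = conj_act_perm_gl[OF bij' A']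
  have \<alpha>\<beta>: "\<alpha> a = \<alpha> b \<longleftrightarrow> \<beta> a = \<beta> b" if "a < p" "b < p" for a b
    using \<sigma>\<beta> that permutes_inj[OF \<sigma>] by (metis injD)
  \<comment> \<open>Equal fibres give equal offsets, so matched diagonal blocks correspond entry by
    entry, with no further permutation inside a block.\<close>
  have off: "offset \<beta> a = offset \<alpha> a" if "a < p" for a
    unfolding offset_def using \<alpha>\<beta> that by (intro arg_cong[of _ _ card]) auto
  have bt: "(\<forall>M\<in>set X. Q M) \<longleftrightarrow> (\<forall>m<n. Q (X ! m))" if "X \<in> mtuples p n" for X Q
    using mtuplesD(1)[OF that] by (metis in_set_conv_nth)
  have 1: "?B \<in> block_tuples p n \<pi> \<longleftrightarrow> (\<forall>m<n. \<forall>a<p. \<forall>b<p. \<alpha> b < \<alpha> a \<longrightarrow> A ! m $$ (a, b) = 0)"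
    unfolding block_tuples_def mem_Collect_eq bt[OF B(1)] block_upper_triangular_iff[OF sz]
    using B ent by auto
  have 2: "?B' \<in> block_tuples p n ?\<pi>' \<longleftrightarrow> (\<forall>m<n. \<forall>a<p. \<forall>b<p. \<beta> b < \<beta> a \<longrightarrow> A' ! m $$ (a, b) = 0)"
    unfolding block_tuples_def mem_Collect_eq bt[OF B(2)] block_upper_triangular_iff[OF sz']
    using B ent' by auto
  have nth': "?\<pi>' ! i = \<pi> ! \<sigma> i" if "i < length \<pi>" for i
    using permute_list_nth[OF \<sigma> that] .
  have \<sigma>lt: "\<sigma> i < length \<pi>" if "i < length \<pi>" for i using permutes_in_image[OF \<sigma>] that by auto
  have 3: "(\<forall>i<length \<pi>. diag_block ?\<pi>' i ?B' = diag_block \<pi> (\<sigma> i) ?B) \<longleftrightarrow>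
      (\<forall>m<n. \<forall>a<p. \<forall>b<p. \<alpha> a = \<alpha> b \<longrightarrow> A ! m $$ (a, b) = A' ! m $$ (a, b))" (is "?L \<longleftrightarrow> ?R")
  proof
    assume L: ?L
    show ?R
    proof (intro allI impI)
      fix m a b assume mab: "m < n" "a < p" "b < p" "\<alpha> a = \<alpha> b"
      hence "\<beta> a = \<beta> b" using \<alpha>\<beta> by auto
      have i: "\<beta> a < length \<pi>" using sz' mab unfolding has_sizes_def by auto
      have "diag_block ?\<pi>' (\<beta> a) ?B' ! m = diag_block \<pi> (\<alpha> a) ?B ! m"
        using L i \<sigma>\<beta>[OF mab(2)] by auto
      hence "block ?\<pi>' (\<beta> a) (\<beta> b) (?B' ! m) = block \<pi> (\<alpha> a) (\<alpha> b) (?B ! m)"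
        using mab \<open>\<beta> a = \<beta> b\<close> mtuplesD(1)[OF B(1)] mtuplesD(1)[OF B(2)] unfolding diag_block_def by simp
      hence "?B' ! m $$ (?r' a, ?r' b) = ?B ! m $$ (?r a, ?r b)"
        using block_entry[OF sz mab(2,3)] block_entry[OF sz' mab(2,3)] off mab by metis
      thus "A ! m $$ (a, b) = A' ! m $$ (a, b)" using ent ent' mab by simp
    qed
  next
    assume R: ?R
    show ?L
    proof (intro allI impI nth_equalityI)
      fix i assume i: "i < length \<pi>"
      show "length (diag_block ?\<pi>' i ?B') = length (diag_block \<pi> (\<sigma> i) ?B)"
        using mtuplesD(1)[OF B(1)] mtuplesD(1)[OF B(2)] unfolding diag_block_def by simp
      fix m assume "m < length (diag_block ?\<pi>' i ?B')"
      hence m: "m < n" using mtuplesD(1)[OF B(2)] unfolding diag_block_def by simp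
      have "block ?\<pi>' i i (?B' ! m) = block \<pi> (\<sigma> i) (\<sigma> i) (?B ! m)"
      proof (rule eq_matI)
        fix r c assume "r < dim_row (block \<pi> (\<sigma> i) (\<sigma> i) (?B ! m))" "c < dim_col (block \<pi> (\<sigma> i) (\<sigma> i) (?B ! m))"
        hence rc: "r < ?\<pi>' ! i" "c < ?\<pi>' ! i" using nth'[OF i] unfolding block_def by auto
        obtain a b where ab: "a < p" "\<beta> a = i" "offset \<beta> a = r" "b < p" "\<beta> b = i" "offset \<beta> b = c"
          using offset_surj[OF sz' _ rc(1)] offset_surj[OF sz' _ rc(2)] i by auto
        have "?B' ! m $$ (?r' a, ?r' b) = ?B ! m $$ (?r a, ?r b)"
          unfolding ent[OF m ab(1,4)] ent'[OF m ab(1,4)]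
          using R m ab(1,2,4,5) \<alpha>\<beta>[OF ab(1,4)] by simp
        thus "block ?\<pi>' i i (?B' ! m) $$ (r, c) = block \<pi> (\<sigma> i) (\<sigma> i) (?B ! m) $$ (r, c)"
          using block_entry[OF sz ab(1,4), of "?B ! m"] block_entry[OF sz' ab(1,4), of "?B' ! m"]
            off[OF ab(1)] off[OF ab(4)] \<sigma>\<beta>[OF ab(1)] \<sigma>\<beta>[OF ab(4)] unfolding ab(2,3,5,6) by simp
      qed (use nth'[OF i] in \<open>auto simp: block_def\<close>)
      thus "diag_block ?\<pi>' i ?B' ! m = diag_block \<pi> (\<sigma> i) ?B ! m"
        using m mtuplesD(1)[OF B(1)] mtuplesD(1)[OF B(2)] unfolding diag_block_def by simp
    qed
  qed
  show ?thesis unfolding C_pairs_def level_pairs_def mem_Collect_eq prod.case 1 2 3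
    using A A' by blast
qed

lemma has_sizes_permute:
  assumes sz: "has_sizes p \<pi> \<alpha>" and \<sigma>: "\<sigma> permutes {..<length \<pi>}"
    and \<beta>: "\<And>a. a < p \<Longrightarrow> \<beta> a < length \<pi>" "\<And>a. a < p \<Longrightarrow> \<sigma> (\<beta> a) = \<alpha> a"
  shows "has_sizes p (permute_list \<sigma> \<pi>) \<beta>"
  unfolding has_sizes_def
proof (intro conjI allI impI)
  have "mset (permute_list \<sigma> \<pi>) = mset \<pi>" by (rule mset_permute_list[OF \<sigma>])
  hence "sum_list (permute_list \<sigma> \<pi>) = sum_list \<pi>" by (metis sum_mset_sum_list)
  thus "sum_list (permute_list \<sigma> \<pi>) = p" using sz unfolding has_sizes_def by simp
  fix i assume "i < length (permute_list \<sigma> \<pi>)"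
  hence i: "i < length \<pi>" by simp
  have "\<sigma> i < length \<pi>" using permutes_in_image[OF \<sigma>] i by auto
  hence "permute_list \<sigma> \<pi> ! i = card {a. a < p \<and> \<alpha> a = \<sigma> i}"
    using permute_list_nth[OF \<sigma> i] sz unfolding has_sizes_def by simp
  also have "{a. a < p \<and> \<alpha> a = \<sigma> i} = {a. a < p \<and> \<beta> a = i}"
    using \<beta>(2) permutes_inj[OF \<sigma>] by (metis injD)
  finally show "permute_list \<sigma> \<pi> ! i = card {a. a < p \<and> \<beta> a = i}" .
qed (use \<beta> in auto)

lemma C_pairs_subset: "C_pairs p n \<pi> \<sigma> \<subseteq> mtuples p n \<times> mtuples p n"
  unfolding C_pairs_def block_tuples_def by auto

lemma pair_orbit_C_pairs:
  assumes sz: "has_sizes p \<pi> \<alpha>" and \<sigma>: "\<sigma> permutes {..<length \<pi>}"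
    and \<beta>: "\<And>a. a < p \<Longrightarrow> \<beta> a < length \<pi>" "\<And>a. a < p \<Longrightarrow> \<sigma> (\<beta> a) = \<alpha> a"
  shows "pair_orbit p (C_pairs p n \<pi> \<sigma>) = pair_orbit p (level_pairs p n \<alpha> \<beta>)"
proof (rule equalityI)
  let ?P = "perm_gl p (block_index \<pi> \<alpha>)" and ?P' = "perm_gl p (block_index (permute_list \<sigma> \<pi>) \<beta>)"
  note sz' = has_sizes_permute[OF sz \<sigma> \<beta>]
  have iff: "(conj_act p ?P A, conj_act p ?P' A') \<in> C_pairs p n \<pi> \<sigma> \<longleftrightarrow> (A, A') \<in> level_pairs p n \<alpha> \<beta>"
    if "A \<in> mtuples p n" "A' \<in> mtuples p n" for A A'
    using C_pairs_iff_level_pairs[OF sz sz' \<sigma> _ that] \<beta>(2) by blast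
  have P: "?P \<in> GL p" "?P' \<in> GL p"
    using perm_gl_GL(1) block_index_bij[OF sz] block_index_bij[OF sz'] by blast+
  note Q = GL_D(3)[OF P(1)] GL_D(3)[OF P(2)]
  show "pair_orbit p (C_pairs p n \<pi> \<sigma>) \<subseteq> pair_orbit p (level_pairs p n \<alpha> \<beta>)"
  proof (rule pair_orbit_subsetI[OF level_pairs_subset])
    fix v w assume vw: "(v, w) \<in> C_pairs p n \<pi> \<sigma>"
    hence c: "v \<in> mtuples p n" "w \<in> mtuples p n" using C_pairs_subset by blast+
    have "(conj_act p (ginv p ?P) v, conj_act p (ginv p ?P') w) \<in> level_pairs p n \<alpha> \<beta>"
      using iff[OF conj_act_mtuples[OF Q(1) c(1)] conj_act_mtuples[OF Q(2) c(2)]] vw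
      by (simp add: conj_act_ginv(2)[OF P(1) c(1)] conj_act_ginv(2)[OF P(2) c(2)])
    thus "v \<in> mtuples p n \<and> w \<in> mtuples p n \<and>
      (\<exists>g\<in>GL p. \<exists>h\<in>GL p. (conj_act p g v, conj_act p h w) \<in> level_pairs p n \<alpha> \<beta>)"
      using c Q by blast
  qed
  show "pair_orbit p (level_pairs p n \<alpha> \<beta>) \<subseteq> pair_orbit p (C_pairs p n \<pi> \<sigma>)"
  proof (rule pair_orbit_subsetI[OF C_pairs_subset])
    fix v w assume vw: "(v, w) \<in> level_pairs p n \<alpha> \<beta>"
    hence c: "v \<in> mtuples p n" "w \<in> mtuples p n" using level_pairs_subset by blast+
    thus "v \<in> mtuples p n \<and> w \<in> mtuples p n \<and>
      (\<exists>g\<in>GL p. \<exists>h\<in>GL p. (conj_act p g v, conj_act p h w) \<in> C_pairs p n \<pi> \<sigma>)"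
      using iff[OF c] vw P by blast
  qed
qed

text \<open>The levels come from cutting \<open>{..<p}\<close> into consecutive intervals of lengths
  \<pi>. The description by partial sums is what later recovers \<pi> from the cardinalities of
  initial segments.\<close>

lemma composition_levels:
  assumes "\<pi> \<in> compositions p k"
  obtains \<alpha> where "has_sizes p \<pi> \<alpha>" "\<And>a i. a < p \<Longrightarrow> i \<le> k \<Longrightarrow> \<alpha> a < i \<longleftrightarrow> a < sum_list (take i \<pi>)"
proof -
  have \<pi>: "length \<pi> = k" "sum_list \<pi> = p" using assms unfolding compositions_def by auto
  define \<alpha> where "\<alpha> a = (LEAST i. a < sum_list (take (Suc i) \<pi>))" for a
  have iff: "\<alpha> a < i \<longleftrightarrow> a < sum_list (take i \<pi>)" if a: "a < p" and i: "i \<le> k" for a i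
  proof
    have "k \<noteq> 0" using \<pi> a by auto
    then obtain k' where "k = Suc k'" by (cases k) auto
    hence "a < sum_list (take (Suc k') \<pi>)" using a \<pi> by simp
    hence L: "a < sum_list (take (Suc (\<alpha> a)) \<pi>)" unfolding \<alpha>_def by (rule LeastI)
    assume "\<alpha> a < i"
    hence "sum_list (take (Suc (\<alpha> a)) \<pi>) \<le> sum_list (take i \<pi>)" by (intro sum_list_take_mono) simp
    thus "a < sum_list (take i \<pi>)" using L by simp
  next
    assume A: "a < sum_list (take i \<pi>)"
    then obtain i' where i': "i = Suc i'" by (cases i) auto
    hence "\<alpha> a \<le> i'" unfolding \<alpha>_def using A by (intro Least_le) simp
    thus "\<alpha> a < i" using i' by simp
  qed
  have "has_sizes p \<pi> \<alpha>" unfolding has_sizes_def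
  proof (intro conjI allI impI)
    show "\<alpha> a < length \<pi>" if "a < p" for a using iff[OF that, of k] that \<pi> by simp
    fix i assume i: "i < length \<pi>"
    have "{a. a < p \<and> \<alpha> a = i} = {sum_list (take i \<pi>)..<sum_list (take (Suc i) \<pi>)}"
    proof -
      have "sum_list (take (Suc i) \<pi>) \<le> sum_list (take k \<pi>)" by (rule sum_list_take_mono) (use i \<pi> in simp)
      hence le: "sum_list (take (Suc i) \<pi>) \<le> p" using \<pi> by simp
      have "\<alpha> a = i \<longleftrightarrow> \<not> \<alpha> a < i \<and> \<alpha> a < Suc i" for a by auto
      thus ?thesis using iff[of _ i] iff[of _ "Suc i"] i \<pi> le by (auto simp del: take_Suc_conv_app_nth)
    qed
    thus "\<pi> ! i = card {a. a < p \<and> \<alpha> a = i}" using sum_list_take_Suc[OF i] by simp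
  qed (rule \<pi>)
  thus thesis using iff that by blast
qed

text \<open>Only the relative order of levels enters \<open>level_pairs\<close>, so each level may
  be replaced by its rank among the levels that occur. \<sigma> then sends the \<beta>-rank of a
  fibre to its \<alpha>-rank.\<close>

lemma normalize_levels:
  fixes \<alpha> \<beta> :: "nat \<Rightarrow> nat"
  assumes sf: "same_fibres p \<alpha> \<beta>" and "0 < p"
  shows "\<exists>\<pi> \<sigma> \<alpha>' \<beta>'.
    \<pi> \<in> compositions p (card (\<alpha> ` {..<p})) \<and> \<sigma> permutes {..<card (\<alpha> ` {..<p})} \<and>
    has_sizes p \<pi> \<alpha>' \<and> (\<forall>a<p. \<beta>' a < length \<pi> \<and> \<sigma> (\<beta>' a) = \<alpha>' a) \<and>
    level_pairs p n \<alpha> \<beta> = level_pairs p n \<alpha>' \<beta>' \<and> same_fibres p \<alpha>' \<beta>'"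
proof -
  define rk where "rk f a = card {l \<in> f ` {..<p}. l < f a}" for f :: "nat \<Rightarrow> nat" and a
  have less: "rk f a < rk f b \<longleftrightarrow> f a < f b" if "a < p" "b < p" for f a b
  proof -
    have *: "rk f x < rk f y" if "x < p" "f x < f y" for x y
      unfolding rk_def using that by (intro psubset_card_mono) auto
    have "rk f x = rk f y" if "f x = f y" for x y unfolding rk_def using that by simp
    thus ?thesis using *[of a b] *[of b a] that by (metis linorder_neqE_nat order_less_asym')
  qed
  hence eq: "rk f a = rk f b \<longleftrightarrow> f a = f b" if "a < p" "b < p" for f a b
    using that by (metis linorder_neqE_nat less_irrefl)
  define k where "k = card (\<alpha> ` {..<p})"
  have lt: "rk f a < card (f ` {..<p})" if "a < p" for f a
    unfolding rk_def using that by (intro psubset_card_mono) auto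
  have onto: "rk f ` {..<p} = {..<card (f ` {..<p})}" for f
  proof (rule card_subset_eq)
    show "rk f ` {..<p} \<subseteq> {..<card (f ` {..<p})}" using lt by auto
    have "bij_betw (\<lambda>l. card {l' \<in> f ` {..<p}. l' < l}) (f ` {..<p}) (rk f ` {..<p})"
      unfolding bij_betw_def
    proof
      show "inj_on (\<lambda>l. card {l' \<in> f ` {..<p}. l' < l}) (f ` {..<p})"
        using eq[of _ _ f] unfolding rk_def by (auto intro!: inj_onI)
    qed (auto simp: rk_def image_image)
    thus "card (rk f ` {..<p}) = card {..<card (f ` {..<p})}" using bij_betw_same_card by fastforce
  qed simp
  have cardeq: "card (\<beta> ` {..<p}) = k"
  proof -
    have "bij_betw (\<lambda>l. \<beta> (SOME a. a < p \<and> \<alpha> a = l)) (\<alpha> ` {..<p}) (\<beta> ` {..<p})"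
    proof -
      have S: "\<beta> (SOME a'. a' < p \<and> \<alpha> a' = \<alpha> a) = \<beta> a" if "a < p" for a
        using someI[of "\<lambda>a'. a' < p \<and> \<alpha> a' = \<alpha> a" a] that sf unfolding same_fibres_def by blast
      show ?thesis unfolding bij_betw_def
      proof
        show "inj_on (\<lambda>l. \<beta> (SOME a. a < p \<and> \<alpha> a = l)) (\<alpha> ` {..<p})"
          using S sf unfolding same_fibres_def by (auto intro!: inj_onI)
      qed (use S in \<open>auto simp: image_image\<close>)
    qed
    thus ?thesis unfolding k_def by (simp add: bij_betw_same_card)
  qed
  define \<pi> where "\<pi> = map (\<lambda>i. card {a. a < p \<and> rk \<alpha> a = i}) [0..<k]"
  have sum\<pi>: "sum_list \<pi> = p"
  proof -
    have "sum_list \<pi> = (\<Sum>i<k. card {a. a < p \<and> rk \<alpha> a = i})"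
      unfolding \<pi>_def by (simp add: interv_sum_list_conv_sum_set_nat atLeast0LessThan)
    also have "\<dots> = card (\<Union>i<k. {a. a < p \<and> rk \<alpha> a = i})"
      by (rule card_UN_disjoint[symmetric]) auto
    also have "(\<Union>i<k. {a. a < p \<and> rk \<alpha> a = i}) = {..<p}" using lt unfolding k_def by auto
    finally show ?thesis by simp
  qed
  have pos: "0 < card {a. a < p \<and> rk \<alpha> a = i}" if "i < k" for i
  proof -
    have "i \<in> rk \<alpha> ` {..<p}" using onto[of \<alpha>] that unfolding k_def by auto
    thus ?thesis by (auto simp: card_gt_0_iff)
  qed
  define g where "g i = (SOME a. a < p \<and> rk \<beta> a = i)" for i
  have g: "g i < p \<and> rk \<beta> (g i) = i" if "i < k" for i
  proof -
    have "i \<in> rk \<beta> ` {..<p}" using onto[of \<beta>] that cardeq by auto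
    thus ?thesis unfolding g_def by (auto intro!: someI_ex[of "\<lambda>a. a < p \<and> rk \<beta> a = i"])
  qed
  define \<sigma> where "\<sigma> i = (if i < k then rk \<alpha> (g i) else i)" for i
  have sf': "rk \<alpha> a = rk \<alpha> b \<longleftrightarrow> rk \<beta> a = rk \<beta> b" if "a < p" "b < p" for a b
    using sf that eq unfolding same_fibres_def by auto
  have \<sigma>\<beta>: "\<sigma> (rk \<beta> a) = rk \<alpha> a" if "a < p" for a
  proof -
    have "rk \<beta> a < k" using lt[OF that, of \<beta>] cardeq by simp
    thus ?thesis unfolding \<sigma>_def using g sf'[of "g (rk \<beta> a)" a] that by auto
  qed
  have "\<sigma> permutes {..<k}"
  proof (rule bij_imp_permutes)
    have "inj_on \<sigma> {..<k}"
    proof (rule inj_onI)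
      fix i j assume ij: "i \<in> {..<k}" "j \<in> {..<k}" "\<sigma> i = \<sigma> j"
      hence "rk \<alpha> (g i) = rk \<alpha> (g j)" unfolding \<sigma>_def by simp
      thus "i = j" using g[of i] g[of j] sf'[of "g i" "g j"] ij by auto
    qed
    moreover have "\<sigma> ` {..<k} \<subseteq> {..<k}"
    proof (rule image_subsetI)
      fix i assume "i \<in> {..<k}"
      thus "\<sigma> i \<in> {..<k}" using lt[of "g i" \<alpha>] g[of i] unfolding \<sigma>_def k_def[symmetric] by simp
    qed
    ultimately show "bij_betw \<sigma> {..<k} {..<k}" unfolding bij_betw_def using endo_inj_surj[of "{..<k}" \<sigma>] by auto
  qed (simp add: \<sigma>_def)
  moreover have "\<pi> \<in> compositions p k" unfolding compositions_def using sum\<pi> pos by (auto simp: \<pi>_def)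
  moreover have "has_sizes p \<pi> (rk \<alpha>)" unfolding has_sizes_def using sum\<pi> lt[of _ \<alpha>] by (auto simp: \<pi>_def k_def)
  moreover have "rk \<beta> a < length \<pi>" if "a < p" for a using lt[OF that, of \<beta>] cardeq by (simp add: \<pi>_def)
  moreover have "level_pairs p n \<alpha> \<beta> = level_pairs p n (rk \<alpha>) (rk \<beta>)"
    unfolding level_pairs_def using less eq by auto
  moreover have "same_fibres p (rk \<alpha>) (rk \<beta>)" unfolding same_fibres_def using sf' by auto
  ultimately show ?thesis using \<sigma>\<beta> unfolding k_def by blast
qed

lemma finite_compositions: "finite (compositions p k)"
proof (rule finite_subset)
  show "compositions p k \<subseteq> {xs. set xs \<subseteq> {..p} \<and> length xs = k}"
    unfolding compositions_def using member_le_sum_list by fastforce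
qed (rule finite_lists_length_eq, simp)

lemma finite_T_perms: "finite (T_perms k)"
  unfolding T_perms_def by (rule finite_subset[OF _ finite_permutations[of "{..<k}"]]) auto

text \<open>Induction on the number of levels: a partial reversal puts the orbit into the closure of
  one with fewer levels, and without partial reversal the normalized orbit is itself one of the
  terms.\<close>

lemma orbit_level_pairs_covered:
  assumes "same_fibres p \<alpha> \<beta>" "0 < p"
  shows "pair_orbit p (level_pairs p n \<alpha> \<beta>) \<subseteq>
    (\<Union>k\<in>{1..p}. \<Union>\<pi>\<in>compositions p k. \<Union>\<sigma>\<in>T_perms k.
      pair_zariski p n closure_of pair_orbit p (C_pairs p n \<pi> \<sigma>))" (is "_ \<subseteq> ?U")
  using assms(1)
proof (induction "card (\<alpha> ` {..<p})" arbitrary: \<alpha> \<beta> rule: less_induct)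
  case less
  define k where "k = card (\<alpha> ` {..<p})"
  obtain \<pi> \<sigma> \<alpha>' \<beta>' where N: "\<pi> \<in> compositions p k" "\<sigma> permutes {..<k}"
    "has_sizes p \<pi> \<alpha>'" and N': "\<forall>a<p. \<beta>' a < length \<pi> \<and> \<sigma> (\<beta>' a) = \<alpha>' a" and
    N2: "level_pairs p n \<alpha> \<beta> = level_pairs p n \<alpha>' \<beta>'" "same_fibres p \<alpha>' \<beta>'"
    using normalize_levels[OF less.prems assms(2), of n] unfolding k_def by (elim exE conjE)
  have N4: "\<beta>' a < length \<pi>" "\<sigma> (\<beta>' a) = \<alpha>' a" if "a < p" for a using N' that by auto
  have len: "length \<pi> = k" using N(1) unfolding compositions_def by simp
  have "k \<le> p" unfolding k_def using card_image_le[of "{..<p}" \<alpha>] by simp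
  moreover have "k \<noteq> 0" unfolding k_def using assms(2) by auto
  ultimately have k: "k \<in> {1..p}" by auto
  have O: "pair_orbit p (level_pairs p n \<alpha>' \<beta>') = pair_orbit p (C_pairs p n \<pi> \<sigma>)"
    using pair_orbit_C_pairs[OF N(3) _ N4] N(2) len by simp
  have top: "pair_orbit p (level_pairs p n x y) \<subseteq> topspace (pair_zariski p n)" for x y
    unfolding pair_zariski_def topspace_zariski by (rule pair_orbit_subset[OF level_pairs_subset])
  have cl: "closedin (pair_zariski p n) ?U"
    by (intro closedin_Union finite_imageI finite_compositions finite_T_perms finite_atLeastAtMost)
      (auto intro!: closedin_Union finite_imageI finite_compositions finite_T_perms)
  show ?case
  proof (cases "partial_reversal k \<sigma>")
    case False
    hence "\<sigma> \<in> T_perms k" using N(2) unfolding T_perms_def by simp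
    moreover have "pair_orbit p (level_pairs p n \<alpha> \<beta>) \<subseteq> pair_zariski p n closure_of pair_orbit p (C_pairs p n \<pi> \<sigma>)"
      unfolding N2(1) O[symmetric] using top by (rule closure_of_subset)
    ultimately show ?thesis using k N(1) by blast
  next
    case True
    then obtain l where l: "l + 1 < k" "\<sigma> l = \<sigma> (l + 1) + 1" unfolding partial_reversal_def by blast
    have inj: "\<sigma> x = \<sigma> y \<longleftrightarrow> x = y" for x y using permutes_inj[OF N(2)] by (auto dest: injD)
    have fib: "\<alpha>' a = \<sigma> x \<longleftrightarrow> \<beta>' a = x" if "a < p" for a x using N4(2)[OF that] inj by metis
    define \<alpha>2 where "\<alpha>2 = (\<lambda>a. if \<alpha>' a = \<sigma> l then \<sigma> (l + 1) else \<alpha>' a)"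
    define \<beta>2 where "\<beta>2 = (\<lambda>a. if \<beta>' a = l + 1 then l else \<beta>' a)"
    \<comment> \<open>Levels that differ by one have nothing between them; this is where a drop by
      exactly one is needed.\<close>
    have gap: "\<sigma> (l + 1) < \<sigma> l" "l < l + 1" "\<not> (\<sigma> (l + 1) < \<alpha>' a \<and> \<alpha>' a < \<sigma> l)" "\<not> (l < \<beta>' a \<and> \<beta>' a < l + 1)" for a
      using l(2) by auto
    have D: "same_fibres p \<alpha>2 \<beta>2"
      "pair_orbit p (level_pairs p n \<alpha>' \<beta>') \<subseteq> pair_zariski p n closure_of pair_orbit p (level_pairs p n \<alpha>2 \<beta>2)"
      unfolding \<alpha>2_def \<beta>2_def
      using level_pairs_degeneration[OF N2(2) gap(1,2) fib fib gap(3,4)] by blast+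
    have lt: "\<alpha>' a < k" if "a < p" for a using N(3) len that unfolding has_sizes_def by auto
    have \<sigma>lt: "\<sigma> x < k" if "x < k" for x using permutes_in_image[OF N(2), of x] that by auto
    have "\<alpha>2 ` {..<p} \<subseteq> {..<k} - {\<sigma> l}" using lt \<sigma>lt l unfolding \<alpha>2_def by auto
    hence "card (\<alpha>2 ` {..<p}) \<le> card ({..<k} - {\<sigma> l})" by (intro card_mono) auto
    also have "\<dots> < k" using \<sigma>lt[of l] l by simp
    finally have "pair_orbit p (level_pairs p n \<alpha>2 \<beta>2) \<subseteq> ?U"
      using less.hyps[OF _ D(1)] unfolding k_def by simp
    hence "pair_zariski p n closure_of pair_orbit p (level_pairs p n \<alpha>2 \<beta>2) \<subseteq> ?U"
      using cl by (rule closure_of_minimal)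
    thus ?thesis using D(2) unfolding N2(1) by blast
  qed
qed

section \<open>Burnside's theorem\<close>

definition vec_subspace :: "nat \<Rightarrow> complex vec set \<Rightarrow> bool" where
  "vec_subspace q U \<longleftrightarrow> U \<subseteq> carrier_vec q \<and> 0\<^sub>v q \<in> U \<and> (\<forall>u\<in>U. \<forall>v\<in>U. u + v \<in> U) \<and>
     (\<forall>c. \<forall>u\<in>U. c \<cdot>\<^sub>v u \<in> U)"

lemma mult_mat_vec_entry:
  "A \<in> carrier_mat p q \<Longrightarrow> v \<in> carrier_vec q \<Longrightarrow> i < p \<Longrightarrow> (A *\<^sub>v v) $ i = (\<Sum>k<q. A $$ (i, k) * v $ k)"
  by (auto simp: scalar_prod_def atLeast0LessThan)

lemma vec_subspace_combination:
  assumes U: "vec_subspace q U" and fin: "finite J" and x: "\<And>j. j \<in> J \<Longrightarrow> x j \<in> U"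
  shows "vec q (\<lambda>i. \<Sum>j\<in>J. c j * x j $ i) \<in> U"
  using fin x
proof induction
  case empty
  have "vec q (\<lambda>i. 0) = (0\<^sub>v q :: complex vec)" by auto
  thus ?case using U unfolding vec_subspace_def by simp
next
  case (insert j J)
  have xj: "x j \<in> carrier_vec q" using insert.prems U unfolding vec_subspace_def by auto
  have "vec q (\<lambda>i. \<Sum>j\<in>insert j J. c j * x j $ i) = c j \<cdot>\<^sub>v x j + vec q (\<lambda>i. \<Sum>j\<in>J. c j * x j $ i)"
    using insert.hyps xj by (intro eq_vecI) auto
  thus ?case using insert U unfolding vec_subspace_def by auto
qed

text \<open>Take an invertible matrix with as many columns in \<open>U\<close> as possible. A vector
  of \<open>U\<close> with a nonzero coordinate outside \<open>J\<close> could replace the column of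
  that coordinate, contradicting maximality; so the columns in \<open>J\<close> are a basis of
  \<open>U\<close>.\<close>

lemma vec_subspace_adapted:
  assumes U: "vec_subspace q U"
  shows "\<exists>g J. g \<in> GL q \<and> J \<subseteq> {..<q} \<and> (\<forall>j\<in>J. col g j \<in> U) \<and>
    U = {v \<in> carrier_vec q. \<forall>i<q. i \<notin> J \<longrightarrow> (ginv q g *\<^sub>v v) $ i = 0}"
proof -
  define P where "P s \<longleftrightarrow> (\<exists>g J. g \<in> GL q \<and> J \<subseteq> {..<q} \<and> (\<forall>j\<in>J. col g j \<in> U) \<and> card J = s)" for s
  have "P 0" unfolding P_def using GL_one(1)[of q] by (intro exI[of _ "1\<^sub>m q"] exI[of _ "{}"]) auto
  moreover have bound: "s \<le> q" if "P s" for s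
    using that unfolding P_def by (metis card_lessThan card_mono finite_lessThan)
  ultimately have gr: "P (Greatest P)" by (rule GreatestI_nat)
  define s where "s = Greatest P"
  have s: "P s" "s' \<le> s" if "P s'" for s'
    unfolding s_def using gr Greatest_le_nat[of P s' q, OF that bound] by auto
  have "P s" using gr unfolding s_def .
  then obtain g J where g: "g \<in> GL q" "J \<subseteq> {..<q}" "\<And>j. j \<in> J \<Longrightarrow> col g j \<in> U" "card J = s"
    unfolding P_def by blast
  note c = GL_D[OF g(1)]
  have Uc: "U \<subseteq> carrier_vec q" using U unfolding vec_subspace_def by auto
  have rep: "g *\<^sub>v (ginv q g *\<^sub>v v) = v" if "v \<in> carrier_vec q" for v
    using c that by (metis assoc_mult_mat_vec one_mult_mat_vec)
  have "U = {v \<in> carrier_vec q. \<forall>i<q. i \<notin> J \<longrightarrow> (ginv q g *\<^sub>v v) $ i = 0}"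
  proof (intro equalityI subsetI)
    fix v assume v: "v \<in> U"
    hence vc: "v \<in> carrier_vec q" using Uc by auto
    have "(ginv q g *\<^sub>v v) $ i = 0" if i: "i < q" "i \<notin> J" for i
    proof (rule ccontr)
      assume n: "(ginv q g *\<^sub>v v) $ i \<noteq> 0"
      let ?g = "replace_col g v i"
      have y: "ginv q g *\<^sub>v v \<in> carrier_vec q" using c vc by auto
      \<comment> \<open>By Cramer's rule this determinant is the \<open>i\<close>-th coordinate of
        \<open>v\<close> times \<open>det g\<close>.\<close>
      have "det ?g \<noteq> 0" using cramer_lemma_mat[OF c(1) y i(1)] n GL_det_nonzero[OF g(1)]
        unfolding rep[OF vc] by simp
      moreover have gc: "?g \<in> carrier_mat q q" using c unfolding replace_col_def by auto
      ultimately have "?g \<in> GL q" by (intro GL_det)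
      moreover have "col ?g j \<in> U" if j: "j \<in> insert i J" for j
      proof (cases "j = i")
        case True
        have "col ?g j = v" using True i vc c(1) by (intro eq_vecI) (auto simp: replace_col_def)
        thus ?thesis using v by simp
      next
        case False
        have "col ?g j = col g j" using False j g(2) c(1) by (intro eq_vecI) (auto simp: replace_col_def)
        thus ?thesis using False j g by auto
      qed
      moreover have "card (insert i J) = Suc s" using i(2) g(4) finite_subset[OF g(2)] by simp
      ultimately have "P (Suc s)" unfolding P_def using i g(2)
        by (intro exI[of _ ?g] exI[of _ "insert i J"]) auto
      thus False using s(2) by fastforce
    qed
    thus "v \<in> {v \<in> carrier_vec q. \<forall>i<q. i \<notin> J \<longrightarrow> (ginv q g *\<^sub>v v) $ i = 0}" using vc by auto
  next
    fix v assume v: "v \<in> {v \<in> carrier_vec q. \<forall>i<q. i \<notin> J \<longrightarrow> (ginv q g *\<^sub>v v) $ i = 0}"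
    hence vc: "v \<in> carrier_vec q" by auto
    define y where "y = ginv q g *\<^sub>v v"
    have y: "y \<in> carrier_vec q" unfolding y_def using c vc by auto
    have "v = vec q (\<lambda>i. \<Sum>j\<in>J. y $ j * col g j $ i)"
    proof (rule eq_vecI)
      fix i assume "i < dim_vec (vec q (\<lambda>i. \<Sum>j\<in>J. y $ j * col g j $ i))"
      hence i: "i < q" by simp
      have "v $ i = (\<Sum>k<q. g $$ (i, k) * y $ k)"
        using rep[OF vc] mult_mat_vec_entry[OF c(1) y i] unfolding y_def by simp
      also have "\<dots> = (\<Sum>k\<in>J. g $$ (i, k) * y $ k)"
        using g(2) v unfolding y_def by (intro sum.mono_neutral_right) auto
      also have "\<dots> = (\<Sum>j\<in>J. y $ j * col g j $ i)" using c(1) g(2) i by (intro sum.cong) auto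
      finally show "v $ i = vec q (\<lambda>i. \<Sum>j\<in>J. y $ j * col g j $ i) $ i" using i by simp
    qed (use vc in simp)
    also have "\<dots> \<in> U" by (rule vec_subspace_combination[OF U finite_subset[OF g(2)] g(3)]) auto
    finally show "v \<in> U" .
  qed
  thus ?thesis using g(1-3) by blast
qed

text \<open>A kernel vector with nonzero coordinate k expresses column k of \<open>N\<close> through
  the other columns. \<open>U\<close> keeps those columns and \<open>W\<close> records the
  relation.\<close>

lemma singular_factor:
  assumes N: "N \<in> carrier_mat s s" and v: "v \<in> carrier_vec s" "v \<noteq> 0\<^sub>v s" "N *\<^sub>v v = 0\<^sub>v s"
  obtains U W :: "complex mat" where "U \<in> carrier_mat s (s - 1)" "W \<in> carrier_mat (s - 1) s" "N = U * W"
proof -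
  obtain k where k: "k < s" "v $ k \<noteq> 0"
    using v(1,2) by (metis eq_vecI carrier_vecD index_zero_vec)
  define \<iota> where "\<iota> j = (if j < k then j else Suc j)" for j
  have bij: "bij_betw \<iota> {..<s - 1} ({..<s} - {k})"
  proof (rule bij_betw_byWitness[where f' = "\<lambda>i. if i < k then i else i - 1"])
    show "\<iota> ` {..<s - 1} \<subseteq> {..<s} - {k}" using k unfolding \<iota>_def by auto
    show "(\<lambda>i. if i < k then i else i - 1) ` ({..<s} - {k}) \<subseteq> {..<s - 1}" using k by auto
  qed (auto simp: \<iota>_def)
  have \<iota>: "\<iota> j < s" "\<iota> j \<noteq> k" if "j < s - 1" for j using bij_betwE[OF bij] that by auto
  define U where "U = mat s (s - 1) (\<lambda>(r, j). N $$ (r, \<iota> j))"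
  define W where "W = mat (s - 1) s (\<lambda>(j, c). if c = k then - (v $ \<iota> j / v $ k) else if c = \<iota> j then 1 else 0)"
  have UW: "U \<in> carrier_mat s (s - 1)" "W \<in> carrier_mat (s - 1) s" unfolding U_def W_def by auto
  have "N = U * W"
  proof (rule eq_matI)
    fix r c assume "r < dim_row (U * W)" "c < dim_col (U * W)"
    hence rc: "r < s" "c < s" using UW by auto
    have re: "(\<Sum>j<s - 1. f (\<iota> j)) = (\<Sum>i\<in>{..<s} - {k}. f i)" for f :: "nat \<Rightarrow> complex"
      by (rule sum.reindex_bij_betw[OF bij])
    have "(U * W) $$ (r, c) = (\<Sum>j<s - 1. U $$ (r, j) * W $$ (j, c))" by (rule mult_mat_entry[OF UW rc])
    also have "\<dots> = (\<Sum>j<s - 1. N $$ (r, \<iota> j) * (if c = k then - (v $ \<iota> j / v $ k) else if c = \<iota> j then 1 else 0))"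
      using rc by (intro sum.cong) (auto simp: U_def W_def)
    also have "\<dots> = (\<Sum>i\<in>{..<s} - {k}. N $$ (r, i) * (if c = k then - (v $ i / v $ k) else if c = i then 1 else 0))"
      by (rule re)
    also have "\<dots> = N $$ (r, c)"
    proof (cases "c = k")
      case False
      have "(\<Sum>i\<in>{..<s} - {k}. N $$ (r, i) * (if c = k then - (v $ i / v $ k) else if c = i then 1 else 0))
        = (\<Sum>i\<in>{..<s} - {k}. if i = c then N $$ (r, c) else 0)" using False by (intro sum.cong) auto
      thus ?thesis using False rc by simp
    next
      case True
      have "0 = (\<Sum>i<s. N $$ (r, i) * v $ i)" using mult_mat_vec_entry[OF N v(1) rc(1)] v(3) rc by simp
      also have "\<dots> = N $$ (r, k) * v $ k + (\<Sum>i\<in>{..<s} - {k}. N $$ (r, i) * v $ i)"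
        using k by (simp add: sum.remove)
      finally have "N $$ (r, k) = - (\<Sum>i\<in>{..<s} - {k}. N $$ (r, i) * v $ i) / v $ k"
        using k by (simp add: field_simps eq_neg_iff_add_eq_0)
      thus ?thesis using True by (simp add: sum_divide_distrib sum_negf)
    qed
    finally show "N $$ (r, c) = (U * W) $$ (r, c)" by simp
  qed (use UW N in auto)
  thus thesis using that UW by blast
qed

definition matrix_unit :: "nat \<Rightarrow> nat \<Rightarrow> nat \<Rightarrow> nat \<Rightarrow> complex mat" where
  "matrix_unit q q' a b = mat q q' (\<lambda>(i, j). if i = a \<and> j = b then 1 else 0)"

text \<open>The working form of irreducibility; \<open>burnside\<close> supplies it when there is no
  proper nonzero invariant subspace.\<close>

definition full_tuple :: "nat \<Rightarrow> mtuple \<Rightarrow> bool" where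
  "full_tuple q B \<longleftrightarrow> (\<forall>M \<in> carrier_mat q q. \<exists>w. nc_eval q w B = M)"

lemma full_tupleI:
  assumes B: "B \<in> mtuples q n"
    and E: "\<And>a b. a < q \<Longrightarrow> b < q \<Longrightarrow> \<exists>w. nc_eval q w B = matrix_unit q q a b"
  shows "full_tuple q B"
  unfolding full_tuple_def
proof
  fix M :: "complex mat" assume M: "M \<in> carrier_mat q q"
  have "\<exists>w. nc_eval q w B = mat q q (\<lambda>ij. if ij \<in> S then M $$ ij else 0)"
    if "finite S" "S \<subseteq> {..<q} \<times> {..<q}" for S
    using that
  proof induction
    case empty
    have "nc_eval q (NScale 0 NOne) B = mat q q (\<lambda>ij. if ij \<in> {} then M $$ ij else 0)"
      by (rule eq_matI) auto
    thus ?case by blast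
  next
    case (insert ij S)
    obtain a b where ij: "ij = (a, b)" "a < q" "b < q" using insert.prems by (cases ij) auto
    obtain w w' where w: "nc_eval q w B = mat q q (\<lambda>ij. if ij \<in> S then M $$ ij else 0)"
      "nc_eval q w' B = matrix_unit q q a b" using insert E[OF ij(2,3)] by blast
    have "nc_eval q (NAdd w (NScale (M $$ (a, b)) w')) B = mat q q (\<lambda>ij'. if ij' \<in> insert ij S then M $$ ij' else 0)"
      using insert.hyps(2) ij by (intro eq_matI) (auto simp: w matrix_unit_def)
    thus ?case by blast
  qed
  from this[of "{..<q} \<times> {..<q}"] obtain w where
    "nc_eval q w B = mat q q (\<lambda>ij. if ij \<in> {..<q} \<times> {..<q} then M $$ ij else 0)" by blast
  moreover have "\<dots> = M" using M by (intro eq_matI) auto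
  ultimately show "\<exists>w. nc_eval q w B = M" by auto
qed

lemma complex_eigenvector:
  assumes S: "(S :: complex mat) \<in> carrier_mat s s" and "s > 0"
  shows "\<exists>\<mu> v. v \<in> carrier_vec s \<and> v \<noteq> 0\<^sub>v s \<and> S *\<^sub>v v = \<mu> \<cdot>\<^sub>v v"
proof -
  have "degree (char_poly S) = s" using degree_monic_char_poly[OF S] by simp
  hence "\<not> constant (poly (char_poly S))" using constant_degree[of "char_poly S"] assms(2) by simp
  then obtain \<mu> where "poly (char_poly S) \<mu> = 0" using fundamental_theorem_of_algebra by blast
  hence "eigenvalue S \<mu>" using eigenvalue_root_char_poly[OF S] by simp
  thus ?thesis using S unfolding eigenvalue_def eigenvector_def by auto
qed

text \<open>
  An element of the generated algebra with the shortest factorisation has rank one: otherwise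
  composing it with a suitable algebra element and subtracting an eigenvalue gives a shorter one.
\<close>
lemma transitive_rank_one:
  assumes B: "B \<in> mtuples q n" and q: "q > 0"
    and T1: "\<forall>x y. x \<in> carrier_vec q \<longrightarrow> x \<noteq> 0\<^sub>v q \<longrightarrow> y \<in> carrier_vec q \<longrightarrow> (\<exists>w. nc_eval q w B *\<^sub>v x = y)"
  shows "\<exists>w u r. u \<in> carrier_vec q \<and> r \<in> carrier_vec q \<and> u \<noteq> 0\<^sub>v q \<and> r \<noteq> 0\<^sub>v q \<and>
    nc_eval q w B = mat q q (\<lambda>(i, j). u $ i * r $ j)"
proof -
  have ev: "nc_eval q w B \<in> carrier_mat q q" for w by (rule nc_eval_carrier[OF B])
  define P where "P s \<longleftrightarrow> (\<exists>w U W. U \<in> carrier_mat q s \<and> W \<in> carrier_mat s q \<and> nc_eval q w B = U * W \<and>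
    nc_eval q w B \<noteq> 0\<^sub>m q q)" for s
  have one: "1\<^sub>m q \<noteq> (0\<^sub>m q q :: complex mat)"
    using q by (metis index_one_mat(1) index_zero_mat(1) zero_neq_one)
  have "P q" unfolding P_def
    by (intro exI[of _ NOne] exI[of _ "1\<^sub>m q"]) (use one in auto)
  define s where "s = (LEAST s. P s)"
  have Ps: "P s" unfolding s_def by (rule LeastI, rule \<open>P q\<close>)
  then obtain w U W where UW: "U \<in> carrier_mat q s" "W \<in> carrier_mat s q" "nc_eval q w B = U * W"
    "nc_eval q w B \<noteq> 0\<^sub>m q q" unfolding P_def by blast
  let ?T = "nc_eval q w B"
  have "s \<noteq> 0"
  proof
    assume "s = 0"
    hence "?T = 0\<^sub>m q q" using UW(1-3) by (intro eq_matI) (auto simp: scalar_prod_def)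
    thus False using UW(4) by simp
  qed
  obtain i0 b where b: "i0 < q" "b < q" "?T $$ (i0, b) \<noteq> 0"
  proof -
    have "\<exists>i j. i < q \<and> j < q \<and> ?T $$ (i, j) \<noteq> 0"
    proof (rule ccontr)
      assume "\<not> ?thesis"
      hence "?T = 0\<^sub>m q q" using ev[of w] by (intro eq_matI) auto
      thus False using UW(4) by simp
    qed
    thus thesis using that by blast
  qed
  let ?u = "col ?T b"
  have u: "?u \<in> carrier_vec q" using ev[of w] by (simp add: carrier_vecI)
  have u0: "?u \<noteq> 0\<^sub>v q"
  proof
    assume "?u = 0\<^sub>v q"
    hence "?u $ i0 = 0" using b by simp
    thus False using b ev[of w] by simp
  qed
  have rank1: "\<exists>\<mu>. \<forall>i<q. ?T $$ (i, c) = \<mu> * ?T $$ (i, b)" if c: "c < q" for c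
  proof (rule ccontr)
    assume nc: "\<not> ?thesis"
    \<comment> \<open>Since \<open>w1\<close> maps column \<open>b\<close> of \<open>?T\<close> to
      the basis vector \<open>c\<close>, inserting it between two factors \<open>?T\<close> gives a
      matrix whose column \<open>b\<close> is column \<open>c\<close> of \<open>?T\<close>.
      Subtracting \<mu> times \<open>?T\<close> leaves it nonzero, because column \<open>c\<close>
      is not a multiple of column \<open>b\<close>, while the inner factor becomes singular.\<close>
    obtain w1 where w1: "nc_eval q w1 B *\<^sub>v ?u = unit_vec q c" using T1 u u0 by (metis unit_vec_carrier)
    let ?S = "W * (nc_eval q w1 B * U)"
    have S: "?S \<in> carrier_mat s s" using UW ev[of w1] by auto
    obtain \<mu> v where v: "v \<in> carrier_vec s" "v \<noteq> 0\<^sub>v s" "?S *\<^sub>v v = \<mu> \<cdot>\<^sub>v v"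
      using complex_eigenvector[OF S] \<open>s \<noteq> 0\<close> by auto
    let ?N = "?S + (- \<mu>) \<cdot>\<^sub>m 1\<^sub>m s"
    have N: "?N \<in> carrier_mat s s" using S by auto
    have "?N *\<^sub>v v = ?S *\<^sub>v v + ((- \<mu>) \<cdot>\<^sub>m 1\<^sub>m s) *\<^sub>v v" by (rule add_mult_distrib_mat_vec[OF S _ v(1)]) auto
    also have "\<dots> = 0\<^sub>v s" unfolding v(3) using v(1)
      by (intro eq_vecI) (auto simp: mult_mat_vec_entry[of _ s s] if_distrib sum.delta cong: if_cong)
    finally obtain U1 W1 where U1: "U1 \<in> carrier_mat s (s - 1)" "W1 \<in> carrier_mat (s - 1) s" "?N = U1 * W1"
      using singular_factor[OF N v(1,2)] by blast
    let ?w = "NAdd (NMul w (NMul w1 w)) (NScale (- \<mu>) w)"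
    have "nc_eval q ?w B = U * ?N * W"
    proof -
      have "U * ?N = U * ?S + U * ((- \<mu>) \<cdot>\<^sub>m 1\<^sub>m s)" by (rule mult_add_distrib_mat[OF UW(1) S]) simp
      moreover have "U * ((- \<mu>) \<cdot>\<^sub>m 1\<^sub>m s) = (- \<mu>) \<cdot>\<^sub>m (U * 1\<^sub>m s)"
        by (rule mult_smult_distrib[OF UW(1) one_carrier_mat])
      moreover have "U * 1\<^sub>m s = U" by (rule right_mult_one_mat[OF UW(1)])
      moreover have "(U * ?S + (- \<mu>) \<cdot>\<^sub>m U) * W = U * ?S * W + ((- \<mu>) \<cdot>\<^sub>m U) * W"
        by (rule add_mult_distrib_mat[OF mult_carrier_mat[OF UW(1) S] smult_carrier_mat[OF UW(1)] UW(2)])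
      ultimately have "U * ?N * W = U * ?S * W + ((- \<mu>) \<cdot>\<^sub>m U) * W" by (simp only:)
      also have "((- \<mu>) \<cdot>\<^sub>m U) * W = (- \<mu>) \<cdot>\<^sub>m (U * W)" by (rule mult_smult_assoc_mat[OF UW(1,2)])
      also have "U * ?S * W = U * W * (nc_eval q w1 B * (U * W))"
      proof -
        have EU: "nc_eval q w1 B * U \<in> carrier_mat q s" using ev[of w1] UW(1) by auto
        have "U * ?S = U * W * (nc_eval q w1 B * U)" by (rule assoc_mult_mat[OF UW(1,2) EU, symmetric])
        moreover have "U * W * (nc_eval q w1 B * U) * W = U * W * (nc_eval q w1 B * U * W)"
          by (rule assoc_mult_mat[OF _ EU UW(2)]) (use UW in auto)
        moreover have "nc_eval q w1 B * U * W = nc_eval q w1 B * (U * W)" by (rule assoc_mult_mat[OF ev UW(1,2)])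
        ultimately show ?thesis by simp
      qed
      finally show ?thesis by (simp add: UW(3))
    qed
    also have "\<dots> = (U * U1) * (W1 * W)"
    proof -
      have "U * (U1 * W1) = U * U1 * W1" by (rule assoc_mult_mat[OF UW(1) U1(1,2), symmetric])
      moreover have "U * U1 * W1 * W = (U * U1) * (W1 * W)"
        by (rule assoc_mult_mat[OF _ U1(2) UW(2)]) (use UW U1 in auto)
      ultimately show ?thesis unfolding U1(3) by simp
    qed
    finally have fac: "nc_eval q ?w B = (U * U1) * (W1 * W)" .
    obtain i where i: "i < q" "?T $$ (i, c) \<noteq> \<mu> * ?T $$ (i, b)" using nc by blast
    have "nc_eval q ?w B $$ (i, b) = ?T $$ (i, c) - \<mu> * ?T $$ (i, b)"
    proof -
      have "(?T * (nc_eval q w1 B * ?T)) $$ (i, b) = (\<Sum>k<q. ?T $$ (i, k) * (nc_eval q w1 B * ?T) $$ (k, b))"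
        by (rule mult_mat_entry[OF ev mult_carrier_mat[OF ev ev] i(1) b(2)])
      also have "\<dots> = (\<Sum>k<q. if k = c then ?T $$ (i, c) else 0)"
      proof (intro sum.cong refl)
        fix k assume "k \<in> {..<q}"
        hence k: "k < q" by simp
        have "(nc_eval q w1 B * ?T) $$ (k, b) = (nc_eval q w1 B *\<^sub>v ?u) $ k"
          using k b ev[of w1] ev[of w] by simp
        thus "?T $$ (i, k) * (nc_eval q w1 B * ?T) $$ (k, b) = (if k = c then ?T $$ (i, c) else 0)"
          unfolding w1 using k c by simp
      qed
      finally show ?thesis using i b c ev[of w] ev[of w1] by simp
    qed
    hence ne: "nc_eval q ?w B \<noteq> 0\<^sub>m q q" using i b(2)
      by (metis eq_iff_diff_eq_0 index_zero_mat(1))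
    have "P (s - 1)" unfolding P_def
      by (rule exI[of _ ?w], rule exI[of _ "U * U1"], rule exI[of _ "W1 * W"], intro conjI
          mult_carrier_mat[OF UW(1) U1(1)] mult_carrier_mat[OF U1(2) UW(2)] fac ne)
    hence "s \<le> s - 1" unfolding s_def by (rule Least_le)
    thus False using \<open>s \<noteq> 0\<close> by simp
  qed
  then obtain \<mu> where \<mu>: "\<And>c i. c < q \<Longrightarrow> i < q \<Longrightarrow> ?T $$ (i, c) = \<mu> c * ?T $$ (i, b)" by metis
  show ?thesis
  proof (intro exI conjI)
    show "?u \<in> carrier_vec q" "?u \<noteq> 0\<^sub>v q" by (fact u u0)+
    show "vec q \<mu> \<in> carrier_vec q" by simp
    show "?T = mat q q (\<lambda>(i, j). ?u $ i * vec q \<mu> $ j)"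
    proof (rule eq_matI)
      fix i j assume "i < dim_row (mat q q (\<lambda>(i, j). ?u $ i * vec q \<mu> $ j))"
        "j < dim_col (mat q q (\<lambda>(i, j). ?u $ i * vec q \<mu> $ j))"
      hence ij: "i < q" "j < q" by auto
      have "?u $ i = ?T $$ (i, b)" using ev[of w] ij b by simp
      thus "?T $$ (i, j) = mat q q (\<lambda>(i, j). ?u $ i * vec q \<mu> $ j) $$ (i, j)"
        using ij by (simp only: index_mat prod.case index_vec \<mu>[OF ij(2,1)] mult.commute)
    qed (use ev[of w] in \<open>simp_all only: carrier_matD dim_row_mat dim_col_mat\<close>)
    show "vec q \<mu> \<noteq> 0\<^sub>v q"
    proof
      assume "vec q \<mu> = 0\<^sub>v q"
      hence "\<mu> b = 0" using b(2) by (metis index_vec index_zero_vec(1))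
      thus False using \<mu>[OF b(2,1)] b(3) by simp
    qed
  qed
qed

definition invariant_subspace :: "nat \<Rightarrow> mtuple \<Rightarrow> complex vec set \<Rightarrow> bool" where
  "invariant_subspace q B U \<longleftrightarrow> vec_subspace q U \<and> (\<forall>m<length B. \<forall>u\<in>U. B ! m *\<^sub>v u \<in> U)"

lemma orbit_vec_subspace:
  assumes B: "B \<in> mtuples q n" and x: "x \<in> carrier_vec q"
  shows "vec_subspace q (range (\<lambda>w. nc_eval q w B *\<^sub>v x))"
  unfolding vec_subspace_def
proof (intro conjI allI ballI)
  have ev: "nc_eval q w B \<in> carrier_mat q q" for w by (rule nc_eval_carrier[OF B])
  show "range (\<lambda>w. nc_eval q w B *\<^sub>v x) \<subseteq> carrier_vec q" using mult_mat_vec_carrier[OF ev x] by auto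
  have "0\<^sub>v q = nc_eval q (NScale 0 NOne) B *\<^sub>v x"
    using x by (intro eq_vecI) (auto simp: mult_mat_vec_entry[of _ q q])
  thus "0\<^sub>v q \<in> range (\<lambda>w. nc_eval q w B *\<^sub>v x)" by blast
  fix u assume "u \<in> range (\<lambda>w. nc_eval q w B *\<^sub>v x)"
  then obtain w where w: "u = nc_eval q w B *\<^sub>v x" by auto
  have "c \<cdot>\<^sub>v u = nc_eval q (NScale c w) B *\<^sub>v x" for c
    using w ev[of w] x by (intro eq_vecI) (auto simp: mult_mat_vec_entry[of _ q q] sum_distrib_left mult.assoc
        simp del: index_mult_mat_vec)
  thus "c \<cdot>\<^sub>v u \<in> range (\<lambda>w. nc_eval q w B *\<^sub>v x)" for c by blast
  fix v assume "v \<in> range (\<lambda>w. nc_eval q w B *\<^sub>v x)"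
  then obtain w' where w': "v = nc_eval q w' B *\<^sub>v x" by auto
  have "u + v = nc_eval q (NAdd w w') B *\<^sub>v x"
    using w w' ev[of w] ev[of w'] x by (simp add: add_mult_distrib_mat_vec)
  thus "u + v \<in> range (\<lambda>w. nc_eval q w B *\<^sub>v x)" by blast
qed

text \<open>Irreducibility makes the algebra transitive on nonzero vectors, so it contains a
  rank-one element, a column u times a row r. Left factors turn u into any basis vector. The rows
  reached from r by right factors fill the whole space, since a functional killing all of them would
  contradict transitivity. Together these give every matrix unit.\<close>

theorem burnside:
  assumes B: "B \<in> mtuples q n" and q: "q > 0" and nf: "\<not> full_tuple q B"
  shows "\<exists>U. invariant_subspace q B U \<and> U \<noteq> {0\<^sub>v q} \<and> U \<noteq> carrier_vec q"
proof (rule ccontr)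
  assume "\<not> ?thesis"
  hence irr: "U = {0\<^sub>v q} \<or> U = carrier_vec q" if "invariant_subspace q B U" for U using that by blast
  have ev: "nc_eval q w B \<in> carrier_mat q q" for w by (rule nc_eval_carrier[OF B])
  have len: "length B = n" by (rule mtuplesD[OF B])
  have mulv: "nc_eval q (NMul w w') B *\<^sub>v x = nc_eval q w B *\<^sub>v (nc_eval q w' B *\<^sub>v x)"
    if "x \<in> carrier_vec q" for w w' x using ev[of w] ev[of w'] that by (simp add: assoc_mult_mat_vec[of _ q q _ q])
  have T1: "\<exists>w. nc_eval q w B *\<^sub>v x = y" if x: "x \<in> carrier_vec q" "x \<noteq> 0\<^sub>v q" and y: "y \<in> carrier_vec q" for x y
  proof -
    let ?U = "range (\<lambda>w. nc_eval q w B *\<^sub>v x)"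
    have "B ! m *\<^sub>v u \<in> ?U" if m: "m < length B" and u: "u \<in> ?U" for m u
    proof -
      obtain w where "u = nc_eval q w B *\<^sub>v x" using u by auto
      hence "B ! m *\<^sub>v u = nc_eval q (NMul (NVar m) w) B *\<^sub>v x" using mulv[OF x(1), of "NVar m" w] m by simp
      thus ?thesis by blast
    qed
    hence "invariant_subspace q B ?U" unfolding invariant_subspace_def using orbit_vec_subspace[OF B x(1)] by blast
    moreover have "x \<in> ?U"
    proof -
      have "x = nc_eval q NOne B *\<^sub>v x" using x by simp
      thus ?thesis by blast
    qed
    ultimately have "?U = carrier_vec q" using irr x(2) by blast
    hence "y \<in> ?U" using y by simp
    thus ?thesis by (auto simp: image_iff)
  qed
  obtain w0 u r where T: "u \<in> carrier_vec q" "r \<in> carrier_vec q" "u \<noteq> 0\<^sub>v q" "r \<noteq> 0\<^sub>v q"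
    "nc_eval q w0 B = mat q q (\<lambda>(i, j). u $ i * r $ j)" using transitive_rank_one[OF B q] T1 by metis
  define R where "R = range (\<lambda>w. vec q (\<lambda>j. \<Sum>i<q. r $ i * nc_eval q w B $$ (i, j)))"
  have Rsub: "vec_subspace q R"
    unfolding vec_subspace_def
  proof (intro conjI allI ballI)
    show "R \<subseteq> carrier_vec q" unfolding R_def by auto
    have "0\<^sub>v q = vec q (\<lambda>j. \<Sum>i<q. r $ i * nc_eval q (NScale 0 NOne) B $$ (i, j))"
      by (intro eq_vecI) (simp_all)
    thus "0\<^sub>v q \<in> R" unfolding R_def by blast
    fix y assume "y \<in> R"
    then obtain w where w: "y = vec q (\<lambda>j. \<Sum>i<q. r $ i * nc_eval q w B $$ (i, j))" unfolding R_def by auto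
    have "c \<cdot>\<^sub>v y = vec q (\<lambda>j. \<Sum>i<q. r $ i * nc_eval q (NScale c w) B $$ (i, j))" for c
    proof (rule eq_vecI, goal_cases)
      case (1 j)
      hence "nc_eval q (NScale c w) B $$ (i, j) = c * nc_eval q w B $$ (i, j)" if "i < q" for i
        using that ev[of w] by simp
      thus ?case using 1 unfolding w by (simp add: sum_distrib_left mult.left_commute)
    qed (simp add: w)
    thus "c \<cdot>\<^sub>v y \<in> R" for c unfolding R_def by blast
    fix z assume "z \<in> R"
    then obtain w' where w': "z = vec q (\<lambda>j. \<Sum>i<q. r $ i * nc_eval q w' B $$ (i, j))" unfolding R_def by auto
    have "y + z = vec q (\<lambda>j. \<Sum>i<q. r $ i * nc_eval q (NAdd w w') B $$ (i, j))"
    proof (rule eq_vecI, goal_cases)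
      case (1 j)
      hence "nc_eval q (NAdd w w') B $$ (i, j) = nc_eval q w B $$ (i, j) + nc_eval q w' B $$ (i, j)" if "i < q" for i
        using that ev[of w] ev[of w'] by simp
      thus ?case using 1 unfolding w w' by (simp add: sum.distrib distrib_left)
    qed (simp add: w w')
    thus "y + z \<in> R" unfolding R_def by blast
  qed
  obtain g J where g: "g \<in> GL q" "J \<subseteq> {..<q}"
    "R = {v \<in> carrier_vec q. \<forall>i<q. i \<notin> J \<longrightarrow> (ginv q g *\<^sub>v v) $ i = 0}"
    using vec_subspace_adapted[OF Rsub] by (elim exE conjE)
  have "J = {..<q}"
  proof (rule ccontr)
    assume "J \<noteq> {..<q}"
    then obtain i where i: "i < q" "i \<notin> J" using g(2) by auto
    note c = GL_D[OF g(1)]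
    \<comment> \<open>If \<open>R\<close> were proper, a row of the inverse with index outside
      \<open>J\<close> would be a nonzero functional vanishing on \<open>R\<close>.\<close>
    define x where "x = row (ginv q g) i"
    have x: "x \<in> carrier_vec q" unfolding x_def using c i by (auto intro: row_carrier_vec)
    have "x \<noteq> 0\<^sub>v q"
    proof
      assume x0: "x = 0\<^sub>v q"
      have "1 = (ginv q g * g) $$ (i, i)" unfolding c(5) using i by simp
      also have "\<dots> = x \<bullet> col g i" unfolding x_def by (rule index_mult_mat(1)) (use c(1,2) i in auto)
      also have "\<dots> = 0" unfolding x0 using c i by (auto intro!: scalar_prod_left_zero col_carrier_vec)
      finally show False by simp
    qed
    \<comment> \<open>The target is the conjugate of \<open>r\<close>, so that pairing it with
      \<open>r\<close> gives a sum of squared moduli, which vanishes only for \<open>r\<close> =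
      0.\<close>
    then obtain w where w: "nc_eval q w B *\<^sub>v x = vec q (\<lambda>i. cnj (r $ i))"
      using T1[OF x _ vec_carrier, of "\<lambda>i. cnj (r $ i)"] by auto
    let ?y = "vec q (\<lambda>j. \<Sum>i<q. r $ i * nc_eval q w B $$ (i, j))"
    have "?y \<in> R" unfolding R_def by blast
    hence "0 = (ginv q g *\<^sub>v ?y) $ i" using g(3) i by auto
    also have "\<dots> = (\<Sum>j<q. x $ j * (\<Sum>k<q. r $ k * nc_eval q w B $$ (k, j)))"
      unfolding x_def using c i by (simp add: mult_mat_vec_entry[of _ q q] del: index_mult_mat_vec)
    also have "\<dots> = (\<Sum>k<q. r $ k * (\<Sum>j<q. nc_eval q w B $$ (k, j) * x $ j))"
      unfolding sum_distrib_left by (subst sum.swap) (simp add: mult_ac)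
    also have "\<dots> = (\<Sum>k<q. r $ k * (nc_eval q w B *\<^sub>v x) $ k)"
      using ev[of w] x by (intro sum.cong) (auto simp: mult_mat_vec_entry[of _ q q] simp del: index_mult_mat_vec)
    also have "\<dots> = (\<Sum>k<q. of_real ((cmod (r $ k))\<^sup>2))" unfolding w
      by (intro sum.cong) (simp_all add: complex_norm_square del: of_real_power)
    finally have "(\<Sum>k<q. (cmod (r $ k))\<^sup>2) = 0" by (metis of_real_0 of_real_eq_iff of_real_sum)
    hence "\<forall>k<q. r $ k = 0" by (simp add: sum_nonneg_eq_0_iff)
    hence "r = 0\<^sub>v q" using T(2) by (intro eq_vecI) auto
    thus False using T(4) by simp
  qed
  hence Rall: "R = carrier_vec q" using g(3) by auto
  have "full_tuple q B"
  proof (rule full_tupleI[OF B])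
    fix a b assume ab: "a < q" "b < q"
    obtain w1 where w1: "nc_eval q w1 B *\<^sub>v u = unit_vec q a" using T1[OF T(1,3), of "unit_vec q a"] by auto
    have "unit_vec q b \<in> R" unfolding Rall by simp
    then obtain w2 where w2: "unit_vec q b = vec q (\<lambda>j. \<Sum>i<q. r $ i * nc_eval q w2 B $$ (i, j))"
      unfolding R_def by auto
    have "nc_eval q (NMul w1 (NMul w0 w2)) B = matrix_unit q q a b"
    proof (rule eq_matI)
      fix i j assume "i < dim_row (matrix_unit q q a b)" "j < dim_col (matrix_unit q q a b)"
      hence ij: "i < q" "j < q" by (auto simp: matrix_unit_def)
      have 2: "(nc_eval q w0 B * nc_eval q w2 B) $$ (k, j) = u $ k * (if j = b then 1 else 0)" if k: "k < q" for k
      proof -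
        have "(nc_eval q w0 B * nc_eval q w2 B) $$ (k, j) = (\<Sum>l<q. u $ k * (r $ l * nc_eval q w2 B $$ (l, j)))"
          unfolding mult_mat_entry[OF ev ev k ij(2)] using k by (intro sum.cong) (auto simp: T(5))
        also have "\<dots> = u $ k * (\<Sum>l<q. r $ l * nc_eval q w2 B $$ (l, j))" by (simp add: sum_distrib_left)
        also have "(\<Sum>l<q. r $ l * nc_eval q w2 B $$ (l, j)) = unit_vec q b $ j" unfolding w2 using ij by simp
        finally show ?thesis using ij ab by simp
      qed
      have "nc_eval q (NMul w1 (NMul w0 w2)) B $$ (i, j) =
        (\<Sum>k<q. nc_eval q w1 B $$ (i, k) * (nc_eval q w0 B * nc_eval q w2 B) $$ (k, j))"
        unfolding nc_eval.simps by (rule mult_mat_entry[OF ev mult_carrier_mat[OF ev ev] ij])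
      also have "\<dots> = (\<Sum>k<q. nc_eval q w1 B $$ (i, k) * u $ k) * (if j = b then 1 else 0)"
        unfolding sum_distrib_right by (intro sum.cong) (auto simp: 2)
      also have "(\<Sum>k<q. nc_eval q w1 B $$ (i, k) * u $ k) = (nc_eval q w1 B *\<^sub>v u) $ i"
        by (rule mult_mat_vec_entry[OF ev T(1) ij(1), symmetric])
      finally show "nc_eval q (NMul w1 (NMul w0 w2)) B $$ (i, j) = matrix_unit q q a b $$ (i, j)"
        unfolding w1 using ij ab by (simp add: matrix_unit_def)
    qed (use nc_eval_carrier[OF B, of "NMul w1 (NMul w0 w2)"] in \<open>auto simp: matrix_unit_def\<close>)
    thus "\<exists>w. nc_eval q w B = matrix_unit q q a b" by blast
  qed
  thus False using nf by simp
qed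

section \<open>Matching irreducible tuples by their traces\<close>

lemma matrix_unit_carrier [simp]: "matrix_unit q q' a b \<in> carrier_mat q q'"
  unfolding matrix_unit_def by simp

lemma matrix_unit_sandwich:
  assumes M: "M \<in> carrier_mat q q'" and ab: "a < q" "b < q'" and ij: "i < s" "j < s'"
  shows "(matrix_unit s q c a * (M * matrix_unit q' s' b d)) $$ (i, j) = (if i = c \<and> j = d then M $$ (a, b) else 0)"
proof -
  have 1: "(M * matrix_unit q' s' b d) $$ (k, j) = (if j = d then M $$ (k, b) else 0)" if k: "k < q" for k
  proof -
    have "(M * matrix_unit q' s' b d) $$ (k, j) = (\<Sum>l<q'. M $$ (k, l) * matrix_unit q' s' b d $$ (l, j))"
      by (rule mult_mat_entry[OF M matrix_unit_carrier k ij(2)])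
    also have "\<dots> = (\<Sum>l<q'. if l = b then (if j = d then M $$ (k, b) else 0) else 0)"
      using ij by (intro sum.cong) (auto simp: matrix_unit_def)
    finally show ?thesis using ab by simp
  qed
  have "(matrix_unit s q c a * (M * matrix_unit q' s' b d)) $$ (i, j) =
    (\<Sum>k<q. matrix_unit s q c a $$ (i, k) * (M * matrix_unit q' s' b d) $$ (k, j))"
    by (rule mult_mat_entry[OF matrix_unit_carrier mult_carrier_mat[OF M matrix_unit_carrier] ij])
  also have "\<dots> = (\<Sum>k<q. if k = a then (if i = c \<and> j = d then M $$ (a, b) else 0) else 0)"
  proof (intro sum.cong refl)
    fix k assume "k \<in> {..<q}"
    hence k: "k < q" by simp
    show "matrix_unit s q c a $$ (i, k) * (M * matrix_unit q' s' b d) $$ (k, j) =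
      (if k = a then (if i = c \<and> j = d then M $$ (a, b) else 0) else 0)"
      unfolding 1[OF k] using k ij by (auto simp: matrix_unit_def)
  qed
  finally show ?thesis using ab by simp
qed

text \<open>The term is chosen before the tuple, so the same linear combination can be evaluated at
  several tuples at once.\<close>

lemma nc_combination:
  assumes "finite D"
  shows "\<exists>w. \<forall>q n G i j. G \<in> mtuples q n \<longrightarrow> i < q \<longrightarrow> j < q \<longrightarrow>
    nc_eval q w G $$ (i, j) = (\<Sum>d\<in>D. x d * nc_eval q (u d) G $$ (i, j))"
  using assms
proof induction
  case empty
  show ?case by (rule exI[of _ "NScale 0 NOne"]) auto
next
  case (insert d D)
  then obtain w where w: "\<And>q n G i j. G \<in> mtuples q n \<Longrightarrow> i < q \<Longrightarrow> j < q \<Longrightarrow>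
    nc_eval q w G $$ (i, j) = (\<Sum>d\<in>D. x d * nc_eval q (u d) G $$ (i, j))" by blast
  show ?case
  proof (intro exI[of _ "NAdd (NScale (x d) (u d)) w"] allI impI)
    fix q n G i j assume G: "G \<in> mtuples q n" and ij: "i < q" "j < q"
    have "nc_eval q (NAdd (NScale (x d) (u d)) w) G $$ (i, j) = x d * nc_eval q (u d) G $$ (i, j) + nc_eval q w G $$ (i, j)"
      using nc_eval_carrier[OF G, of w] nc_eval_carrier[OF G, of "u d"] ij by simp
    thus "nc_eval q (NAdd (NScale (x d) (u d)) w) G $$ (i, j) = (\<Sum>d\<in>insert d D. x d * nc_eval q (u d) G $$ (i, j))"
      unfolding w[OF G ij] using insert.hyps by simp
  qed
qed

text \<open>A full matrix algebra is simple: multiplying \<open>w\<close> by matrix units on both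
  sides moves a nonzero entry to every diagonal place. The result stays in the two-sided ideal of
  \<open>w\<close>, so it vanishes wherever \<open>w\<close> does.\<close>

lemma full_tuple_ideal_one:
  assumes F: "F \<in> mtuples q n" "full_tuple q F" and ne: "nc_eval q w F \<noteq> 0\<^sub>m q q"
  shows "\<exists>w'. nc_eval q w' F = 1\<^sub>m q \<and>
    (\<forall>q' n' G. G \<in> mtuples q' n' \<longrightarrow> nc_eval q' w G = 0\<^sub>m q' q' \<longrightarrow> nc_eval q' w' G = 0\<^sub>m q' q')"
proof -
  have ev: "nc_eval q w F \<in> carrier_mat q q" for w by (rule nc_eval_carrier[OF F(1)])
  obtain a b where ab: "a < q" "b < q" "nc_eval q w F $$ (a, b) \<noteq> 0"
    using ne ev[of w] by (metis carrier_matD eq_matI index_zero_mat)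
  have "\<forall>c. \<exists>l r. nc_eval q l F = matrix_unit q q c a \<and> nc_eval q r F = matrix_unit q q b c"
    using F(2) matrix_unit_carrier unfolding full_tuple_def by blast
  then obtain l r where lr: "\<And>c. nc_eval q (l c) F = matrix_unit q q c a" "\<And>c. nc_eval q (r c) F = matrix_unit q q b c"
    by metis
  define u where "u c = NMul (l c) (NMul w (r c))" for c
  obtain w' where w': "\<And>q' n G i j. G \<in> mtuples q' n \<Longrightarrow> i < q' \<Longrightarrow> j < q' \<Longrightarrow>
    nc_eval q' w' G $$ (i, j) = (\<Sum>c\<in>{..<q}. inverse (nc_eval q w F $$ (a, b)) * nc_eval q' (u c) G $$ (i, j))"
    using nc_combination[OF finite_lessThan[of q], of "\<lambda>_. inverse (nc_eval q w F $$ (a, b))" u] by blast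
  have "nc_eval q w' F = 1\<^sub>m q"
  proof (rule eq_matI)
    fix i j assume "i < dim_row (1\<^sub>m q :: complex mat)" "j < dim_col (1\<^sub>m q :: complex mat)"
    hence ij: "i < q" "j < q" by auto
    have "nc_eval q (u c) F $$ (i, j) = (if i = c \<and> j = c then nc_eval q w F $$ (a, b) else 0)" for c
      unfolding u_def nc_eval.simps lr by (rule matrix_unit_sandwich[OF ev ab(1,2) ij])
    hence "nc_eval q w' F $$ (i, j) = (\<Sum>c<q. if c = i then (if i = j then 1 else 0) else 0)"
      unfolding w'[OF F(1) ij] using ab(3) by (intro sum.cong) auto
    thus "nc_eval q w' F $$ (i, j) = 1\<^sub>m q $$ (i, j)" using ij by simp
  qed (use ev[of w'] in auto)
  moreover have "nc_eval q' w' G = 0\<^sub>m q' q'"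
    if G: "G \<in> mtuples q' n'" and z: "nc_eval q' w G = 0\<^sub>m q' q'" for q' n' G
  proof (rule eq_matI)
    fix i j assume "i < dim_row (0\<^sub>m q' q' :: complex mat)" "j < dim_col (0\<^sub>m q' q' :: complex mat)"
    hence ij: "i < q'" "j < q'" by auto
    have "nc_eval q' (u c) G = 0\<^sub>m q' q'" for c
      unfolding u_def nc_eval.simps z
      using nc_eval_carrier[OF G, of "l c"] nc_eval_carrier[OF G, of "r c"] by simp
    thus "nc_eval q' w' G $$ (i, j) = 0\<^sub>m q' q' $$ (i, j)" unfolding w'[OF G ij] using ij by simp
  qed (use nc_eval_carrier[OF G, of w'] in auto)
  ultimately show ?thesis by blast
qed

definition iso_tuples :: "nat \<Rightarrow> mtuple \<Rightarrow> nat \<Rightarrow> mtuple \<Rightarrow> bool" where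
  "iso_tuples q F q' G \<longleftrightarrow> q' = q \<and> (\<exists>X \<in> GL q. conj_act q X G = F)"

text \<open>Schur's lemma. A nonzero intertwiner between full tuples has a right inverse and a left
  inverse, both assembled from multiples of \<open>X\<close> that are matrix units up to a
  scalar.\<close>

lemma intertwiner_iso:
  assumes F: "F \<in> mtuples q n" "full_tuple q F" and G: "G \<in> mtuples q' n" "full_tuple q' G"
    and q: "q > 0" "q' > 0"
    and X: "X \<in> carrier_mat q q'" "X \<noteq> 0\<^sub>m q q'" "\<And>w. nc_eval q w F * X = X * nc_eval q' w G"
  shows "iso_tuples q F q' G"
proof -
  have ev: "nc_eval q w F \<in> carrier_mat q q" "nc_eval q' w G \<in> carrier_mat q' q'" for w
    by (rule nc_eval_carrier[OF F(1)], rule nc_eval_carrier[OF G(1)])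
  obtain a b where ab: "a < q" "b < q'" "X $$ (a, b) \<noteq> 0"
    using X(1,2) by (metis carrier_matD eq_matI index_zero_mat)
  \<comment> \<open>The sandwich of \<open>X\<close> between two matrix units is a scalar times a
    matrix unit. By the intertwining relation the algebra elements can be collected on either side
    of \<open>X\<close>, which gives \<open>M\<close> and \<open>M'\<close>.\<close>
  have ex: "\<exists>M M'. M \<in> carrier_mat q' q' \<and> M' \<in> carrier_mat q q \<and>
      (\<forall>i<q. \<forall>j<q'. (X * M) $$ (i, j) = (if i = c \<and> j = d then X $$ (a, b) else 0)
        \<and> (M' * X) $$ (i, j) = (if i = c \<and> j = d then X $$ (a, b) else 0))" for c d
  proof -
    obtain w1 w2 where w: "nc_eval q w1 F = matrix_unit q q c a" "nc_eval q' w2 G = matrix_unit q' q' b d"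
      using F(2) G(2) matrix_unit_carrier unfolding full_tuple_def by meson
    have "nc_eval q w1 F * (X * nc_eval q' w2 G) = nc_eval q (NMul w1 w2) F * X"
      unfolding X(3)[symmetric] using ev X(1) by (simp add: assoc_mult_mat[of _ q q _ q _ q'])
    moreover have "\<dots> = X * nc_eval q' (NMul w1 w2) G" by (rule X(3))
    moreover have "(nc_eval q w1 F * (X * nc_eval q' w2 G)) $$ (i, j) = (if i = c \<and> j = d then X $$ (a, b) else 0)"
      if "i < q" "j < q'" for i j
      unfolding w by (rule matrix_unit_sandwich[OF X(1) ab(1,2) that])
    ultimately show ?thesis
      using ev(1)[of "NMul w1 w2"] ev(2)[of "NMul w1 w2"]
      by (intro exI[of _ "nc_eval q' (NMul w1 w2) G"] exI[of _ "nc_eval q (NMul w1 w2) F"]) simp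
  qed
  obtain R where R: "\<And>c. R c \<in> carrier_mat q' q'"
    "\<And>c i j. i < q \<Longrightarrow> j < q' \<Longrightarrow> (X * R c) $$ (i, j) = (if i = c \<and> j = 0 then X $$ (a, b) else 0)"
    using ex[of _ 0] by metis
  obtain L where L: "\<And>d. L d \<in> carrier_mat q q"
    "\<And>d i j. i < q \<Longrightarrow> j < q' \<Longrightarrow> (L d * X) $$ (i, j) = (if i = 0 \<and> j = d then X $$ (a, b) else 0)"
    using ex[of 0] by metis
  define Y where "Y = mat q' q (\<lambda>(i, c). R c $$ (i, 0) / X $$ (a, b))"
  define Z where "Z = mat q' q (\<lambda>(d, i). L d $$ (0, i) / X $$ (a, b))"
  have YZ: "Y \<in> carrier_mat q' q" "Z \<in> carrier_mat q' q" unfolding Y_def Z_def by auto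
  have XY: "X * Y = 1\<^sub>m q"
  proof (rule eq_matI)
    fix i c assume "i < dim_row (1\<^sub>m q :: complex mat)" "c < dim_col (1\<^sub>m q :: complex mat)"
    hence ic: "i < q" "c < q" by auto
    have "(X * Y) $$ (i, c) = (\<Sum>k<q'. X $$ (i, k) * Y $$ (k, c))" by (rule mult_mat_entry[OF X(1) YZ(1) ic])
    also have "\<dots> = (\<Sum>k<q'. X $$ (i, k) * R c $$ (k, 0)) / X $$ (a, b)"
      unfolding sum_divide_distrib using ic by (intro sum.cong) (auto simp: Y_def)
    also have "(\<Sum>k<q'. X $$ (i, k) * R c $$ (k, 0)) = (X * R c) $$ (i, 0)"
      by (rule mult_mat_entry[OF X(1) R(1) ic(1) q(2), symmetric])
    finally show "(X * Y) $$ (i, c) = 1\<^sub>m q $$ (i, c)" unfolding R(2)[OF ic(1) q(2)] using ab ic by simp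
  qed (use X YZ in auto)
  have ZX: "Z * X = 1\<^sub>m q'"
  proof (rule eq_matI)
    fix d j assume "d < dim_row (1\<^sub>m q' :: complex mat)" "j < dim_col (1\<^sub>m q' :: complex mat)"
    hence dj: "d < q'" "j < q'" by auto
    have "(Z * X) $$ (d, j) = (\<Sum>k<q. Z $$ (d, k) * X $$ (k, j))" by (rule mult_mat_entry[OF YZ(2) X(1) dj])
    also have "\<dots> = (\<Sum>k<q. L d $$ (0, k) * X $$ (k, j)) / X $$ (a, b)"
      unfolding sum_divide_distrib using dj by (intro sum.cong) (auto simp: Z_def)
    also have "(\<Sum>k<q. L d $$ (0, k) * X $$ (k, j)) = (L d * X) $$ (0, j)"
      by (rule mult_mat_entry[OF L(1) X(1) q(1) dj(2), symmetric])
    finally show "(Z * X) $$ (d, j) = 1\<^sub>m q' $$ (d, j)" unfolding L(2)[OF q(1) dj(2)] using ab dj by simp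
  qed (use X YZ in auto)
  have "Z = Z * (X * Y)" unfolding XY using YZ by simp
  also have "\<dots> = (Z * X) * Y" by (rule assoc_mult_mat[OF YZ(2) X(1) YZ(1), symmetric])
  also have "\<dots> = Y" unfolding ZX using YZ by simp
  finally have YX: "Y * X = 1\<^sub>m q'" using ZX by simp
  \<comment> \<open>The sizes agree because \<open>X * Y\<close> and \<open>Y * X\<close> are
    identities with the same trace, and the characteristic is 0.\<close>
  have "of_nat q = (\<Sum>i<q. (X * Y) $$ (i, i))" unfolding XY by simp
  also have "\<dots> = (\<Sum>i<q. \<Sum>k<q'. X $$ (i, k) * Y $$ (k, i))"
    using X(1) YZ by (intro sum.cong) (auto simp: mult_mat_entry[of _ q q' _ q] simp del: index_mult_mat(1))
  also have "\<dots> = (\<Sum>k<q'. \<Sum>i<q. Y $$ (k, i) * X $$ (i, k))" by (rule sum_trace_commute)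
  also have "\<dots> = (\<Sum>k<q'. (Y * X) $$ (k, k))"
    using X(1) YZ by (intro sum.cong) (auto simp: mult_mat_entry[of _ q' q _ q'] simp del: index_mult_mat(1))
  also have "\<dots> = (of_nat q' :: complex)" unfolding YX by simp
  finally have qq: "q' = q" by simp
  have Xg: "X \<in> GL q" using GL_I(1)[of X q Y] X(1) YZ(1) XY qq by simp
  have "conj_act q X G = F"
  proof (rule conj_act_eqI[OF Xg])
    show "G \<in> mtuples q n" "F \<in> mtuples q n" using F G qq by auto
    fix m assume "m < n"
    thus "X * G ! m = F ! m * X" using X(3)[of "NVar m"] mtuplesD(1)[OF F(1)] mtuplesD(1)[OF G(1)] by simp
  qed
  thus ?thesis unfolding iso_tuples_def using qq Xg by blast
qed

text \<open>Without a separating element, simplicity puts the kernel of evaluation at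
  \<open>G\<close> inside the kernel of evaluation at \<open>F\<close>. Evaluation at
  \<open>F\<close> then factors through evaluation at \<open>G\<close>, and this algebra
  homomorphism yields a nonzero intertwiner.\<close>

lemma full_tuples_separate:
  assumes F: "F \<in> mtuples q n" "full_tuple q F" and G: "G \<in> mtuples q' n" "full_tuple q' G"
    and q: "q > 0" "q' > 0" and niso: "\<not> iso_tuples q F q' G"
  shows "\<exists>w. nc_eval q w F = 1\<^sub>m q \<and> nc_eval q' w G = 0\<^sub>m q' q'"
proof (rule ccontr)
  assume neg: "\<not> ?thesis"
  have ev: "nc_eval q w F \<in> carrier_mat q q" "nc_eval q' w G \<in> carrier_mat q' q'" for w
    by (rule nc_eval_carrier[OF F(1)], rule nc_eval_carrier[OF G(1)])
  have ker: "nc_eval q w F = 0\<^sub>m q q" if "nc_eval q' w G = 0\<^sub>m q' q'" for w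
    using full_tuple_ideal_one[OF F, of w] neg that G(1) by blast
  have eqF: "nc_eval q w F = nc_eval q w' F" if e: "nc_eval q' w G = nc_eval q' w' G" for w w'
  proof -
    let ?d = "NAdd w (NScale (- 1) w')"
    have "nc_eval q' ?d G = 0\<^sub>m q' q'" using e ev(2)[of w] ev(2)[of w'] by (intro eq_matI) auto
    hence z: "nc_eval q ?d F = 0\<^sub>m q q" by (rule ker)
    show ?thesis
    proof (rule eq_matI)
      fix i j assume "i < dim_row (nc_eval q w' F)" "j < dim_col (nc_eval q w' F)"
      hence ij: "i < q" "j < q" using ev(1)[of w'] by auto
      have "nc_eval q ?d F $$ (i, j) = nc_eval q w F $$ (i, j) - nc_eval q w' F $$ (i, j)"
        using ij ev(1)[of w] ev(1)[of w'] by simp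
      thus "nc_eval q w F $$ (i, j) = nc_eval q w' F $$ (i, j)" unfolding z using ij by simp
    qed (use ev(1)[of w] ev(1)[of w'] in auto)
  qed
  \<comment> \<open>The matrix units of column 0 span a left ideal isomorphic to the module of
    \<open>G\<close>; \<open>s\<close> lifts them to the free algebra.\<close>
  have "\<forall>c. \<exists>s. nc_eval q' s G = matrix_unit q' q' c 0"
    using G(2) matrix_unit_carrier unfolding full_tuple_def by blast
  then obtain s where s: "\<And>c. nc_eval q' (s c) G = matrix_unit q' q' c 0" by metis
  have ms: "(M * matrix_unit q' q' c 0) $$ (i, j) = (if j = 0 then M $$ (i, c) else 0)"
    if M: "M \<in> carrier_mat q' q'" and "c < q'" "i < q'" "j < q'" for M c i j
  proof -
    have "(M * matrix_unit q' q' c 0) $$ (i, j) = (\<Sum>k<q'. M $$ (i, k) * matrix_unit q' q' c 0 $$ (k, j))"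
      by (rule mult_mat_entry[OF M matrix_unit_carrier that(3,4)])
    also have "\<dots> = (\<Sum>k<q'. if k = c then (if j = 0 then M $$ (i, c) else 0) else 0)"
      using that by (intro sum.cong) (auto simp: matrix_unit_def)
    finally show ?thesis using that by simp
  qed
  have "nc_eval q (s 0) F \<noteq> 0\<^sub>m q q"
  proof
    assume z: "nc_eval q (s 0) F = 0\<^sub>m q q"
    have "nc_eval q' (s 0) G $$ (0, 0) = 1" unfolding s using q by (simp add: matrix_unit_def)
    hence "nc_eval q' (s 0) G \<noteq> 0\<^sub>m q' q'" using q by auto
    then obtain w' where w': "nc_eval q' w' G = 1\<^sub>m q'" "nc_eval q w' F = 0\<^sub>m q q"
      using full_tuple_ideal_one[OF G] z F(1) by blast
    have "nc_eval q w' F = nc_eval q NOne F" by (rule eqF) (simp add: w')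
    hence "(0\<^sub>m q q :: complex mat) $$ (0, 0) = 1\<^sub>m q $$ (0, 0)" unfolding w' by simp
    thus False using q by simp
  qed
  then obtain i0 b where b: "i0 < q" "b < q" "nc_eval q (s 0) F $$ (i0, b) \<noteq> 0"
    using ev(1)[of "s 0"] by (metis carrier_matD eq_matI index_zero_mat)
  \<comment> \<open>Following the induced map on this left ideal by the projection to column
    \<open>b\<close> lands in the module of \<open>F\<close>; \<open>b\<close> was chosen so that
    the result is nonzero.\<close>
  define X where "X = mat q q' (\<lambda>(i, c). nc_eval q (s c) F $$ (i, b))"
  have X: "X \<in> carrier_mat q q'" unfolding X_def by simp
  have "X $$ (i0, 0) \<noteq> 0" using b q unfolding X_def by simp
  hence X0: "X \<noteq> 0\<^sub>m q q'" using b q by auto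
  have "nc_eval q w F * X = X * nc_eval q' w G" for w
  proof (rule eq_matI)
    fix i c assume "i < dim_row (X * nc_eval q' w G)" "c < dim_col (X * nc_eval q' w G)"
    hence ic: "i < q" "c < q'" using X ev(2)[of w] by auto
    obtain W where W: "\<And>q n H i j. H \<in> mtuples q n \<Longrightarrow> i < q \<Longrightarrow> j < q \<Longrightarrow>
      nc_eval q W H $$ (i, j) = (\<Sum>d\<in>{..<q'}. nc_eval q' w G $$ (d, c) * nc_eval q (s d) H $$ (i, j))"
      using nc_combination[OF finite_lessThan[of q'], of "\<lambda>d. nc_eval q' w G $$ (d, c)" s] by blast
    have "nc_eval q' (NMul w (s c)) G = nc_eval q' W G"
    proof (rule eq_matI)
      fix k j assume "k < dim_row (nc_eval q' W G)" "j < dim_col (nc_eval q' W G)"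
      hence kj: "k < q'" "j < q'" using ev(2)[of W] by auto
      have "nc_eval q' W G $$ (k, j) = (\<Sum>d<q'. if d = k then (if j = 0 then nc_eval q' w G $$ (k, c) else 0) else 0)"
        unfolding W[OF G(1) kj] s using kj by (intro sum.cong) (auto simp: matrix_unit_def)
      thus "nc_eval q' (NMul w (s c)) G $$ (k, j) = nc_eval q' W G $$ (k, j)"
        unfolding nc_eval.simps s ms[OF ev(2) ic(2) kj] using kj by simp
    qed (use ev(2)[of "NMul w (s c)"] ev(2)[of W] in auto)
    hence e: "nc_eval q (NMul w (s c)) F = nc_eval q W F" by (rule eqF)
    have "(nc_eval q w F * X) $$ (i, c) = (\<Sum>k<q. nc_eval q w F $$ (i, k) * X $$ (k, c))"
      by (rule mult_mat_entry[OF ev(1) X ic])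
    also have "\<dots> = (\<Sum>k<q. nc_eval q w F $$ (i, k) * nc_eval q (s c) F $$ (k, b))"
      using ic by (intro sum.cong) (auto simp: X_def)
    also have "\<dots> = nc_eval q (NMul w (s c)) F $$ (i, b)"
      unfolding nc_eval.simps by (rule mult_mat_entry[OF ev(1) ev(1) ic(1) b(2), symmetric])
    also have "\<dots> = (\<Sum>d<q'. X $$ (i, d) * nc_eval q' w G $$ (d, c))"
      unfolding e W[OF F(1) ic(1) b(2)] using ic by (intro sum.cong) (auto simp: X_def)
    also have "\<dots> = (X * nc_eval q' w G) $$ (i, c)"
      by (rule mult_mat_entry[OF X ev(2) ic, symmetric])
    finally show "(nc_eval q w F * X) $$ (i, c) = (X * nc_eval q' w G) $$ (i, c)" .
  qed (use X ev(1)[of w] ev(2)[of w] in auto)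
  thus False using niso intertwiner_iso[OF F G q X X0] by blast
qed

section \<open>Traces and the matching of irreducible blocks\<close>

definition mtrace :: "nat \<Rightarrow> complex mat \<Rightarrow> complex" where
  "mtrace q M = (\<Sum>a<q. M $$ (a, a))"

lemma mtrace_commute:
  assumes "M \<in> carrier_mat q q'" "N \<in> carrier_mat q' q"
  shows "mtrace q (M * N) = mtrace q' (N * M)"
proof -
  have "mtrace q (M * N) = (\<Sum>a<q. \<Sum>b<q'. M $$ (a, b) * N $$ (b, a))"
    unfolding mtrace_def by (intro sum.cong refl mult_mat_entry[OF assms]) auto
  also have "\<dots> = (\<Sum>b<q'. \<Sum>a<q. N $$ (b, a) * M $$ (a, b))" by (rule sum_trace_commute)
  also have "\<dots> = mtrace q' (N * M)"
    unfolding mtrace_def by (intro sum.cong refl mult_mat_entry[OF assms(2,1), symmetric]) auto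
  finally show ?thesis .
qed

lemma mtrace_conj:
  assumes g: "g \<in> GL q" and M: "M \<in> carrier_mat q q"
  shows "mtrace q (g * M * ginv q g) = mtrace q M"
proof -
  note c = GL_D[OF g]
  have "mtrace q (g * M * ginv q g) = mtrace q (ginv q g * (g * M))"
    by (rule mtrace_commute[OF mult_carrier_mat[OF c(1) M] c(2)])
  also have "ginv q g * (g * M) = (ginv q g * g) * M" by (rule assoc_mult_mat[OF c(2,1) M, symmetric])
  also have "\<dots> = M" unfolding c(5) using M by simp
  finally show ?thesis .
qed

lemma iso_tuples_mtrace:
  assumes "iso_tuples q F q' G" "G \<in> mtuples q' n"
  shows "mtrace q (nc_eval q w F) = mtrace q' (nc_eval q' w G)"
proof -
  obtain X where X: "q' = q" "X \<in> GL q" "conj_act q X G = F" using assms unfolding iso_tuples_def by blast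
  have "G \<in> mtuples q n" using assms(2) X(1) by simp
  thus ?thesis unfolding X(1) X(3)[symmetric]
    using nc_eval_conj[OF X(2), of G n w] mtrace_conj[OF X(2) nc_eval_carrier, of G n w] by simp
qed

definition irreducible_family :: "nat \<Rightarrow> 'k set \<Rightarrow> ('k \<Rightarrow> nat) \<Rightarrow> ('k \<Rightarrow> mtuple) \<Rightarrow> bool" where
  "irreducible_family n K c F \<longleftrightarrow> finite K \<and> (\<forall>k\<in>K. 0 < c k \<and> F k \<in> mtuples (c k) n \<and> full_tuple (c k) (F k))"

text \<open>The separating elements for the single members are multiplied: identities at
  \<open>F\<close> multiply to the identity, and one zero factor suffices at each member.\<close>

lemma separate_family:
  assumes F: "F \<in> mtuples q n" "full_tuple q F" "q > 0" and K: "irreducible_family n K c G"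
    and niso: "\<And>k. k \<in> K \<Longrightarrow> \<not> iso_tuples q F (c k) (G k)"
  shows "\<exists>w. nc_eval q w F = 1\<^sub>m q \<and> (\<forall>k\<in>K. nc_eval (c k) w (G k) = 0\<^sub>m (c k) (c k))"
proof -
  have "finite K" using K unfolding irreducible_family_def by simp
  thus ?thesis using K niso
  proof (induction K)
    case empty
    show ?case by (rule exI[of _ NOne]) simp
  next
    case (insert k K)
    have Kf: "irreducible_family n K c G" using insert.prems(1) unfolding irreducible_family_def by auto
    obtain w where w: "nc_eval q w F = 1\<^sub>m q" "\<And>k. k \<in> K \<Longrightarrow> nc_eval (c k) w (G k) = 0\<^sub>m (c k) (c k)"
      using insert.IH[OF Kf] insert.prems(2) by blast
    have k: "0 < c k" "G k \<in> mtuples (c k) n" "full_tuple (c k) (G k)"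
      using insert.prems(1) unfolding irreducible_family_def by auto
    obtain w' where w': "nc_eval q w' F = 1\<^sub>m q" "nc_eval (c k) w' (G k) = 0\<^sub>m (c k) (c k)"
      using full_tuples_separate[OF F(1,2) k(2,3) F(3) k(1)] insert.prems(2)[of k] by blast
    have "nc_eval (c x) (NMul w w') (G x) = 0\<^sub>m (c x) (c x)" if x: "x \<in> insert k K" for x
    proof -
      have "G x \<in> mtuples (c x) n" using insert.prems(1) x unfolding irreducible_family_def by auto
      note e = nc_eval_carrier[OF this, of w] nc_eval_carrier[OF this, of w']
      show ?thesis
      proof (cases "x = k")
        case True
        thus ?thesis using w'(2) e by simp
      next
        case False
        thus ?thesis using w(2)[of x] x e by simp
      qed
    qed
    moreover have "nc_eval q (NMul w w') F = 1\<^sub>m q" using w w' by simp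
    ultimately show ?case by blast
  qed
qed

text \<open>Separate \<open>F k0\<close> from everything not isomorphic to it. If nothing on the
  other side were isomorphic to it, the separating element would have trace 0 there, but on this
  side its trace is \<open>c k0\<close> times the positive number of members isomorphic to
  \<open>F k0\<close>. A matched pair is removed and induction applies.\<close>

lemma match_families:
  assumes "irreducible_family n K c F" "irreducible_family n K' c' F'"
    and "\<And>w. (\<Sum>k\<in>K. mtrace (c k) (nc_eval (c k) w (F k))) = (\<Sum>k\<in>K'. mtrace (c' k) (nc_eval (c' k) w (F' k)))"
  shows "\<exists>\<tau>. bij_betw \<tau> K K' \<and> (\<forall>k\<in>K. iso_tuples (c k) (F k) (c' (\<tau> k)) (F' (\<tau> k)))"
proof -
  have "finite K" using assms(1) unfolding irreducible_family_def by simp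
  thus ?thesis using assms
  proof (induction K arbitrary: K')
    case empty
    have "(\<Sum>k\<in>K'. of_nat (c' k)) = (0 :: complex)"
      using empty.prems(3)[of NOne] by (simp add: mtrace_def)
    hence "(\<Sum>k\<in>K'. c' k) = 0" by (metis of_nat_eq_0_iff of_nat_sum)
    hence "K' = {}" using empty.prems(2) unfolding irreducible_family_def by auto
    thus ?case by (auto simp: bij_betw_def)
  next
    case (insert k0 K)
    have k0: "0 < c k0" "F k0 \<in> mtuples (c k0) n" "full_tuple (c k0) (F k0)"
      and Kf: "irreducible_family n K c F"
      using insert.prems(1) unfolding irreducible_family_def by auto
    have "\<exists>j\<in>K'. iso_tuples (c k0) (F k0) (c' j) (F' j)"
    proof (rule ccontr)
      assume neg: "\<not> ?thesis"
      define S where "S = {k \<in> insert k0 K. \<not> iso_tuples (c k0) (F k0) (c k) (F k)}"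
      \<comment> \<open>One family indexed by a sum type, so that a single element vanishes on the
        nonisomorphic members of this side and on the entire other side.\<close>
      define c2 where "c2 = case_sum c c'"
      define F2 where "F2 = case_sum F F'"
      have fam: "irreducible_family n (Inl ` S \<union> Inr ` K') c2 F2"
        using insert.prems(1,2) unfolding irreducible_family_def S_def c2_def F2_def by auto
      have nis: "\<not> iso_tuples (c k0) (F k0) (c2 k) (F2 k)" if "k \<in> Inl ` S \<union> Inr ` K'" for k
        using that neg unfolding S_def c2_def F2_def by auto
      have "\<exists>w. nc_eval (c k0) w (F k0) = 1\<^sub>m (c k0) \<and>
        (\<forall>k\<in>Inl ` S \<union> Inr ` K'. nc_eval (c2 k) w (F2 k) = 0\<^sub>m (c2 k) (c2 k))"
        by (rule separate_family[OF k0(2,3,1) fam nis])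
      then obtain w where w: "nc_eval (c k0) w (F k0) = 1\<^sub>m (c k0)"
        and w2: "\<forall>k\<in>Inl ` S \<union> Inr ` K'. nc_eval (c2 k) w (F2 k) = 0\<^sub>m (c2 k) (c2 k)" by (elim exE conjE)
      have wS: "nc_eval (c k) w (F k) = 0\<^sub>m (c k) (c k)" if "k \<in> S" for k
        using bspec[OF w2, of "Inl k"] that unfolding c2_def F2_def by simp
      have wK': "nc_eval (c' k) w (F' k) = 0\<^sub>m (c' k) (c' k)" if "k \<in> K'" for k
        using bspec[OF w2, of "Inr k"] that unfolding c2_def F2_def by simp
      have t: "mtrace (c k) (nc_eval (c k) w (F k)) = of_nat (if k \<in> S then 0 else c k0)"
        if k: "k \<in> insert k0 K" for k
      proof (cases "k \<in> S")
        case True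
        thus ?thesis using wS by (simp add: mtrace_def)
      next
        case False
        hence "iso_tuples (c k0) (F k0) (c k) (F k)" using k unfolding S_def by auto
        moreover have "F k \<in> mtuples (c k) n" using insert.prems(1) k unfolding irreducible_family_def by auto
        ultimately have "mtrace (c k0) (nc_eval (c k0) w (F k0)) = mtrace (c k) (nc_eval (c k) w (F k))"
          by (rule iso_tuples_mtrace)
        hence "mtrace (c k) (nc_eval (c k) w (F k)) = mtrace (c k0) (1\<^sub>m (c k0))" unfolding w by simp
        thus ?thesis using False by (simp add: mtrace_def)
      qed
      have "(\<Sum>k\<in>insert k0 K. of_nat (if k \<in> S then 0 else c k0)) = (\<Sum>k\<in>insert k0 K. mtrace (c k) (nc_eval (c k) w (F k)))"
        by (intro sum.cong refl t[symmetric])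
      also have "\<dots> = (0 :: complex)" unfolding insert.prems(3)
        by (intro sum.neutral ballI) (simp add: wK' mtrace_def)
      finally have "(\<Sum>k\<in>insert k0 K. if k \<in> S then 0 else c k0) = 0" by (metis of_nat_eq_0_iff of_nat_sum)
      hence "(if k0 \<in> S then 0 else c k0) = 0" using insert.hyps(1) by simp
      moreover have "k0 \<notin> S"
      proof -
        have "conj_act (c k0) (1\<^sub>m (c k0)) (F k0) = F k0" by (rule conj_act_one[OF k0(2)])
        thus ?thesis unfolding S_def iso_tuples_def using GL_one(1) by blast
      qed
      ultimately show False using k0(1) by simp
    qed
    then obtain j where j: "j \<in> K'" "iso_tuples (c k0) (F k0) (c' j) (F' j)" by blast
    have fin': "finite K'" using insert.prems(2) unfolding irreducible_family_def by simp
    have Kf': "irreducible_family n (K' - {j}) c' F'" using insert.prems(2) unfolding irreducible_family_def by auto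
    have jt: "F' j \<in> mtuples (c' j) n" using insert.prems(2) j unfolding irreducible_family_def by auto
    have "(\<Sum>k\<in>K. mtrace (c k) (nc_eval (c k) w (F k))) = (\<Sum>k\<in>K' - {j}. mtrace (c' k) (nc_eval (c' k) w (F' k)))" for w
    proof -
      have "mtrace (c k0) (nc_eval (c k0) w (F k0)) + (\<Sum>k\<in>K. mtrace (c k) (nc_eval (c k) w (F k)))
        = mtrace (c' j) (nc_eval (c' j) w (F' j)) + (\<Sum>k\<in>K' - {j}. mtrace (c' k) (nc_eval (c' k) w (F' k)))"
        using insert.prems(3)[of w] insert.hyps sum.remove[OF fin' j(1), of "\<lambda>k. mtrace (c' k) (nc_eval (c' k) w (F' k))"]
        by simp
      thus ?thesis using iso_tuples_mtrace[OF j(2) jt] by simp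
    qed
    then obtain \<tau> where \<tau>: "bij_betw \<tau> K (K' - {j})" "\<And>k. k \<in> K \<Longrightarrow> iso_tuples (c k) (F k) (c' (\<tau> k)) (F' (\<tau> k))"
      using insert.IH[OF Kf Kf'] by blast
    have "bij_betw (\<tau>(k0 := j)) K (K' - {j})"
      by (rule iffD1[OF bij_betw_cong \<tau>(1)]) (use insert.hyps in auto)
    hence "bij_betw (\<tau>(k0 := j)) (insert k0 K) (insert j (K' - {j}))"
      using notIn_Un_bij_betw[of k0 K "\<tau>(k0 := j)" "K' - {j}"] insert.hyps(2) by simp
    hence "bij_betw (\<tau>(k0 := j)) (insert k0 K) K'" using j(1) by (simp add: insert_absorb)
    moreover have "\<forall>k\<in>insert k0 K. iso_tuples (c k) (F k) (c' ((\<tau>(k0 := j)) k)) (F' ((\<tau>(k0 := j)) k))"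
      using \<tau>(2) j(2) by auto
    ultimately show ?case by blast
  qed
qed

section \<open>Triangular form with irreducible diagonal blocks\<close>

definition level_tri :: "nat \<Rightarrow> (nat \<Rightarrow> nat) \<Rightarrow> complex mat \<Rightarrow> bool" where
  "level_tri p \<gamma> M \<longleftrightarrow> (\<forall>a<p. \<forall>b<p. \<gamma> b < \<gamma> a \<longrightarrow> M $$ (a, b) = 0)"

text \<open>The diagonal block on the fibre over \<open>l\<close>, which has size \<open>c l\<close>
  and is enumerated by \<open>e l\<close>; fibres need not be intervals.\<close>

definition fibre_mat :: "(nat \<Rightarrow> nat) \<Rightarrow> (nat \<Rightarrow> nat \<Rightarrow> nat) \<Rightarrow> nat \<Rightarrow> complex mat \<Rightarrow> complex mat" where
  "fibre_mat c e l M = mat (c l) (c l) (\<lambda>(r, s). M $$ (e l r, e l s))"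

definition fibre_tuple :: "(nat \<Rightarrow> nat) \<Rightarrow> (nat \<Rightarrow> nat \<Rightarrow> nat) \<Rightarrow> nat \<Rightarrow> mtuple \<Rightarrow> mtuple" where
  "fibre_tuple c e l A = map (fibre_mat c e l) A"

lemma fibre_mat_carrier [simp]: "fibre_mat c e l M \<in> carrier_mat (c l) (c l)"
  unfolding fibre_mat_def by simp

lemma fibre_mat_dim [simp]: "dim_row (fibre_mat c e l M) = c l" "dim_col (fibre_mat c e l M) = c l"
  unfolding fibre_mat_def by auto

lemma fibre_mat_entry [simp]: "r < c l \<Longrightarrow> s < c l \<Longrightarrow> fibre_mat c e l M $$ (r, s) = M $$ (e l r, e l s)"
  unfolding fibre_mat_def by simp

lemma fibre_tuple_mtuples: "A \<in> mtuples p n \<Longrightarrow> fibre_tuple c e l A \<in> mtuples (c l) n"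
  unfolding fibre_tuple_def by (rule mtuplesI) (simp_all add: mtuplesD(1))

lemma fibre_tuple_nth: "m < length A \<Longrightarrow> fibre_tuple c e l A ! m = fibre_mat c e l (A ! m)"
  unfolding fibre_tuple_def by simp

text \<open>
  The level function \<open>\<gamma>\<close> only supplies the order in which the fibres of \<open>\<alpha>\<close> are arranged.
\<close>

locale fibre_blocks =
  fixes p :: nat and \<alpha> \<gamma> :: "nat \<Rightarrow> nat" and c :: "nat \<Rightarrow> nat" and e :: "nat \<Rightarrow> nat \<Rightarrow> nat"
  assumes enum: "\<And>l. bij_betw (e l) {..<c l} {a. a < p \<and> \<alpha> a = l}"
    and same: "same_fibres p \<alpha> \<gamma>"
begin

lemma enum_in:
  assumes "r < c l" shows "e l r < p" "\<alpha> (e l r) = l"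
  using bij_betwE[OF enum[of l]] assms by auto

lemma enum_ex:
  assumes "a < p" obtains r where "r < c (\<alpha> a)" "e (\<alpha> a) r = a"
proof -
  have "a \<in> e (\<alpha> a) ` {..<c (\<alpha> a)}" using bij_betw_imp_surj_on[OF enum[of "\<alpha> a"]] assms by auto
  thus thesis using that by auto
qed

lemma enum_inj: "r < c l \<Longrightarrow> s < c l \<Longrightarrow> e l r = e l s \<longleftrightarrow> r = s"
  using bij_betw_imp_inj_on[OF enum[of l]] by (auto dest: inj_onD)

lemma fibre_sum:
  fixes f :: "nat \<Rightarrow> complex"
  shows "(\<Sum>a | a < p \<and> \<alpha> a = l. f a) = (\<Sum>r<c l. f (e l r))"
  by (rule sum.reindex_bij_betw[OF enum, symmetric])

lemma sum_over_fibres: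
  fixes f :: "nat \<Rightarrow> complex"
  shows "(\<Sum>a<p. f a) = (\<Sum>l\<in>\<alpha> ` {..<p}. \<Sum>r<c l. f (e l r))"
proof -
  have "(\<Sum>a<p. f a) = (\<Sum>l\<in>\<alpha> ` {..<p}. \<Sum>a\<in>{a \<in> {..<p}. \<alpha> a = l}. f a)"
    by (rule sum.image_gen) simp
  also have "\<dots> = (\<Sum>l\<in>\<alpha> ` {..<p}. \<Sum>r<c l. f (e l r))"
    by (simp add: fibre_sum)
  finally show ?thesis .
qed

text \<open>An intermediate index whose level differs from that of the block makes one of the two
  factors vanish.\<close>

lemma mult_level_tri:
  assumes M: "M \<in> carrier_mat p p" "level_tri p \<gamma> M" and N: "N \<in> carrier_mat p p" "level_tri p \<gamma> N"
  shows "level_tri p \<gamma> (M * N)" "fibre_mat c e l (M * N) = fibre_mat c e l M * fibre_mat c e l N"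
proof -
  show "level_tri p \<gamma> (M * N)" unfolding level_tri_def
  proof (intro allI impI)
    fix a b assume ab: "a < p" "b < p" "\<gamma> b < \<gamma> a"
    have "M $$ (a, k) * N $$ (k, b) = 0" if "k < p" for k
    proof (cases "\<gamma> k < \<gamma> a")
      case True
      thus ?thesis using M(2) ab that unfolding level_tri_def by auto
    next
      case False
      hence "\<gamma> b < \<gamma> k" using ab by simp
      thus ?thesis using N(2) ab that unfolding level_tri_def by auto
    qed
    thus "(M * N) $$ (a, b) = 0" unfolding mult_mat_entry[OF M(1) N(1) ab(1,2)] by (intro sum.neutral) auto
  qed
  show "fibre_mat c e l (M * N) = fibre_mat c e l M * fibre_mat c e l N"
  proof (rule eq_matI)
    fix r s assume "r < dim_row (fibre_mat c e l M * fibre_mat c e l N)" "s < dim_col (fibre_mat c e l M * fibre_mat c e l N)"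
    hence rs: "r < c l" "s < c l" by auto
    note R = enum_in[OF rs(1)] and S = enum_in[OF rs(2)]
    have "fibre_mat c e l (M * N) $$ (r, s) = (\<Sum>k<p. M $$ (e l r, k) * N $$ (k, e l s))"
      using rs mult_mat_entry[OF M(1) N(1) R(1) S(1)] by simp
    also have "\<dots> = (\<Sum>k | k < p \<and> \<alpha> k = l. M $$ (e l r, k) * N $$ (k, e l s))"
    proof (rule sum.mono_neutral_right)
      show "\<forall>k\<in>{..<p} - {k. k < p \<and> \<alpha> k = l}. M $$ (e l r, k) * N $$ (k, e l s) = 0"
      proof
        fix k assume "k \<in> {..<p} - {k. k < p \<and> \<alpha> k = l}"
        hence k: "k < p" "\<alpha> k \<noteq> l" by auto
        have ne: "\<gamma> k \<noteq> \<gamma> (e l r)" "\<gamma> (e l r) = \<gamma> (e l s)"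
          using same[unfolded same_fibres_def, rule_format, OF k(1) R(1)]
            same[unfolded same_fibres_def, rule_format, OF R(1) S(1)] k R S by auto
        show "M $$ (e l r, k) * N $$ (k, e l s) = 0"
        proof (cases "\<gamma> k < \<gamma> (e l r)")
          case True
          thus ?thesis using M(2) k R unfolding level_tri_def by simp
        next
          case False
          hence "\<gamma> (e l s) < \<gamma> k" using ne by simp
          thus ?thesis using N(2) k S unfolding level_tri_def by simp
        qed
      qed
    qed auto
    also have "\<dots> = (\<Sum>q<c l. M $$ (e l r, e l q) * N $$ (e l q, e l s))" by (rule fibre_sum)
    also have "\<dots> = (fibre_mat c e l M * fibre_mat c e l N) $$ (r, s)"
      unfolding mult_mat_entry[OF fibre_mat_carrier[of c e l M] fibre_mat_carrier[of c e l N] rs] using rs by simp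
    finally show "fibre_mat c e l (M * N) $$ (r, s) = (fibre_mat c e l M * fibre_mat c e l N) $$ (r, s)" .
  qed auto
qed

lemma nc_eval_fibre:
  assumes A: "A \<in> mtuples p n" and tri: "\<And>m. m < n \<Longrightarrow> level_tri p \<gamma> (A ! m)"
  shows "level_tri p \<gamma> (nc_eval p w A)" "fibre_mat c e l (nc_eval p w A) = nc_eval (c l) w (fibre_tuple c e l A)"
proof (induction w)
  case NOne
  show "level_tri p \<gamma> (nc_eval p NOne A)" by (auto simp: level_tri_def)
  show "fibre_mat c e l (nc_eval p NOne A) = nc_eval (c l) NOne (fibre_tuple c e l A)"
    by (rule eq_matI) (auto simp: enum_in enum_inj)
next
  case (NVar m)
  have len: "length A = n" by (rule mtuplesD[OF A])
  show "level_tri p \<gamma> (nc_eval p (NVar m) A)" using tri len by (auto simp: level_tri_def)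
  show "fibre_mat c e l (nc_eval p (NVar m) A) = nc_eval (c l) (NVar m) (fibre_tuple c e l A)"
    by (rule eq_matI) (auto simp: fibre_tuple_def enum_in)
next
  case (NAdd u v)
  note ev = nc_eval_carrier[OF A, of u] nc_eval_carrier[OF A, of v]
  show "level_tri p \<gamma> (nc_eval p (NAdd u v) A)" using NAdd ev by (auto simp: level_tri_def)
  have "fibre_mat c e l (nc_eval p u A + nc_eval p v A) = fibre_mat c e l (nc_eval p u A) + fibre_mat c e l (nc_eval p v A)"
    using ev by (intro eq_matI) (auto simp: enum_in)
  thus "fibre_mat c e l (nc_eval p (NAdd u v) A) = nc_eval (c l) (NAdd u v) (fibre_tuple c e l A)"
    using NAdd by simp
next
  case (NMul u v)
  note ev = nc_eval_carrier[OF A, of u] nc_eval_carrier[OF A, of v]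
  show "level_tri p \<gamma> (nc_eval p (NMul u v) A)" using mult_level_tri(1)[OF ev(1) _ ev(2)] NMul by simp
  show "fibre_mat c e l (nc_eval p (NMul u v) A) = nc_eval (c l) (NMul u v) (fibre_tuple c e l A)"
    using mult_level_tri(2)[OF ev(1) _ ev(2)] NMul by simp
next
  case (NScale x u)
  note ev = nc_eval_carrier[OF A, of u]
  show "level_tri p \<gamma> (nc_eval p (NScale x u) A)" using NScale ev by (auto simp: level_tri_def)
  have "fibre_mat c e l (x \<cdot>\<^sub>m nc_eval p u A) = x \<cdot>\<^sub>m fibre_mat c e l (nc_eval p u A)"
    using ev by (intro eq_matI) (auto simp: enum_in)
  thus "fibre_mat c e l (nc_eval p (NScale x u) A) = nc_eval (c l) (NScale x u) (fibre_tuple c e l A)"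
    using NScale by simp
qed

definition block_diagonal :: "(nat \<Rightarrow> complex mat) \<Rightarrow> complex mat" where
  "block_diagonal H = mat p p (\<lambda>(a, b). if \<alpha> a = \<alpha> b then
     H (\<alpha> a) $$ (inv_into {..<c (\<alpha> a)} (e (\<alpha> a)) a, inv_into {..<c (\<alpha> a)} (e (\<alpha> a)) b) else 0)"

lemma block_diagonal_carrier: "block_diagonal H \<in> carrier_mat p p"
  unfolding block_diagonal_def by simp

lemma block_diagonal_entry:
  assumes "r < c l" "s < c l" shows "block_diagonal H $$ (e l r, e l s) = H l $$ (r, s)"
proof -
  have "inv_into {..<c l} (e l) (e l x) = x" if "x < c l" for x
    using bij_betw_imp_inj_on[OF enum[of l]] that by (intro inv_into_f_f) auto
  thus ?thesis unfolding block_diagonal_def using enum_in[OF assms(1)] enum_in[OF assms(2)] assms by simp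
qed

lemma block_diagonal_off: "a < p \<Longrightarrow> b < p \<Longrightarrow> \<alpha> a \<noteq> \<alpha> b \<Longrightarrow> block_diagonal H $$ (a, b) = 0"
  unfolding block_diagonal_def by simp

lemma block_diagonal_tri: "level_tri p \<gamma> (block_diagonal H)"
  unfolding level_tri_def
proof (intro allI impI)
  fix a b assume ab: "a < p" "b < p" "\<gamma> b < \<gamma> a"
  hence "\<alpha> a \<noteq> \<alpha> b" using same unfolding same_fibres_def by auto
  thus "block_diagonal H $$ (a, b) = 0" using ab block_diagonal_off by simp
qed

lemma fibre_mat_block_diagonal: "H l \<in> carrier_mat (c l) (c l) \<Longrightarrow> fibre_mat c e l (block_diagonal H) = H l"
  by (rule eq_matI) (auto simp: block_diagonal_entry)

lemma block_diagonal_mult: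
  assumes H: "\<And>l. H l \<in> carrier_mat (c l) (c l)" and K: "\<And>l. K l \<in> carrier_mat (c l) (c l)"
  shows "block_diagonal H * block_diagonal K = block_diagonal (\<lambda>l. H l * K l)"
proof (rule eq_matI)
  fix a b assume "a < dim_row (block_diagonal (\<lambda>l. H l * K l))" "b < dim_col (block_diagonal (\<lambda>l. H l * K l))"
  hence ab: "a < p" "b < p" unfolding block_diagonal_def by auto
  show "(block_diagonal H * block_diagonal K) $$ (a, b) = block_diagonal (\<lambda>l. H l * K l) $$ (a, b)"
  proof (cases "\<alpha> a = \<alpha> b")
    case True
    obtain r s where r: "r < c (\<alpha> a)" "e (\<alpha> a) r = a" and s: "s < c (\<alpha> a)" "e (\<alpha> a) s = b"
      using enum_ex[OF ab(1)] enum_ex[OF ab(2)] True by metis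
    have "fibre_mat c e (\<alpha> a) (block_diagonal H * block_diagonal K) = H (\<alpha> a) * K (\<alpha> a)"
      using mult_level_tri(2)[OF block_diagonal_carrier block_diagonal_tri block_diagonal_carrier block_diagonal_tri]
        fibre_mat_block_diagonal H K by simp
    hence "(block_diagonal H * block_diagonal K) $$ (a, b) = (H (\<alpha> a) * K (\<alpha> a)) $$ (r, s)"
      using fibre_mat_entry[of r c "\<alpha> a" s e "block_diagonal H * block_diagonal K"] r s by simp
    also have "\<dots> = block_diagonal (\<lambda>l. H l * K l) $$ (a, b)"
      using block_diagonal_entry[of r "\<alpha> a" s "\<lambda>l. H l * K l"] r s by simp
    finally show ?thesis .
  next
    case False
    have "block_diagonal H $$ (a, k) * block_diagonal K $$ (k, b) = 0" if "k < p" for k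
      using False ab that block_diagonal_off by (cases "\<alpha> a = \<alpha> k") auto
    thus ?thesis unfolding mult_mat_entry[OF block_diagonal_carrier block_diagonal_carrier ab]
      using block_diagonal_off[OF ab False] by (simp add: sum.neutral)
  qed
qed (auto simp: block_diagonal_def)

lemma block_diagonal_one: "block_diagonal (\<lambda>l. 1\<^sub>m (c l)) = 1\<^sub>m p"
proof (rule eq_matI)
  fix a b assume "a < dim_row (1\<^sub>m p :: complex mat)" "b < dim_col (1\<^sub>m p :: complex mat)"
  hence ab: "a < p" "b < p" by auto
  show "block_diagonal (\<lambda>l. 1\<^sub>m (c l)) $$ (a, b) = 1\<^sub>m p $$ (a, b)"
  proof (cases "\<alpha> a = \<alpha> b")
    case True
    obtain r s where r: "r < c (\<alpha> a)" "e (\<alpha> a) r = a" and s: "s < c (\<alpha> a)" "e (\<alpha> a) s = b"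
      using enum_ex[OF ab(1)] enum_ex[OF ab(2)] True by metis
    have "block_diagonal (\<lambda>l. 1\<^sub>m (c l)) $$ (e (\<alpha> a) r, e (\<alpha> a) s) = 1\<^sub>m (c (\<alpha> a)) $$ (r, s)"
      by (rule block_diagonal_entry[OF r(1) s(1)])
    also have "\<dots> = (if e (\<alpha> a) r = e (\<alpha> a) s then 1 else 0)" using r(1) s(1) enum_inj[OF r(1) s(1)] by simp
    finally show ?thesis unfolding r(2) s(2) using ab by simp
  next
    case False
    thus ?thesis using block_diagonal_off[OF ab False] ab by auto
  qed
qed (auto simp: block_diagonal_def)

lemma block_diagonal_GL:
  assumes "\<And>l. H l \<in> GL (c l)"
  shows "block_diagonal H \<in> GL p" "ginv p (block_diagonal H) = block_diagonal (\<lambda>l. ginv (c l) (H l))"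
proof -
  note h = GL_D[OF assms]
  have "block_diagonal H * block_diagonal (\<lambda>l. ginv (c l) (H l)) = 1\<^sub>m p"
    unfolding block_diagonal_mult[of H "\<lambda>l. ginv (c l) (H l)", OF h(1,2)] h(4) by (rule block_diagonal_one)
  thus "block_diagonal H \<in> GL p" "ginv p (block_diagonal H) = block_diagonal (\<lambda>l. ginv (c l) (H l))"
    using GL_I[OF block_diagonal_carrier block_diagonal_carrier] by auto
qed

lemma conj_block_diagonal:
  assumes H: "\<And>l. H l \<in> GL (c l)"
    and A: "A \<in> mtuples p n" and tri: "\<And>m. m < n \<Longrightarrow> level_tri p \<gamma> (A ! m)"
  shows "m < n \<Longrightarrow> level_tri p \<gamma> (conj_act p (block_diagonal H) A ! m)"
    "fibre_tuple c e l (conj_act p (block_diagonal H) A) = conj_act (c l) (H l) (fibre_tuple c e l A)"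
proof -
  let ?G = "block_diagonal H" and ?G' = "block_diagonal (\<lambda>l. ginv (c l) (H l))"
  have len: "length A = n" by (rule mtuplesD[OF A])
  note c = block_diagonal_carrier and t = block_diagonal_tri
  have eq: "conj_act p ?G A ! m = ?G * A ! m * ?G'" if "m < n" for m
    using that len by (simp add: conj_act_nth block_diagonal_GL(2)[of H, OF H])
  have 1: "level_tri p \<gamma> (?G * A ! m)" "fibre_mat c e l (?G * A ! m) = H l * fibre_mat c e l (A ! m)" if m: "m < n" for m
    using mult_level_tri[OF c t mtuplesD(2)[OF A m] tri[OF m]] fibre_mat_block_diagonal[of H l, OF GL_D(1)[OF H]] by auto
  have 2: "?G * A ! m \<in> carrier_mat p p" if m: "m < n" for m
    by (rule mult_carrier_mat[OF c mtuplesD(2)[OF A m]])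
  show "level_tri p \<gamma> (conj_act p ?G A ! m)" if m: "m < n" for m
    unfolding eq[OF m] by (rule mult_level_tri(1)[OF 2[OF m] 1(1)[OF m] c t])
  show "fibre_tuple c e l (conj_act p ?G A) = conj_act (c l) (H l) (fibre_tuple c e l A)"
  proof (rule nth_equalityI)
    fix m assume "m < length (fibre_tuple c e l (conj_act p ?G A))"
    hence m: "m < n" "m < length A" using len by (auto simp: fibre_tuple_def)
    have "fibre_mat c e l (conj_act p ?G A ! m) = H l * fibre_mat c e l (A ! m) * ginv (c l) (H l)"
      unfolding eq[OF m(1)] mult_level_tri(2)[OF 2[OF m(1)] 1(1)[OF m(1)] c t] 1(2)[OF m(1)]
      using fibre_mat_block_diagonal[of "\<lambda>l. ginv (c l) (H l)" l, OF GL_D(2)[OF H]] by simp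
    thus "fibre_tuple c e l (conj_act p ?G A) ! m = conj_act (c l) (H l) (fibre_tuple c e l A) ! m"
      using m by (simp add: fibre_tuple_def conj_act_nth)
  qed (simp add: fibre_tuple_def)
qed

end

lemma enumeration_exists:
  fixes \<alpha> :: "nat \<Rightarrow> nat"
  shows "\<exists>(c :: nat \<Rightarrow> nat) (e :: nat \<Rightarrow> nat \<Rightarrow> nat). \<forall>l. bij_betw (e l) {..<c l} {a. a < p \<and> \<alpha> a = l}"
proof -
  define c where "c l = card {a. a < p \<and> \<alpha> a = l}" for l
  have "\<exists>h. bij_betw h {..<c l} {a. a < p \<and> \<alpha> a = l}" for l
    using ex_bij_betw_nat_finite[of "{a. a < p \<and> \<alpha> a = l}"] by (simp add: c_def atLeast0LessThan)
  note ex = this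
  define e where "e l = (SOME h. bij_betw h {..<c l} {a. a < p \<and> \<alpha> a = l})" for l
  have "bij_betw (e l) {..<c l} {a. a < p \<and> \<alpha> a = l}" for l
    unfolding e_def by (rule someI_ex[OF ex])
  thus ?thesis by (intro exI[where x = c] exI[where x = e] allI)
qed

lemma not_full_split:
  assumes B: "B \<in> mtuples q n" and q: "q > 0" and nf: "\<not> full_tuple q B"
  shows "\<exists>g J. g \<in> GL q \<and> J \<subseteq> {..<q} \<and> J \<noteq> {} \<and> J \<noteq> {..<q} \<and>
    (\<forall>m<n. \<forall>a b. a < q \<longrightarrow> a \<notin> J \<longrightarrow> b \<in> J \<longrightarrow> conj_act q g B ! m $$ (a, b) = 0)"
proof -
  obtain U where U: "invariant_subspace q B U" "U \<noteq> {0\<^sub>v q}" "U \<noteq> carrier_vec q"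
    using burnside[OF B q nf] by blast
  have sub: "vec_subspace q U" and inv: "\<And>m u. m < length B \<Longrightarrow> u \<in> U \<Longrightarrow> B ! m *\<^sub>v u \<in> U"
    using U(1) unfolding invariant_subspace_def by auto
  obtain g J where g: "g \<in> GL q" "J \<subseteq> {..<q}" "\<forall>j\<in>J. col g j \<in> U"
    and Ueq: "U = {v \<in> carrier_vec q. \<forall>i<q. i \<notin> J \<longrightarrow> (ginv q g *\<^sub>v v) $ i = 0}"
    using vec_subspace_adapted[OF sub] by (elim exE conjE)
  note c = GL_D[OF g(1)]
  have "J \<noteq> {..<q}" using U(3) Ueq by auto
  moreover have "J \<noteq> {}"
  proof
    assume J: "J = {}"
    have "v = 0\<^sub>v q" if v: "v \<in> U" for v
    proof -
      have vc: "v \<in> carrier_vec q" and z: "\<And>i. i < q \<Longrightarrow> (ginv q g *\<^sub>v v) $ i = 0" using v J unfolding Ueq by auto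
      have "ginv q g *\<^sub>v v = 0\<^sub>v q" using z c(2) by (intro eq_vecI) auto
      hence "g *\<^sub>v (ginv q g *\<^sub>v v) = 0\<^sub>v q" using c(1) by (intro eq_vecI) (auto simp: scalar_prod_def)
      moreover have "g *\<^sub>v (ginv q g *\<^sub>v v) = (g * ginv q g) *\<^sub>v v" by (rule assoc_mult_mat_vec[OF c(1,2) vc, symmetric])
      ultimately show ?thesis unfolding c(4) using vc by simp
    qed
    moreover have "0\<^sub>v q \<in> U" using sub unfolding vec_subspace_def by simp
    ultimately have "U = {0\<^sub>v q}" by blast
    thus False using U(2) by contradiction
  qed
  moreover have "conj_act q (ginv q g) B ! m $$ (a, b) = 0" if m: "m < n" and ab: "a < q" "a \<notin> J" "b \<in> J" for m a b
  proof -
    have b: "b < q" using ab g(2) by auto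
    have mB: "m < length B" using mtuplesD(1)[OF B] m by simp
    note Bm = mtuplesD(2)[OF B m]
    have colU: "B ! m *\<^sub>v col g b \<in> U" using inv[OF mB] g(3) ab by blast
    have "conj_act q (ginv q g) B ! m = ginv q g * (B ! m * g)"
      using mB Bm c by (simp add: conj_act_nth assoc_mult_mat[of _ q q _ q _ q])
    also have "(ginv q g * (B ! m * g)) $$ (a, b) = (\<Sum>k<q. ginv q g $$ (a, k) * (B ! m * g) $$ (k, b))"
      by (rule mult_mat_entry[OF c(2) mult_carrier_mat[OF Bm c(1)] ab(1) b])
    also have "\<dots> = (\<Sum>k<q. ginv q g $$ (a, k) * (B ! m *\<^sub>v col g b) $ k)"
      using Bm c(1) b by (intro sum.cong refl) simp
    also have "\<dots> = (ginv q g *\<^sub>v (B ! m *\<^sub>v col g b)) $ a"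
      by (rule mult_mat_vec_entry[symmetric, OF c(2) _ ab(1)]) (use colU Ueq in auto)
    also have "\<dots> = 0" using colU ab unfolding Ueq by auto
    finally show ?thesis .
  qed
  ultimately show ?thesis using c(3) g(2) by blast
qed

text \<open>Among all triangular forms take one with the largest number of levels. A diagonal block
  that is not full has a proper invariant subspace by \<open>burnside\<close>, and splitting along
  it would add a level.\<close>

lemma full_triangular_form:
  assumes A: "A \<in> mtuples p n"
  shows "\<exists>g \<alpha> c e. g \<in> GL p \<and> fibre_blocks p \<alpha> \<alpha> c e \<and>
    (\<forall>m<n. level_tri p \<alpha> (conj_act p g A ! m)) \<and>
    (\<forall>l\<in>\<alpha> ` {..<p}. full_tuple (c l) (fibre_tuple c e l (conj_act p g A)))"
proof -
  define P where "P s \<longleftrightarrow> (\<exists>g \<alpha>. g \<in> GL p \<and> (\<forall>m<n. level_tri p \<alpha> (conj_act p g A ! m)) \<and> card (\<alpha> ` {..<p}) = s)" for s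
  have "P (card ((\<lambda>_. 0 :: nat) ` {..<p}))" unfolding P_def
    by (intro exI[of _ "1\<^sub>m p"] exI[of _ "\<lambda>_. 0"]) (auto simp: level_tri_def GL_one)
  moreover have bd: "s \<le> p" if Ps: "P s" for s
  proof -
    obtain \<alpha> :: "nat \<Rightarrow> nat" where "card (\<alpha> ` {..<p}) = s" using Ps unfolding P_def by blast
    thus ?thesis using card_image_le[of "{..<p}" \<alpha>] by simp
  qed
  ultimately have gr: "P (Greatest P)" by (rule GreatestI_nat)
  then obtain g \<alpha> where g: "g \<in> GL p" "\<And>m. m < n \<Longrightarrow> level_tri p \<alpha> (conj_act p g A ! m)"
    "card (\<alpha> ` {..<p}) = Greatest P" unfolding P_def by blast
  have max: "s \<le> Greatest P" if "P s" for s by (rule Greatest_le_nat[of P s p, OF that bd])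
  obtain c where "\<exists>e. \<forall>l. bij_betw (e l) {..<(c l :: nat)} {a. a < p \<and> \<alpha> a = l}"
    using enumeration_exists[of p \<alpha>] by (rule exE)
  then obtain e where ce: "\<forall>l. bij_betw (e l) {..<c l} {a. a < p \<and> \<alpha> a = l}" by (rule exE)
  interpret fibre_blocks p \<alpha> \<alpha> c e
    by unfold_locales (use ce in \<open>auto simp: same_fibres_def\<close>)
  define A1 where "A1 = conj_act p g A"
  have A1: "A1 \<in> mtuples p n" unfolding A1_def by (rule conj_act_mtuples[OF g(1) A])
  have tri1: "level_tri p \<alpha> (A1 ! m)" if "m < n" for m using g(2)[OF that] unfolding A1_def .
  have "full_tuple (c l) (fibre_tuple c e l A1)" if l: "l \<in> \<alpha> ` {..<p}" for l
  proof (rule ccontr)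
    assume nf: "\<not> ?thesis"
    obtain a0 where a0: "a0 < p" "\<alpha> a0 = l" using l by auto
    obtain r0 where "r0 < c l" using enum_ex[OF a0(1)] a0 by metis
    hence cl: "0 < c l" by simp
    obtain h J where h: "h \<in> GL (c l)" "J \<subseteq> {..<c l}" "J \<noteq> {}" "J \<noteq> {..<c l}"
      and hz: "\<forall>m<n. \<forall>a b. a < c l \<longrightarrow> a \<notin> J \<longrightarrow> b \<in> J \<longrightarrow> conj_act (c l) h (fibre_tuple c e l A1) ! m $$ (a, b) = 0"
      using not_full_split[OF fibre_tuple_mtuples[OF A1] cl nf] by (elim exE conjE)
    define H where "H k = (if k = l then h else 1\<^sub>m (c k))" for k
    have H: "H k \<in> GL (c k)" for k unfolding H_def using h(1) GL_one(1) by simp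
    have CB: "level_tri p \<alpha> (conj_act p (block_diagonal H) A1 ! m)" if "m < n" for m
      by (rule conj_block_diagonal(1)[of H, OF H A1 tri1 that])
    have CB2: "fibre_tuple c e k (conj_act p (block_diagonal H) A1) = conj_act (c k) (H k) (fibre_tuple c e k A1)" for k
      by (rule conj_block_diagonal(2)[of H, OF H A1 tri1])
    define A2 where "A2 = conj_act p (block_diagonal H) A1"
    have A2: "A2 = conj_act p (block_diagonal H * g) A"
      unfolding A2_def A1_def by (rule conj_act_mult[OF block_diagonal_GL(1)[of H, OF H] g(1) A])
    \<comment> \<open>Doubling makes room for one new level: inside the fibre over \<open>l\<close>,
      the indices outside \<open>J\<close> move just above those in \<open>J\<close>.\<close>
    define \<alpha>2 where "\<alpha>2 a = 2 * \<alpha> a + (if a \<in> e l ` ({..<c l} - J) then 1 else 0)" for a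
    have "level_tri p \<alpha>2 (A2 ! m)" if m: "m < n" for m
      unfolding level_tri_def
    proof (intro allI impI)
      fix a b assume ab: "a < p" "b < p" "\<alpha>2 b < \<alpha>2 a"
      show "A2 ! m $$ (a, b) = 0"
      proof (cases "\<alpha> b < \<alpha> a")
        case True
        thus ?thesis using CB[OF m] ab unfolding A2_def level_tri_def by auto
      next
        case False
        hence *: "\<alpha> a = \<alpha> b" "a \<in> e l ` ({..<c l} - J)" "b \<notin> e l ` ({..<c l} - J)"
          using ab(3) unfolding \<alpha>2_def by (auto split: if_splits)
        then obtain r where r: "r < c l" "r \<notin> J" "a = e l r" by auto
        have "\<alpha> b = l" using * r enum_in[OF r(1)] by simp
        then obtain s where s: "s < c l" "b = e l s" using enum_ex[OF ab(2)] by metis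
        have "s \<in> J" using *(3) s by auto
        have "A2 ! m $$ (a, b) = fibre_tuple c e l A2 ! m $$ (r, s)"
          using r s m mtuplesD(1)[OF A1] unfolding A2_def by (simp add: fibre_tuple_nth)
        also have "\<dots> = conj_act (c l) h (fibre_tuple c e l A1) ! m $$ (r, s)"
          unfolding A2_def CB2 by (simp add: H_def)
        also have "\<dots> = 0" using hz m r(1,2) \<open>s \<in> J\<close> by blast
        finally show ?thesis .
      qed
    qed
    hence "P (card (\<alpha>2 ` {..<p}))" unfolding P_def A2
      using GL_mult(1)[OF block_diagonal_GL(1)[of H, OF H] g(1)] by blast
    hence le: "card (\<alpha>2 ` {..<p}) \<le> card (\<alpha> ` {..<p})" using max g(3) by simp
    \<comment> \<open>Halving maps the refined levels onto the old ones. By maximality both sets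
      have the same size, so halving would be injective, contrary to the two levels into which
      \<open>l\<close> was split.\<close>
    have im: "\<alpha> ` {..<p} = (\<lambda>x. x div 2) ` \<alpha>2 ` {..<p}"
      unfolding image_image by (intro image_cong refl) (simp add: \<alpha>2_def)
    have "card (\<alpha> ` {..<p}) \<le> card (\<alpha>2 ` {..<p})" unfolding im by (rule card_image_le) simp
    hence "inj_on (\<lambda>x. x div 2) (\<alpha>2 ` {..<p})"
      using le im by (intro eq_card_imp_inj_on) auto
    moreover obtain r s where r: "r < c l" "r \<notin> J" and s: "s \<in> J" "s < c l" using h(2-4) by auto
    have "\<alpha>2 (e l r) = 2 * l + 1" using r enum_in[OF r(1)] unfolding \<alpha>2_def by auto
    moreover have "\<alpha>2 (e l s) = 2 * l"
    proof -
      have "e l s \<notin> e l ` ({..<c l} - J)" using s enum_inj[OF s(2)] by auto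
      thus ?thesis using enum_in[OF s(2)] unfolding \<alpha>2_def by simp
    qed
    moreover have "\<alpha>2 (e l r) \<in> \<alpha>2 ` {..<p}" "\<alpha>2 (e l s) \<in> \<alpha>2 ` {..<p}"
      using enum_in(1)[OF r(1)] enum_in(1)[OF s(2)] by auto
    ultimately have "2 * l + 1 = 2 * l" by (metis inj_onD div_mult_self1_is_m even_succ_div_two even_mult_iff even_numeral nonzero_mult_div_cancel_left zero_neq_numeral)
    thus False by simp
  qed
  thus ?thesis using g(1,2) fibre_blocks_axioms unfolding A1_def by blast
qed

text \<open>Both tuples get full diagonal blocks, which the traces match up to isomorphism. A
  permutation of coordinates puts matched blocks of the second tuple on the indices of the first,
  and a block diagonal conjugation by the isomorphisms makes them equal.\<close>

lemma separating_variety_level_pairs: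
  assumes vw: "(v, w) \<in> separating_variety p n"
  shows "\<exists>\<alpha> \<beta>. same_fibres p \<alpha> \<beta> \<and> (v, w) \<in> pair_orbit p (level_pairs p n \<alpha> \<beta>)"
proof -
  have v: "v \<in> mtuples p n" and w: "w \<in> mtuples p n" using vw unfolding separating_variety_def by auto
  obtain g \<alpha> c e where g: "g \<in> GL p" and fa: "fibre_blocks p \<alpha> \<alpha> c e"
    and triA: "\<forall>m<n. level_tri p \<alpha> (conj_act p g v ! m)"
    and fullA: "\<forall>l\<in>\<alpha> ` {..<p}. full_tuple (c l) (fibre_tuple c e l (conj_act p g v))"
    using full_triangular_form[OF v] by (elim exE conjE)
  obtain h \<beta> c' e' where h: "h \<in> GL p" and fb: "fibre_blocks p \<beta> \<beta> c' e'"
    and triB: "\<forall>m<n. level_tri p \<beta> (conj_act p h w ! m)"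
    and fullB: "\<forall>l\<in>\<beta> ` {..<p}. full_tuple (c' l) (fibre_tuple c' e' l (conj_act p h w))"
    using full_triangular_form[OF w] by (elim exE conjE)
  interpret a: fibre_blocks p \<alpha> \<alpha> c e by (rule fa)
  interpret b: fibre_blocks p \<beta> \<beta> c' e' by (rule fb)
  define A where "A = conj_act p g v"
  define B where "B = conj_act p h w"
  have A: "A \<in> mtuples p n" and B: "B \<in> mtuples p n" unfolding A_def B_def by (rule conj_act_mtuples; fact)+
  have posa: "0 < c l" if l: "l \<in> \<alpha> ` {..<p}" for l
  proof -
    obtain x where "x < p" "l = \<alpha> x" using l by auto
    then obtain r where "r < c l" using a.enum_ex by metis
    thus ?thesis by simp
  qed
  have posb: "0 < c' l" if l: "l \<in> \<beta> ` {..<p}" for l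
  proof -
    obtain x where "x < p" "l = \<beta> x" using l by auto
    then obtain r where "r < c' l" using b.enum_ex by metis
    thus ?thesis by simp
  qed
  have famA: "irreducible_family n (\<alpha> ` {..<p}) c (\<lambda>l. fibre_tuple c e l A)"
    unfolding irreducible_family_def using fullA posa fibre_tuple_mtuples[OF A] unfolding A_def by auto
  have famB: "irreducible_family n (\<beta> ` {..<p}) c' (\<lambda>l. fibre_tuple c' e' l B)"
    unfolding irreducible_family_def using fullB posb fibre_tuple_mtuples[OF B] unfolding B_def by auto
  have tr: "(\<Sum>l\<in>\<alpha> ` {..<p}. mtrace (c l) (nc_eval (c l) u (fibre_tuple c e l A))) =
      (\<Sum>l\<in>\<beta> ` {..<p}. mtrace (c' l) (nc_eval (c' l) u (fibre_tuple c' e' l B)))" for u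
  proof -
    have "mtrace p (nc_eval p u A) = (\<Sum>l\<in>\<alpha> ` {..<p}. mtrace (c l) (nc_eval (c l) u (fibre_tuple c e l A)))"
    proof -
      have "mtrace (c l) (nc_eval (c l) u (fibre_tuple c e l A)) = (\<Sum>r<c l. nc_eval p u A $$ (e l r, e l r))" for l
      proof -
        have "nc_eval (c l) u (fibre_tuple c e l A) = fibre_mat c e l (nc_eval p u A)"
          using a.nc_eval_fibre(2)[OF A, of l u] triA unfolding A_def by simp
        thus ?thesis unfolding mtrace_def by simp
      qed
      thus ?thesis unfolding mtrace_def[of p] a.sum_over_fibres by simp
    qed
    moreover have "mtrace p (nc_eval p u B) = (\<Sum>l\<in>\<beta> ` {..<p}. mtrace (c' l) (nc_eval (c' l) u (fibre_tuple c' e' l B)))"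
    proof -
      have "mtrace (c' l) (nc_eval (c' l) u (fibre_tuple c' e' l B)) = (\<Sum>r<c' l. nc_eval p u B $$ (e' l r, e' l r))" for l
      proof -
        have "nc_eval (c' l) u (fibre_tuple c' e' l B) = fibre_mat c' e' l (nc_eval p u B)"
          using b.nc_eval_fibre(2)[OF B, of l u] triB unfolding B_def by simp
        thus ?thesis unfolding mtrace_def by simp
      qed
      thus ?thesis unfolding mtrace_def[of p] b.sum_over_fibres by simp
    qed
    moreover have "mtrace p (nc_eval p u A) = mtrace p (nc_eval p u B)"
      unfolding A_def B_def nc_eval_conj[OF g v] nc_eval_conj[OF h w]
        mtrace_conj[OF g nc_eval_carrier[OF v]] mtrace_conj[OF h nc_eval_carrier[OF w]]
      using separating_trace[OF vw] unfolding mtrace_def .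
    ultimately show ?thesis by simp
  qed
  obtain \<tau> where \<tau>: "bij_betw \<tau> (\<alpha> ` {..<p}) (\<beta> ` {..<p})"
    and iso: "\<forall>l\<in>\<alpha> ` {..<p}. iso_tuples (c l) (fibre_tuple c e l A) (c' (\<tau> l)) (fibre_tuple c' e' (\<tau> l) B)"
    using match_families[OF famA famB tr] by (elim exE conjE)
  \<comment> \<open>An invertible matrix is chosen also for levels that do not occur, because
    \<open>block_diagonal_GL\<close> asks for one at every level.\<close>
  have "\<forall>l. \<exists>X. X \<in> GL (c l) \<and> (l \<in> \<alpha> ` {..<p} \<longrightarrow> c' (\<tau> l) = c l \<and>
      conj_act (c l) X (fibre_tuple c' e' (\<tau> l) B) = fibre_tuple c e l A)"
    using iso GL_one(1) unfolding iso_tuples_def by (metis (no_types, lifting))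
  then obtain X where X: "\<And>l. X l \<in> GL (c l)" "\<And>l. l \<in> \<alpha> ` {..<p} \<Longrightarrow> c' (\<tau> l) = c l"
    "\<And>l. l \<in> \<alpha> ` {..<p} \<Longrightarrow> conj_act (c l) (X l) (fibre_tuple c' e' (\<tau> l) B) = fibre_tuple c e l A"
    by metis
  \<comment> \<open>Sends the r-th index of the \<alpha>-fibre over l to the r-th index of the
    matched \<beta>-fibre over \<open>\<tau> l\<close>.\<close>
  define \<theta> where "\<theta> x = e' (\<tau> (\<alpha> x)) (inv_into {..<c (\<alpha> x)} (e (\<alpha> x)) x)" for x
  have \<theta>e: "\<theta> (e l r) = e' (\<tau> l) r" "\<theta> (e l r) < p" "\<beta> (\<theta> (e l r)) = \<tau> l" if r: "r < c l" for l r
  proof -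
    have "inv_into {..<c l} (e l) (e l r) = r"
      using bij_betw_imp_inj_on[OF a.enum[of l]] r by (intro inv_into_f_f) auto
    thus *: "\<theta> (e l r) = e' (\<tau> l) r" unfolding \<theta>_def using a.enum_in[OF r] by simp
    have "\<alpha> (e l r) \<in> \<alpha> ` {..<p}" using a.enum_in(1)[OF r] by blast
    hence "l \<in> \<alpha> ` {..<p}" unfolding a.enum_in(2)[OF r] .
    hence "r < c' (\<tau> l)" using X(2) r by simp
    thus "\<theta> (e l r) < p" "\<beta> (\<theta> (e l r)) = \<tau> l" unfolding * using b.enum_in by auto
  qed
  have \<theta>p: "\<theta> x < p" "\<beta> (\<theta> x) = \<tau> (\<alpha> x)" if x: "x < p" for x
    using a.enum_ex[OF x] \<theta>e(2,3) by metis+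
  have \<tau>inj: "\<tau> (\<alpha> x) = \<tau> (\<alpha> y) \<longleftrightarrow> \<alpha> x = \<alpha> y" if "x < p" "y < p" for x y
    using bij_betw_imp_inj_on[OF \<tau>] that by (auto dest: inj_onD)
  have \<theta>inj: "inj_on \<theta> {..<p}"
  proof (rule inj_onI)
    fix x y assume xy: "x \<in> {..<p}" "y \<in> {..<p}" "\<theta> x = \<theta> y"
    hence lt: "x < p" "y < p" by auto
    have "\<tau> (\<alpha> x) = \<tau> (\<alpha> y)" unfolding \<theta>p(2)[OF lt(1), symmetric] \<theta>p(2)[OF lt(2), symmetric] xy(3) ..
    hence al: "\<alpha> x = \<alpha> y" using \<tau>inj[OF lt] by (rule iffD1[rotated])
    obtain r where r: "r < c (\<alpha> x)" "e (\<alpha> x) r = x" using a.enum_ex[of x] xy by auto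
    obtain s where s: "s < c (\<alpha> x)" "e (\<alpha> x) s = y" using a.enum_ex[of y] xy al by auto
    have cc: "c' (\<tau> (\<alpha> x)) = c (\<alpha> x)" using X(2) xy(1) by auto
    have "e' (\<tau> (\<alpha> x)) r = e' (\<tau> (\<alpha> x)) s" using \<theta>e(1)[OF r(1)] \<theta>e(1)[OF s(1)] r s xy(3) by simp
    hence "r = s" using b.enum_inj[of r "\<tau> (\<alpha> x)" s] r s cc by simp
    thus "x = y" using r s by simp
  qed
  have \<theta>bij: "bij_betw \<theta> {..<p} {..<p}"
    unfolding bij_betw_def using \<theta>inj \<theta>p(1) endo_inj_surj[of "{..<p}" \<theta>] by auto
  define \<rho> where "\<rho> = inv_into {..<p} \<theta>"
  have \<rho>: "bij_betw \<rho> {..<p} {..<p}" unfolding \<rho>_def by (rule bij_betw_inv_into[OF \<theta>bij])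
  have \<rho>\<theta>: "\<rho> (\<theta> x) = x" if "x < p" for x unfolding \<rho>_def using \<theta>inj that by (intro inv_into_f_f) auto
  define B1 where "B1 = conj_act p (perm_gl p \<rho>) B"
  have B1: "B1 \<in> mtuples p n" unfolding B1_def by (rule conj_act_mtuples[OF perm_gl_GL(1)[OF \<rho>] B])
  have B1e: "B1 ! m $$ (x, y) = B ! m $$ (\<theta> x, \<theta> y)" if "m < n" "x < p" "y < p" for m x y
    using conj_act_perm_gl[OF \<rho> B that(1) \<theta>p(1)[OF that(2)] \<theta>p(1)[OF that(3)]] \<rho>\<theta> that unfolding B1_def by simp
  \<comment> \<open>The order of the blocks in the second tuple, transported to the fibres of
    \<alpha>.\<close>
  define \<gamma> where "\<gamma> x = \<beta> (\<theta> x)" for x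
  have sf: "same_fibres p \<alpha> \<gamma>" unfolding same_fibres_def \<gamma>_def using \<theta>p(2) \<tau>inj by auto
  interpret d: fibre_blocks p \<alpha> \<gamma> c e by unfold_locales (use a.enum sf in auto)
  have tri1: "level_tri p \<gamma> (B1 ! m)" if m: "m < n" for m
    unfolding level_tri_def
  proof (intro allI impI)
    fix x y assume xy: "x < p" "y < p" "\<gamma> y < \<gamma> x"
    have "level_tri p \<beta> (B ! m)" using triB m unfolding B_def by simp
    thus "B1 ! m $$ (x, y) = 0" unfolding B1e[OF m xy(1,2)]
      using \<theta>p(1)[OF xy(1)] \<theta>p(1)[OF xy(2)] xy(3) unfolding level_tri_def \<gamma>_def by blast
  qed
  have fibB1: "fibre_tuple c e l B1 = fibre_tuple c' e' (\<tau> l) B" if l: "l \<in> \<alpha> ` {..<p}" for l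
  proof (rule nth_equalityI)
    show "length (fibre_tuple c e l B1) = length (fibre_tuple c' e' (\<tau> l) B)" unfolding B1_def by (simp add: fibre_tuple_def)
    fix m assume "m < length (fibre_tuple c e l B1)"
    hence m: "m < n" "m < length B1" "m < length B" using mtuplesD(1)[OF B1] mtuplesD(1)[OF B] by (auto simp: fibre_tuple_def)
    show "fibre_tuple c e l B1 ! m = fibre_tuple c' e' (\<tau> l) B ! m"
      unfolding fibre_tuple_nth[OF m(2)] fibre_tuple_nth[OF m(3)]
      using X(2)[OF l] B1e[OF m(1)] a.enum_in \<theta>e(1) by (intro eq_matI) auto
  qed
  have CB: "level_tri p \<gamma> (conj_act p (d.block_diagonal X) B1 ! m)" if "m < n" for m
    by (rule d.conj_block_diagonal(1)[of X, OF X(1) B1 tri1 that])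
  have CB2: "fibre_tuple c e k (conj_act p (d.block_diagonal X) B1) = conj_act (c k) (X k) (fibre_tuple c e k B1)" for k
    by (rule d.conj_block_diagonal(2)[of X, OF X(1) B1 tri1])
  define B2 where "B2 = conj_act p (d.block_diagonal X) B1"
  note dG = d.block_diagonal_GL(1)[of X, OF X(1)]
  have B2: "B2 \<in> mtuples p n" unfolding B2_def by (rule conj_act_mtuples[OF dG B1])
  have "(A, B2) \<in> level_pairs p n \<alpha> \<gamma>"
    unfolding level_pairs_def
  proof (clarify, intro conjI allI impI A B2)
    fix m x y assume m: "m < n" and xy: "x < p" "y < p"
    show "A ! m $$ (x, y) = 0" if "\<alpha> y < \<alpha> x" using triA m xy that unfolding A_def level_tri_def by blast
    show "B2 ! m $$ (x, y) = 0" if "\<gamma> y < \<gamma> x" using CB[OF m] xy that unfolding B2_def level_tri_def by blast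
    show "A ! m $$ (x, y) = B2 ! m $$ (x, y)" if al: "\<alpha> x = \<alpha> y"
    proof -
      have l: "\<alpha> x \<in> \<alpha> ` {..<p}" using xy by auto
      obtain r where r: "r < c (\<alpha> x)" "e (\<alpha> x) r = x" using a.enum_ex[OF xy(1)] by auto
      obtain s where s: "s < c (\<alpha> x)" "e (\<alpha> x) s = y" using a.enum_ex[OF xy(2)] al by auto
      have "fibre_tuple c e (\<alpha> x) B2 = fibre_tuple c e (\<alpha> x) A"
        unfolding B2_def CB2 fibB1[OF l] by (rule X(3)[OF l])
      hence "fibre_tuple c e (\<alpha> x) B2 ! m $$ (r, s) = fibre_tuple c e (\<alpha> x) A ! m $$ (r, s)" by simp
      thus ?thesis using r s m mtuplesD(1)[OF A] mtuplesD(1)[OF B2] by (simp add: fibre_tuple_nth)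
    qed
  qed
  moreover have "B2 = conj_act p (d.block_diagonal X * (perm_gl p \<rho> * h)) w"
    unfolding B2_def B1_def B_def
    using dG perm_gl_GL(1)[OF \<rho>] h w GL_mult(1)[OF perm_gl_GL(1)[OF \<rho>] h] by (simp add: conj_act_mult)
  moreover have "d.block_diagonal X * (perm_gl p \<rho> * h) \<in> GL p"
    using dG perm_gl_GL(1)[OF \<rho>] h by (intro GL_mult(1))
  ultimately have "(v, w) \<in> pair_orbit p (level_pairs p n \<alpha> \<gamma>)"
    using pair_orbitI[of p g v _ w] v w g unfolding A_def by metis
  thus ?thesis using sf by blast
qed

section \<open>A closed condition from Pluecker coordinates\<close>

text \<open>A Pluecker coordinate of the span of the \<open>M\<close> columns of \<open>Q\<close>.
  Tuples of rows are used instead of sets, so that replacing a row needs no sign.\<close>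

definition minor :: "nat \<Rightarrow> ('i \<Rightarrow> nat \<Rightarrow> complex) \<Rightarrow> (nat \<Rightarrow> 'i) \<Rightarrow> complex" where
  "minor M Q f = det (mat M M (\<lambda>(r, s). Q (f r) s))"

lemma minor_row_expansion:
  assumes r: "r < M"
  shows "minor M Q (f(r := j)) = (\<Sum>s<M. Q j s * cofactor (mat M M (\<lambda>(r, s). Q (f r) s)) r s)"
proof -
  let ?A = "mat M M (\<lambda>(r, s). Q (f r) s)" and ?B = "mat M M (\<lambda>(r', s). Q ((f(r := j)) r') s)"
  have "minor M Q (f(r := j)) = (\<Sum>s<M. ?B $$ (r, s) * cofactor ?B r s)"
    unfolding minor_def by (rule laplace_expansion_row) (use r in auto)
  also have "\<dots> = (\<Sum>s<M. Q j s * cofactor ?A r s)"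
  proof (intro sum.cong refl)
    fix s assume "s \<in> {..<M}"
    hence s: "s < M" by simp
    have "mat_delete ?B r s = mat_delete ?A r s"
      unfolding mat_delete_def using r by (intro eq_matI) auto
    thus "?B $$ (r, s) * cofactor ?B r s = Q j s * cofactor ?A r s"
      using r s unfolding cofactor_def by simp
  qed
  finally show ?thesis .
qed

text \<open>On the top exterior power of an invariant subspace an operator acts as a derivation by
  its trace there. Concretely, each row is expanded by cofactors, and the adjugate times the matrix
  leaves only diagonal terms.\<close>

lemma minor_derivation:
  fixes D :: "'i \<Rightarrow> 'i \<Rightarrow> complex"
  assumes C: "C \<in> carrier_mat M M" and f: "\<And>r. r < M \<Longrightarrow> f r \<in> Idx"
    and DQ: "\<And>i s. i \<in> Idx \<Longrightarrow> s < M \<Longrightarrow> (\<Sum>j\<in>Idx. D i j * Q j s) = (\<Sum>t<M. Q i t * C $$ (t, s))"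
  shows "(\<Sum>r<M. \<Sum>j\<in>Idx. D (f r) j * minor M Q (f(r := j))) = (\<Sum>t<M. C $$ (t, t)) * minor M Q f"
proof -
  let ?A = "mat M M (\<lambda>(r, s). Q (f r) s)"
  have A: "?A \<in> carrier_mat M M" by simp
  have "(\<Sum>r<M. \<Sum>j\<in>Idx. D (f r) j * minor M Q (f(r := j))) =
    (\<Sum>r<M. \<Sum>t<M. \<Sum>s<M. C $$ (t, s) * (cofactor ?A r s * ?A $$ (r, t)))"
  proof (intro sum.cong refl)
    fix r assume "r \<in> {..<M}"
    hence r: "r < M" by simp
    have "(\<Sum>j\<in>Idx. D (f r) j * minor M Q (f(r := j))) = (\<Sum>j\<in>Idx. \<Sum>s<M. (D (f r) j * Q j s) * cofactor ?A r s)"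
      unfolding minor_row_expansion[OF r] by (simp add: sum_distrib_left mult.assoc)
    also have "\<dots> = (\<Sum>s<M. (\<Sum>j\<in>Idx. D (f r) j * Q j s) * cofactor ?A r s)"
      by (subst sum.swap) (simp add: sum_distrib_right)
    also have "\<dots> = (\<Sum>s<M. \<Sum>t<M. C $$ (t, s) * (cofactor ?A r s * ?A $$ (r, t)))"
      using DQ[OF f[OF r]] r by (intro sum.cong refl) (simp add: sum_distrib_right sum_distrib_left mult_ac)
    finally show "(\<Sum>j\<in>Idx. D (f r) j * minor M Q (f(r := j))) = (\<Sum>t<M. \<Sum>s<M. C $$ (t, s) * (cofactor ?A r s * ?A $$ (r, t)))"
      by (subst sum.swap)
  qed
  also have "\<dots> = (\<Sum>t<M. \<Sum>r<M. \<Sum>s<M. C $$ (t, s) * (cofactor ?A r s * ?A $$ (r, t)))"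
    by (rule sum.swap)
  also have "\<dots> = (\<Sum>t<M. \<Sum>s<M. C $$ (t, s) * (\<Sum>r<M. cofactor ?A r s * ?A $$ (r, t)))"
    unfolding sum_distrib_left by (rule sum.cong[OF refl], rule sum.swap)
  also have "\<dots> = (\<Sum>t<M. \<Sum>s<M. if s = t then C $$ (t, t) * det ?A else 0)"
  proof (intro sum.cong refl)
    fix t s assume "t \<in> {..<M}" "s \<in> {..<M}"
    hence ts: "t < M" "s < M" by auto
    have "(\<Sum>r<M. cofactor ?A r s * ?A $$ (r, t)) = (\<Sum>r<M. adj_mat ?A $$ (s, r) * ?A $$ (r, t))"
      using ts by (intro sum.cong refl) (simp add: adj_mat_def)
    also have "\<dots> = (adj_mat ?A * ?A) $$ (s, t)"
      by (rule mult_mat_entry[OF adj_mat(1)[OF A] A ts(2,1), symmetric])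
    also have "\<dots> = (if s = t then det ?A else 0)" unfolding adj_mat(3)[OF A] using ts by simp
    finally show "C $$ (t, s) * (\<Sum>r<M. cofactor ?A r s * ?A $$ (r, t)) = (if s = t then C $$ (t, t) * det ?A else 0)"
      by simp
  qed
  also have "\<dots> = (\<Sum>t<M. C $$ (t, t)) * minor M Q f" unfolding minor_def by (simp add: sum_distrib_right)
  finally show ?thesis .
qed

lemma minor_not_inj:
  assumes "\<not> inj_on f {..<M}" shows "minor M Q f = 0"
proof -
  obtain r r' where r: "r < M" "r' < M" "r \<noteq> r'" "f r = f r'" using assms unfolding inj_on_def by auto
  show ?thesis unfolding minor_def
    by (rule det_identical_rows[of _ M r r']) (use r in \<open>auto intro!: eq_vecI\<close>)
qed

text \<open>A Cauchy-Binet expansion over tuples of rows; it carries nonvanishing of a minor through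
  a change of coordinates.\<close>

lemma minor_expansion:
  fixes G :: "'i \<Rightarrow> 'i \<Rightarrow> complex"
  assumes "finite Idx"
  shows "minor M (\<lambda>i s. \<Sum>j\<in>Idx. G i j * Q j s) f =
    (\<Sum>f'\<in>PiE {..<M} (\<lambda>_. Idx). (\<Prod>r<M. G (f r) (f' r)) * minor M Q f')"
proof -
  have lt: "s r < M" if "s permutes {0..<M}" "r < M" for s r
    using permutes_in_image[OF that(1), of r] that(2) by simp
  have "minor M (\<lambda>i s. \<Sum>j\<in>Idx. G i j * Q j s) f =
    (\<Sum>s | s permutes {0..<M}. signof s * (\<Prod>r<M. \<Sum>j\<in>Idx. G (f r) j * Q j (s r)))"
    unfolding minor_def by (subst det_def'[of _ M]) (auto simp: lt atLeast0LessThan intro!: sum.cong prod.cong)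
  also have "\<dots> = (\<Sum>s | s permutes {0..<M}. \<Sum>f'\<in>PiE {..<M} (\<lambda>_. Idx). signof s * ((\<Prod>r<M. G (f r) (f' r)) * (\<Prod>r<M. Q (f' r) (s r))))"
  proof (intro sum.cong refl)
    fix s
    have "(\<Prod>r<M. \<Sum>j\<in>Idx. G (f r) j * Q j (s r)) = (\<Sum>f'\<in>PiE {..<M} (\<lambda>_. Idx). \<Prod>r<M. G (f r) (f' r) * Q (f' r) (s r))"
      by (rule prod_sum_PiE) (use assms in auto)
    thus "signof s * (\<Prod>r<M. \<Sum>j\<in>Idx. G (f r) j * Q j (s r)) =
      (\<Sum>f'\<in>PiE {..<M} (\<lambda>_. Idx). signof s * ((\<Prod>r<M. G (f r) (f' r)) * (\<Prod>r<M. Q (f' r) (s r))))"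
      by (simp add: sum_distrib_left prod.distrib)
  qed
  also have "\<dots> = (\<Sum>f'\<in>PiE {..<M} (\<lambda>_. Idx). \<Sum>s | s permutes {0..<M}. signof s * ((\<Prod>r<M. G (f r) (f' r)) * (\<Prod>r<M. Q (f' r) (s r))))"
    by (rule sum.swap)
  also have "\<dots> = (\<Sum>f'\<in>PiE {..<M} (\<lambda>_. Idx). (\<Prod>r<M. G (f r) (f' r)) * minor M Q f')"
  proof (intro sum.cong refl)
    fix f'
    have "minor M Q f' = (\<Sum>s | s permutes {0..<M}. signof s * (\<Prod>r<M. Q (f' r) (s r)))"
      unfolding minor_def by (subst det_def'[of _ M]) (auto simp: lt atLeast0LessThan intro!: sum.cong prod.cong)
    thus "(\<Sum>s | s permutes {0..<M}. signof s * ((\<Prod>r<M. G (f r) (f' r)) * (\<Prod>r<M. Q (f' r) (s r)))) =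
      (\<Prod>r<M. G (f r) (f' r)) * minor M Q f'"
      by (simp add: sum_distrib_left mult.left_commute)
  qed
  finally show ?thesis .
qed

text \<open>At \<open>x\<close> the square system is diagonal with nonzero pivots, so its
  determinant is nonzero there. The determinant is regular, hence nonzero at some \<open>y\<close>
  in \<open>Y\<close>, where the kernel is therefore trivial.\<close>

lemma kernel_nontrivial_closed:
  fixes row :: "'w \<Rightarrow> 'x \<Rightarrow> 'w \<Rightarrow> complex"
  assumes YX: "Y \<subseteq> X" and x: "x \<in> zariski X K closure_of Y" and fin: "finite \<Omega>"
    and reg: "\<And>\<omega> \<omega>'. \<omega> \<in> \<Omega> \<Longrightarrow> \<omega>' \<in> \<Omega> \<Longrightarrow> regular_on X K (\<lambda>y. row \<omega> y \<omega>')"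
    and diag: "\<And>\<omega> \<omega>'. \<omega> \<in> \<Omega> \<Longrightarrow> \<omega>' \<in> \<Omega> \<Longrightarrow> row \<omega> x \<omega>' = (if \<omega>' = \<omega> then d \<omega> else 0)"
    and d: "\<And>\<omega>. \<omega> \<in> \<Omega> \<Longrightarrow> d \<omega> \<noteq> 0"
  shows "\<exists>y\<in>Y. \<forall>T. (\<forall>\<omega>\<in>\<Omega>. (\<Sum>\<omega>'\<in>\<Omega>. row \<omega> y \<omega>' * T \<omega>') = 0) \<longrightarrow> (\<forall>\<omega>\<in>\<Omega>. T \<omega> = 0)"
proof -
  define N where "N = card \<Omega>"
  obtain h where h0: "bij_betw h {0..<N} \<Omega>" using ex_bij_betw_nat_finite[OF fin] unfolding N_def by blast
  hence h: "bij_betw h {..<N} \<Omega>" by (simp add: atLeast0LessThan)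
  have hin: "h i \<in> \<Omega>" if "i < N" for i using bij_betwE[OF h] that by auto
  have hinj: "h i = h j \<longleftrightarrow> i = j" if "i < N" "j < N" for i j
    using bij_betw_imp_inj_on[OF h] that by (auto dest: inj_onD)
  have re: "(\<Sum>\<omega>\<in>\<Omega>. f \<omega>) = (\<Sum>j<N. f (h j))" for f :: "'w \<Rightarrow> complex"
    by (rule sum.reindex_bij_betw[OF h, symmetric])
  define m where "m y = mat N N (\<lambda>(i, j). row (h i) y (h j))" for y
  have mc: "m y \<in> carrier_mat N N" for y unfolding m_def by simp
  have "regular_on X K (\<lambda>y. det (m y))" unfolding m_def by (intro regular_on_det reg hin)
  moreover have "det (m x) \<noteq> 0"
  proof
    assume "det (m x) = 0"
    then obtain v where v: "v \<in> carrier_vec N" "v \<noteq> 0\<^sub>v N" "m x *\<^sub>v v = 0\<^sub>v N"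
      using det_0_iff_vec_prod_zero[OF mc] by blast
    have "v $ i = 0" if i: "i < N" for i
    proof -
      have "0 = (\<Sum>k<N. m x $$ (i, k) * v $ k)" using mult_mat_vec_entry[OF mc[of x] v(1) i] v(3) i by simp
      also have "\<dots> = (\<Sum>k<N. if k = i then d (h i) * v $ i else 0)"
        using i hin hinj by (intro sum.cong refl) (auto simp: m_def diag)
      finally show ?thesis using i d[OF hin[OF i]] by simp
    qed
    hence "v = 0\<^sub>v N" using v(1) by (intro eq_vecI) auto
    thus False using v(2) by contradiction
  qed
  ultimately obtain y where y: "y \<in> Y" "det (m y) \<noteq> 0" using regular_nonzero_near[OF YX x] by blast
  have "\<forall>\<omega>\<in>\<Omega>. T \<omega> = 0" if T: "\<forall>\<omega>\<in>\<Omega>. (\<Sum>\<omega>'\<in>\<Omega>. row \<omega> y \<omega>' * T \<omega>') = 0" for T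
  proof -
    define v where "v = vec N (\<lambda>i. T (h i))"
    have v: "v \<in> carrier_vec N" unfolding v_def by simp
    have "m y *\<^sub>v v = 0\<^sub>v N"
    proof (rule eq_vecI)
      fix i assume "i < dim_vec (0\<^sub>v N :: complex vec)"
      hence i: "i < N" by simp
      have "(m y *\<^sub>v v) $ i = (\<Sum>k<N. row (h i) y (h k) * T (h k))"
        unfolding mult_mat_vec_entry[OF mc v i] using i by (intro sum.cong refl) (auto simp: m_def v_def)
      also have "\<dots> = 0" using T hin[OF i] unfolding re by blast
      finally show "(m y *\<^sub>v v) $ i = 0\<^sub>v N $ i" using i by simp
    qed (use mc[of y] in auto)
    hence "v = 0\<^sub>v N" using det_0_iff_vec_prod_zero[OF mc] y(2) v by blast
    hence "T (h i) = 0" if "i < N" for i using that unfolding v_def by (metis index_vec index_zero_vec(1))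
    thus ?thesis using bij_betw_imp_surj_on[OF h] by force
  qed
  thus ?thesis using y(1) by blast
qed

text \<open>The multidegree of a row tuple: how many of its rows come from each summand.\<close>

definition grade_count :: "('i \<Rightarrow> nat) \<Rightarrow> nat \<Rightarrow> (nat \<Rightarrow> 'i) \<Rightarrow> nat \<Rightarrow> nat" where
  "grade_count gr M f g = card {r. r < M \<and> gr (f r) = g}"

lemma grade_count_cong:
  "(\<And>r. r < M \<Longrightarrow> gr (f r) = gr (f' r)) \<Longrightarrow> grade_count gr M f = grade_count gr M f'"
  unfolding grade_count_def by (intro ext arg_cong[of _ _ card]) auto

text \<open>
  The minors of \<open>Q\<close> with row pattern \<open>P\<close> satisfy linear equations with coefficients regular in \<open>y\<close>.
  If at \<open>x\<close> every minor could be isolated by one of these equations, then the square system made of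
  them would be invertible at \<open>x\<close>, hence at some \<open>y\<close>, forcing all the minors of \<open>Q\<close> to vanish.
\<close>
lemma surviving_row_tuple:
  fixes Idx :: "'i set" and \<D> :: "('x \<Rightarrow> 'i \<Rightarrow> 'i \<Rightarrow> complex) set"
  assumes fin: "finite Idx" and YX: "Y \<subseteq> X" and x: "x \<in> zariski X K closure_of Y"
    and reg: "\<And>d i j. d \<in> \<D> \<Longrightarrow> i \<in> Idx \<Longrightarrow> j \<in> Idx \<Longrightarrow> regular_on X K (\<lambda>y. d y i j)"
    and graded: "\<And>d y i j. d \<in> \<D> \<Longrightarrow> gr i \<noteq> gr j \<Longrightarrow> d y i j = 0"
    and sub: "\<And>y. y \<in> Y \<Longrightarrow> \<exists>Q. (\<forall>d\<in>\<D>. \<exists>C\<in>carrier_mat M M. (\<Sum>t<M. C $$ (t, t)) = 0 \<and>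
          (\<forall>i\<in>Idx. \<forall>s<M. (\<Sum>j\<in>Idx. d y i j * Q j s) = (\<Sum>t<M. Q i t * C $$ (t, s)))) \<and>
        (\<exists>f\<in>PiE {..<M} (\<lambda>_. Idx). grade_count gr M f = P \<and> minor M Q f \<noteq> 0)"
  shows "\<exists>f\<in>PiE {..<M} (\<lambda>_. Idx). grade_count gr M f = P \<and> inj_on f {..<M} \<and>
    (\<forall>d\<in>\<D>. \<forall>a\<in>Idx. \<forall>b\<in>Idx. a \<noteq> b \<longrightarrow> (\<forall>i\<in>Idx. \<forall>j\<in>Idx. d x i j = (if i = a \<and> j = b then 1 else 0)) \<longrightarrow>
       b \<in> f ` {..<M} \<longrightarrow> a \<in> f ` {..<M}) \<and>
    (\<forall>d\<in>\<D>. \<forall>\<delta>. (\<forall>i\<in>Idx. \<forall>j\<in>Idx. d x i j = (if i = j then \<delta> i else 0)) \<longrightarrow> (\<Sum>r<M. \<delta> (f r)) = 0)"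
proof (rule ccontr)
  assume neg: "\<not> ?thesis"
  let ?\<Omega> = "PiE {..<M} (\<lambda>_. Idx)"
  have fin\<Omega>: "finite ?\<Omega>" by (intro finite_PiE) (use fin in auto)
  define good where "good y Q \<longleftrightarrow> (\<forall>d\<in>\<D>. \<exists>C\<in>carrier_mat M M. (\<Sum>t<M. C $$ (t, t)) = 0 \<and>
          (\<forall>i\<in>Idx. \<forall>s<M. (\<Sum>j\<in>Idx. d y i j * Q j s) = (\<Sum>t<M. Q i t * C $$ (t, s))))" for y Q
  \<comment> \<open>Minors of other multidegrees are replaced by 0; the operators preserve grades,
    so the equations for \<open>P\<close> do not involve them.\<close>
  define T where "T Q f = (if grade_count gr M f = P then minor M Q f else 0)" for Q f
  have upd: "f(r := j) \<in> ?\<Omega>" if "f \<in> ?\<Omega>" "r < M" "j \<in> Idx" for f r j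
    using that by (auto simp: PiE_iff extensional_def)
  \<comment> \<open>Coefficients of the equation from \<open>minor_derivation\<close> at the row
    tuple \<open>f\<close>, for trace 0.\<close>
  define E where "E d f y \<omega>' = (\<Sum>r<M. \<Sum>j\<in>Idx. d y (f r) j * (if f(r := j) = \<omega>' then 1 else 0))"
    for d :: "'x \<Rightarrow> 'i \<Rightarrow> 'i \<Rightarrow> complex" and f y \<omega>'
  have E_reg: "regular_on X K (\<lambda>y. E d f y \<omega>')" if "d \<in> \<D>" "f \<in> ?\<Omega>" for d f \<omega>'
    unfolding E_def using that
    by (intro regular_on_sum regular_on_mult regular_on_const reg) (auto simp: PiE_iff)
  have E_zero: "(\<Sum>\<omega>'\<in>?\<Omega>. E d f y \<omega>' * T Q \<omega>') = 0" if d: "d \<in> \<D>" and f: "f \<in> ?\<Omega>" and Q: "good y Q" for d f y Q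
  proof -
    obtain C where C: "C \<in> carrier_mat M M" "(\<Sum>t<M. C $$ (t, t)) = 0"
      "\<And>i s. i \<in> Idx \<Longrightarrow> s < M \<Longrightarrow> (\<Sum>j\<in>Idx. d y i j * Q j s) = (\<Sum>t<M. Q i t * C $$ (t, s))"
      using Q d unfolding good_def by meson
    have fI: "f r \<in> Idx" if "r < M" for r using f that by (auto simp: PiE_iff)
    have "(\<Sum>\<omega>'\<in>?\<Omega>. E d f y \<omega>' * T Q \<omega>') =
      (\<Sum>\<omega>'\<in>?\<Omega>. \<Sum>r<M. \<Sum>j\<in>Idx. if \<omega>' = f(r := j) then d y (f r) j * T Q \<omega>' else 0)"
      unfolding E_def sum_distrib_right by (intro sum.cong refl) auto
    also have "\<dots> = (\<Sum>r<M. \<Sum>j\<in>Idx. \<Sum>\<omega>'\<in>?\<Omega>. if \<omega>' = f(r := j) then d y (f r) j * T Q \<omega>' else 0)"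
      by (subst sum.swap, intro sum.cong refl, rule sum.swap)
    also have "\<dots> = (\<Sum>r<M. \<Sum>j\<in>Idx. d y (f r) j * T Q (f(r := j)))"
    proof (intro sum.cong refl)
      fix r j assume "r \<in> {..<M}" "j \<in> Idx"
      hence "f(r := j) \<in> ?\<Omega>" using upd f by simp
      thus "(\<Sum>\<omega>'\<in>?\<Omega>. if \<omega>' = f(r := j) then d y (f r) j * T Q \<omega>' else 0) = d y (f r) j * T Q (f(r := j))"
        using fin\<Omega> by (simp add: sum.delta)
    qed
    also have "\<dots> = (\<Sum>r<M. \<Sum>j\<in>Idx. if grade_count gr M f = P then d y (f r) j * minor M Q (f(r := j)) else 0)"
    proof (intro sum.cong refl)
      fix r j
      show "d y (f r) j * T Q (f(r := j)) = (if grade_count gr M f = P then d y (f r) j * minor M Q (f(r := j)) else 0)"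
      proof (cases "gr (f r) = gr j")
        case True
        have "grade_count gr M (f(r := j)) = grade_count gr M f" by (rule grade_count_cong) (use True in auto)
        thus ?thesis unfolding T_def by simp
      next
        case False
        thus ?thesis using graded[OF d False] by simp
      qed
    qed
    also have "\<dots> = (if grade_count gr M f = P then (\<Sum>r<M. \<Sum>j\<in>Idx. d y (f r) j * minor M Q (f(r := j))) else 0)"
      by simp
    also have "(\<Sum>r<M. \<Sum>j\<in>Idx. d y (f r) j * minor M Q (f(r := j))) = 0"
      using minor_derivation[OF C(1) fI C(3)] C(2) by simp
    finally show ?thesis by simp
  qed
  \<comment> \<open>For each row tuple, \<open>fst\<close> is the coefficient row of an equation and
    \<open>snd\<close> its pivot at \<open>x\<close>.\<close>
  have "\<forall>\<omega>\<in>?\<Omega>. \<exists>\<rho>c. snd \<rho>c \<noteq> (0 :: complex) \<and> (\<forall>\<omega>'\<in>?\<Omega>. regular_on X K (\<lambda>y. fst \<rho>c y \<omega>')) \<and>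
    (\<forall>\<omega>'\<in>?\<Omega>. fst \<rho>c x \<omega>' = (if \<omega>' = \<omega> then snd \<rho>c else 0)) \<and>
    (\<forall>y Q. good y Q \<longrightarrow> (\<Sum>\<omega>'\<in>?\<Omega>. fst \<rho>c y \<omega>' * T Q \<omega>') = 0)"
  proof
    fix \<omega> assume \<omega>: "\<omega> \<in> ?\<Omega>"
    have \<omega>I: "\<omega> r \<in> Idx" if "r < M" for r using \<omega> that by (auto simp: PiE_iff)
    consider (bad) "grade_count gr M \<omega> \<noteq> P \<or> \<not> inj_on \<omega> {..<M}"
      | (move) d a b where "d \<in> \<D>" "a \<in> Idx" "b \<in> Idx" "a \<noteq> b"
        "\<forall>i\<in>Idx. \<forall>j\<in>Idx. d x i j = (if i = a \<and> j = b then 1 else 0)" "b \<in> \<omega> ` {..<M}" "a \<notin> \<omega> ` {..<M}"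
        "inj_on \<omega> {..<M}"
      | (weight) d \<delta> where "d \<in> \<D>" "\<forall>i\<in>Idx. \<forall>j\<in>Idx. d x i j = (if i = j then \<delta> i else 0)"
        "(\<Sum>r<M. \<delta> (\<omega> r)) \<noteq> 0"
      using neg \<omega> by blast
    thus "\<exists>\<rho>c. snd \<rho>c \<noteq> (0 :: complex) \<and> (\<forall>\<omega>'\<in>?\<Omega>. regular_on X K (\<lambda>y. fst \<rho>c y \<omega>')) \<and>
      (\<forall>\<omega>'\<in>?\<Omega>. fst \<rho>c x \<omega>' = (if \<omega>' = \<omega> then snd \<rho>c else 0)) \<and>
      (\<forall>y Q. good y Q \<longrightarrow> (\<Sum>\<omega>'\<in>?\<Omega>. fst \<rho>c y \<omega>' * T Q \<omega>') = 0)"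
    proof cases
      case bad
      hence "T Q \<omega> = 0" for Q unfolding T_def using minor_not_inj[of \<omega> M Q] by auto
      hence "(\<Sum>\<omega>'\<in>?\<Omega>. (if \<omega>' = \<omega> then 1 else 0) * T Q \<omega>') = 0" for Q by (intro sum.neutral) auto
      thus ?thesis
        by (intro exI[of _ "((\<lambda>y \<omega>'. if \<omega>' = \<omega> then 1 else 0), 1)"]) (auto intro: regular_on_const)
    next
      case move
      obtain r0 where r0: "r0 < M" "b = \<omega> r0" using move(6) by auto
      \<comment> \<open>At \<open>x\<close> the operator only replaces \<open>a\<close> by
        \<open>b\<close>. In \<open>f\<close> the entry \<open>a\<close> occurs exactly once, at
        \<open>r0\<close>, so the equation at \<open>f\<close> reduces to the single minor of
        \<omega>.\<close>
      define f where "f = \<omega>(r0 := a)"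
      have f: "f \<in> ?\<Omega>" unfolding f_def by (rule upd[OF \<omega> r0(1) move(2)])
      have fI: "f r \<in> Idx" if "r < M" for r using f that by (auto simp: PiE_iff)
      have "E d f x \<omega>' = (if \<omega>' = \<omega> then 1 else 0)" for \<omega>'
      proof -
        have fa: "f r = a \<longleftrightarrow> r = r0" if "r < M" for r
          using move(7) that unfolding f_def by auto
        have "E d f x \<omega>' = (\<Sum>r<M. \<Sum>j\<in>Idx. if j = b then (if r = r0 then (if \<omega>' = \<omega> then 1 else 0) else 0) else 0)"
          unfolding E_def
        proof (intro sum.cong refl)
          fix r j assume "r \<in> {..<M}" and j: "j \<in> Idx"
          hence r: "r < M" by simp
          have "f(r0 := b) = \<omega>" unfolding f_def r0(2) by simp
          moreover have "d x (f r) j = (if r = r0 \<and> j = b then 1 else 0)"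
            using move(5) fI[OF r] j fa[OF r] by simp
          ultimately show "d x (f r) j * (if f(r := j) = \<omega>' then 1 else 0) =
            (if j = b then (if r = r0 then (if \<omega>' = \<omega> then 1 else 0) else 0) else 0)"
            by auto
        qed
        also have "\<dots> = (if \<omega>' = \<omega> then 1 else 0)" using fin move(3) r0(1) by (simp add: sum.delta)
        finally show ?thesis .
      qed
      thus ?thesis using E_reg[OF move(1) f] E_zero[OF move(1) f]
        by (intro exI[of _ "(E d f, 1)"]) auto
    next
      case weight
      \<comment> \<open>A diagonal operator multiplies the minor of \<omega> by the sum of the
        weights of its rows, which is the pivot.\<close>
      have "E d \<omega> x \<omega>' = (if \<omega>' = \<omega> then (\<Sum>r<M. \<delta> (\<omega> r)) else 0)" for \<omega>'
      proof -
        have "E d \<omega> x \<omega>' = (\<Sum>r<M. \<Sum>j\<in>Idx. if j = \<omega> r then (if \<omega>' = \<omega> then \<delta> (\<omega> r) else 0) else 0)"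
          unfolding E_def
        proof (intro sum.cong refl)
          fix r j assume "r \<in> {..<M}" and j: "j \<in> Idx"
          hence r: "r < M" by simp
          have "d x (\<omega> r) j = (if \<omega> r = j then \<delta> (\<omega> r) else 0)" using weight(2) \<omega>I[OF r] j by simp
          thus "d x (\<omega> r) j * (if \<omega>(r := j) = \<omega>' then 1 else 0) =
            (if j = \<omega> r then (if \<omega>' = \<omega> then \<delta> (\<omega> r) else 0) else 0)" by auto
        qed
        also have "\<dots> = (\<Sum>r<M. if \<omega>' = \<omega> then \<delta> (\<omega> r) else 0)"
          using fin \<omega>I by (intro sum.cong refl) (simp add: sum.delta)
        finally show ?thesis by simp
      qed
      thus ?thesis using E_reg[OF weight(1) \<omega>] E_zero[OF weight(1) \<omega>] weight(3)
        by (intro exI[of _ "(E d \<omega>, \<Sum>r<M. \<delta> (\<omega> r))"]) auto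
    qed
  qed
  then obtain \<rho>c where \<rho>c: "\<forall>\<omega>\<in>?\<Omega>. snd (\<rho>c \<omega>) \<noteq> (0 :: complex) \<and> (\<forall>\<omega>'\<in>?\<Omega>. regular_on X K (\<lambda>y. fst (\<rho>c \<omega>) y \<omega>')) \<and>
    (\<forall>\<omega>'\<in>?\<Omega>. fst (\<rho>c \<omega>) x \<omega>' = (if \<omega>' = \<omega> then snd (\<rho>c \<omega>) else 0)) \<and>
    (\<forall>y Q. good y Q \<longrightarrow> (\<Sum>\<omega>'\<in>?\<Omega>. fst (\<rho>c \<omega>) y \<omega>' * T Q \<omega>') = 0)"
    by (rule bchoice[THEN exE])
  have "\<exists>y\<in>Y. \<forall>T. (\<forall>\<omega>\<in>?\<Omega>. (\<Sum>\<omega>'\<in>?\<Omega>. fst (\<rho>c \<omega>) y \<omega>' * T \<omega>') = 0) \<longrightarrow> (\<forall>\<omega>\<in>?\<Omega>. T \<omega> = 0)"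
    by (rule kernel_nontrivial_closed[OF YX x fin\<Omega>, where d = "\<lambda>\<omega>. snd (\<rho>c \<omega>)"]) (use \<rho>c in auto)
  then obtain y where y: "y \<in> Y"
    "\<And>T. \<forall>\<omega>\<in>?\<Omega>. (\<Sum>\<omega>'\<in>?\<Omega>. fst (\<rho>c \<omega>) y \<omega>' * T \<omega>') = 0 \<Longrightarrow> \<forall>\<omega>\<in>?\<Omega>. T \<omega> = 0" by blast
  obtain Q f where Q: "good y Q" and f: "f \<in> ?\<Omega>" "grade_count gr M f = P" "minor M Q f \<noteq> 0"
    using sub[OF y(1)] unfolding good_def by blast
  have "\<forall>\<omega>\<in>?\<Omega>. T Q \<omega> = 0" using y(2)[of "T Q"] \<rho>c Q by blast
  thus False using f unfolding T_def by auto
qed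

section \<open>Submodules attached to a pair of matching blocks\<close>

text \<open>The same fibres are ordered once by \<alpha> and once by \<beta>. Evaluation preserves
  both triangular shapes, and on a diagonal block it depends only on the diagonal blocks of the
  arguments, which the two tuples share.\<close>

lemma nc_eval_level_pairs:
  assumes AA: "(A, A') \<in> level_pairs p n \<alpha> \<beta>" and sf: "same_fibres p \<alpha> \<beta>" and ab: "a < p" "b < p"
  shows "\<alpha> b < \<alpha> a \<Longrightarrow> nc_eval p w A $$ (a, b) = 0" "\<beta> b < \<beta> a \<Longrightarrow> nc_eval p w A' $$ (a, b) = 0"
    "\<alpha> a = \<alpha> b \<Longrightarrow> nc_eval p w A $$ (a, b) = nc_eval p w A' $$ (a, b)"
proof -
  have A: "A \<in> mtuples p n" and A': "A' \<in> mtuples p n" using AA unfolding level_pairs_def by auto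
  obtain c where "\<exists>e. \<forall>l. bij_betw (e l) {..<(c l :: nat)} {a. a < p \<and> \<alpha> a = l}"
    using enumeration_exists[of p \<alpha>] by (rule exE)
  then obtain e where ce: "\<forall>l. bij_betw (e l) {..<c l} {a. a < p \<and> \<alpha> a = l}" by (rule exE)
  interpret a: fibre_blocks p \<alpha> \<alpha> c e by unfold_locales (use ce in \<open>auto simp: same_fibres_def\<close>)
  interpret b: fibre_blocks p \<alpha> \<beta> c e by unfold_locales (use ce sf in auto)
  have tri: "level_tri p \<alpha> (A ! m)" "level_tri p \<beta> (A' ! m)" if "m < n" for m
    using AA that unfolding level_pairs_def level_tri_def by auto
  have ev: "level_tri p \<alpha> (nc_eval p w A)" "level_tri p \<beta> (nc_eval p w A')"
    using a.nc_eval_fibre(1)[OF A tri(1)] b.nc_eval_fibre(1)[OF A' tri(2)] by auto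
  show "\<alpha> b < \<alpha> a \<Longrightarrow> nc_eval p w A $$ (a, b) = 0" "\<beta> b < \<beta> a \<Longrightarrow> nc_eval p w A' $$ (a, b) = 0"
    using ev ab unfolding level_tri_def by blast+
  have eqA: "A ! m $$ (x, y) = A' ! m $$ (x, y)" if "m < n" "x < p" "y < p" "\<alpha> x = \<alpha> y" for m x y
    using AA that unfolding level_pairs_def by auto
  have "fibre_tuple c e l A = fibre_tuple c e l A'" for l
  proof (rule mtuples_eqI[OF fibre_tuple_mtuples[OF A] fibre_tuple_mtuples[OF A']])
    fix m r s assume mrs: "m < n" "r < c l" "s < c l"
    have "A ! m $$ (e l r, e l s) = A' ! m $$ (e l r, e l s)"
      using eqA[OF mrs(1) a.enum_in(1)[OF mrs(2)] a.enum_in(1)[OF mrs(3)]]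
      unfolding a.enum_in(2)[OF mrs(2)] a.enum_in(2)[OF mrs(3)] by simp
    thus "fibre_tuple c e l A ! m $$ (r, s) = fibre_tuple c e l A' ! m $$ (r, s)"
      using mrs mtuplesD(1)[OF A] mtuplesD(1)[OF A'] by (simp add: fibre_tuple_nth)
  qed
  hence fm: "fibre_mat c e l (nc_eval p w A) = fibre_mat c e l (nc_eval p w A')" for l
    using a.nc_eval_fibre(2)[OF A tri(1), of l w] b.nc_eval_fibre(2)[OF A' tri(2), of l w] by simp
  show "nc_eval p w A $$ (a, b) = nc_eval p w A' $$ (a, b)" if al: "\<alpha> a = \<alpha> b"
  proof -
    obtain r where r: "r < c (\<alpha> a)" "e (\<alpha> a) r = a" using a.enum_ex[OF ab(1)] by auto
    obtain s where s: "s < c (\<alpha> a)" "e (\<alpha> a) s = b" using a.enum_ex[OF ab(2)] al by auto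
    have "fibre_mat c e (\<alpha> a) (nc_eval p w A) $$ (r, s) = fibre_mat c e (\<alpha> a) (nc_eval p w A') $$ (r, s)"
      unfolding fm ..
    thus ?thesis using r s by simp
  qed
qed

definition nc_zero :: nc where "nc_zero = NScale 0 NOne"

definition nc_comm :: "nc \<Rightarrow> nc \<Rightarrow> nc" where
  "nc_comm u v = NAdd (NMul u v) (NScale (- 1) (NMul v u))"

text \<open>The components act on the two copies of the module. A commutator has trace 0 on an
  invariant subspace of either copy, and \<open>w\<close> cancels against \<open>- w\<close> when
  the subspace is the same in both.\<close>

definition traceless_pairs :: "(nc \<times> nc) set" where
  "traceless_pairs = (\<Union>u v. {(nc_comm u v, nc_zero), (nc_zero, nc_comm u v)}) \<union> (\<Union>w. {(w, NScale (- 1) w)})"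

text \<open>
  The action of a pair of noncommutative polynomials on four summands: the module given by the
  first tuple, the one given by the second tuple, and a further copy of both.
\<close>
definition quad_op :: "nat \<Rightarrow> nc \<times> nc \<Rightarrow> mtuple \<times> mtuple \<Rightarrow> nat \<times> nat \<Rightarrow> nat \<times> nat \<Rightarrow> complex" where
  "quad_op p w y i j = (if fst i = fst j then
     nc_eval p (if fst i < 2 then fst w else snd w) (if even (fst i) then fst y else snd y) $$ (snd i, snd j) else 0)"

abbreviation quad_index :: "nat \<Rightarrow> (nat \<times> nat) set" where
  "quad_index p \<equiv> {..<4} \<times> {..<p}"

definition quad_gl :: "complex mat \<Rightarrow> complex mat \<Rightarrow> nat \<times> nat \<Rightarrow> nat \<times> nat \<Rightarrow> complex" where
  "quad_gl g h i j = (if fst i = fst j then (if even (fst i) then g else h) $$ (snd i, snd j) else 0)"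

lemma quad_sum:
  assumes "g < 4" "\<And>k. fst k \<noteq> g \<Longrightarrow> f k = (0 :: complex)"
  shows "(\<Sum>k\<in>quad_index p. f k) = (\<Sum>b<p. f (g, b))"
proof -
  have "(\<Sum>k\<in>quad_index p. f k) = (\<Sum>k\<in>Pair g ` {..<p}. f k)"
    by (rule sum.mono_neutral_right) (use assms in \<open>auto simp: image_iff\<close>)
  thus ?thesis by (simp add: sum.reindex inj_on_def)
qed

lemma quad_gl_inverse:
  assumes g: "g \<in> GL p" and h: "h \<in> GL p" and i: "i \<in> quad_index p" and j: "j \<in> quad_index p"
  shows "(\<Sum>k\<in>quad_index p. quad_gl (ginv p g) (ginv p h) i k * quad_gl g h k j) = (if i = j then 1 else 0)"
proof -
  obtain g1 a g2 b where ij: "i = (g1, a)" "j = (g2, b)" "g1 < 4" "a < p" "g2 < 4" "b < p" using i j by auto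
  have "(\<Sum>k\<in>quad_index p. quad_gl (ginv p g) (ginv p h) i k * quad_gl g h k j)
    = (\<Sum>c<p. quad_gl (ginv p g) (ginv p h) i (g1, c) * quad_gl g h (g1, c) j)"
    by (rule quad_sum) (use ij in \<open>auto simp: quad_gl_def\<close>)
  also have "\<dots> = (if i = j then 1 else 0)"
  proof (cases "g1 = g2")
    case False
    thus ?thesis using ij by (simp add: quad_gl_def)
  next
    case True
    define k where "k = (if even g1 then g else h)"
    have k: "k \<in> GL p" "(if even g1 then ginv p g else ginv p h) = ginv p k" unfolding k_def using g h by auto
    note c = GL_D[OF k(1)]
    have "(\<Sum>c<p. quad_gl (ginv p g) (ginv p h) i (g1, c) * quad_gl g h (g1, c) j)
      = (\<Sum>c<p. ginv p k $$ (a, c) * k $$ (c, b))"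
      using True ij k(2) by (simp add: quad_gl_def k_def)
    also have "\<dots> = (ginv p k * k) $$ (a, b)" by (rule mult_mat_entry[OF c(2,1) ij(4,6), symmetric])
    also have "\<dots> = (if i = j then 1 else 0)" unfolding c(5) using ij True by simp
    finally show ?thesis .
  qed
  finally show ?thesis .
qed

lemma quad_op_conj:
  assumes g: "g \<in> GL p" and h: "h \<in> GL p" and A: "A \<in> mtuples p n" and A': "A' \<in> mtuples p n"
    and i: "i \<in> quad_index p" and j: "j \<in> quad_index p"
  shows "(\<Sum>k\<in>quad_index p. quad_op p w (conj_act p g A, conj_act p h A') i k * quad_gl g h k j) =
    (\<Sum>k\<in>quad_index p. quad_gl g h i k * quad_op p w (A, A') k j)"
proof -
  obtain g1 a g2 b where ij: "i = (g1, a)" "j = (g2, b)" "g1 < 4" "a < p" "g2 < 4" "b < p" using i j by auto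
  have L: "(\<Sum>k\<in>quad_index p. quad_op p w (conj_act p g A, conj_act p h A') i k * quad_gl g h k j)
    = (\<Sum>c<p. quad_op p w (conj_act p g A, conj_act p h A') i (g1, c) * quad_gl g h (g1, c) j)"
    by (rule quad_sum) (use ij in \<open>auto simp: quad_op_def\<close>)
  have R: "(\<Sum>k\<in>quad_index p. quad_gl g h i k * quad_op p w (A, A') k j)
    = (\<Sum>c<p. quad_gl g h i (g1, c) * quad_op p w (A, A') (g1, c) j)"
    by (rule quad_sum) (use ij in \<open>auto simp: quad_gl_def\<close>)
  show ?thesis
  proof (cases "g1 = g2")
    case False
    thus ?thesis unfolding L R using ij by (simp add: quad_gl_def quad_op_def)
  next
    case True
    define k where "k = (if even g1 then g else h)"
    define B where "B = (if even g1 then A else A')"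
    define u where "u = (if g1 < 2 then fst w else snd w)"
    have k: "k \<in> GL p" and B: "B \<in> mtuples p n" unfolding k_def B_def using g h A A' by auto
    note c = GL_D[OF k] and ev = nc_eval_carrier[OF B, of u]
    have "(\<Sum>c<p. quad_op p w (conj_act p g A, conj_act p h A') i (g1, c) * quad_gl g h (g1, c) j)
      = (\<Sum>c<p. nc_eval p u (conj_act p k B) $$ (a, c) * k $$ (c, b))"
      using True ij by (simp add: quad_op_def quad_gl_def k_def B_def u_def)
    also have "\<dots> = (nc_eval p u (conj_act p k B) * k) $$ (a, b)"
      by (rule mult_mat_entry[symmetric, OF nc_eval_carrier[OF conj_act_mtuples[OF k B]] c(1) ij(4,6)])
    also have "nc_eval p u (conj_act p k B) * k = k * nc_eval p u B * (ginv p k * k)"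
      unfolding nc_eval_conj[OF k B] by (rule assoc_mult_mat[OF mult_carrier_mat[OF c(1) ev] c(2,1)])
    also have "\<dots> = k * nc_eval p u B" unfolding c(5) by (rule right_mult_one_mat[OF mult_carrier_mat[OF c(1) ev]])
    also have "\<dots> $$ (a, b) = (\<Sum>x<p. k $$ (a, x) * nc_eval p u B $$ (x, b))"
      by (rule mult_mat_entry[OF c(1) ev ij(4,6)])
    also have "\<dots> = (\<Sum>c<p. quad_gl g h i (g1, c) * quad_op p w (A, A') (g1, c) j)"
      using True ij by (simp add: quad_op_def quad_gl_def k_def B_def u_def)
    finally show ?thesis unfolding L R .
  qed
qed

text \<open>Compression to an invariant coordinate subspace is multiplicative, so a commutator is
  compressed to a commutator.\<close>

lemma commutator_trace_invariant_set:
  assumes A: "A \<in> mtuples p n" and S: "S \<subseteq> {..<p}"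
    and inv: "\<And>w a b. a \<in> S \<Longrightarrow> b < p \<Longrightarrow> b \<notin> S \<Longrightarrow> nc_eval p w A $$ (b, a) = 0"
  shows "(\<Sum>a\<in>S. nc_eval p (nc_comm u v) A $$ (a, a)) = 0"
proof -
  have P: "(\<Sum>a\<in>S. nc_eval p (NMul x y) A $$ (a, a)) = (\<Sum>a\<in>S. \<Sum>b\<in>S. nc_eval p x A $$ (a, b) * nc_eval p y A $$ (b, a))" for x y
  proof (intro sum.cong refl)
    fix a assume a: "a \<in> S"
    hence ap: "a < p" using S by auto
    have "nc_eval p (NMul x y) A $$ (a, a) = (\<Sum>b<p. nc_eval p x A $$ (a, b) * nc_eval p y A $$ (b, a))"
      unfolding nc_eval.simps by (rule mult_mat_entry[OF nc_eval_carrier[OF A] nc_eval_carrier[OF A] ap ap])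
    also have "\<dots> = (\<Sum>b\<in>S. nc_eval p x A $$ (a, b) * nc_eval p y A $$ (b, a))"
      by (rule sum.mono_neutral_right) (use S inv[OF a] in auto)
    finally show "nc_eval p (NMul x y) A $$ (a, a) = (\<Sum>b\<in>S. nc_eval p x A $$ (a, b) * nc_eval p y A $$ (b, a))" .
  qed
  have "(\<Sum>a\<in>S. nc_eval p (nc_comm u v) A $$ (a, a)) =
    (\<Sum>a\<in>S. nc_eval p (NMul u v) A $$ (a, a) - nc_eval p (NMul v u) A $$ (a, a))"
  proof (intro sum.cong refl)
    fix a assume "a \<in> S"
    hence a: "a < p" using S by auto
    thus "nc_eval p (nc_comm u v) A $$ (a, a) = nc_eval p (NMul u v) A $$ (a, a) - nc_eval p (NMul v u) A $$ (a, a)"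
      using nc_eval_carrier[OF A, of "NMul u v"] nc_eval_carrier[OF A, of "NMul v u"] unfolding nc_comm_def
      by (simp del: nc_eval.simps(4) index_mult_mat)
  qed
  also have "\<dots> = (\<Sum>a\<in>S. \<Sum>b\<in>S. nc_eval p u A $$ (a, b) * nc_eval p v A $$ (b, a)) -
      (\<Sum>a\<in>S. \<Sum>b\<in>S. nc_eval p v A $$ (a, b) * nc_eval p u A $$ (b, a))"
    unfolding sum_subtractf P ..
  also have "\<dots> = 0" by (subst sum_trace_commute) simp
  finally show ?thesis .
qed

text \<open>
  For \<open>\<Lambda> = {}\<close> the submodule is the sum of the steps \<open>\<alpha> \<le> j\<close> and \<open>\<beta> < i\<close> of the two flags. If
  \<open>\<Lambda>\<close> is a common block, it is the graph-like submodule in which the two copies of that block are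
  identified; it then has nonzero Pluecker coordinates in several bidegrees.
\<close>

locale matched_step =
  fixes p n \<alpha> \<beta> A A' and j i :: nat and \<Lambda> :: "nat set"
  assumes AA: "(A, A') \<in> level_pairs p n \<alpha> \<beta>" and sf: "same_fibres p \<alpha> \<beta>"
    and \<Lambda>: "\<Lambda> = {} \<or> \<Lambda> = {a. a < p \<and> \<alpha> a = j} \<and> \<Lambda> = {a. a < p \<and> \<beta> a = i}"
begin

text \<open>One bound is weak and the other strict: the block \<Lambda> is counted in
  \<open>S0\<close> only, its counterpart in the second tuple being tied to it.\<close>

definition "S0 = {a. a < p \<and> \<alpha> a \<le> j}"
definition "S1 = {a. a < p \<and> \<beta> a < i}"
definition "S = (SIGMA g:{..<4 :: nat}. if even g then S0 else S1)"
definition "M = card S"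

text \<open>The columns with index in \<open>S\<close> span the submodule. For a in \<Lambda> and
  even g, column (g, a) is the sum of the basis vectors (g, a) and (g + 1, a).\<close>

definition E :: "nat \<times> nat \<Rightarrow> nat \<times> nat \<Rightarrow> complex" where
  "E \<iota> \<kappa> = (if \<iota> = \<kappa> \<or> odd (fst \<iota>) \<and> \<kappa> = (fst \<iota> - 1, snd \<iota>) \<and> snd \<iota> \<in> \<Lambda> then 1 else 0)"

lemma A: "A \<in> mtuples p n" and A': "A' \<in> mtuples p n"
  using AA unfolding level_pairs_def by auto

lemma \<Lambda>_D: "a \<in> \<Lambda> \<Longrightarrow> a < p \<and> \<alpha> a = j \<and> \<beta> a = i" "a \<in> \<Lambda> \<Longrightarrow> b < p \<Longrightarrow> \<alpha> b = j \<Longrightarrow> b \<in> \<Lambda>"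
  "a \<in> \<Lambda> \<Longrightarrow> b < p \<Longrightarrow> \<beta> b = i \<Longrightarrow> b \<in> \<Lambda>"
  using \<Lambda> by auto

lemma S_subset: "S \<subseteq> quad_index p"
  unfolding S_def S0_def S1_def by (auto split: if_splits)

lemma S_iff: "(g, a) \<in> S \<longleftrightarrow> g < 4 \<and> a < p \<and> (if even g then \<alpha> a \<le> j else \<beta> a < i)"
  unfolding S_def S0_def S1_def by auto

lemma finS: "finite S" by (rule finite_subset[OF S_subset]) simp

lemma M_eq: "M = 2 * (card S0 + card S1)"
proof -
  have "M = (\<Sum>g<4 :: nat. card (if even g then S0 else S1))"
    unfolding M_def S_def by (rule card_SigmaI) (auto simp: S0_def S1_def)
  also have "{..<4 :: nat} = {0, 1, 2, 3}" by auto
  finally show ?thesis by simp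
qed

lemma sum_column:
  assumes "\<kappa> \<in> quad_index p"
  shows "(\<Sum>\<iota>\<in>quad_index p. F \<iota> * E \<iota> \<kappa>) =
    F \<kappa> + (if even (fst \<kappa>) \<and> snd \<kappa> \<in> \<Lambda> then F (fst \<kappa> + 1, snd \<kappa>) else 0)"
proof -
  obtain g b where \<kappa>: "\<kappa> = (g, b)" "g < 4" "b < p" using assms by auto
  have "(\<Sum>\<iota>\<in>quad_index p. F \<iota> * E \<iota> \<kappa>) = (\<Sum>\<iota>\<in>quad_index p. (if \<iota> = \<kappa> then F \<kappa> else 0) +
    (if \<iota> = (g + 1, b) then (if even g \<and> b \<in> \<Lambda> then F (g + 1, b) else 0) else 0))"
  proof (intro sum.cong refl)
    fix \<iota> :: "nat \<times> nat" obtain g1 a where \<iota>: "\<iota> = (g1, a)" by (cases \<iota>)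
    have "odd g1 \<and> g = g1 - 1 \<longleftrightarrow> g1 = g + 1 \<and> even g" by (cases g1) auto
    thus "F \<iota> * E \<iota> \<kappa> = (if \<iota> = \<kappa> then F \<kappa> else 0) +
      (if \<iota> = (g + 1, b) then (if even g \<and> b \<in> \<Lambda> then F (g + 1, b) else 0) else 0)"
      unfolding E_def \<iota> \<kappa> by auto
  qed
  also have "\<dots> = F \<kappa> + (if even g \<and> b \<in> \<Lambda> then F (g + 1, b) else 0)"
  proof -
    have "g + 1 < 4" if "even g" using \<kappa>(2) that by (cases "g = 3") auto
    hence "(g + 1, b) \<in> quad_index p" if "even g" using that \<kappa>(3) by simp
    thus ?thesis unfolding sum.distrib using assms by (auto simp: sum.delta)
  qed
  finally show ?thesis unfolding \<kappa> by simp
qed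

lemma sum_row:
  assumes "\<iota> \<in> quad_index p"
  shows "(\<Sum>\<kappa>\<in>S. E \<iota> \<kappa> * F \<kappa>) = (if \<iota> \<in> S then F \<iota> else 0) +
    (if odd (fst \<iota>) \<and> snd \<iota> \<in> \<Lambda> then F (fst \<iota> - 1, snd \<iota>) else 0)"
proof -
  obtain g a where \<iota>: "\<iota> = (g, a)" "g < 4" "a < p" using assms by auto
  have "(\<Sum>\<kappa>\<in>S. E \<iota> \<kappa> * F \<kappa>) = (\<Sum>\<kappa>\<in>S. (if \<kappa> = \<iota> then F \<iota> else 0) +
    (if \<kappa> = (g - 1, a) then (if odd g \<and> a \<in> \<Lambda> then F (g - 1, a) else 0) else 0))"
  proof (intro sum.cong refl)
    fix \<kappa> :: "nat \<times> nat"
    have "odd g \<Longrightarrow> g - 1 \<noteq> g" by (cases g) auto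
    thus "E \<iota> \<kappa> * F \<kappa> = (if \<kappa> = \<iota> then F \<iota> else 0) +
      (if \<kappa> = (g - 1, a) then (if odd g \<and> a \<in> \<Lambda> then F (g - 1, a) else 0) else 0)"
      unfolding E_def \<iota> by auto
  qed
  also have "\<dots> = (if \<iota> \<in> S then F \<iota> else 0) + (if odd g \<and> a \<in> \<Lambda> then F (g - 1, a) else 0)"
  proof -
    have "(g - 1, a) \<in> S" if "odd g" "a \<in> \<Lambda>"
      using that \<Lambda>_D(1)[OF that(2)] \<iota> unfolding S_iff by auto
    thus ?thesis unfolding sum.distrib using finS by (auto simp: sum.delta)
  qed
  finally show ?thesis unfolding \<iota> by simp
qed

text \<open>The entries of the operator times \<open>E\<close>. Since \<open>E\<close> is the
  identity on the rows in \<open>S\<close>, the entries in these rows are the coordinates with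
  respect to the spanning columns.\<close>

definition c :: "nc \<times> nc \<Rightarrow> nat \<times> nat \<Rightarrow> nat \<times> nat \<Rightarrow> complex" where
  "c w \<iota> \<kappa> = quad_op p w (A, A') \<iota> \<kappa> +
    (if even (fst \<kappa>) \<and> snd \<kappa> \<in> \<Lambda> then quad_op p w (A, A') \<iota> (fst \<kappa> + 1, snd \<kappa>) else 0)"

text \<open>Rows outside \<open>S\<close> vanish by triangularity, except those of \<Lambda> in the
  second tuple. These must repeat the corresponding rows of the first tuple, and do so because the
  two tuples have the same diagonal block on \<Lambda>.\<close>

lemma c_invariant:
  assumes \<iota>: "\<iota> \<in> quad_index p" and \<kappa>: "\<kappa> \<in> S"
  shows "c w \<iota> \<kappa> = (\<Sum>\<kappa>'\<in>S. E \<iota> \<kappa>' * c w \<kappa>' \<kappa>)"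
proof -
  obtain g1 a g b where gg: "\<iota> = (g1, a)" "g1 < 4" "a < p" "\<kappa> = (g, b)" "g < 4" "b < p"
    using \<iota> \<kappa> S_subset by (cases \<iota>; cases \<kappa>) auto
  have Sk: "if even g then \<alpha> b \<le> j else \<beta> b < i" using \<kappa> unfolding gg S_iff by simp
  note LP = nc_eval_level_pairs[OF AA sf gg(3,6)]
  have *: "c w \<iota> \<kappa> = (if \<iota> \<in> S then c w \<iota> \<kappa> else 0) + (if odd g1 \<and> a \<in> \<Lambda> then c w (g1 - 1, a) \<kappa> else 0)"
  proof (cases "even g1")
    case True
    have "c w \<iota> \<kappa> = 0" if "\<iota> \<notin> S"
    proof -
      have "\<not> \<alpha> a \<le> j" using that gg True unfolding gg S_iff by simp
      hence "nc_eval p x A $$ (a, b) = 0" if "even g" for x using LP(1) Sk that by simp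
      thus ?thesis unfolding c_def gg quad_op_def using True by auto
    qed
    thus ?thesis using True by simp
  next
    case odd: False
    show ?thesis
    proof (cases "a \<in> \<Lambda>")
      case True
      have a: "\<alpha> a = j" "\<beta> a = i" using \<Lambda>_D(1)[OF True] by auto
      have notS: "\<iota> \<notin> S" unfolding gg S_iff using odd a by simp
      have "c w \<iota> \<kappa> = c w (g1 - 1, a) \<kappa>"
      proof (cases "even g")
        case False
        have "nc_eval p x A' $$ (a, b) = 0" for x using LP(2) Sk False a by simp
        moreover have "g1 - 1 \<noteq> g" using odd False by (cases g1) auto
        ultimately show ?thesis unfolding c_def gg quad_op_def using False odd by auto
      next
        case ev: True
        have ne: "g1 \<noteq> g" "g1 - 1 \<noteq> g + 1" using odd ev by (cases g1; auto)+
        have g1: "g1 - 1 = g \<longleftrightarrow> g1 = g + 1" using odd by (cases g1) auto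
        have lt: "g < 2 \<longleftrightarrow> g + 1 < 2" using ev by (cases "g = 1") auto
        show ?thesis
        proof (cases "g1 = g + 1")
          case False
          thus ?thesis unfolding c_def gg quad_op_def using ne g1 by simp
        next
          case g1g: True
          have "c w \<iota> \<kappa> = (if b \<in> \<Lambda> then nc_eval p (if g < 2 then fst w else snd w) A' $$ (a, b) else 0)"
            unfolding c_def gg quad_op_def using g1g ev lt by simp
          also have "\<dots> = nc_eval p (if g < 2 then fst w else snd w) A $$ (a, b)"
          proof (cases "b \<in> \<Lambda>")
            case True
            thus ?thesis using LP(3) a \<Lambda>_D(1)[OF True] by simp
          next
            case False
            hence "\<alpha> b \<noteq> j" using \<Lambda>_D(2)[OF True gg(6)] by blast
            hence "\<alpha> b < \<alpha> a" using Sk ev a by simp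
            thus ?thesis using LP(1) False by simp
          qed
          also have "\<dots> = c w (g1 - 1, a) \<kappa>" unfolding c_def gg quad_op_def using g1g ev by simp
          finally show ?thesis .
        qed
      qed
      thus ?thesis using notS odd True by simp
    next
      case False
      have "c w \<iota> \<kappa> = 0" if "\<iota> \<notin> S"
      proof -
        have ai: "\<not> \<beta> a < i" using that gg odd unfolding gg S_iff by simp
        have "nc_eval p x A' $$ (a, b) = 0" if "odd g" for x using LP(2) Sk that ai by simp
        moreover have "nc_eval p x A' $$ (a, b) = 0" if "b \<in> \<Lambda>" for x
        proof -
          have "\<beta> a \<noteq> i" using \<Lambda>_D(3)[OF that gg(3)] False by blast
          thus ?thesis using LP(2) ai \<Lambda>_D(1)[OF that] by simp
        qed
        ultimately show ?thesis unfolding c_def gg quad_op_def using odd by auto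
      qed
      thus ?thesis using False by simp
    qed
  qed
  show ?thesis unfolding sum_row[OF \<iota>] using * by (simp only: gg(1) fst_conv snd_conv)
qed

text \<open>The operators do not mix summands, so tying the two copies of \<Lambda> together leaves
  the diagonal unchanged. Both module copies then contribute the same function \<tau>.\<close>

lemma c_trace:
  assumes "w \<in> traceless_pairs" shows "(\<Sum>\<kappa>\<in>S. c w \<kappa> \<kappa>) = 0"
proof -
  define \<tau> where "\<tau> u = (\<Sum>a\<in>S0. nc_eval p u A $$ (a, a)) + (\<Sum>a\<in>S1. nc_eval p u A' $$ (a, a))" for u
  have "(\<Sum>\<kappa>\<in>S. c w \<kappa> \<kappa>) = (\<Sum>g<4 :: nat. \<Sum>a\<in>(if even g then S0 else S1). c w (g, a) (g, a))"
    unfolding S_def by (subst sum.Sigma) (auto simp: S0_def S1_def intro!: sum.cong)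
  also have "\<dots> = \<tau> (fst w) + \<tau> (snd w)"
  proof -
    have f4: "{..<4 :: nat} = {0, 1, 2, 3}" by auto
    have "c w (x, a) (x, a) = quad_op p w (A, A') (x, a) (x, a)" for x a
      unfolding c_def quad_op_def by simp
    thus ?thesis unfolding f4 \<tau>_def by (simp add: quad_op_def)
  qed
  finally have eq: "(\<Sum>\<kappa>\<in>S. c w \<kappa> \<kappa>) = \<tau> (fst w) + \<tau> (snd w)" .
  have comm: "\<tau> (nc_comm u v) = 0" for u v
  proof -
    have "(\<Sum>a\<in>S0. nc_eval p (nc_comm u v) A $$ (a, a)) = 0"
      by (rule commutator_trace_invariant_set[OF A]) (auto simp: S0_def intro!: nc_eval_level_pairs(1)[OF AA sf])
    moreover have "(\<Sum>a\<in>S1. nc_eval p (nc_comm u v) A' $$ (a, a)) = 0"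
      by (rule commutator_trace_invariant_set[OF A']) (auto simp: S1_def intro!: nc_eval_level_pairs(2)[OF AA sf])
    ultimately show ?thesis unfolding \<tau>_def by simp
  qed
  have sc: "\<tau> (NScale x u) = x * \<tau> u" for x u
  proof -
    have "(\<Sum>a\<in>S0. nc_eval p (NScale x u) A $$ (a, a)) = (\<Sum>a\<in>S0. x * nc_eval p u A $$ (a, a))"
      using nc_eval_carrier[OF A, of u] by (intro sum.cong refl) (simp add: S0_def)
    moreover have "(\<Sum>a\<in>S1. nc_eval p (NScale x u) A' $$ (a, a)) = (\<Sum>a\<in>S1. x * nc_eval p u A' $$ (a, a))"
      using nc_eval_carrier[OF A', of u] by (intro sum.cong refl) (simp add: S1_def)
    ultimately show ?thesis unfolding \<tau>_def by (simp add: sum_distrib_left distrib_left)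
  qed
  from assms show ?thesis unfolding eq traceless_pairs_def nc_zero_def using comm sc by auto
qed

text \<open>A row of \<Lambda> in the first tuple can be traded for its counterpart in the second
  without changing the minor. Trading the rows of \<open>R\<close> in the second module copy only
  realizes the shifted multidegree.\<close>

lemma pluecker_submodule:
  assumes g: "g \<in> GL p" and h: "h \<in> GL p" and R: "R \<subseteq> \<Lambda>"
  shows "\<exists>Q. (\<forall>d\<in>quad_op p ` traceless_pairs. \<exists>C\<in>carrier_mat M M. (\<Sum>t<M. C $$ (t, t)) = 0 \<and>
      (\<forall>\<iota>\<in>quad_index p. \<forall>s<M. (\<Sum>k\<in>quad_index p. d (conj_act p g A, conj_act p h A') \<iota> k * Q k s) =
        (\<Sum>t<M. Q \<iota> t * C $$ (t, s)))) \<and>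
    (\<exists>f\<in>PiE {..<M} (\<lambda>_. quad_index p). grade_count fst M f =
      (\<lambda>x. if x = 0 then card S0 else if x = 1 then card S1 else if x = 2 then card S0 - card R
        else if x = 3 then card S1 + card R else 0) \<and> minor M Q f \<noteq> 0)"
proof -
  obtain L where L0: "bij_betw L {0..<M} S" using ex_bij_betw_nat_finite[OF finS] unfolding M_def by blast
  hence L: "bij_betw L {..<M} S" by (simp add: atLeast0LessThan)
  have LS: "L t \<in> S" if "t < M" for t using bij_betwE[OF L] that by auto
  have LI: "L t \<in> quad_index p" if "t < M" for t using LS[OF that] S_subset by auto
  have Linj: "L t = L s \<longleftrightarrow> t = s" if "t < M" "s < M" for t s
    using bij_betw_imp_inj_on[OF L] that by (auto dest: inj_onD)
  have re: "(\<Sum>\<kappa>\<in>S. f \<kappa>) = (\<Sum>t<M. f (L t))" for f :: "nat \<times> nat \<Rightarrow> complex"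
    by (rule sum.reindex_bij_betw[OF L, symmetric])
  let ?I = "quad_index p" and ?y = "(conj_act p g A, conj_act p h A')"
  define Q where "Q \<iota> s = (\<Sum>k\<in>?I. quad_gl g h \<iota> k * E k (L s))" for \<iota> s
  have base: "(\<Sum>k\<in>?I. quad_op p w (A, A') \<iota> k * E k (L s)) = (\<Sum>t<M. E \<iota> (L t) * c w (L t) (L s))"
    if "\<iota> \<in> ?I" "s < M" for w \<iota> s
    using sum_column[OF LI[OF that(2)], of "quad_op p w (A, A') \<iota>"] c_invariant[OF that(1) LS[OF that(2)], of w]
    unfolding re c_def by simp
  have eqs: "(\<Sum>k\<in>?I. quad_op p w ?y \<iota> k * Q k s) = (\<Sum>t<M. Q \<iota> t * c w (L t) (L s))"
    if \<iota>: "\<iota> \<in> ?I" and s: "s < M" for w \<iota> s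
  proof -
    have "(\<Sum>k\<in>?I. quad_op p w ?y \<iota> k * Q k s) = (\<Sum>k\<in>?I. \<Sum>l\<in>?I. quad_op p w ?y \<iota> k * quad_gl g h k l * E l (L s))"
      unfolding Q_def sum_distrib_left by (simp add: mult.assoc)
    also have "\<dots> = (\<Sum>l\<in>?I. \<Sum>k\<in>?I. quad_op p w ?y \<iota> k * quad_gl g h k l * E l (L s))" by (rule sum.swap)
    also have "\<dots> = (\<Sum>l\<in>?I. (\<Sum>k\<in>?I. quad_gl g h \<iota> k * quad_op p w (A, A') k l) * E l (L s))"
    proof (rule sum.cong[OF refl])
      fix l assume l: "l \<in> ?I"
      show "(\<Sum>k\<in>?I. quad_op p w ?y \<iota> k * quad_gl g h k l * E l (L s)) =
        (\<Sum>k\<in>?I. quad_gl g h \<iota> k * quad_op p w (A, A') k l) * E l (L s)"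
        unfolding sum_distrib_right[symmetric] quad_op_conj[OF g h A A' \<iota> l] ..
    qed
    also have "\<dots> = (\<Sum>l\<in>?I. \<Sum>k\<in>?I. quad_gl g h \<iota> k * (quad_op p w (A, A') k l * E l (L s)))"
      unfolding sum_distrib_right by (simp add: mult.assoc)
    also have "\<dots> = (\<Sum>k\<in>?I. \<Sum>l\<in>?I. quad_gl g h \<iota> k * (quad_op p w (A, A') k l * E l (L s)))" by (rule sum.swap)
    also have "\<dots> = (\<Sum>k\<in>?I. quad_gl g h \<iota> k * (\<Sum>t<M. E k (L t) * c w (L t) (L s)))"
      by (rule sum.cong[OF refl]) (simp only: sum_distrib_left[symmetric] base[OF _ s])
    also have "\<dots> = (\<Sum>k\<in>?I. \<Sum>t<M. quad_gl g h \<iota> k * E k (L t) * c w (L t) (L s))"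
      unfolding sum_distrib_left by (simp add: mult.assoc)
    also have "\<dots> = (\<Sum>t<M. \<Sum>k\<in>?I. quad_gl g h \<iota> k * E k (L t) * c w (L t) (L s))" by (rule sum.swap)
    also have "\<dots> = (\<Sum>t<M. Q \<iota> t * c w (L t) (L s))" unfolding Q_def sum_distrib_right ..
    finally show ?thesis .
  qed
  have part1: "\<exists>C\<in>carrier_mat M M. (\<Sum>t<M. C $$ (t, t)) = 0 \<and>
      (\<forall>\<iota>\<in>?I. \<forall>s<M. (\<Sum>k\<in>?I. quad_op p w ?y \<iota> k * Q k s) = (\<Sum>t<M. Q \<iota> t * C $$ (t, s)))"
    if w: "w \<in> traceless_pairs" for w
  proof (intro bexI[of _ "mat M M (\<lambda>(t, s). c w (L t) (L s))"] conjI ballI allI impI)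
    show "(\<Sum>t<M. mat M M (\<lambda>(t, s). c w (L t) (L s)) $$ (t, t)) = 0"
      using c_trace[OF w] unfolding re by simp
  qed (simp_all add: eqs)
  \<comment> \<open>On the columns in \<open>S\<close>, row (3, a) of \<open>E\<close> equals row
    (2, a) for a in \<Lambda>, so the chosen rows still form an identity matrix.\<close>
  define \<phi> where "\<phi> \<kappa> = (if fst \<kappa> = 2 \<and> snd \<kappa> \<in> R then (3, snd \<kappa>) else \<kappa>)" for \<kappa> :: "nat \<times> nat"
  define f0 where "f0 t = (if t < M then \<phi> (L t) else undefined)" for t
  have \<phi>I: "\<phi> \<kappa> \<in> ?I" if "\<kappa> \<in> ?I" for \<kappa> using that unfolding \<phi>_def by auto
  have E\<phi>: "E (\<phi> \<kappa>) \<kappa>' = (if \<kappa> = \<kappa>' then 1 else 0)" if \<kappa>: "\<kappa> \<in> S" and \<kappa>': "\<kappa>' \<in> S" for \<kappa> \<kappa>'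
  proof (cases "fst \<kappa> = 2 \<and> snd \<kappa> \<in> R")
    case True
    then obtain a where a: "\<kappa> = (2, a)" "a \<in> R" "a \<in> \<Lambda>" using R by (cases \<kappa>) auto
    have "(3, a) \<notin> S" unfolding S_iff using \<Lambda>_D(1)[OF a(3)] by simp
    hence "\<kappa>' \<noteq> (3, a)" using \<kappa>' by blast
    thus ?thesis unfolding \<phi>_def E_def a(1) using a(2,3) by auto
  next
    case False
    have "snd \<kappa> \<notin> \<Lambda>" if "odd (fst \<kappa>)"
      using \<kappa> \<Lambda>_D(1)[of "snd \<kappa>"] that by (cases \<kappa>) (auto simp: S_iff)
    thus ?thesis unfolding \<phi>_def E_def using False by auto
  qed
  \<comment> \<open>Undoing the conjugation expresses this minor, which is 1, through minors of
    \<open>Q\<close>. The change of coordinates preserves grades, so some minor of the same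
    multidegree is nonzero.\<close>
  have "minor M (\<lambda>\<iota> s. \<Sum>k\<in>?I. quad_gl (ginv p g) (ginv p h) \<iota> k * Q k s) f0 = minor M (\<lambda>\<iota> s. E \<iota> (L s)) f0"
  proof -
    have "(\<Sum>k\<in>?I. quad_gl (ginv p g) (ginv p h) \<iota> k * Q k s) = E \<iota> (L s)" if \<iota>: "\<iota> \<in> ?I" for \<iota> s
    proof -
      have "(\<Sum>k\<in>?I. quad_gl (ginv p g) (ginv p h) \<iota> k * Q k s) =
        (\<Sum>k\<in>?I. \<Sum>l\<in>?I. quad_gl (ginv p g) (ginv p h) \<iota> k * quad_gl g h k l * E l (L s))"
        unfolding Q_def sum_distrib_left by (simp add: mult.assoc)
      also have "\<dots> = (\<Sum>l\<in>?I. (\<Sum>k\<in>?I. quad_gl (ginv p g) (ginv p h) \<iota> k * quad_gl g h k l) * E l (L s))"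
        unfolding sum_distrib_right by (rule sum.swap)
      also have "\<dots> = (\<Sum>l\<in>?I. (if \<iota> = l then 1 else 0) * E l (L s))"
        by (rule sum.cong[OF refl]) (simp only: quad_gl_inverse[OF g h \<iota>])
      also have "\<dots> = (\<Sum>l\<in>?I. if l = \<iota> then E \<iota> (L s) else 0)" by (rule sum.cong) auto
      finally show ?thesis using \<iota> by (simp add: sum.delta)
    qed
    thus ?thesis unfolding minor_def f0_def using \<phi>I LI
      by (intro arg_cong[of _ _ det] eq_matI) auto
  qed
  also have "mat M M (\<lambda>(r, s). E (f0 r) (L s)) = 1\<^sub>m M"
    using E\<phi>[OF LS LS] Linj by (intro eq_matI) (auto simp: f0_def)
  hence "minor M (\<lambda>\<iota> s. E \<iota> (L s)) f0 = 1" unfolding minor_def by simp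
  finally have "(\<Sum>f'\<in>PiE {..<M} (\<lambda>_. ?I). (\<Prod>r<M. quad_gl (ginv p g) (ginv p h) (f0 r) (f' r)) * minor M Q f') \<noteq> 0"
    by (subst (asm) minor_expansion) auto
  then obtain f' where f': "f' \<in> PiE {..<M} (\<lambda>_. ?I)" "(\<Prod>r<M. quad_gl (ginv p g) (ginv p h) (f0 r) (f' r)) * minor M Q f' \<noteq> 0"
    by (rule sum.not_neutral_contains_not_neutral)
  have "fst (f0 r) = fst (f' r)" if "r < M" for r
  proof -
    have "quad_gl (ginv p g) (ginv p h) (f0 r) (f' r) \<noteq> 0" using f'(2) that by auto
    thus ?thesis unfolding quad_gl_def by (auto split: if_splits)
  qed
  hence "grade_count fst M f' = grade_count fst M f0" by (intro grade_count_cong) simp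
  also have "\<dots> = (\<lambda>x. if x = 0 then card S0 else if x = 1 then card S1 else if x = 2 then card S0 - card R
        else if x = 3 then card S1 + card R else 0)"
  proof
    fix x
    have Rfin: "finite R" "R \<subseteq> S0" using R \<Lambda>_D(1) finite_subset[of R "{..<p}"] unfolding S0_def by auto
    have "grade_count fst M f0 x = card {\<kappa> \<in> S. fst (\<phi> \<kappa>) = x}"
    proof -
      have "bij_betw L {r. r < M \<and> fst (f0 r) = x} {\<kappa> \<in> S. fst (\<phi> \<kappa>) = x}"
        unfolding bij_betw_def
      proof
        show "inj_on L {r. r < M \<and> fst (f0 r) = x}" using Linj by (auto intro!: inj_onI)
        show "L ` {r. r < M \<and> fst (f0 r) = x} = {\<kappa> \<in> S. fst (\<phi> \<kappa>) = x}"
        proof (intro equalityI subsetI)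
          fix \<kappa> assume "\<kappa> \<in> {\<kappa> \<in> S. fst (\<phi> \<kappa>) = x}"
          moreover then obtain t where "t < M" "\<kappa> = L t" using bij_betw_imp_surj_on[OF L] by auto
          ultimately show "\<kappa> \<in> L ` {r. r < M \<and> fst (f0 r) = x}" unfolding f0_def by auto
        qed (use LS in \<open>auto simp: f0_def\<close>)
      qed
      thus ?thesis unfolding grade_count_def by (rule bij_betw_same_card)
    qed
    moreover have "{\<kappa> \<in> S. fst (\<phi> \<kappa>) = 0} = Pair 0 ` S0" "{\<kappa> \<in> S. fst (\<phi> \<kappa>) = 1} = Pair 1 ` S1"
      "{\<kappa> \<in> S. fst (\<phi> \<kappa>) = 2} = Pair 2 ` (S0 - R)"
      "{\<kappa> \<in> S. fst (\<phi> \<kappa>) = 3} = Pair 3 ` S1 \<union> Pair 2 ` R"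
      unfolding \<phi>_def S_def using Rfin(2) by (auto split: if_splits simp: image_iff)
    moreover have "card {\<kappa> \<in> S. fst (\<phi> \<kappa>) = x} = 0" if "x \<notin> {0, 1, 2, 3}"
    proof -
      have "fst (\<phi> \<kappa>) \<noteq> x" if "\<kappa> \<in> S" for \<kappa>
        using \<open>x \<notin> {0, 1, 2, 3}\<close> that S_subset unfolding \<phi>_def by (force split: if_splits)
      hence "{\<kappa> \<in> S. fst (\<phi> \<kappa>) = x} = {}" by blast
      thus ?thesis by (simp only: card.empty)
    qed
    moreover have "card (Pair y ` Z) = card Z" for y :: nat and Z :: "nat set" by (simp add: card_image inj_on_def)
    moreover have "card (Pair (3 :: nat) ` S1 \<union> Pair 2 ` R) = card S1 + card R"
    proof -
      have "finite S1" unfolding S1_def by simp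
      thus ?thesis using Rfin(1) by (subst card_Un_disjoint) (auto simp: card_image inj_on_def)
    qed
    moreover have "card (S0 - R) = card S0 - card R" by (rule card_Diff_subset[OF Rfin])
    ultimately show "grade_count fst M f0 x = (if x = 0 then card S0 else if x = 1 then card S1 else if x = 2 then card S0 - card R
        else if x = 3 then card S1 + card R else 0)" by (cases "x \<in> {0, 1, 2, 3}") auto
  qed
  finally show ?thesis using part1 f' by (intro exI[of _ Q]) auto
qed

end

section \<open>Generating pairs\<close>

lemma matrix_unit_mult:
  assumes "b < p" "c < p"
  shows "matrix_unit p p a b * matrix_unit p p c d = (if b = c then matrix_unit p p a d else 0\<^sub>m p p)"
proof (rule eq_matI)
  fix i j assume "i < dim_row (if b = c then matrix_unit p p a d else 0\<^sub>m p p)"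
    "j < dim_col (if b = c then matrix_unit p p a d else 0\<^sub>m p p)"
  hence ij: "i < p" "j < p" by (auto simp: matrix_unit_def split: if_splits)
  have "(matrix_unit p p a b * matrix_unit p p c d) $$ (i, j) =
    (\<Sum>k<p. matrix_unit p p a b $$ (i, k) * matrix_unit p p c d $$ (k, j))"
    by (rule mult_mat_entry[OF matrix_unit_carrier matrix_unit_carrier ij])
  also have "\<dots> = (\<Sum>k<p. if k = b then (if i = a \<and> b = c \<and> j = d then 1 else 0) else 0)"
    using ij by (intro sum.cong) (auto simp: matrix_unit_def)
  finally show "(matrix_unit p p a b * matrix_unit p p c d) $$ (i, j) =
    (if b = c then matrix_unit p p a d else 0\<^sub>m p p) $$ (i, j)"
    using ij assms by (auto simp: matrix_unit_def)
qed (auto simp: matrix_unit_def)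

lemma matrix_unit_corner:
  assumes "M \<in> carrier_mat p p" "a < p" "b < p"
  shows "matrix_unit p p a a * (M * matrix_unit p p b b) = M $$ (a, b) \<cdot>\<^sub>m matrix_unit p p a b"
proof (rule eq_matI)
  fix i j assume "i < dim_row (M $$ (a, b) \<cdot>\<^sub>m matrix_unit p p a b)" "j < dim_col (M $$ (a, b) \<cdot>\<^sub>m matrix_unit p p a b)"
  hence ij: "i < p" "j < p" by (auto simp: matrix_unit_def)
  show "(matrix_unit p p a a * (M * matrix_unit p p b b)) $$ (i, j) = (M $$ (a, b) \<cdot>\<^sub>m matrix_unit p p a b) $$ (i, j)"
    unfolding matrix_unit_sandwich[OF assms ij] using ij by (auto simp: matrix_unit_def)
qed (auto simp: matrix_unit_def)

lemma diag_gl_carrier: "diag_gl p d \<in> carrier_mat p p"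
  unfolding diag_gl_def by simp

lemma diag_gl_mult: "diag_gl p d * diag_gl p d' = diag_gl p (\<lambda>a. d a * d' a)"
proof (rule eq_matI)
  fix i j assume "i < dim_row (diag_gl p (\<lambda>a. d a * d' a))" "j < dim_col (diag_gl p (\<lambda>a. d a * d' a))"
  hence ij: "i < p" "j < p" by (auto simp: diag_gl_def)
  have "(diag_gl p d * diag_gl p d') $$ (i, j) = (\<Sum>k<p. diag_gl p d $$ (i, k) * diag_gl p d' $$ (k, j))"
    by (rule mult_mat_entry[OF diag_gl_carrier diag_gl_carrier ij])
  also have "\<dots> = (\<Sum>k<p. if k = i then (if i = j then d i * d' i else 0) else 0)"
    using ij by (intro sum.cong) (auto simp: diag_gl_def)
  finally show "(diag_gl p d * diag_gl p d') $$ (i, j) = diag_gl p (\<lambda>a. d a * d' a) $$ (i, j)"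
    using ij by (auto simp: diag_gl_def)
qed (auto simp: diag_gl_def)

text \<open>Lagrange interpolation in a diagonal matrix with distinct entries; the polynomial is the
  same for every such tuple.\<close>

lemma nc_diagonal_idempotent:
  assumes a: "a < p"
  shows "\<exists>w. \<forall>A \<in> mtuples p n. 0 < n \<longrightarrow> A ! 0 = diag_gl p of_nat \<longrightarrow> nc_eval p w A = matrix_unit p p a a"
proof -
  have "\<exists>w. \<forall>A \<in> mtuples p n. 0 < n \<longrightarrow> A ! 0 = diag_gl p of_nat \<longrightarrow>
      nc_eval p w A = diag_gl p (\<lambda>c. \<Prod>b\<in>B. of_nat c - of_nat b)" if "finite B" for B :: "nat set"
    using that
  proof induction
    case empty
    show ?case by (rule exI[of _ NOne]) (auto simp: diag_gl_def)
  next
    case (insert b B)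
    then obtain w where w: "\<And>A. A \<in> mtuples p n \<Longrightarrow> 0 < n \<Longrightarrow> A ! 0 = diag_gl p of_nat \<Longrightarrow>
      nc_eval p w A = diag_gl p (\<lambda>c. \<Prod>b\<in>B. of_nat c - of_nat b)" by blast
    let ?w = "NMul (NAdd (NVar 0) (NScale (- of_nat b) NOne)) w"
    have "nc_eval p ?w A = diag_gl p (\<lambda>c. \<Prod>b\<in>insert b B. of_nat c - of_nat b)"
      if A: "A \<in> mtuples p n" "0 < n" "A ! 0 = diag_gl p of_nat" for A
    proof -
      have "nc_eval p (NAdd (NVar 0) (NScale (- of_nat b) NOne)) A = diag_gl p (\<lambda>c. of_nat c - of_nat b)"
        using A mtuplesD(1)[OF A(1)] by (intro eq_matI) (auto simp: diag_gl_def)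
      thus ?thesis using w[OF A] insert.hyps by (simp add: diag_gl_mult)
    qed
    thus ?case by blast
  qed
  from this[of "{..<p} - {a}"] obtain w where w: "\<And>A. A \<in> mtuples p n \<Longrightarrow> 0 < n \<Longrightarrow> A ! 0 = diag_gl p of_nat \<Longrightarrow>
    nc_eval p w A = diag_gl p (\<lambda>c. \<Prod>b\<in>{..<p} - {a}. of_nat c - of_nat b)" by auto
  define x where "x = (\<Prod>b\<in>{..<p} - {a}. (of_nat a - of_nat b :: complex))"
  have x: "x \<noteq> 0" unfolding x_def by (auto simp: prod_zero_iff)
  have z: "(\<Prod>b\<in>{..<p} - {a}. (of_nat c - of_nat b :: complex)) = 0" if "c < p" "c \<noteq> a" for c
    using that by (auto simp: prod_zero_iff)
  have "nc_eval p (NScale (inverse x) w) A = matrix_unit p p a a"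
    if A: "A \<in> mtuples p n" "0 < n" "A ! 0 = diag_gl p of_nat" for A
    unfolding nc_eval.simps w[OF A] using x z by (intro eq_matI) (auto simp: diag_gl_def matrix_unit_def x_def)
  thus ?thesis by blast
qed

text \<open>Evaluation at the pair reaches a spanning set of all pairs of matrices that the levels
  permit.\<close>

definition generating_pair :: "nat \<Rightarrow> (nat \<Rightarrow> nat) \<Rightarrow> (nat \<Rightarrow> nat) \<Rightarrow> mtuple \<Rightarrow> mtuple \<Rightarrow> bool" where
  "generating_pair p \<alpha> \<beta> A A' \<longleftrightarrow> (\<forall>a<p. \<forall>b<p.
     (\<alpha> a < \<alpha> b \<longrightarrow> (\<exists>w. nc_eval p w A = matrix_unit p p a b \<and> nc_eval p w A' = 0\<^sub>m p p)) \<and>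
     (\<beta> a < \<beta> b \<longrightarrow> (\<exists>w. nc_eval p w A = 0\<^sub>m p p \<and> nc_eval p w A' = matrix_unit p p a b)) \<and>
     (\<alpha> a = \<alpha> b \<longrightarrow> (\<exists>w. nc_eval p w A = matrix_unit p p a b \<and> nc_eval p w A' = matrix_unit p p a b)))"

text \<open>Three matrices do it: a diagonal one with distinct entries isolates single entries, one
  with all permitted entries 1 supplies matrix units, and one that is strictly triangular in
  \<open>A\<close> and zero in \<open>A'\<close> tells the two tuples apart. Further matrices are
  zero.\<close>

lemma generating_pair_exists:
  assumes sf: "same_fibres p \<alpha> \<beta>" and n: "n \<ge> 3"
  shows "\<exists>A A'. (A, A') \<in> level_pairs p n \<alpha> \<beta> \<and> generating_pair p \<alpha> \<beta> A A'"
proof -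
  define A where "A = mk_tuple p n (\<lambda>m a b. if m = 0 then (if a = b then of_nat a else 0)
    else if m = 1 then (if \<alpha> a \<le> \<alpha> b then 1 else 0) else if m = 2 then (if \<alpha> a < \<alpha> b then 1 else 0) else 0)"
  define A' where "A' = mk_tuple p n (\<lambda>m a b. if m = 0 then (if a = b then of_nat a else 0)
    else if m = 1 then (if \<beta> a \<le> \<beta> b then 1 else 0) else 0)"
  have A: "A \<in> mtuples p n" "A' \<in> mtuples p n" unfolding A_def A'_def by (rule mk_tuple_mtuples)+
  have len: "length A = n" "length A' = n" using mtuplesD(1)[OF A(1)] mtuplesD(1)[OF A(2)] by auto
  have "(A, A') \<in> level_pairs p n \<alpha> \<beta>"
    unfolding level_pairs_def
  proof (clarify, intro conjI allI impI A)
    fix m a b assume m: "m < n" "a < p" "b < p"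
    have "\<alpha> a = \<alpha> b \<longleftrightarrow> \<beta> a = \<beta> b" using sf m unfolding same_fibres_def by auto
    thus "A ! m $$ (a, b) = A' ! m $$ (a, b)" if "\<alpha> a = \<alpha> b" using m that unfolding A_def A'_def by auto
  qed (auto simp: A_def A'_def)
  moreover have "generating_pair p \<alpha> \<beta> A A'"
    unfolding generating_pair_def
  proof (intro allI impI conjI)
    fix a b assume ab: "a < p" "b < p"
    have A0: "A ! 0 = diag_gl p of_nat" "A' ! 0 = diag_gl p of_nat"
      using n unfolding A_def A'_def mk_tuple_def diag_gl_def by (auto intro!: eq_matI)
    obtain u where u: "nc_eval p u A = matrix_unit p p a a" "nc_eval p u A' = matrix_unit p p a a"
      using nc_diagonal_idempotent[OF ab(1), of n] A A0 n by force
    obtain v where v: "nc_eval p v A = matrix_unit p p b b" "nc_eval p v A' = matrix_unit p p b b"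
      using nc_diagonal_idempotent[OF ab(2), of n] A A0 n by force
    have ev: "nc_eval p (NMul u (NMul w v)) A = nc_eval p w A $$ (a, b) \<cdot>\<^sub>m matrix_unit p p a b"
      "nc_eval p (NMul u (NMul w v)) A' = nc_eval p w A' $$ (a, b) \<cdot>\<^sub>m matrix_unit p p a b" for w
      unfolding nc_eval.simps u v
      by (rule matrix_unit_corner[OF nc_eval_carrier[OF A(1)] ab], rule matrix_unit_corner[OF nc_eval_carrier[OF A(2)] ab])
    have e1: "nc_eval p (NVar 1) A $$ (a, b) = (if \<alpha> a \<le> \<alpha> b then 1 else 0)"
      "nc_eval p (NVar 1) A' $$ (a, b) = (if \<beta> a \<le> \<beta> b then 1 else 0)"
      "nc_eval p (NVar 2) A $$ (a, b) = (if \<alpha> a < \<alpha> b then 1 else 0)"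
      "nc_eval p (NVar 2) A' $$ (a, b) = 0"
      using n ab len unfolding A_def A'_def by auto
    have sc: "1 \<cdot>\<^sub>m matrix_unit p p a b = matrix_unit p p a b" "0 \<cdot>\<^sub>m matrix_unit p p a b = 0\<^sub>m p p"
      by (auto intro!: eq_matI simp: matrix_unit_def)
    have fib: "\<alpha> a = \<alpha> b \<longleftrightarrow> \<beta> a = \<beta> b" using sf ab unfolding same_fibres_def by auto
    let ?w1 = "NMul u (NMul (NVar 1) v)" and ?w2 = "NMul u (NMul (NVar 2) v)"
    show s: "\<exists>w. nc_eval p w A = matrix_unit p p a b \<and> nc_eval p w A' = 0\<^sub>m p p" if "\<alpha> a < \<alpha> b"
      using ev[of "NVar 2"] that unfolding e1 sc by (intro exI[of _ ?w2]) (simp add: sc)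
    show "\<exists>w. nc_eval p w A = matrix_unit p p a b \<and> nc_eval p w A' = matrix_unit p p a b" if "\<alpha> a = \<alpha> b"
      using ev[of "NVar 1"] that fib unfolding e1 by (intro exI[of _ ?w1]) (simp add: sc)
    show "\<exists>w. nc_eval p w A = 0\<^sub>m p p \<and> nc_eval p w A' = matrix_unit p p a b" if \<beta>: "\<beta> a < \<beta> b"
    proof (cases "\<alpha> a < \<alpha> b")
      case False
      hence "\<not> \<alpha> a \<le> \<alpha> b" using fib \<beta> by auto
      thus ?thesis using ev[of "NVar 1"] \<beta> unfolding e1 by (intro exI[of _ ?w1]) (simp add: sc)
    next
      case True
      then obtain w where w: "nc_eval p w A = matrix_unit p p a b" "nc_eval p w A' = 0\<^sub>m p p" using s by blast
      have w1: "nc_eval p ?w1 A = matrix_unit p p a b" "nc_eval p ?w1 A' = matrix_unit p p a b"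
        using ev[of "NVar 1"] \<beta> True unfolding e1 by (simp_all add: sc)
      \<comment> \<open>Entry (a, b) is permitted in both tuples here; the unit acting on both,
        minus the one acting on \<open>A\<close> alone, acts on \<open>A'\<close> alone.\<close>
      have "nc_eval p (NAdd ?w1 (NScale (- 1) w)) A = 0\<^sub>m p p"
        "nc_eval p (NAdd ?w1 (NScale (- 1) w)) A' = matrix_unit p p a b"
        unfolding nc_eval.simps(3,5) w1 w by (auto intro!: eq_matI simp: matrix_unit_def)
      thus ?thesis by blast
    qed
  qed
  ultimately show ?thesis by blast
qed

lemma quad_op_single:
  assumes g: "g < 4" and ab: "a < p" "b < p"
    and u: "\<And>x. x < 4 \<Longrightarrow> nc_eval p (if x < 2 then fst w else snd w) (if even x then A else A') =
      (if x = g then matrix_unit p p a b else 0\<^sub>m p p)"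
  shows "\<forall>i\<in>quad_index p. \<forall>j\<in>quad_index p. quad_op p w (A, A') i j = (if i = (g, a) \<and> j = (g, b) then 1 else 0)"
proof (intro ballI)
  fix i j assume ij: "i \<in> quad_index p" "j \<in> quad_index p"
  obtain x c y d where x: "i = (x, c)" "j = (y, d)" by (cases i; cases j) auto
  show "quad_op p w (A, A') i j = (if i = (g, a) \<and> j = (g, b) then 1 else 0)"
  proof (cases "x = y")
    case False
    thus ?thesis unfolding x quad_op_def by auto
  next
    case True
    have "quad_op p w (A, A') i j = nc_eval p (if x < 2 then fst w else snd w) (if even x then A else A') $$ (c, d)"
      unfolding x quad_op_def using True by simp
    also have "\<dots> = (if x = g then matrix_unit p p a b else 0\<^sub>m p p) $$ (c, d)" using u[of x] ij x by simp
    finally show ?thesis using ij True unfolding x by (auto simp: matrix_unit_def)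
  qed
qed

text \<open>An off-diagonal matrix unit is its own commutator with a diagonal one, so it is
  available among the elements of trace 0.\<close>

lemma nc_comm_units:
  assumes "a < p" "b < p" "a \<noteq> b" "nc_eval p u A = matrix_unit p p a a"
  shows "nc_eval p v A = matrix_unit p p a b \<Longrightarrow> nc_eval p (nc_comm u v) A = matrix_unit p p a b"
    "nc_eval p v A = 0\<^sub>m p p \<Longrightarrow> nc_eval p (nc_comm u v) A = 0\<^sub>m p p"
proof -
  have z: "(0\<^sub>m p p :: complex mat) + (- 1) \<cdot>\<^sub>m 0\<^sub>m p p = 0\<^sub>m p p"
    by (rule eq_matI) simp_all
  have m: "matrix_unit p p a b + (- 1) \<cdot>\<^sub>m 0\<^sub>m p p = matrix_unit p p a b"
    by (rule eq_matI) (simp_all add: matrix_unit_def)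
  show "nc_eval p (nc_comm u v) A = matrix_unit p p a b" if v: "nc_eval p v A = matrix_unit p p a b"
    unfolding nc_comm_def nc_eval.simps assms(4) v matrix_unit_mult[OF assms(1,1)] matrix_unit_mult[OF assms(2,1)]
    unfolding if_not_P[OF assms(3)[symmetric]] if_P[OF refl] by (rule m)
  show "nc_eval p (nc_comm u v) A = 0\<^sub>m p p" if v: "nc_eval p v A = 0\<^sub>m p p"
    unfolding nc_comm_def nc_eval.simps assms(4) v
      right_mult_zero_mat[OF matrix_unit_carrier] left_mult_zero_mat[OF matrix_unit_carrier] by (rule z)
qed

text \<open>
  The four sets are the index sets of a Pluecker coordinate of the limit submodule in the two tuples
  and their copies; \<open>r\<close> is the part of the common block moved from the first tuple to the second.
\<close>
lemma limit_index_sets: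
  assumes gen: "generating_pair p \<alpha> \<beta> A A'" and AA: "A \<in> mtuples p n" "A' \<in> mtuples p n"
    and cl: "(A, A') \<in> pair_zariski p n closure_of pair_orbit p (level_pairs p n \<alpha>' \<beta>')"
    and sf': "same_fibres p \<alpha>' \<beta>'"
    and \<Lambda>: "\<Lambda> = {} \<or> \<Lambda> = {a. a < p \<and> \<alpha>' a = j} \<and> \<Lambda> = {a. a < p \<and> \<beta>' a = i}"
    and r: "r \<le> card \<Lambda>"
  shows "\<exists>I I' J J'. I \<subseteq> {..<p} \<and> I' \<subseteq> {..<p} \<and> J \<subseteq> {..<p} \<and> J' \<subseteq> {..<p} \<and>
    card I = card {a. a < p \<and> \<alpha>' a \<le> j} \<and> card I' = card {a. a < p \<and> \<beta>' a < i} \<and>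
    card J = card {a. a < p \<and> \<alpha>' a \<le> j} - r \<and> card J' = card {a. a < p \<and> \<beta>' a < i} + r \<and>
    (\<forall>a<p. \<forall>b<p. (\<alpha> a < \<alpha> b \<longrightarrow> (b \<in> I \<longrightarrow> a \<in> I) \<and> (b \<in> J \<longrightarrow> a \<in> J)) \<and>
      (\<beta> a < \<beta> b \<longrightarrow> (b \<in> I' \<longrightarrow> a \<in> I') \<and> (b \<in> J' \<longrightarrow> a \<in> J')) \<and>
      (\<alpha> a = \<alpha> b \<longrightarrow> of_bool (a \<in> I) + of_bool (a \<in> I') = of_bool (b \<in> I) + (of_bool (b \<in> I') :: nat))) \<and>
    (\<forall>a<p. of_bool (a \<in> I) + of_bool (a \<in> I') = of_bool (a \<in> J) + (of_bool (a \<in> J') :: nat))"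
proof -
  let ?q = "card {a. a < p \<and> \<alpha>' a \<le> j}" and ?q' = "card {a. a < p \<and> \<beta>' a < i}"
  define M where "M = 2 * (?q + ?q')"
  define P where "P = (\<lambda>x :: nat. if x = 0 then ?q else if x = 1 then ?q' else if x = 2 then ?q - r
    else if x = 3 then ?q' + r else 0)"
  let ?D = "quad_op p ` traceless_pairs" and ?x = "(A, A')"
  obtain R where R: "R \<subseteq> \<Lambda>" "card R = r" by (rule obtain_subset_with_card_n[OF r])
  have "\<exists>f\<in>PiE {..<M} (\<lambda>_. quad_index p). grade_count fst M f = P \<and> inj_on f {..<M} \<and>
    (\<forall>d\<in>?D. \<forall>a\<in>quad_index p. \<forall>b\<in>quad_index p. a \<noteq> b \<longrightarrow>
       (\<forall>i\<in>quad_index p. \<forall>j\<in>quad_index p. d ?x i j = (if i = a \<and> j = b then 1 else 0)) \<longrightarrow>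
       b \<in> f ` {..<M} \<longrightarrow> a \<in> f ` {..<M}) \<and>
    (\<forall>d\<in>?D. \<forall>\<delta>. (\<forall>i\<in>quad_index p. \<forall>j\<in>quad_index p. d ?x i j = (if i = j then \<delta> i else 0)) \<longrightarrow> (\<Sum>r<M. \<delta> (f r)) = 0)"
  proof (rule surviving_row_tuple)
    show "pair_orbit p (level_pairs p n \<alpha>' \<beta>') \<subseteq> mtuples p n \<times> mtuples p n"
      by (rule pair_orbit_subset[OF level_pairs_subset])
    show "?x \<in> zariski (mtuples p n \<times> mtuples p n) (pair_coords p n) closure_of pair_orbit p (level_pairs p n \<alpha>' \<beta>')"
      using cl unfolding pair_zariski_def .
  next
    fix d i j assume "d \<in> ?D" and ij: "i \<in> quad_index p" "j \<in> quad_index p"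
    then obtain w where d: "d = quad_op p w" by auto
    show "regular_on (mtuples p n \<times> mtuples p n) (pair_coords p n) (\<lambda>y. d y i j)"
    proof (cases "fst i = fst j")
      case False
      thus ?thesis unfolding d quad_op_def by (simp add: regular_on_const)
    next
      case True
      have "snd i < p" "snd j < p" using ij by auto
      thus ?thesis unfolding d quad_op_def using True
        by (cases "even (fst i)") (simp_all add: regular_on_pair_nc_eval)
    qed
  next
    fix d :: "mtuple \<times> mtuple \<Rightarrow> nat \<times> nat \<Rightarrow> nat \<times> nat \<Rightarrow> complex" and y and i j :: "nat \<times> nat"
    assume "d \<in> ?D" "fst i \<noteq> fst (j :: nat \<times> nat)"
    thus "d y i j = 0" by (auto simp: quad_op_def)
  next
    fix y assume "y \<in> pair_orbit p (level_pairs p n \<alpha>' \<beta>')"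
    then obtain g h B B' where y: "y = (conj_act p g B, conj_act p h B')" "g \<in> GL p" "h \<in> GL p"
      "(B, B') \<in> level_pairs p n \<alpha>' \<beta>'" unfolding pair_orbit_def by blast
    interpret MS: matched_step p n \<alpha>' \<beta>' B B' j i \<Lambda> by unfold_locales (fact y(4) sf' \<Lambda>)+
    have Mq: "MS.M = M" unfolding MS.M_eq MS.S0_def MS.S1_def M_def ..
    show "\<exists>Q. (\<forall>d\<in>?D. \<exists>C\<in>carrier_mat M M. (\<Sum>t<M. C $$ (t, t)) = 0 \<and>
          (\<forall>i\<in>quad_index p. \<forall>s<M. (\<Sum>j\<in>quad_index p. d y i j * Q j s) = (\<Sum>t<M. Q i t * C $$ (t, s)))) \<and>
        (\<exists>f\<in>PiE {..<M} (\<lambda>_. quad_index p). grade_count fst M f = P \<and> minor M Q f \<noteq> 0)"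
      using MS.pluecker_submodule[OF y(2,3) R(1)] unfolding Mq y(1) P_def R(2) MS.S0_def MS.S1_def .
  qed simp
  then obtain f where f: "f \<in> PiE {..<M} (\<lambda>_. quad_index p)" "grade_count fst M f = P" "inj_on f {..<M}"
    and mv0: "\<forall>d\<in>?D. \<forall>a\<in>quad_index p. \<forall>b\<in>quad_index p. a \<noteq> b \<longrightarrow>
       (\<forall>i\<in>quad_index p. \<forall>j\<in>quad_index p. d ?x i j = (if i = a \<and> j = b then 1 else 0)) \<longrightarrow>
       b \<in> f ` {..<M} \<longrightarrow> a \<in> f ` {..<M}"
    and wt0: "\<forall>d\<in>?D. \<forall>\<delta>. (\<forall>i\<in>quad_index p. \<forall>j\<in>quad_index p. d ?x i j = (if i = j then \<delta> i else 0)) \<longrightarrow>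
       (\<Sum>r<M. \<delta> (f r)) = 0"
    by (elim bexE conjE)
  have mv: "a \<in> f ` {..<M}" if w: "w \<in> traceless_pairs" and ab: "a \<in> quad_index p" "b \<in> quad_index p" "a \<noteq> b"
    "\<forall>i\<in>quad_index p. \<forall>j\<in>quad_index p. quad_op p w ?x i j = (if i = a \<and> j = b then 1 else 0)"
    "b \<in> f ` {..<M}" for w a b
    using bspec[OF bspec[OF bspec[OF mv0 imageI[OF w]] ab(1)] ab(2)] ab(3-5) by (elim impE)
  have wt: "(\<Sum>r<M. \<delta> (f r)) = 0" if w: "w \<in> traceless_pairs" and
    d: "\<forall>i\<in>quad_index p. \<forall>j\<in>quad_index p. quad_op p w ?x i j = (if i = j then \<delta> i else 0)" for w \<delta>
    using spec[OF bspec[OF wt0 imageI[OF w]], of \<delta>] d by (rule mp)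
  \<comment> \<open>\<open>N 0\<close> and \<open>N 1\<close> belong to the two tuples,
    \<open>N 2\<close> and \<open>N 3\<close> to their copies.\<close>
  define N where "N g = {a. a < p \<and> (g, a) \<in> f ` {..<M}}" for g :: nat
  have fI: "f t \<in> quad_index p" if "t < M" for t using f(1) that by (auto simp: PiE_iff)
  have cardN: "card (N g) = P g" for g
  proof -
    have "bij_betw (\<lambda>t. snd (f t)) {t. t < M \<and> fst (f t) = g} (N g)"
      unfolding bij_betw_def
    proof
      show "inj_on (\<lambda>t. snd (f t)) {t. t < M \<and> fst (f t) = g}"
      proof (rule inj_onI)
        fix s t assume "s \<in> {t. t < M \<and> fst (f t) = g}" "t \<in> {t. t < M \<and> fst (f t) = g}" "snd (f s) = snd (f t)"
        hence "s < M" "t < M" "f s = f t" by (auto intro: prod_eqI)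
        thus "s = t" using f(3) by (auto dest: inj_onD)
      qed
      show "(\<lambda>t. snd (f t)) ` {t. t < M \<and> fst (f t) = g} = N g"
      proof (intro equalityI subsetI)
        fix a assume "a \<in> (\<lambda>t. snd (f t)) ` {t. t < M \<and> fst (f t) = g}"
        then obtain t where t: "t < M" "fst (f t) = g" "a = snd (f t)" by auto
        have "f t = (g, a)" using t by (auto intro: prod_eqI)
        thus "a \<in> N g" unfolding N_def using fI[OF t(1)] t(1) by force
      next
        fix a assume "a \<in> N g"
        then obtain t where "t < M" "f t = (g, a)" unfolding N_def by force
        thus "a \<in> (\<lambda>t. snd (f t)) ` {t. t < M \<and> fst (f t) = g}" by force
      qed
    qed
    hence "card {t. t < M \<and> fst (f t) = g} = card (N g)" by (rule bij_betw_same_card)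
    thus ?thesis unfolding f(2)[symmetric] grade_count_def by simp
  qed
  have sumN: "(\<Sum>t<M. \<delta> (f t)) = (\<Sum>g<4. \<Sum>a\<in>N g. \<delta> (g, a))" for \<delta> :: "nat \<times> nat \<Rightarrow> complex"
  proof -
    have "f ` {..<M} = (SIGMA g:{..<4}. N g)" unfolding N_def using fI by fastforce
    moreover have "(\<Sum>t<M. \<delta> (f t)) = (\<Sum>\<kappa>\<in>f ` {..<M}. \<delta> \<kappa>)"
      unfolding sum.reindex[OF f(3)] o_def ..
    moreover have "(\<Sum>g<4. \<Sum>a\<in>N g. \<delta> (g, a)) = (\<Sum>(g, a)\<in>(SIGMA g:{..<4}. N g). \<delta> (g, a))"
      by (rule sum.Sigma) (auto simp: N_def)
    ultimately show ?thesis by (simp only: case_prod_eta)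
  qed
  have f4: "{..<4 :: nat} = {0, 1, 2, 3}" by auto
  have finN: "finite (N g)" for g unfolding N_def by simp
  have dlt: "(\<Sum>a\<in>N g. if a = b then z else 0) = (if b \<in> N g then z else (0 :: complex))" for g b z
    using finN by (simp add: sum.delta)
  have unit: "\<exists>u. nc_eval p u A = matrix_unit p p a a \<and> nc_eval p u A' = matrix_unit p p a a" if "a < p" for a
    using gen that unfolding generating_pair_def by blast
  have x4: "x = 0 \<or> x = 1 \<or> x = 2 \<or> x = 3" if "x < 4" for x :: nat using that by auto
  have z0: "nc_eval p nc_zero B = 0\<^sub>m p p" for B unfolding nc_zero_def by (intro eq_matI) auto
  \<comment> \<open>A commutator acting as a single matrix unit in one summand and as 0 in the other
    three gives closure under that summand's order.\<close>
  have move: "a \<in> N g" if g: "g < 4" and ab: "a < p" "b < p" "(if even g then \<alpha> a < \<alpha> b else \<beta> a < \<beta> b)" and b: "b \<in> N g" for g a b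
  proof -
    have ne: "a \<noteq> b" using ab(3) by (auto split: if_splits)
    obtain u where u: "nc_eval p u A = matrix_unit p p a a" "nc_eval p u A' = matrix_unit p p a a" using unit[OF ab(1)] by blast
    obtain v where v: "nc_eval p v A = (if even g then matrix_unit p p a b else 0\<^sub>m p p)"
      "nc_eval p v A' = (if even g then 0\<^sub>m p p else matrix_unit p p a b)"
      using gen ab unfolding generating_pair_def by (cases "even g") auto
    have c: "nc_eval p (nc_comm u v) A = (if even g then matrix_unit p p a b else 0\<^sub>m p p)"
      "nc_eval p (nc_comm u v) A' = (if even g then 0\<^sub>m p p else matrix_unit p p a b)"
      using nc_comm_units[OF ab(1,2) ne u(1), of v] nc_comm_units[OF ab(1,2) ne u(2), of v] v by (auto split: if_splits)
    define w where "w = (if g < 2 then (nc_comm u v, nc_zero) else (nc_zero, nc_comm u v))"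
    have w: "w \<in> traceless_pairs" unfolding w_def traceless_pairs_def by auto
    have "nc_eval p (if x < 2 then fst w else snd w) (if even x then A else A') =
      (if x = g then matrix_unit p p a b else 0\<^sub>m p p)" if "x < 4" for x
      using x4[OF that] x4[OF g] c unfolding w_def by (elim disjE) (simp_all add: z0)
    hence "\<forall>i\<in>quad_index p. \<forall>j\<in>quad_index p. quad_op p w (A, A') i j = (if i = (g, a) \<and> j = (g, b) then 1 else 0)"
      by (intro quad_op_single[OF g ab(1,2)])
    hence "(g, a) \<in> f ` {..<M}" using mv[OF w, of "(g, a)" "(g, b)"] b g ab ne unfolding N_def by simp
    thus ?thesis unfolding N_def using ab(1) by simp
  qed
  \<comment> \<open>The commutator of the units (a, b) and (b, a) is diagonal with weights 1 at a
    and -1 at b. It acts on both tuples alike, so only the total weight over the two tuples is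
    controlled.\<close>
  have balance: "of_bool (a \<in> N 0) + of_bool (a \<in> N 1) = of_bool (b \<in> N 0) + (of_bool (b \<in> N 1) :: nat)"
    if ab: "a < p" "b < p" "\<alpha> a = \<alpha> b" for a b
  proof (cases "a = b")
    case False
    obtain u where u: "nc_eval p u A = matrix_unit p p a b" "nc_eval p u A' = matrix_unit p p a b"
      using gen ab unfolding generating_pair_def by blast
    obtain v where v: "nc_eval p v A = matrix_unit p p b a" "nc_eval p v A' = matrix_unit p p b a"
      using gen ab unfolding generating_pair_def by metis
    define \<delta> where "\<delta> \<kappa> = (if fst \<kappa> < (2 :: nat) then (if snd \<kappa> = a then 1 else 0) - (if snd \<kappa> = b then 1 else 0) else (0 :: complex))" for \<kappa>
    have w: "(nc_comm u v, nc_zero) \<in> traceless_pairs" unfolding traceless_pairs_def by auto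
    have "\<forall>i\<in>quad_index p. \<forall>j\<in>quad_index p. quad_op p (nc_comm u v, nc_zero) ?x i j = (if i = j then \<delta> i else 0)"
      using u v ab False unfolding quad_op_def nc_comm_def \<delta>_def
      by (auto simp: matrix_unit_mult z0) (auto simp: matrix_unit_def)
    from wt[OF w this] have "(\<Sum>g<4. \<Sum>a\<in>N g. \<delta> (g, a)) = 0" unfolding sumN .
    hence "complex_of_nat (of_bool (a \<in> N 0) + of_bool (a \<in> N 1)) = of_nat (of_bool (b \<in> N 0) + of_bool (b \<in> N 1))"
      unfolding f4 \<delta>_def by (simp add: sum_subtractf dlt split: if_splits)
    thus ?thesis by (simp only: of_nat_eq_iff)
  qed simp
  \<comment> \<open>The diagonal unit at a, with opposite signs on the two copies, compares the
    total weight of a in one copy with that in the other.\<close>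
  have same_weight: "of_bool (a \<in> N 0) + of_bool (a \<in> N 1) = of_bool (a \<in> N 2) + (of_bool (a \<in> N 3) :: nat)" if a: "a < p" for a
  proof -
    obtain u where u: "nc_eval p u A = matrix_unit p p a a" "nc_eval p u A' = matrix_unit p p a a" using unit[OF a] by blast
    define \<delta> where "\<delta> \<kappa> = (if snd \<kappa> = a then (if fst \<kappa> < (2 :: nat) then 1 else - 1) else (0 :: complex))" for \<kappa>
    have \<delta>0: "\<delta> (0, x) = (if x = a then 1 else 0)" "\<delta> (1, x) = (if x = a then 1 else 0)"
      "\<delta> (Suc 0, x) = (if x = a then 1 else 0)"
      "\<delta> (2, x) = (if x = a then - 1 else 0)" "\<delta> (3, x) = (if x = a then - 1 else 0)" for x
      by (simp_all add: \<delta>_def)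
    have w: "(u, NScale (- 1) u) \<in> traceless_pairs" unfolding traceless_pairs_def by auto
    have "\<forall>i\<in>quad_index p. \<forall>j\<in>quad_index p. quad_op p (u, NScale (- 1) u) ?x i j = (if i = j then \<delta> i else 0)"
      using u a unfolding quad_op_def \<delta>_def by (auto simp: matrix_unit_def)
    from wt[OF w this] have "(\<Sum>g<4. \<Sum>a\<in>N g. \<delta> (g, a)) = 0" unfolding sumN .
    hence "complex_of_nat (of_bool (a \<in> N 0) + of_bool (a \<in> N 1)) = of_nat (of_bool (a \<in> N 2) + of_bool (a \<in> N 3))"
      unfolding f4 by (simp add: \<delta>0 dlt split: if_splits)
    thus ?thesis by (simp only: of_nat_eq_iff)
  qed
  have cards: "card (N 0) = ?q" "card (N 1) = ?q'" "card (N 2) = ?q - r" "card (N 3) = ?q' + r"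
    unfolding cardN P_def by simp_all
  have sub: "N g \<subseteq> {..<p}" for g unfolding N_def by auto
  have order: "\<forall>a<p. \<forall>b<p. (\<alpha> a < \<alpha> b \<longrightarrow> (b \<in> N 0 \<longrightarrow> a \<in> N 0) \<and> (b \<in> N 2 \<longrightarrow> a \<in> N 2)) \<and>
      (\<beta> a < \<beta> b \<longrightarrow> (b \<in> N 1 \<longrightarrow> a \<in> N 1) \<and> (b \<in> N 3 \<longrightarrow> a \<in> N 3)) \<and>
      (\<alpha> a = \<alpha> b \<longrightarrow> of_bool (a \<in> N 0) + of_bool (a \<in> N 1) = of_bool (b \<in> N 0) + (of_bool (b \<in> N 1) :: nat))"
  proof (intro allI impI conjI)
    fix a b assume ab: "a < p" "b < p"
    { assume l: "\<alpha> a < \<alpha> b"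
      show "a \<in> N 0" if "b \<in> N 0" by (rule move[of 0]) (use ab l that in simp_all)
      show "a \<in> N 2" if "b \<in> N 2" by (rule move[of 2]) (use ab l that in simp_all) }
    { assume l: "\<beta> a < \<beta> b"
      show "a \<in> N 1" if "b \<in> N 1" by (rule move[of 1]) (use ab l that in simp_all)
      show "a \<in> N 3" if "b \<in> N 3" by (rule move[of 3]) (use ab l that in simp_all) }
    show "of_bool (a \<in> N 0) + of_bool (a \<in> N 1) = of_bool (b \<in> N 0) + (of_bool (b \<in> N 1) :: nat)"
      if "\<alpha> a = \<alpha> b" by (rule balance[OF ab that])
  qed
  have same: "\<forall>a<p. of_bool (a \<in> N 0) + of_bool (a \<in> N 1) = of_bool (a \<in> N 2) + (of_bool (a \<in> N 3) :: nat)"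
    using same_weight by (intro allI impI)
  show ?thesis
    by (rule exI[of _ "N 0"], rule exI[of _ "N 1"], rule exI[of _ "N 2"], rule exI[of _ "N 3"])
      (intro conjI sub cards order same)
qed

section \<open>Irredundancy\<close>

text \<open>A down-closed set may cut through a fibre, yet it is comparable with every initial
  segment; the cardinality then decides.\<close>

lemma down_closed_eq_initial:
  fixes \<alpha> :: "nat \<Rightarrow> nat"
  assumes I: "I \<subseteq> {..<p}" and dc: "\<And>a b. a < p \<Longrightarrow> b < p \<Longrightarrow> \<alpha> a < \<alpha> b \<Longrightarrow> b \<in> I \<Longrightarrow> a \<in> I"
    and c: "card I = card {a. a < p \<and> \<alpha> a < t}"
  shows "I = {a. a < p \<and> \<alpha> a < t}"
proof -
  let ?L = "{a. a < p \<and> \<alpha> a < t}"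
  have fin: "finite I" "finite ?L" using I finite_subset[OF I] by auto
  have "I \<subseteq> ?L \<or> ?L \<subseteq> I"
  proof (rule disjCI)
    assume "\<not> ?L \<subseteq> I"
    then obtain b where b: "b < p" "\<alpha> b < t" "b \<notin> I" by auto
    show "I \<subseteq> ?L"
    proof
      fix a assume a: "a \<in> I"
      hence "a < p" using I by auto
      have "\<not> \<alpha> b < \<alpha> a" using dc[OF b(1) \<open>a < p\<close> _ a] b(3) by blast
      thus "a \<in> ?L" using \<open>a < p\<close> b(2) by simp
    qed
  qed
  thus ?thesis
  proof
    assume "I \<subseteq> ?L" thus ?thesis by (rule card_subset_eq[OF fin(2) _ c])
  next
    assume "?L \<subseteq> I" thus ?thesis using card_subset_eq[OF fin(1) _ c[symmetric]] by blast
  qed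
qed

lemma card_initial_strict_mono:
  fixes \<alpha> :: "nat \<Rightarrow> nat"
  assumes onto: "\<forall>i<k. \<exists>a<p. \<alpha> a = i" and "s \<le> k" "t \<le> k"
  shows "card {a. a < p \<and> \<alpha> a < s} < card {a. a < p \<and> \<alpha> a < t} \<longleftrightarrow> s < t"
proof -
  have less: "card {a. a < p \<and> \<alpha> a < s} < card {a. a < p \<and> \<alpha> a < t}" if "s < t" "t \<le> k" for s t
  proof (rule psubset_card_mono)
    have "s < k" using that by simp
    then obtain a where "a < p" "\<alpha> a = s" using onto by blast
    thus "{a. a < p \<and> \<alpha> a < s} \<subset> {a. a < p \<and> \<alpha> a < t}" using \<open>s < t\<close> by auto
  qed simp
  show ?thesis using less[of s t] less[of t s] assms(2,3) by (cases s t rule: linorder_cases) auto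
qed

lemma order_preserving_permutation:
  fixes f :: "nat \<Rightarrow> nat"
  assumes f: "f permutes {..<k}" and mono: "\<And>a b. a < b \<Longrightarrow> b < k \<Longrightarrow> f a < f b"
  shows "f b = b"
proof (induction b rule: less_induct)
  case (less b)
  show ?case
  proof (cases "b < k")
    case True
    have "b \<le> f b"
    proof (rule ccontr)
      assume "\<not> b \<le> f b"
      hence "f (f b) = f b" using less by simp
      hence "f b = b" using permutes_inj[OF f] by (auto dest: injD)
      thus False using \<open>\<not> b \<le> f b\<close> by simp
    qed
    obtain c where c: "f c = b" using permutes_surj[OF f] by (metis surjD)
    have "c < k" using permutes_in_image[OF f, of c] c True by simp
    show ?thesis
    proof (cases c b rule: linorder_cases)
      case l: less thus ?thesis using less.IH[OF l] c by simp
    next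
      case equal thus ?thesis using c by simp
    next
      case greater thus ?thesis using mono[OF greater \<open>c < k\<close>] \<open>b \<le> f b\<close> c by simp
    qed
  qed (use f in \<open>simp add: permutes_def\<close>)
qed

text \<open>Unprimed data describe a generating pair, primed data the orbit whose closure contains
  it. The assumption \<open>lim\<close> is the conclusion of \<open>limit_index_sets\<close>; what
  remains is combinatorics of levels.\<close>

context
  fixes p k k' :: nat and \<alpha> \<beta> \<alpha>' \<beta>' \<sigma> \<sigma>' :: "nat \<Rightarrow> nat"
  assumes onto: "\<And>a. a < p \<Longrightarrow> \<alpha> a < k" "\<forall>i<k. \<exists>a<p. \<alpha> a = i"
    and onto': "\<And>a. a < p \<Longrightarrow> \<alpha>' a < k'" "\<forall>i<k'. \<exists>a<p. \<alpha>' a = i"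
    and perm: "\<sigma> permutes {..<k}" "\<And>a. a < p \<Longrightarrow> \<sigma> (\<beta> a) = \<alpha> a"
    and perm': "\<sigma>' permutes {..<k'}" "\<And>a. a < p \<Longrightarrow> \<sigma>' (\<beta>' a) = \<alpha>' a"
    and norev: "\<not> partial_reversal k \<sigma>"
    and lim: "\<And>\<Lambda> i j r. \<Lambda> = {} \<or> \<Lambda> = {a. a < p \<and> \<alpha>' a = j} \<and> \<Lambda> = {a. a < p \<and> \<beta>' a = i} \<Longrightarrow> r \<le> card \<Lambda> \<Longrightarrow>
      \<exists>I I' J J'. I \<subseteq> {..<p} \<and> I' \<subseteq> {..<p} \<and> J \<subseteq> {..<p} \<and> J' \<subseteq> {..<p} \<and>
    card I = card {a. a < p \<and> \<alpha>' a \<le> j} \<and> card I' = card {a. a < p \<and> \<beta>' a < i} \<and>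
    card J = card {a. a < p \<and> \<alpha>' a \<le> j} - r \<and> card J' = card {a. a < p \<and> \<beta>' a < i} + r \<and>
    (\<forall>a<p. \<forall>b<p. (\<alpha> a < \<alpha> b \<longrightarrow> (b \<in> I \<longrightarrow> a \<in> I) \<and> (b \<in> J \<longrightarrow> a \<in> J)) \<and>
      (\<beta> a < \<beta> b \<longrightarrow> (b \<in> I' \<longrightarrow> a \<in> I') \<and> (b \<in> J' \<longrightarrow> a \<in> J')) \<and>
      (\<alpha> a = \<alpha> b \<longrightarrow> of_bool (a \<in> I) + of_bool (a \<in> I') = of_bool (b \<in> I) + (of_bool (b \<in> I') :: nat))) \<and>
    (\<forall>a<p. of_bool (a \<in> I) + of_bool (a \<in> I') = of_bool (a \<in> J) + (of_bool (a \<in> J') :: nat))"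
begin

abbreviation "ini \<equiv> \<lambda>f t :: nat. card {a. a < p \<and> f a < (t :: nat)}"

lemma \<beta>_iff: "a < p \<Longrightarrow> \<beta> a = b \<longleftrightarrow> \<alpha> a = \<sigma> b"
  using perm(2) permutes_inj[OF perm(1)] by (metis injD)

lemma \<beta>'_iff: "a < p \<Longrightarrow> \<beta>' a = b \<longleftrightarrow> \<alpha>' a = \<sigma>' b"
  using perm'(2) permutes_inj[OF perm'(1)] by (metis injD)

lemma \<beta>_onto: "\<forall>b<k. \<exists>a<p. \<beta> a = b"
proof (intro allI impI)
  fix b assume "b < k"
  hence "\<sigma> b < k" using permutes_in_image[OF perm(1), of b] by simp
  then obtain a where "a < p" "\<alpha> a = \<sigma> b" using onto(2) by blast
  thus "\<exists>a<p. \<beta> a = b" using \<beta>_iff by blast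
qed

lemma \<beta>'_onto: "\<forall>b<k'. \<exists>a<p. \<beta>' a = b"
proof (intro allI impI)
  fix b assume "b < k'"
  hence "\<sigma>' b < k'" using permutes_in_image[OF perm'(1), of b] by simp
  then obtain a where "a < p" "\<alpha>' a = \<sigma>' b" using onto'(2) by blast
  thus "\<exists>a<p. \<beta>' a = b" using \<beta>'_iff by blast
qed

lemma initial_Suc: "ini f (Suc t) = ini f t + card {a. a < p \<and> f a = t}" for f :: "nat \<Rightarrow> nat"
proof -
  have "{a. a < p \<and> f a < Suc t} = {a. a < p \<and> f a < t} \<union> {a. a < p \<and> f a = t}" by auto
  thus ?thesis by (simp add: card_Un_disjoint disjoint_iff)
qed

text \<open>With i = 0 the second index set is empty. The balance inside blocks then makes the first
  one a union of fibres, hence an initial segment of \<alpha>.\<close>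

lemma limit_initial_is_initial: "\<exists>l\<le>k. ini \<alpha>' (Suc j) = ini \<alpha> l"
proof -
  obtain I I' where I: "I \<subseteq> {..<p}" "I' \<subseteq> {..<p}" "card I = card {a. a < p \<and> \<alpha>' a \<le> j}" "card I' = card {a. a < p \<and> \<beta>' a < 0}"
    and mv: "\<forall>a<p. \<forall>b<p. (\<alpha> a < \<alpha> b \<longrightarrow> b \<in> I \<longrightarrow> a \<in> I) \<and>
      (\<alpha> a = \<alpha> b \<longrightarrow> of_bool (a \<in> I) + of_bool (a \<in> I') = of_bool (b \<in> I) + (of_bool (b \<in> I') :: nat))"
    using lim[of "{}" j 0 0] by (simp del: of_bool_eq_iff) (elim exE conjE, meson)
  have "I' = {}" using I(2,4) finite_subset[OF I(2)] by simp
  hence fib: "b \<in> I" if "a \<in> I" "b < p" "\<alpha> b = \<alpha> a" for a b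
  proof -
    have "a < p" using I(1) that(1) by auto
    hence "of_bool (b \<in> I) + of_bool (b \<in> I') = of_bool (a \<in> I) + (of_bool (a \<in> I') :: nat)" using mv that(2,3) by blast
    thus ?thesis using that(1) \<open>I' = {}\<close> by (cases "b \<in> I") simp_all
  qed
  have cI: "card I = ini \<alpha>' (Suc j)" using I(3) by (simp add: less_Suc_eq_le)
  show ?thesis
  proof (cases "I = {}")
    case True thus ?thesis using cI by (intro exI[of _ 0]) simp
  next
    case False
    have fin: "finite (\<alpha> ` I)" using finite_subset[OF I(1)] by simp
    have "Max (\<alpha> ` I) \<in> \<alpha> ` I" using Max_in[OF fin] False by blast
    then obtain b where b: "\<alpha> b = Max (\<alpha> ` I)" "b \<in> I" by (metis imageE)
    have max: "\<alpha> a \<le> \<alpha> b" if "a \<in> I" for a unfolding b(1) using fin that by simp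
    have "b < p" using b(2) I(1) by auto
    have "I = {a. a < p \<and> \<alpha> a < Suc (\<alpha> b)}"
    proof (intro equalityI subsetI)
      fix a assume "a \<in> I" thus "a \<in> {a. a < p \<and> \<alpha> a < Suc (\<alpha> b)}" using max[of a] I(1) by auto
    next
      fix a assume "a \<in> {a. a < p \<and> \<alpha> a < Suc (\<alpha> b)}"
      hence "a < p" "\<alpha> a < \<alpha> b \<or> \<alpha> a = \<alpha> b" by auto
      thus "a \<in> I" using mv \<open>b < p\<close> b(2) fib[OF b(2)] by blast
    qed
    thus ?thesis using cI onto(1)[OF \<open>b < p\<close>] by (intro exI[of _ "Suc (\<alpha> b)"]) simp
  qed
qed

text \<open>Identify the block \<open>i\<close> of the primed pair and let the first part shrink
  from \<alpha> \<le> l to \<alpha> < t. Equality of weights in the two copies forces exactly the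
  fibres from t to l to reappear in the second part.\<close>

lemma limit_block_exchange:
  assumes i: "i < k'" and l: "ini \<alpha>' (Suc (\<sigma>' i)) = ini \<alpha> (Suc l)" "l < k" and m: "ini \<alpha>' (\<sigma>' i) = ini \<alpha> m" "m \<le> t" "t \<le> l"
  shows "\<exists>J'. J' \<subseteq> {..<p} \<and> (\<forall>a<p. \<forall>b<p. \<beta> a < \<beta> b \<longrightarrow> b \<in> J' \<longrightarrow> a \<in> J') \<and>
    (\<exists>I'. I' \<subseteq> {..<p} \<and> card I' = ini \<beta>' i \<and> (\<forall>a<p. \<forall>b<p. \<beta> a < \<beta> b \<longrightarrow> b \<in> I' \<longrightarrow> a \<in> I') \<and>
      (\<forall>a<p. (t \<le> \<alpha> a \<and> \<alpha> a \<le> l \<longrightarrow> a \<notin> I' \<and> a \<in> J') \<and> (\<not> (t \<le> \<alpha> a \<and> \<alpha> a \<le> l) \<longrightarrow> (a \<in> I' \<longleftrightarrow> a \<in> J'))))"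
proof -
  let ?\<Lambda> = "{a. a < p \<and> \<alpha>' a = \<sigma>' i}"
  have mono: "ini \<alpha> x \<le> ini \<alpha> y" if "x \<le> y" for x y by (rule card_mono) (use that in auto)
  \<comment> \<open>The amount that makes the shrunken part as large as the segment \<alpha> < t; it
    is at most the block size because m \<le> t.\<close>
  define r where "r = ini \<alpha> (Suc l) - ini \<alpha> t"
  have "?\<Lambda> = {a. a < p \<and> \<beta>' a = i}" using \<beta>'_iff by auto
  hence \<Lambda>: "?\<Lambda> = {} \<or> ?\<Lambda> = {a. a < p \<and> \<alpha>' a = \<sigma>' i} \<and> ?\<Lambda> = {a. a < p \<and> \<beta>' a = i}" by blast
  have r: "r \<le> card ?\<Lambda>" using initial_Suc[of \<alpha>' "\<sigma>' i"] l(1) m(1) mono[OF m(2)] unfolding r_def by simp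
  obtain I I' J J' where I: "I \<subseteq> {..<p}" "I' \<subseteq> {..<p}" "J \<subseteq> {..<p}" "J' \<subseteq> {..<p}"
    and c: "card I = card {a. a < p \<and> \<alpha>' a \<le> \<sigma>' i}" "card I' = ini \<beta>' i"
      "card J = card {a. a < p \<and> \<alpha>' a \<le> \<sigma>' i} - r"
    and mv: "\<forall>a<p. \<forall>b<p. (\<alpha> a < \<alpha> b \<longrightarrow> (b \<in> I \<longrightarrow> a \<in> I) \<and> (b \<in> J \<longrightarrow> a \<in> J)) \<and>
      (\<beta> a < \<beta> b \<longrightarrow> (b \<in> I' \<longrightarrow> a \<in> I') \<and> (b \<in> J' \<longrightarrow> a \<in> J')) \<and>
      (\<alpha> a = \<alpha> b \<longrightarrow> of_bool (a \<in> I) + of_bool (a \<in> I') = of_bool (b \<in> I) + (of_bool (b \<in> I') :: nat))"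
    and eq: "\<forall>a<p. of_bool (a \<in> I) + of_bool (a \<in> I') = of_bool (a \<in> J) + (of_bool (a \<in> J') :: nat)"
    using lim[OF \<Lambda> r] by (elim exE conjE)
  have le: "card {a. a < p \<and> \<alpha>' a \<le> \<sigma>' i} = ini \<alpha> (Suc l)" using l(1) by (simp only: less_Suc_eq_le)
  have "I = {a. a < p \<and> \<alpha> a < Suc l}"
    by (rule down_closed_eq_initial[OF I(1)]) (use mv c(1) le in simp_all)
  moreover have "J = {a. a < p \<and> \<alpha> a < t}"
    by (rule down_closed_eq_initial[OF I(3)]) (use mv c(3) le mono[of t "Suc l"] m(3) in \<open>simp_all add: r_def\<close>)
  ultimately have IJ: "a \<in> I \<longleftrightarrow> \<alpha> a \<le> l" "a \<in> J \<longleftrightarrow> \<alpha> a < t" if "a < p" for a using that by auto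
  have ex: "\<forall>a<p. (t \<le> \<alpha> a \<and> \<alpha> a \<le> l \<longrightarrow> a \<notin> I' \<and> a \<in> J') \<and> (\<not> (t \<le> \<alpha> a \<and> \<alpha> a \<le> l) \<longrightarrow> (a \<in> I' \<longleftrightarrow> a \<in> J'))"
  proof (intro allI impI)
    fix a assume "a < p"
    hence "of_bool (\<alpha> a \<le> l) + of_bool (a \<in> I') = of_bool (\<alpha> a < t) + (of_bool (a \<in> J') :: nat)" using eq IJ by simp
    thus "(t \<le> \<alpha> a \<and> \<alpha> a \<le> l \<longrightarrow> a \<notin> I' \<and> a \<in> J') \<and> (\<not> (t \<le> \<alpha> a \<and> \<alpha> a \<le> l) \<longrightarrow> (a \<in> I' \<longleftrightarrow> a \<in> J'))"
      using m(3) by (cases "\<alpha> a \<le> l"; cases "\<alpha> a < t"; cases "a \<in> I'"; cases "a \<in> J'") simp_all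
  qed
  have dc: "\<forall>a<p. \<forall>b<p. \<beta> a < \<beta> b \<longrightarrow> b \<in> J' \<longrightarrow> a \<in> J'"
    "\<forall>a<p. \<forall>b<p. \<beta> a < \<beta> b \<longrightarrow> b \<in> I' \<longrightarrow> a \<in> I'"
    subgoal by (intro allI impI) (rule mv[THEN spec, THEN mp, THEN spec, THEN mp, THEN conjunct2, THEN conjunct1,
      THEN mp, THEN conjunct2, THEN mp], assumption+)
    subgoal by (intro allI impI) (rule mv[THEN spec, THEN mp, THEN spec, THEN mp, THEN conjunct2, THEN conjunct1,
      THEN mp, THEN conjunct1, THEN mp], assumption+)
    done
  show ?thesis
    by (rule exI[of _ J'], intro conjI I(4) dc(1), rule exI[of _ I'], intro conjI I(2) c(2) dc(2) ex)
qed

text \<open>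
  If \<open>m\<close> were smaller, the fibres of \<open>\<alpha>\<close> over \<open>\<sigma> b - 1\<close> and \<open>\<sigma> b\<close> could both be moved to the initial
  segment \<open>\<beta> < b\<close>. They would then be consecutive for \<open>\<beta>\<close>, so \<open>\<sigma>\<close> would be a partial reversal.
\<close>
lemma limit_block:
  assumes i: "i < k'" and b: "b < k" and l: "ini \<alpha>' (Suc (\<sigma>' i)) = ini \<alpha> (Suc (\<sigma> b))"
    and m: "ini \<alpha>' (\<sigma>' i) = ini \<alpha> m" "m \<le> \<sigma> b"
  shows "m = \<sigma> b \<and> ini \<beta>' i = ini \<beta> b"
proof -
  have lk: "\<sigma> b < k" using permutes_in_image[OF perm(1), of b] b by simp
  obtain J' I' where dc: "\<forall>a<p. \<forall>b<p. \<beta> a < \<beta> b \<longrightarrow> b \<in> J' \<longrightarrow> a \<in> J'" and I': "I' \<subseteq> {..<p}" "card I' = ini \<beta>' i"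
    and ex: "\<forall>a<p. (\<sigma> b \<le> \<alpha> a \<and> \<alpha> a \<le> \<sigma> b \<longrightarrow> a \<notin> I' \<and> a \<in> J') \<and> (\<not> (\<sigma> b \<le> \<alpha> a \<and> \<alpha> a \<le> \<sigma> b) \<longrightarrow> (a \<in> I' \<longleftrightarrow> a \<in> J'))"
    and dcI: "\<forall>a<p. \<forall>b<p. \<beta> a < \<beta> b \<longrightarrow> b \<in> I' \<longrightarrow> a \<in> I'"
    using limit_block_exchange[OF i l lk m order.refl] by (elim exE conjE)
  obtain c where c: "c < p" "\<beta> c = b" using \<beta>_onto b by auto
  have cJ: "c \<notin> I'" "c \<in> J'" using ex c \<beta>_iff[OF c(1), of b] by auto
  \<comment> \<open>\<open>I'\<close> is down-closed for \<beta> and misses the fibre over b, so it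
    lies below b. Adding that fibre keeps it down-closed, so it contains everything below b.\<close>
  have "I' = {a. a < p \<and> \<beta> a < b}"
  proof (intro equalityI subsetI)
    fix a assume a: "a \<in> I'"
    hence ap: "a < p" using I' by auto
    have "\<beta> a \<noteq> b" using ex a ap \<beta>_iff[OF ap, of b] by auto
    moreover have "\<not> b < \<beta> a" using dcI a ap c cJ(1) by blast
    ultimately show "a \<in> {a. a < p \<and> \<beta> a < b}" using ap by simp
  next
    fix a assume "a \<in> {a. a < p \<and> \<beta> a < b}"
    hence a: "a < p" "\<beta> a < b" by auto
    have "a \<in> J'" using dc a c cJ(2) by blast
    moreover have "\<alpha> a \<noteq> \<sigma> b" using \<beta>_iff[OF a(1), of b] a(2) by simp
    ultimately show "a \<in> I'" using ex a(1) by (meson order.antisym)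
  qed
  hence ini: "ini \<beta>' i = ini \<beta> b" using I'(2) by simp
  have "m = \<sigma> b"
  proof (rule ccontr)
    assume "m \<noteq> \<sigma> b"
    hence pos: "m \<le> \<sigma> b - 1" "\<sigma> b - 1 < \<sigma> b" using m(2) by auto
    obtain J' I' where dc: "\<forall>a<p. \<forall>b<p. \<beta> a < \<beta> b \<longrightarrow> b \<in> J' \<longrightarrow> a \<in> J'" and I': "I' \<subseteq> {..<p}" "card I' = ini \<beta>' i"
      and ex: "\<forall>a<p. (\<sigma> b - 1 \<le> \<alpha> a \<and> \<alpha> a \<le> \<sigma> b \<longrightarrow> a \<notin> I' \<and> a \<in> J') \<and> (\<not> (\<sigma> b - 1 \<le> \<alpha> a \<and> \<alpha> a \<le> \<sigma> b) \<longrightarrow> (a \<in> I' \<longleftrightarrow> a \<in> J'))"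
      and dcI: "\<forall>a<p. \<forall>b<p. \<beta> a < \<beta> b \<longrightarrow> b \<in> I' \<longrightarrow> a \<in> I'"
      using limit_block_exchange[OF i l lk m(1) pos(1) less_imp_le[OF pos(2)]] by (elim exE conjE)
    \<comment> \<open>The new set is down-closed with the same cardinality as the earlier one, so it
      is the same initial segment.\<close>
    have II: "I' = {a. a < p \<and> \<beta> a < b}"
      by (rule down_closed_eq_initial[OF I'(1)]) (use dcI I'(2) ini in simp_all)
    have "\<sigma> b - 1 < k" using lk by simp
    then obtain d where d: "d < p" "\<alpha> d = \<sigma> b - 1" using onto(2) by blast
    have dJ: "d \<notin> I'" "d \<in> J'" using ex d by auto
    have "\<beta> d \<noteq> b" using \<beta>_iff[OF d(1), of b] d(2) pos by simp
    hence bd: "b < \<beta> d" using dJ(1) d(1) unfolding II by auto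
    have dk: "\<beta> d < k" using permutes_in_image[OF perm(1), of "\<beta> d"] perm(2)[OF d(1)] onto(1)[OF d(1)] by simp
    \<comment> \<open>An index strictly between b and \<open>\<beta> d\<close> would lie in
      \<open>J'\<close> but not in \<open>I'\<close>, hence in one of the two moved fibres.\<close>
    have "\<beta> d = b + 1"
    proof (rule ccontr)
      assume "\<beta> d \<noteq> b + 1"
      hence b1: "b + 1 < \<beta> d" using bd by simp
      have "b + 1 < k" using b1 dk by simp
      then obtain e where e: "e < p" "\<beta> e = b + 1" using \<beta>_onto by blast
      have "e \<in> J'" using dc e(1) d(1) b1 dJ(2) unfolding e(2)[symmetric] by blast
      moreover have "e \<notin> I'" unfolding II using e by simp
      ultimately have "\<sigma> b - 1 \<le> \<alpha> e" "\<alpha> e \<le> \<sigma> b" using ex e(1) by blast+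
      hence "\<alpha> e = \<sigma> b \<or> \<alpha> e = \<alpha> d" using d by auto
      hence "\<beta> e = b \<or> \<beta> e = \<beta> d" using \<beta>_iff[OF e(1)] perm(2)[OF d(1)] by auto
      thus False using e b1 by auto
    qed
    hence "partial_reversal k \<sigma>" using perm(2)[OF d(1)] d(2) dk pos
      unfolding partial_reversal_def by (intro exI[of _ b]) auto
    thus False using norev by blast
  qed
  thus ?thesis using ini by blast
qed

text \<open>Each further step of the \<alpha>'-flag ends at some step of the \<alpha>-flag, and
  \<open>limit_block\<close> shows that it covers one \<alpha>-level only. The last conjunct keeps
  the \<beta>-positions found on the way.\<close>

lemma limit_initial_eq: "j \<le> k' \<Longrightarrow> j \<le> k \<and> ini \<alpha>' j = ini \<alpha> j \<and>
  (\<forall>i<k'. \<forall>b<k. \<sigma>' i = \<sigma> b \<longrightarrow> \<sigma> b < j \<longrightarrow> ini \<beta>' i = ini \<beta> b)"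
proof (induction j)
  case (Suc j)
  hence IH: "j < k'" "j \<le> k" "ini \<alpha>' j = ini \<alpha> j"
    "\<forall>i<k'. \<forall>b<k. \<sigma>' i = \<sigma> b \<longrightarrow> \<sigma> b < j \<longrightarrow> ini \<beta>' i = ini \<beta> b" by auto
  obtain l where l: "l \<le> k" "ini \<alpha>' (Suc j) = ini \<alpha> l" using limit_initial_is_initial by auto
  have "ini \<alpha>' j < ini \<alpha>' (Suc j)"
    using card_initial_strict_mono[OF onto'(2), where s = j and t = "Suc j"] IH(1) by simp
  hence jl: "j < l" using card_initial_strict_mono[OF onto(2) IH(2) l(1)] l(2) IH(3) by simp
  then obtain l1 where l1: "l = Suc l1" by (cases l) auto
  have blk: "j = l1 \<and> ini \<beta>' i = ini \<beta> b" if "i < k'" "b < k" "\<sigma>' i = j" "\<sigma> b = l1" for i b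
    using limit_block[OF that(1,2), of j] that(3,4) l(2) IH(3) jl l1 by simp
  obtain i where i: "\<sigma>' i = j" using permutes_surj[OF perm'(1)] by (metis surjD)
  obtain b where b: "\<sigma> b = l1" using permutes_surj[OF perm(1)] by (metis surjD)
  have "i < k'" using permutes_in_image[OF perm'(1), of i] i IH(1) by simp
  moreover have "b < k" using permutes_in_image[OF perm(1), of b] b l l1 by simp
  ultimately have j: "j = l1" using blk i b by blast
  have "ini \<beta>' x = ini \<beta> y" if "x < k'" "y < k" "\<sigma>' x = \<sigma> y" "\<sigma> y < Suc j" for x y
  proof (cases "\<sigma> y < j")
    case True thus ?thesis using IH(4) that(1-3) by blast
  next
    case False
    hence "\<sigma> y = j" using that(4) by simp
    thus ?thesis using blk[OF that(1,2)] that(3) j by simp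
  qed
  thus ?case using l l1 j by (intro conjI allI impI) simp_all
qed simp

text \<open>At j = k' the \<alpha>'-flag reaches p, which forces k' = k. Matched blocks stand above
  equally large initial segments in the \<beta>-orders, so the two orders agree.\<close>

lemma limit_levels_unique:
  assumes "0 < p"
  shows "k = k' \<and> \<sigma> = \<sigma>' \<and> (\<forall>j\<le>k. ini \<alpha>' j = ini \<alpha> j)"
proof -
  have all: "{a. a < p \<and> \<alpha>' a < k'} = {..<p}" "{a. a < p \<and> \<alpha> a < k} = {..<p}" using onto(1) onto'(1) by auto
  have L: "k' \<le> k" "ini \<alpha>' k' = ini \<alpha> k'" using limit_initial_eq[of k'] by auto
  have "\<not> k' < k" using card_initial_strict_mono[OF onto(2) L(1), of k] L(2) all by simp
  hence kk: "k' = k" using L(1) by simp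
  \<comment> \<open>Sends the \<beta>-position of a block to the \<beta>'-position of the block on
    the same \<alpha>-level; it preserves order, hence is the identity.\<close>
  define f where "f = inv_into UNIV \<sigma>' \<circ> \<sigma>"
  have f: "f permutes {..<k}" unfolding f_def using permutes_compose[OF perm(1)] permutes_inv[OF perm'(1)] kk by simp
  have \<sigma>f: "\<sigma>' (f b) = \<sigma> b" for b unfolding f_def using permutes_inverses(1)[OF perm'(1)] by simp
  have fk: "f b < k" if "b < k" for b using permutes_in_image[OF f, of b] that by simp
  have ini: "ini \<beta>' (f b) = ini \<beta> b" if "b < k" for b
    using limit_initial_eq[of k'] that fk[OF that] \<sigma>f[of b] kk permutes_in_image[OF perm(1), of b] by simp
  have "f a < f b" if "a < b" "b < k" for a b
  proof -
    have "ini \<beta> a < ini \<beta> b" using card_initial_strict_mono[OF \<beta>_onto, where s = a and t = b] that by simp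
    hence "ini \<beta>' (f a) < ini \<beta>' (f b)" using ini that by simp
    thus ?thesis using card_initial_strict_mono[OF \<beta>'_onto, where s = "f a" and t = "f b"] less_imp_le[OF fk] that kk by simp
  qed
  hence "f b = b" for b by (rule order_preserving_permutation[OF f])
  hence "\<sigma> = \<sigma>'" using \<sigma>f by (metis ext)
  thus ?thesis using kk limit_initial_eq by auto
qed

end

section \<open>Inclusions between closures and the final decomposition\<close>

lemma composition_orbit:
  assumes \<pi>: "\<pi> \<in> compositions p k" and \<sigma>: "\<sigma> permutes {..<k}"
  shows "\<exists>\<alpha> \<beta>. (\<forall>a<p. \<alpha> a < k) \<and> (\<forall>i<k. \<exists>a<p. \<alpha> a = i) \<and> (\<forall>a<p. \<sigma> (\<beta> a) = \<alpha> a) \<and> same_fibres p \<alpha> \<beta> \<and>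
    (\<forall>n. pair_orbit p (C_pairs p n \<pi> \<sigma>) = pair_orbit p (level_pairs p n \<alpha> \<beta>)) \<and>
    (\<forall>i\<le>k. card {a. a < p \<and> \<alpha> a < i} = sum_list (take i \<pi>))"
proof (rule composition_levels[OF \<pi>])
  fix \<alpha> assume sz: "has_sizes p \<pi> \<alpha>"
    and lt: "\<And>a i. a < p \<Longrightarrow> i \<le> k \<Longrightarrow> \<alpha> a < i \<longleftrightarrow> a < sum_list (take i \<pi>)"
  have len: "length \<pi> = k" and pos: "\<And>x. x \<in> set \<pi> \<Longrightarrow> 0 < x" and sum: "sum_list \<pi> = p"
    using \<pi> unfolding compositions_def by auto
  define \<beta> where "\<beta> a = inv_into UNIV \<sigma> (\<alpha> a)" for a
  have \<sigma>\<beta>: "\<sigma> (\<beta> a) = \<alpha> a" for a unfolding \<beta>_def using permutes_inverses(1)[OF \<sigma>] by simp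
  have \<alpha>k: "\<alpha> a < k" if "a < p" for a using sz len that unfolding has_sizes_def by auto
  show ?thesis
  proof (intro exI conjI)
    show "\<forall>i<k. \<exists>a<p. \<alpha> a = i"
    proof (intro allI impI)
      fix i assume i: "i < k"
      have "\<pi> ! i = card {a. a < p \<and> \<alpha> a = i}" using sz i len unfolding has_sizes_def by blast
      hence "0 < card {a. a < p \<and> \<alpha> a = i}" using pos[OF nth_mem, of i] i len by metis
      hence "{a. a < p \<and> \<alpha> a = i} \<noteq> {}" by (metis card.empty less_irrefl)
      thus "\<exists>a<p. \<alpha> a = i" by blast
    qed
    show "same_fibres p \<alpha> \<beta>" unfolding same_fibres_def using \<sigma>\<beta> unfolding \<beta>_def by metis
    show "\<forall>n. pair_orbit p (C_pairs p n \<pi> \<sigma>) = pair_orbit p (level_pairs p n \<alpha> \<beta>)"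
    proof (rule allI, rule pair_orbit_C_pairs[OF sz])
      show "\<beta> a < length \<pi>" if "a < p" for a
        using permutes_in_image[OF \<sigma>, of "\<beta> a"] \<sigma>\<beta> \<alpha>k[OF that] len by simp
    qed (use \<sigma> len \<sigma>\<beta> in simp_all)
    show "\<forall>i\<le>k. card {a. a < p \<and> \<alpha> a < i} = sum_list (take i \<pi>)"
    proof (intro allI impI)
      fix i assume i: "i \<le> k"
      have "sum_list (take i \<pi>) \<le> p" using sum_list_take_mono[of i k \<pi>] i len sum by simp
      hence "{a. a < p \<and> \<alpha> a < i} = {..<sum_list (take i \<pi>)}" using lt[OF _ i] by auto
      thus "card {a. a < p \<and> \<alpha> a < i} = sum_list (take i \<pi>)" by simp
    qed
  qed (use \<alpha>k \<sigma>\<beta> in auto)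
qed

lemma subset_pair_orbit:
  assumes "C \<subseteq> mtuples p n \<times> mtuples p n" shows "C \<subseteq> pair_orbit p C"
proof (rule subrelI)
  fix v w assume vw: "(v, w) \<in> C"
  have id: "conj_act p (1\<^sub>m p) v = v" if "v \<in> mtuples p n" for v
    using conj_act_one that by blast
  show "(v, w) \<in> pair_orbit p C" unfolding pair_orbit_def
    using vw assms id GL_one(1)[of p] by force
qed

text \<open>One generating pair from the left orbit suffices: as a point of the other closure it
  determines the number of levels, their sizes and the permutation.\<close>

lemma closure_inclusion_imp_eq:
  assumes "0 < p" "3 \<le> n" and \<pi>: "\<pi> \<in> compositions p k" and \<sigma>: "\<sigma> \<in> T_perms k"
    and \<pi>': "\<pi>' \<in> compositions p k'" and \<sigma>': "\<sigma>' permutes {..<k'}"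
    and sub: "pair_orbit p (C_pairs p n \<pi> \<sigma>) \<subseteq> pair_zariski p n closure_of pair_orbit p (C_pairs p n \<pi>' \<sigma>')"
  shows "k = k' \<and> \<pi> = \<pi>' \<and> \<sigma> = \<sigma>'"
proof -
  have \<sigma>p: "\<sigma> permutes {..<k}" and norev: "\<not> partial_reversal k \<sigma>" using \<sigma> unfolding T_perms_def by auto
  obtain \<alpha> \<beta> where a: "\<forall>a<p. \<alpha> a < k" "\<forall>i<k. \<exists>a<p. \<alpha> a = i" "\<forall>a<p. \<sigma> (\<beta> a) = \<alpha> a"
    and sf: "same_fibres p \<alpha> \<beta>" and orb: "\<forall>n. pair_orbit p (C_pairs p n \<pi> \<sigma>) = pair_orbit p (level_pairs p n \<alpha> \<beta>)"
    and cnt: "\<forall>i\<le>k. card {a. a < p \<and> \<alpha> a < i} = sum_list (take i \<pi>)"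
    using composition_orbit[OF \<pi> \<sigma>p] by (elim exE conjE)
  obtain \<alpha>' \<beta>' where a': "\<forall>a<p. \<alpha>' a < k'" "\<forall>i<k'. \<exists>a<p. \<alpha>' a = i" "\<forall>a<p. \<sigma>' (\<beta>' a) = \<alpha>' a"
    and sf': "same_fibres p \<alpha>' \<beta>'" and orb': "\<forall>n. pair_orbit p (C_pairs p n \<pi>' \<sigma>') = pair_orbit p (level_pairs p n \<alpha>' \<beta>')"
    and cnt': "\<forall>i\<le>k'. card {a. a < p \<and> \<alpha>' a < i} = sum_list (take i \<pi>')"
    using composition_orbit[OF \<pi>' \<sigma>'] by (elim exE conjE)
  obtain A A' where A: "(A, A') \<in> level_pairs p n \<alpha> \<beta>" and gen: "generating_pair p \<alpha> \<beta> A A'"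
    using generating_pair_exists[OF sf \<open>3 \<le> n\<close>] by (elim exE conjE)
  have AA: "A \<in> mtuples p n" "A' \<in> mtuples p n" using A level_pairs_subset by blast+
  have cl: "(A, A') \<in> pair_zariski p n closure_of pair_orbit p (level_pairs p n \<alpha>' \<beta>')"
    using sub subset_pair_orbit[OF level_pairs_subset] A unfolding orb[rule_format] orb'[rule_format] by blast
  have "k = k' \<and> \<sigma> = \<sigma>' \<and> (\<forall>j\<le>k. card {a. a < p \<and> \<alpha>' a < j} = card {a. a < p \<and> \<alpha> a < j})"
  proof (rule limit_levels_unique)
    show "\<alpha> a < k" if "a < p" for a using a(1) that by blast
    show "\<forall>i<k. \<exists>a<p. \<alpha> a = i" by (rule a(2))
    show "\<alpha>' a < k'" if "a < p" for a using a'(1) that by blast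
    show "\<forall>i<k'. \<exists>a<p. \<alpha>' a = i" by (rule a'(2))
    show "\<sigma> (\<beta> a) = \<alpha> a" if "a < p" for a using a(3) that by blast
    show "\<sigma>' (\<beta>' a) = \<alpha>' a" if "a < p" for a using a'(3) that by blast
    show "\<sigma> permutes {..<k}" "\<sigma>' permutes {..<k'}" "\<not> partial_reversal k \<sigma>" "0 < p" by fact+
  qed (rule limit_index_sets[OF gen AA cl sf'], assumption, assumption)
  hence kk: "k = k'" and ss: "\<sigma> = \<sigma>'" and eq: "sum_list (take j \<pi>') = sum_list (take j \<pi>)" if "j \<le> k" for j
    using cnt cnt' that by auto
  have len: "length \<pi> = k" "length \<pi>' = k" using \<pi> \<pi>' kk[of 0] unfolding compositions_def by auto
  have "\<pi> = \<pi>'"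
  proof (rule nth_equalityI)
    fix i assume i: "i < length \<pi>"
    show "\<pi> ! i = \<pi>' ! i"
      using eq[of i] eq[of "Suc i"] sum_list_take_Suc[of i \<pi>] sum_list_take_Suc[of i \<pi>'] i len by simp
  qed (use len in simp)
  thus ?thesis using kk[of 0] ss[of 0] by simp
qed

theorem theorem4p2:
  fixes p n :: nat
  assumes "p \<ge> 2" and "n \<ge> 3"
  shows "separating_variety p n =
           (\<Union>k\<in>{1..p}. \<Union>\<pi>\<in>compositions p k. \<Union>\<sigma>\<in>T_perms k.
              pair_zariski p n closure_of pair_orbit p (C_pairs p n \<pi> \<sigma>))
         \<and> bij_betw
             (\<lambda>(k, \<pi>, \<sigma>). pair_zariski p n closure_of pair_orbit p (C_pairs p n \<pi> \<sigma>))
             (SIGMA k:{1..p}. compositions p k \<times> T_perms k)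
             (irreducible_components (pair_zariski p n) (separating_variety p n))"
    (is "?S = ?U \<and> bij_betw ?Z ?I _")
proof -
  have p0: "0 < p" using assms(1) by simp
  have orbit: "\<exists>\<alpha> \<beta>. same_fibres p \<alpha> \<beta> \<and> pair_orbit p (C_pairs p n \<pi> \<sigma>) = pair_orbit p (level_pairs p n \<alpha> \<beta>)"
    if "\<pi> \<in> compositions p k" "\<sigma> \<in> T_perms k" for \<pi> \<sigma> k
  proof -
    have "\<sigma> permutes {..<k}" using that(2) unfolding T_perms_def by simp
    from composition_orbit[OF that(1) this] show ?thesis by (elim exE conjE) (intro exI conjI, assumption, simp only:)
  qed
  have S: "?S = ?U"
  proof
    show "?S \<subseteq> ?U"
    proof (rule subrelI)
      fix v w assume "(v, w) \<in> ?S"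
      then obtain \<alpha> \<beta> where "same_fibres p \<alpha> \<beta>" and "(v, w) \<in> pair_orbit p (level_pairs p n \<alpha> \<beta>)"
        using separating_variety_level_pairs by meson
      thus "(v, w) \<in> ?U" using orbit_level_pairs_covered[OF _ p0] by (meson subsetD)
    qed
    show "?U \<subseteq> ?S"
    proof (intro UN_least)
      fix k \<pi> \<sigma> assume "\<pi> \<in> compositions p k" "\<sigma> \<in> T_perms k"
      then obtain \<alpha> \<beta> where "same_fibres p \<alpha> \<beta>"
        and o: "pair_orbit p (C_pairs p n \<pi> \<sigma>) = pair_orbit p (level_pairs p n \<alpha> \<beta>)" using orbit by meson
      thus "pair_zariski p n closure_of pair_orbit p (C_pairs p n \<pi> \<sigma>) \<subseteq> ?S"
        unfolding o by (intro closure_orbit_separating)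
    qed
  qed
  have SI: "?S = (\<Union>x\<in>?I. ?Z x)" unfolding S by (simp add: UN_extend_simps SUP_UNION) blast
  have "bij_betw ?Z ?I (irreducible_components (pair_zariski p n) (\<Union>x\<in>?I. ?Z x))"
  proof (rule bij_betw_irreducible_components)
    show "finite ?I" by (intro finite_SigmaI finite_cartesian_product finite_compositions finite_T_perms finite_atLeastAtMost)
  next
    fix x assume "x \<in> ?I"
    then obtain k \<pi> \<sigma> where x: "x = (k, \<pi>, \<sigma>)" "\<pi> \<in> compositions p k" "\<sigma> \<in> T_perms k" by auto
    obtain \<alpha> \<beta> where o: "pair_orbit p (C_pairs p n \<pi> \<sigma>) = pair_orbit p (level_pairs p n \<alpha> \<beta>)"
      using orbit[OF x(2,3)] by (elim exE conjE)
    show "irreducible_in (pair_zariski p n) (?Z x)"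
      unfolding x(1) prod.case o by (intro irreducible_in_closure_of irreducible_orbit)
    show "closedin (pair_zariski p n) (?Z x)" unfolding x(1) prod.case by (rule closedin_closure_of)
  next
    fix x y assume "x \<in> ?I" "y \<in> ?I" and sub: "?Z x \<subseteq> ?Z y"
    then obtain k \<pi> \<sigma> k' \<pi>' \<sigma>' where x: "x = (k, \<pi>, \<sigma>)" "\<pi> \<in> compositions p k" "\<sigma> \<in> T_perms k"
      and y: "y = (k', \<pi>', \<sigma>')" "\<pi>' \<in> compositions p k'" "\<sigma>' \<in> T_perms k'" by auto
    obtain \<alpha> \<beta> where o: "pair_orbit p (C_pairs p n \<pi> \<sigma>) = pair_orbit p (level_pairs p n \<alpha> \<beta>)"
      using orbit[OF x(2,3)] by (elim exE conjE)
    have "pair_orbit p (C_pairs p n \<pi> \<sigma>) \<subseteq> pair_zariski p n closure_of pair_orbit p (C_pairs p n \<pi> \<sigma>)"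
      unfolding o pair_zariski_def
      by (rule closure_of_subset) (unfold topspace_zariski, rule pair_orbit_subset[OF level_pairs_subset])
    also have "\<dots> \<subseteq> pair_zariski p n closure_of pair_orbit p (C_pairs p n \<pi>' \<sigma>')"
      using sub unfolding x(1) y(1) prod.case .
    finally have "k = k' \<and> \<pi> = \<pi>' \<and> \<sigma> = \<sigma>'"
      using y(3) unfolding T_perms_def by (intro closure_inclusion_imp_eq[OF p0 assms(2) x(2,3) y(2)]) simp_all
    thus "x = y" unfolding x(1) y(1) by simp
  qed
  thus ?thesis using S SI by simp
qed

end
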